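(* Let $\Omega\subset\mathbb R^2$ be a bounded polytope (polygon) with a conforming triangulation $\mathcal T_h$ into triangles. With the finite element spaces $W_h$ (Bell element), $\boldsymbol\Sigma_h^r$ and $\boldsymbol V_h^r$ defined in the context, the finite element elasticity complex $$\mathbb P_1(\Omega)\xrightarrow{\subset}W_h\xrightarrow{\operatorname{airy}}\boldsymbol\Sigma_h^r\xrightarrow{\operatorname{div}}\boldsymbol V_h^r\to0$$ is exact; that is, $\{v\in W_h:\operatorname{airy}v=0\}=\mathbb P_1(\Omega)$, $\operatorname{airy}W_h=\{\boldsymbol\tau\in\boldsymbol\Sigma_h^r:\operatorname{div}\boldsymbol\tau=0\}$, and $\operatorname{div}\boldsymbol\Sigma_h^r=\boldsymbol V_h^r$.
   Context: $\mathbb S$: symmetric $2\times2$ matrices. $\mathbb P_k(D;\mathbb X)$: $\mathbb X$-valued polynomials of total degree at most $k$ on $D$. $\mathbf{RM}=\{\boldsymbol a+b(x_2,-x_1)^{\intercal}:\boldsymbol a\in\mathbb R^2,b\in\mathbb R\}$ is the space of rigid motions. $\operatorname{div}$ of a matrix field is row-wise. For a scalar $v$, $$\operatorname{airy}v=\begin{pmatrix}\partial_{22}v&-\partial_{12}v\\-\partial_{12}v&\partial_{11}v\end{pmatrix}.$$ Each edge $e$ of $\mathcal T_h$ has a fixed unit normal $\boldsymbol n$ and unit tangent $\boldsymbol t$; $\partial_n$ is the normal derivative. $(\cdot,\cdot)_D$ is the $L^2(D)$ inner product. For a triangle $K$: $\mathbb P_5^-(K):=\{q\in\mathbb P_5(K):\partial_nq|_e\in\mathbb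 P_3(e)\text{ for every edge }e\text{ of }K\}$ (the Bell element shape functions), and $\boldsymbol\Sigma^r(K):=\{\boldsymbol\tau\in\mathbb P_3(K;\mathbb S):\operatorname{div}\boldsymbol\tau\in\mathbf{RM},\ (\boldsymbol t^{\intercal}\boldsymbol\tau\boldsymbol n)|_e\in\mathbb P_2(e)\text{ for every edge }e\text{ of }K\}$. Global spaces: - $W_h:=\{v_h\in H^2(\Omega):v_h|_K\in\mathbb P_5^-(K)\ \forall K\in\mathcal T_h\}$, the Bell element space; the degrees of freedom of the Bell element are $v(\mathtt v),\nabla v(\mathtt v),\nabla^2v(\mathtt v)$ at the vertices $\mathtt v$ of $K$. - $\boldsymbol\Sigma_h^r$: all $\boldsymbol\tau_h\in L^2(\Omega;\mathbb S)$ with $\boldsymbol\tau_h|_K\in\boldsymbol\Sigma^r(K)$ for all $K\in\mathcal T_h$ such that the following degrees of freedom are single-valued (values computed from all triangles sharing the vertex or edge agree): $\boldsymbol\tau(\mathtt v)$ at each vertex; $(\boldsymbol n^{\intercal}\boldsymbol\tau\boldsymbol n,q)_e$, $q\in\mathbb P_1(e)$, on each edge; $(\boldsymbol t^{\intercal}\boldsymbol\tau\boldsymbol n,q)_e$, $q\in\mathbb P_0(e)$, on each edge. - $\boldsymbol V_h^r:=\{\boldsymbol q_h\in L^2(\Omega;\mathbb R^2):\boldsymbol q_h|_K\in\mathbf{RM}\ \forall K\in\mathcal T_h\}$.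
   Formalization: The polygon is taken to be the region inside a simple closed polygonal curve (no holes or pinch points), and functions in the Bell space are also required to have single-valued second derivatives at vertices; without these the exactness claim fails. *)

theory Defs
  imports "HOL-Analysis.Analysis"
begin

text \<open>Matrix fields have type \<open>real^2 \<Rightarrow> real^2^2\<close>; \<open>\<tau> x $ i\<close> is the \<open>i\<close>-th row of \<open>\<tau> x\<close>.\<close>

type_synonym pt = "real^2"

subsection \<open>Classical derivatives and test functions\<close>

definition pd :: "2 \<Rightarrow> (pt \<Rightarrow> real) \<Rightarrow> pt \<Rightarrow> real" where
  "pd i f x = frechet_derivative f (at x) (axis i 1)"

definition pds :: "2 list \<Rightarrow> (pt \<Rightarrow> real) \<Rightarrow> pt \<Rightarrow> real" where
  "pds \<alpha> f = foldr pd \<alpha> f"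

definition dir_deriv :: "pt \<Rightarrow> (pt \<Rightarrow> real) \<Rightarrow> pt \<Rightarrow> real" where
  "dir_deriv w f x = frechet_derivative f (at x) w"

definition div_field :: "(pt \<Rightarrow> real^2^2) \<Rightarrow> pt \<Rightarrow> real^2" where
  "div_field \<tau> x = (\<chi> i. \<Sum>j\<in>UNIV. pd j (\<lambda>y. \<tau> y $ i $ j) x)"

definition test_fun :: "pt set \<Rightarrow> (pt \<Rightarrow> real) \<Rightarrow> bool" where
  "test_fun \<Omega> \<phi> \<longleftrightarrow> (\<forall>\<alpha>. pds \<alpha> \<phi> differentiable_on UNIV) \<and>
     compact (closure {x. \<phi> x \<noteq> 0}) \<and> closure {x. \<phi> x \<noteq> 0} \<subseteq> \<Omega>"

subsection \<open>\<open>L\<^sup>2\<close>, weak derivatives, \<open>H\<^sup>2\<close>\<close>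

text \<open>
  Members of \<open>L\<^sup>2\<close>-type spaces are represented by functions on the whole plane, of which only
  the values almost everywhere on \<open>\<Omega>\<close> matter. All function spaces on \<open>\<Omega>\<close> below are closed under
  equality almost everywhere on \<open>\<Omega>\<close>, so equality of two such sets of functions is equality of the
  corresponding spaces of classes. Accordingly a differential operator is a relation between a
  function and the representatives of its derivative.
\<close>

definition L2_space :: "pt set \<Rightarrow> (pt \<Rightarrow> 'a::euclidean_space) set" where
  "L2_space \<Omega> = {f. f \<in> borel_measurable (lebesgue_on \<Omega>) \<and>
     integrable (lebesgue_on \<Omega>) (\<lambda>x. (norm (f x))\<^sup>2)}"

definition weak_deriv :: "pt set \<Rightarrow> 2 list \<Rightarrow> (pt \<Rightarrow> real) \<Rightarrow> (pt \<Rightarrow> real) \<Rightarrow> bool" where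
  "weak_deriv \<Omega> \<alpha> v g \<longleftrightarrow> v \<in> L2_space \<Omega> \<and> g \<in> L2_space \<Omega> \<and>
     (\<forall>\<phi>. test_fun \<Omega> \<phi> \<longrightarrow>
        integral\<^sup>L (lebesgue_on \<Omega>) (\<lambda>x. v x * pds \<alpha> \<phi> x) =
        (-1) ^ length \<alpha> * integral\<^sup>L (lebesgue_on \<Omega>) (\<lambda>x. g x * \<phi> x))"

definition H2_space :: "pt set \<Rightarrow> (pt \<Rightarrow> real) set" where
  "H2_space \<Omega> = {v \<in> L2_space \<Omega>. \<forall>\<alpha>. length \<alpha> \<le> 2 \<longrightarrow> (\<exists>g. weak_deriv \<Omega> \<alpha> v g)}"

definition weak_airy :: "pt set \<Rightarrow> (pt \<Rightarrow> real) \<Rightarrow> (pt \<Rightarrow> real^2^2) \<Rightarrow> bool" where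
  "weak_airy \<Omega> v \<tau> \<longleftrightarrow>
     weak_deriv \<Omega> [2,2] v (\<lambda>x. \<tau> x $ 1 $ 1) \<and>
     weak_deriv \<Omega> [1,2] v (\<lambda>x. - \<tau> x $ 1 $ 2) \<and>
     weak_deriv \<Omega> [1,2] v (\<lambda>x. - \<tau> x $ 2 $ 1) \<and>
     weak_deriv \<Omega> [1,1] v (\<lambda>x. \<tau> x $ 2 $ 2)"

definition weak_div :: "pt set \<Rightarrow> (pt \<Rightarrow> real^2^2) \<Rightarrow> (pt \<Rightarrow> real^2) \<Rightarrow> bool" where
  "weak_div \<Omega> \<tau> q \<longleftrightarrow> \<tau> \<in> L2_space \<Omega> \<and> q \<in> L2_space \<Omega> \<and>
     (\<forall>\<phi> i. test_fun \<Omega> \<phi> \<longrightarrow>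
        integral\<^sup>L (lebesgue_on \<Omega>) (\<lambda>x. \<Sum>j\<in>UNIV. \<tau> x $ i $ j * pd j \<phi> x) =
        - integral\<^sup>L (lebesgue_on \<Omega>) (\<lambda>x. q x $ i * \<phi> x))"

subsection \<open>Polygons and triangulations\<close>

text \<open>
  A polygon is the region enclosed by a simple closed polygonal curve; in particular it is
  simply connected and does not touch itself at a boundary point.
\<close>

definition polygon_domain :: "pt set \<Rightarrow> bool" where
  "polygon_domain \<Omega> \<longleftrightarrow> (\<exists>g S. simple_path g \<and> pathfinish g = pathstart g \<and>
     finite S \<and> (\<forall>s\<in>S. \<exists>a b. s = closed_segment a b) \<and> path_image g = \<Union>S \<and>
     \<Omega> = inside (path_image g))"

definition conforming_mesh :: "pt set \<Rightarrow> pt set set \<Rightarrow> bool" where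
  "conforming_mesh \<Omega> T \<longleftrightarrow> triangulation T \<and> (\<forall>K\<in>T. 2 simplex K) \<and> \<Union>T = closure \<Omega>"

definition unit_tangent :: "pt set \<Rightarrow> pt \<Rightarrow> bool" where
  "unit_tangent e t \<longleftrightarrow> (\<exists>x\<in>e. \<exists>y\<in>e. x \<noteq> y \<and> t = sgn (y - x))"

definition unit_normal :: "pt set \<Rightarrow> pt \<Rightarrow> bool" where
  "unit_normal e n \<longleftrightarrow> norm n = 1 \<and> (\<forall>x\<in>e. \<forall>y\<in>e. n \<bullet> (y - x) = 0)"

text \<open>The \<open>L\<^sup>2\<close> inner product on a segment with respect to arc length; it does not depend on
  which endpoint is called \<open>a\<close>.\<close>

definition edge_inner :: "pt set \<Rightarrow> (pt \<Rightarrow> real) \<Rightarrow> (pt \<Rightarrow> real) \<Rightarrow> real" where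
  "edge_inner e f q = (let (a, b) = (SOME (a, b). e = closed_segment a b)
     in dist a b * integral {0..1} (\<lambda>s. f (linepath a b s) * q (linepath a b s)))"

subsection \<open>Shape functions\<close>

text \<open>
  \<open>Pk k D\<close>: functions agreeing on \<open>D\<close> with a polynomial of total degree at most \<open>k\<close>. For a
  segment \<open>D\<close> these are the polynomials of degree at most \<open>k\<close> in the arc length parameter.
\<close>

definition Pk :: "nat \<Rightarrow> pt set \<Rightarrow> (pt \<Rightarrow> 'a::real_vector) set" where
  "Pk k D = {f. \<exists>c. \<forall>x\<in>D. f x = (\<Sum>i\<le>k. \<Sum>j\<le>k - i. ((x $ 1) ^ i * (x $ 2) ^ j) *\<^sub>R c i j)}"

definition RM :: "(pt \<Rightarrow> real^2) set" where
  "RM = {(\<lambda>x. a + b *\<^sub>R vector [x $ 2, - (x $ 1)]) | a b. True}"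

text \<open>
  A polynomial on a triangle is identified with its unique extension to the plane, so the
  shape functions are polynomials on \<open>UNIV\<close> and their derivatives on the boundary of \<open>K\<close> make
  sense. The parameters \<open>n\<close> and \<open>t\<close> assign to each edge its normal and tangent.
\<close>

definition Bell :: "(pt set \<Rightarrow> pt) \<Rightarrow> pt set \<Rightarrow> (pt \<Rightarrow> real) set" where
  "Bell n K = {p \<in> Pk 5 UNIV. \<forall>e. e edge_of K \<longrightarrow> dir_deriv (n e) p \<in> Pk 3 e}"

definition Sigma_r :: "(pt set \<Rightarrow> pt) \<Rightarrow> (pt set \<Rightarrow> pt) \<Rightarrow> pt set \<Rightarrow> (pt \<Rightarrow> real^2^2) set" where
  "Sigma_r n t K = {\<tau> \<in> Pk 3 UNIV. (\<forall>x. transpose (\<tau> x) = \<tau> x) \<and> div_field \<tau> \<in> RM \<and>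
     (\<forall>e. e edge_of K \<longrightarrow> (\<lambda>x. t e \<bullet> (\<tau> x *v n e)) \<in> Pk 2 e)}"

subsection \<open>Global spaces\<close>

text \<open>
  The Bell space includes the single-valuedness of all degrees of freedom of the Bell element.
  For the values and gradients at vertices this already follows from membership in \<open>H\<^sup>2\<close>, for
  the second derivatives it does not.
\<close>

definition Wh :: "(pt set \<Rightarrow> pt) \<Rightarrow> pt set \<Rightarrow> pt set set \<Rightarrow> (pt \<Rightarrow> real) set" where
  "Wh n \<Omega> T = {v \<in> H2_space \<Omega>. \<exists>p.
     (\<forall>K\<in>T. p K \<in> Bell n K \<and> (AE x in lebesgue_on K. v x = p K x)) \<and>
     (\<forall>K\<in>T. \<forall>K'\<in>T. \<forall>a. a extreme_point_of K \<and> a extreme_point_of K' \<longrightarrow>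
        p K a = p K' a \<and>
        (\<forall>i. pd i (p K) a = pd i (p K') a) \<and>
        (\<forall>i j. pd i (pd j (p K)) a = pd i (pd j (p K')) a))}"

definition Sigma_h ::
  "(pt set \<Rightarrow> pt) \<Rightarrow> (pt set \<Rightarrow> pt) \<Rightarrow> pt set \<Rightarrow> pt set set \<Rightarrow> (pt \<Rightarrow> real^2^2) set" where
  "Sigma_h n t \<Omega> T = {\<tau> \<in> L2_space \<Omega>. (AE x in lebesgue_on \<Omega>. transpose (\<tau> x) = \<tau> x) \<and> (\<exists>\<sigma>.
     (\<forall>K\<in>T. \<sigma> K \<in> Sigma_r n t K \<and> (AE x in lebesgue_on K. \<tau> x = \<sigma> K x)) \<and>
     (\<forall>K\<in>T. \<forall>K'\<in>T. \<forall>a. a extreme_point_of K \<and> a extreme_point_of K' \<longrightarrow> \<sigma> K a = \<sigma> K' a) \<and>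
     (\<forall>K\<in>T. \<forall>K'\<in>T. \<forall>e. e edge_of K \<and> e edge_of K' \<longrightarrow>
        (\<forall>q\<in>Pk 1 e. edge_inner e (\<lambda>x. n e \<bullet> (\<sigma> K x *v n e)) q =
                      edge_inner e (\<lambda>x. n e \<bullet> (\<sigma> K' x *v n e)) q) \<and>
        (\<forall>q\<in>Pk 0 e. edge_inner e (\<lambda>x. t e \<bullet> (\<sigma> K x *v n e)) q =
                      edge_inner e (\<lambda>x. t e \<bullet> (\<sigma> K' x *v n e)) q)))}"

definition Vh :: "pt set \<Rightarrow> pt set set \<Rightarrow> (pt \<Rightarrow> real^2) set" where
  "Vh \<Omega> T = {q \<in> L2_space \<Omega>. \<forall>K\<in>T. \<exists>r\<in>RM. AE x in lebesgue_on K. q x = r x}"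

definition P1_space :: "pt set \<Rightarrow> (pt \<Rightarrow> real) set" where
  "P1_space \<Omega> = {v. \<exists>p\<in>Pk 1 UNIV. AE x in lebesgue_on \<Omega>. v x = p x}"

end

theory Submission
  imports Defs "HOL-Complex_Analysis.Complex_Analysis"
begin

text \<open>
  Everything is reduced to piecewise polynomials: by integration by parts on the triangles,
  membership in \<open>H\<^sup>2\<close> and the weak divergence amount to continuity of the gradient and of the
  traction \<open>\<tau> n\<close> across edges, and the degrees of freedom are unisolvent for these traces.
  A divergence-free \<open>\<tau>\<close> is the Airy tensor of a quintic on each triangle. The quintics are glued
  because a polygon, being homeomorphic to a disc, has trivial monodromy, and agreement across
  edges passes to vertices since the triangles around a vertex are linked through edges; the
  latter rests on the boundary being a simple closed curve.
  For the surjectivity of the divergence, edge loads on rigid motions balance any piecewise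
  rigid motion, by transporting the mismatch from triangle to triangle to a boundary edge.
  Bubbles with vanishing traction then bring the divergence of the loaded stress into the
  rigid motions, where Green's formula determines it.
\<close>

text \<open>No dimensions are counted; preimages are constructed, and the degrees match edge by
  edge. On an edge a quintic trace is fixed by six Hermite data and its normal derivative, cubic by
  the Bell condition, by four. The traction has a cubic normal part, fixed by two end values and two
  moments, and a quadratic tangential part, fixed by two end values and the mean. The two reduced
  degrees are the same condition: for \<open>t\<close> orthogonal to \<open>n\<close> the shear of
  the Airy tensor of \<open>p\<close> is minus the derivative of \<open>p\<close> along
  \<open>n\<close> and \<open>t\<close>. The obstacle sits at the vertices. Continuity across edges
  says nothing directly about two triangles that meet only in a point, yet Bell functions must agree
  there to second order. The second derivatives are entries of \<open>\<tau>\<close> and agree by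
  definition; for the value and the gradient the triangles at a vertex have to form one fan. For the
  divergence, a rigid motion has three parameters, so three scalar flows through the edges prescribe
  all moments of the tractions. The remaining residual is rigid and orthogonal to all rigid motions,
  hence zero.\<close>

no_notation fps_nth (infixl \<open>$\<close> 75)

subsection \<open>Polynomials in two variables\<close>

lemma Pk_cong:
  assumes "f \<in> Pk k D" "\<And>x. x \<in> D \<Longrightarrow> f x = g x"
  shows "g \<in> Pk k D"
  using assms unfolding Pk_def by fastforce

lemma Pk_subset: "f \<in> Pk k D \<Longrightarrow> D' \<subseteq> D \<Longrightarrow> f \<in> Pk k D'"
  unfolding Pk_def by blast

lemma Pk_monomial:
  assumes "i + j \<le> k"
  shows "(\<lambda>x. ((x $ 1) ^ i * (x $ 2) ^ j) *\<^sub>R c) \<in> Pk k D"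
proof -
  have "((x $ 1) ^ i * (x $ 2) ^ j) *\<^sub>R c = (\<Sum>i'\<le>k. \<Sum>j'\<le>k - i'. ((x $ 1) ^ i' * (x $ 2) ^ j') *\<^sub>R
      (if i' = i \<and> j' = j then c else 0))" for x :: pt
  proof -
    have "(\<Sum>i'\<le>k. \<Sum>j'\<le>k - i'. ((x $ 1) ^ i' * (x $ 2) ^ j') *\<^sub>R (if i' = i \<and> j' = j then c else 0))
      = (\<Sum>i'\<le>k. if i' = i then (\<Sum>j'\<le>k - i'. if j' = j then ((x $ 1) ^ i' * (x $ 2) ^ j') *\<^sub>R c else 0) else 0)"
      using assms by (intro sum.cong refl) (auto simp: if_distrib cong: if_cong)
    also have "\<dots> = ((x $ 1) ^ i * (x $ 2) ^ j) *\<^sub>R c"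
      using assms by (simp add: le_diff_conv2)
    finally show ?thesis by simp
  qed
  then show ?thesis unfolding Pk_def by (intro CollectI exI ballI) assumption
qed

lemma Pk_add:
  assumes "f \<in> Pk k D" "g \<in> Pk k D"
  shows "(\<lambda>x. f x + g x) \<in> Pk k D"
proof -
  obtain c d where "\<forall>x\<in>D. f x = (\<Sum>i\<le>k. \<Sum>j\<le>k - i. ((x $ 1) ^ i * (x $ 2) ^ j) *\<^sub>R c i j)"
    "\<forall>x\<in>D. g x = (\<Sum>i\<le>k. \<Sum>j\<le>k - i. ((x $ 1) ^ i * (x $ 2) ^ j) *\<^sub>R d i j)"
    using assms unfolding Pk_def by auto
  then have "\<forall>x\<in>D. f x + g x = (\<Sum>i\<le>k. \<Sum>j\<le>k - i. ((x $ 1) ^ i * (x $ 2) ^ j) *\<^sub>R (c i j + d i j))"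
    by (simp add: scaleR_add_right sum.distrib)
  then show ?thesis unfolding Pk_def by (intro CollectI exI)
qed

lemma Pk_linear_image:
  assumes "f \<in> Pk k D" "linear h"
  shows "(\<lambda>x. h (f x)) \<in> Pk k D"
proof -
  obtain c where "\<forall>x\<in>D. f x = (\<Sum>i\<le>k. \<Sum>j\<le>k - i. ((x $ 1) ^ i * (x $ 2) ^ j) *\<^sub>R c i j)"
    using assms unfolding Pk_def by auto
  then have "\<forall>x\<in>D. h (f x) = (\<Sum>i\<le>k. \<Sum>j\<le>k - i. ((x $ 1) ^ i * (x $ 2) ^ j) *\<^sub>R h (c i j))"
    by (simp add: linear_sum[OF assms(2)] linear_scale[OF assms(2)])
  then show ?thesis unfolding Pk_def by (intro CollectI exI)
qed

lemma Pk_scaleR: "f \<in> Pk k D \<Longrightarrow> (\<lambda>x. c *\<^sub>R f x) \<in> Pk k D"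
  by (rule Pk_linear_image) (auto intro: linear_scale_self)

lemma Pk_cmult: "f \<in> Pk k D \<Longrightarrow> (\<lambda>x. (c::real) * f x) \<in> Pk k D"
  using Pk_scaleR[of f k D c] by simp

lemma Pk_uminus: "f \<in> Pk k D \<Longrightarrow> (\<lambda>x. - f x) \<in> Pk k D"
  using Pk_scaleR[of f k D "-1"] by simp

lemma Pk_diff: "f \<in> Pk k D \<Longrightarrow> g \<in> Pk k D \<Longrightarrow> (\<lambda>x. f x - g x) \<in> Pk k D"
  using Pk_add[OF _ Pk_uminus] by fastforce

lemma Pk_const: "(\<lambda>x. c) \<in> Pk k D"
  using Pk_monomial[of 0 0 k c D] by simp

lemma Pk_sum: "(\<And>a. a \<in> A \<Longrightarrow> f a \<in> Pk k D) \<Longrightarrow> (\<lambda>x. \<Sum>a\<in>A. f a x) \<in> Pk k D"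
  by (induction A rule: infinite_finite_induct) (auto intro: Pk_add Pk_const)

lemma Pk_mono:
  assumes "f \<in> Pk k D" "k \<le> k'"
  shows "f \<in> Pk k' D"
proof -
  obtain c where "\<forall>x\<in>D. f x = (\<Sum>i\<le>k. \<Sum>j\<le>k - i. ((x $ 1) ^ i * (x $ 2) ^ j) *\<^sub>R c i j)"
    using assms unfolding Pk_def by auto
  moreover have "(\<lambda>x. \<Sum>i\<le>k. \<Sum>j\<le>k - i. ((x $ 1) ^ i * (x $ 2) ^ j) *\<^sub>R c i j) \<in> Pk k' D"
    using assms(2) by (intro Pk_sum Pk_monomial) auto
  ultimately show ?thesis by (auto elim: Pk_cong)
qed

lemma Pk_mult:
  fixes f g :: "pt \<Rightarrow> real"
  assumes "f \<in> Pk k D" "g \<in> Pk m D"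
  shows "(\<lambda>x. f x * g x) \<in> Pk (k + m) D"
proof -
  obtain c d where c: "\<forall>x\<in>D. f x = (\<Sum>i\<le>k. \<Sum>j\<le>k - i. ((x $ 1) ^ i * (x $ 2) ^ j) *\<^sub>R c i j)" and
    d: "\<forall>x\<in>D. g x = (\<Sum>i\<le>m. \<Sum>j\<le>m - i. ((x $ 1) ^ i * (x $ 2) ^ j) *\<^sub>R d i j)"
    using assms unfolding Pk_def by auto
  have "(\<lambda>x. \<Sum>i\<le>k. \<Sum>j\<le>k - i. \<Sum>i'\<le>m. \<Sum>j'\<le>m - i'.
     ((x $ 1) ^ (i + i') * (x $ 2) ^ (j + j')) *\<^sub>R (c i j * d i' j')) \<in> Pk (k + m) D"
    by (intro Pk_sum Pk_monomial) auto
  then show ?thesis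
  proof (rule Pk_cong)
    fix x assume "x \<in> D"
    then show "(\<Sum>i\<le>k. \<Sum>j\<le>k - i. \<Sum>i'\<le>m. \<Sum>j'\<le>m - i'.
     ((x $ 1) ^ (i + i') * (x $ 2) ^ (j + j')) *\<^sub>R (c i j * d i' j')) = f x * g x"
    proof -
      let ?t = "\<lambda>i j i' j'. ((x $ 1) ^ i * (x $ 2) ^ j) *\<^sub>R c i j * ((x $ 1) ^ i' * (x $ 2) ^ j') *\<^sub>R d i' j'"
      have "f x * g x = (\<Sum>i'\<le>m. \<Sum>j'\<le>m - i'. \<Sum>i\<le>k. \<Sum>j\<le>k - i. ?t i j i' j')"
        unfolding c[rule_format, OF \<open>x \<in> D\<close>] d[rule_format, OF \<open>x \<in> D\<close>] sum_distrib_left sum_distrib_right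
        by (rule refl)
      also have "(\<Sum>i'\<le>m. \<Sum>j'\<le>m - i'. \<Sum>i\<le>k. \<Sum>j\<le>k - i. ?t i j i' j') =
        (\<Sum>i'\<le>m. \<Sum>i\<le>k. \<Sum>j'\<le>m - i'. \<Sum>j\<le>k - i. ?t i j i' j')"
        by (rule sum.cong[OF refl], rule sum.swap)
      also have "\<dots> = (\<Sum>i\<le>k. \<Sum>i'\<le>m. \<Sum>j\<le>k - i. \<Sum>j'\<le>m - i'. ?t i j i' j')"
        by (rule trans[OF sum.swap]) (rule sum.cong[OF refl], rule sum.cong[OF refl], rule sum.swap)
      also have "\<dots> = (\<Sum>i\<le>k. \<Sum>j\<le>k - i. \<Sum>i'\<le>m. \<Sum>j'\<le>m - i'. ?t i j i' j')"
        by (rule sum.cong[OF refl], rule sum.swap)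
      finally show ?thesis by (simp add: power_add algebra_simps)
    qed
  qed
qed

lemma Pk_multI:
  fixes f g :: "pt \<Rightarrow> real"
  shows "f \<in> Pk a D \<Longrightarrow> g \<in> Pk b D \<Longrightarrow> a + b \<le> k \<Longrightarrow> (\<lambda>x. f x * g x) \<in> Pk k D"
  using Pk_mult Pk_mono by blast

lemma Pk_coord: "1 \<le> k \<Longrightarrow> (\<lambda>x. x $ i) \<in> Pk k D"
  using exhaust_2[of i] Pk_monomial[of 1 0 k "1::real" D] Pk_monomial[of 0 1 k "1::real" D] by auto

lemma Pk_power: "f \<in> Pk k D \<Longrightarrow> (\<lambda>x. (f x :: real) ^ n) \<in> Pk (n * k) D"
proof (induction n)
  case (Suc n)
  then show ?case using Pk_mult[OF Suc.prems Suc.IH[OF Suc.prems]] by simp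
qed (simp add: Pk_const)

text \<open>Coordinate projections and the embeddings \<open>axis i\<close> are linear, so
  \<open>Pk_linear_image\<close> serves both directions. Matrix fields reach the scalar lemmas by
  using it twice.\<close>

lemma Pk_vec_iff:
  fixes f :: "pt \<Rightarrow> 'a::real_normed_vector ^ 'n"
  shows "f \<in> Pk k D \<longleftrightarrow> (\<forall>i. (\<lambda>x. f x $ i) \<in> Pk k D)"
proof
  show "f \<in> Pk k D \<Longrightarrow> \<forall>i. (\<lambda>x. f x $ i) \<in> Pk k D"
    by (auto intro!: Pk_linear_image[where h = "\<lambda>v. v $ _"] simp: linear_iff)
next
  assume "\<forall>i. (\<lambda>x. f x $ i) \<in> Pk k D"
  then have "(\<lambda>x. \<Sum>i\<in>UNIV. axis i (f x $ i)) \<in> Pk k D"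
    by (intro Pk_sum Pk_linear_image[where h = "axis _"])
       (auto simp: linear_iff vec_eq_iff axis_def)
  moreover have "(\<Sum>i\<in>UNIV. axis i (f x $ i)) = f x" for x
    by (auto simp: vec_eq_iff axis_def if_distrib cong: if_cong)
  ultimately show "f \<in> Pk k D" by simp
qed

subsection \<open>Partial derivatives\<close>

lemma pd_eqI: "(f has_derivative f') (at x) \<Longrightarrow> pd i f x = f' (axis i 1)"
  unfolding pd_def by (metis frechet_derivative_at)

lemma frechet_derivative_pd:
  assumes "f differentiable at x"
  shows "frechet_derivative f (at x) h = h $ 1 * pd 1 f x + h $ 2 * pd 2 f x"
proof -
  have l: "linear (frechet_derivative f (at x))"
    using assms linear_frechet_derivative by blast
  have "h = h $ 1 *\<^sub>R axis 1 1 + h $ 2 *\<^sub>R axis 2 1"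
    by (simp add: vec_eq_iff forall_2 axis_def)
  then have "frechet_derivative f (at x) h =
      frechet_derivative f (at x) (h $ 1 *\<^sub>R axis 1 1 + h $ 2 *\<^sub>R axis 2 1)" by simp
  also have "\<dots> = h $ 1 * pd 1 f x + h $ 2 * pd 2 f x"
    by (simp add: linear_add[OF l] linear_scale[OF l] pd_def)
  finally show ?thesis .
qed

lemma has_derivative_pd:
  assumes "f differentiable at x"
  shows "(f has_derivative (\<lambda>h. h $ 1 * pd 1 f x + h $ 2 * pd 2 f x)) (at x)"
proof -
  have "frechet_derivative f (at x) = (\<lambda>h. h $ 1 * pd 1 f x + h $ 2 * pd 2 f x)"
    using frechet_derivative_pd[OF assms] by blast
  then show ?thesis using assms unfolding frechet_derivative_works by simp
qed

lemma pd_add: "f differentiable at x \<Longrightarrow> g differentiable at x \<Longrightarrow>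
    pd i (\<lambda>x. f x + g x) x = pd i f x + pd i g x"
  by (subst pd_eqI[OF has_derivative_add[OF has_derivative_pd has_derivative_pd]])
     (use exhaust_2[of i] in \<open>auto simp: axis_def\<close>)

lemma pd_cmult: "f differentiable at x \<Longrightarrow> pd i (\<lambda>x. c * f x) x = c * pd i f x"
  by (subst pd_eqI[OF has_derivative_mult_right[OF has_derivative_pd]])
     (use exhaust_2[of i] in \<open>auto simp: axis_def\<close>)

lemma pd_uminus: "f differentiable at x \<Longrightarrow> pd i (\<lambda>x. - f x) x = - pd i f x"
  using pd_cmult[of f x i "-1"] by simp

lemma pd_diff: "f differentiable at x \<Longrightarrow> g differentiable at x \<Longrightarrow>
    pd i (\<lambda>x. f x - g x) x = pd i f x - pd i g x"
  by (subst pd_eqI[OF has_derivative_diff[OF has_derivative_pd has_derivative_pd]])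
     (use exhaust_2[of i] in \<open>auto simp: axis_def\<close>)

lemma pd_mult: "f differentiable at x \<Longrightarrow> g differentiable at x \<Longrightarrow>
    pd i (\<lambda>x. f x * g x) x = pd i f x * g x + f x * pd i g x"
  by (subst pd_eqI[OF has_derivative_mult[OF has_derivative_pd has_derivative_pd]])
     (use exhaust_2[of i] in \<open>auto simp: axis_def\<close>)

lemma pd_const [simp]: "pd i (\<lambda>x. c) x = 0"
  by (rule pd_eqI) (rule has_derivative_const)

lemma pd_coord [simp]: "pd i (\<lambda>x. x $ j) x = (if i = j then 1 else 0)"
proof -
  have "((\<lambda>x. x $ j) has_derivative (\<lambda>x. x $ j)) (at x)"
    by (rule bounded_linear.has_derivative[OF bounded_linear_vec_nth]) (rule has_derivative_ident)
  from pd_eqI[OF this] show ?thesis by (auto simp: axis_def)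
qed

lemma differentiable_coord [simp, intro]: "(\<lambda>x::real^'n. x $ j) differentiable at x"
  by (rule bounded_linear_imp_differentiable) (rule bounded_linear_vec_nth)

lemma pd_sum:
  assumes "\<And>a. a \<in> A \<Longrightarrow> f a differentiable at x"
  shows "pd i (\<lambda>x. \<Sum>a\<in>A. f a x) x = (\<Sum>a\<in>A. pd i (f a) x)"
  using assms
proof (induction A rule: infinite_finite_induct)
  case (insert a A)
  then have "(\<lambda>x. \<Sum>a\<in>A. f a x) differentiable at x"
    by (cases "finite A") auto
  with insert show ?case by (simp add: pd_add)
qed auto

lemma pd_monomial_1: "pd 1 (\<lambda>x. (x $ 1) ^ i * (x $ 2) ^ j * c) x = of_nat i * (x $ 1) ^ (i - 1) * (x $ 2) ^ j * c"
  and pd_monomial_2: "pd 2 (\<lambda>x. (x $ 1) ^ i * (x $ 2) ^ j * c) x = of_nat j * (x $ 1) ^ i * (x $ 2) ^ (j - 1) * c"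
proof -
  have "((\<lambda>x::pt. (x $ 1) ^ i * (x $ 2) ^ j * c) has_derivative
     (\<lambda>h. of_nat i * (x $ 1) ^ (i - 1) * (x $ 2) ^ j * c * h $ 1 + of_nat j * (x $ 1) ^ i * (x $ 2) ^ (j - 1) * c * h $ 2)) (at x)"
    by (auto intro!: derivative_eq_intros bounded_linear.has_derivative[OF bounded_linear_vec_nth] ext simp: algebra_simps)
  from pd_eqI[OF this]
  show "pd 1 (\<lambda>x. (x $ 1) ^ i * (x $ 2) ^ j * c) x = of_nat i * (x $ 1) ^ (i - 1) * (x $ 2) ^ j * c"
    and "pd 2 (\<lambda>x. (x $ 1) ^ i * (x $ 2) ^ j * c) x = of_nat j * (x $ 1) ^ i * (x $ 2) ^ (j - 1) * c"
    by (auto simp: axis_def)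
qed

lemma differentiable_monomial: "(\<lambda>x::pt. (x $ 1) ^ i * (x $ 2) ^ j * c) differentiable at x"
  by (intro differentiable_mult differentiable_power) auto

lemma Pk_UNIV_E:
  fixes f :: "pt \<Rightarrow> real"
  assumes "f \<in> Pk k UNIV"
  obtains c where "f = (\<lambda>x. \<Sum>i\<le>k. \<Sum>j\<le>k - i. (x $ 1) ^ i * (x $ 2) ^ j * c i j)"
  using assms unfolding Pk_def by (auto simp: fun_eq_iff)

lemma Pk_differentiable:
  fixes f :: "pt \<Rightarrow> real"
  assumes "f \<in> Pk k UNIV"
  shows "f differentiable at x"
  by (rule Pk_UNIV_E[OF assms]) (simp add: differentiable_monomial)

lemma Pk_pd:
  fixes f :: "pt \<Rightarrow> real"
  assumes f: "f \<in> Pk k UNIV"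
  shows "pd i f \<in> Pk (k - 1) UNIV"
proof -
  obtain c where c: "f = (\<lambda>x. \<Sum>i\<le>k. \<Sum>j\<le>k - i. (x $ 1) ^ i * (x $ 2) ^ j * c i j)"
    using Pk_UNIV_E[OF f] .
  have "pd i f = (\<lambda>x. \<Sum>a\<le>k. \<Sum>b\<le>k - a. pd i (\<lambda>x. (x $ 1) ^ a * (x $ 2) ^ b * c a b) x)"
    unfolding c by (intro ext) (simp add: pd_sum differentiable_monomial)
  moreover have "pd i (\<lambda>x. (x $ 1) ^ a * (x $ 2) ^ b * c a b) \<in> Pk (k - 1) UNIV" if "a + b \<le> k" for a b
  proof (cases "i = 1")
    case True
    show ?thesis
    proof (cases "a = 0")
      case False
      have "(\<lambda>x. ((x $ 1) ^ (a - 1) * (x $ 2) ^ b) *\<^sub>R (of_nat a * c a b)) \<in> Pk (k - 1) UNIV"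
        using False that by (intro Pk_monomial) auto
      then show ?thesis unfolding True pd_monomial_1[abs_def] by (simp add: mult_ac)
    qed (simp only: True pd_monomial_1[abs_def] of_nat_0 mult_zero_left Pk_const)
  next
    case False
    then have i: "i = 2" using exhaust_2[of i] by auto
    show ?thesis
    proof (cases "b = 0")
      case False
      have "(\<lambda>x. ((x $ 1) ^ a * (x $ 2) ^ (b - 1)) *\<^sub>R (of_nat b * c a b)) \<in> Pk (k - 1) UNIV"
        using False that by (intro Pk_monomial) auto
      then show ?thesis unfolding i pd_monomial_2[abs_def] by (simp add: mult_ac)
    qed (simp only: i pd_monomial_2[abs_def] of_nat_0 mult_zero_left Pk_const)
  qed
  ultimately show ?thesis by (auto intro!: Pk_sum)
qed

lemma Pk_continuous_on:
  fixes f :: "pt \<Rightarrow> real"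
  assumes "f \<in> Pk k UNIV"
  shows "continuous_on S f"
  by (meson Pk_differentiable[OF assms] differentiable_imp_continuous_on differentiable_at_withinI
      differentiable_on_def)

lemma Pk_pd_commute:
  fixes f :: "pt \<Rightarrow> real"
  assumes "f \<in> Pk k UNIV"
  shows "pd i (pd j f) = pd j (pd i f)"
proof -
  obtain c where c: "f = (\<lambda>x. \<Sum>i\<le>k. \<Sum>j\<le>k - i. (x $ 1) ^ i * (x $ 2) ^ j * c i j)"
    using Pk_UNIV_E[OF assms] .
  have 1: "pd 1 f = (\<lambda>x. \<Sum>i\<le>k. \<Sum>j\<le>k - i. (x $ 1) ^ (i - 1) * (x $ 2) ^ j * (of_nat i * c i j))"
    unfolding c by (intro ext) (simp add: pd_sum differentiable_monomial pd_monomial_1, simp add: mult_ac)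
  have 2: "pd 2 f = (\<lambda>x. \<Sum>i\<le>k. \<Sum>j\<le>k - i. (x $ 1) ^ i * (x $ 2) ^ (j - 1) * (of_nat j * c i j))"
    unfolding c by (intro ext) (simp add: pd_sum differentiable_monomial pd_monomial_2, simp add: mult_ac)
  have "pd 1 (pd 2 f) = pd 2 (pd 1 f)"
    unfolding 1 2
    by (intro ext) (simp add: pd_sum differentiable_monomial pd_monomial_1 pd_monomial_2, simp add: mult_ac)
  then show ?thesis using exhaust_2[of i] exhaust_2[of j] by auto
qed

lemma Pk_antiderivative_1:
  fixes f :: "pt \<Rightarrow> real"
  assumes "f \<in> Pk k UNIV"
  obtains F where "F \<in> Pk (Suc k) UNIV" "pd 1 F = f"
proof -
  obtain c where c: "f = (\<lambda>x. \<Sum>i\<le>k. \<Sum>j\<le>k - i. (x $ 1) ^ i * (x $ 2) ^ j * c i j)"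
    using Pk_UNIV_E[OF assms] .
  define F :: "pt \<Rightarrow> real" where "F = (\<lambda>x. \<Sum>i\<le>k. \<Sum>j\<le>k - i. (x $ 1) ^ (Suc i) * (x $ 2) ^ j * (c i j / of_nat (Suc i)))"
  have "(\<lambda>x. \<Sum>i\<le>k. \<Sum>j\<le>k - i. ((x $ 1) ^ (Suc i) * (x $ 2) ^ j) *\<^sub>R (c i j / of_nat (Suc i))) \<in> Pk (Suc k) UNIV"
    by (intro Pk_sum Pk_monomial) auto
  then have "F \<in> Pk (Suc k) UNIV" unfolding F_def real_scaleR_def .
  moreover have "pd 1 F = f"
  proof
    fix x
    have "pd 1 F x = (\<Sum>i\<le>k. \<Sum>j\<le>k - i. of_nat (Suc i) * (x $ 1) ^ (Suc i - 1) * (x $ 2) ^ j * (c i j / of_nat (Suc i)))"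
      unfolding F_def
      by (simp add: pd_sum differentiable_monomial pd_monomial_1 del: of_nat_Suc power_Suc times_divide_eq_right)
    also have "\<dots> = f x" unfolding c by (intro sum.cong refl) (simp del: of_nat_Suc)
    finally show "pd 1 F x = f x" .
  qed
  ultimately show ?thesis using that by blast
qed

lemma pd_1_zero_imp_indep:
  assumes d: "\<And>x. f differentiable at x" and z: "\<And>x. pd 1 f x = 0"
  shows "f x = f (vector [0, x $ 2])"
proof -
  let ?g = "\<lambda>s. f (vector [s, x $ 2])"
  have "(?g has_real_derivative 0) (at s)" for s
  proof -
    have eq: "(\<lambda>s. vector [s, x $ 2] :: pt) = (\<lambda>s. axis 2 (x $ 2) + s *\<^sub>R axis 1 1)"
      by (auto simp: vec_eq_iff forall_2 axis_def)
    have "((\<lambda>s. vector [s, x $ 2] :: pt) has_derivative (\<lambda>h. h *\<^sub>R axis 1 1)) (at s)"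
      unfolding eq by (auto intro!: derivative_eq_intros)
    from diff_chain_at[OF this has_derivative_pd[OF d]]
    have "(?g has_derivative (\<lambda>h. 0)) (at s)"
      by (simp add: o_def z axis_def)
    then show ?thesis by (simp add: has_field_derivative_def lambda_zero)
  qed
  then have "?g (x $ 1) = ?g 0"
    using DERIV_isconst_all by blast
  moreover have "vector [x $ 1, x $ 2] = x" by (simp add: vec_eq_iff forall_2)
  ultimately show ?thesis by simp
qed

text \<open>Poincare lemma with control of the degree. After \<open>A1\<close> has been integrated
  in the first variable, the curl condition makes \<open>B\<close>, the defect in the second
  equation, independent of \<open>x $ 1\<close>; it is then a polynomial in \<open>x $ 2\<close> and
  is integrated termwise.\<close>

lemma Pk_potential:
  fixes A1 A2 :: "pt \<Rightarrow> real"
  assumes A: "A1 \<in> Pk k UNIV" "A2 \<in> Pk k UNIV" and curl: "\<And>x. pd 2 A1 x = pd 1 A2 x"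
  obtains g where "g \<in> Pk (Suc k) UNIV" "pd 1 g = A1" "pd 2 g = A2"
proof -
  obtain F where F: "F \<in> Pk (Suc k) UNIV" "pd 1 F = A1" using Pk_antiderivative_1[OF A(1)] .
  define B where "B = (\<lambda>x. A2 x - pd 2 F x)"
  have F2: "pd 2 F \<in> Pk k UNIV" using Pk_pd[OF F(1)] by simp
  have B: "B \<in> Pk k UNIV" unfolding B_def using Pk_diff[OF A(2) F2] .
  have "pd 1 B x = 0" for x
    unfolding B_def
    by (simp add: pd_diff Pk_differentiable[OF A(2)] Pk_differentiable[OF F2] Pk_pd_commute[OF F(1), of 1 2]
      F(2) curl)
  from pd_1_zero_imp_indep[OF Pk_differentiable[OF B] this]
  have Bx: "B x = B (vector [0, x $ 2])" for x .
  obtain c where c: "B = (\<lambda>x. \<Sum>i\<le>k. \<Sum>j\<le>k - i. (x $ 1) ^ i * (x $ 2) ^ j * c i j)"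
    using Pk_UNIV_E[OF B] .
  have B0: "B x = (\<Sum>j\<le>k. (x $ 2) ^ j * c 0 j)" for x
  proof -
    have "B x = (\<Sum>i\<le>k. \<Sum>j\<le>k - i. 0 ^ i * (x $ 2) ^ j * c i j)"
      using Bx[of x] unfolding c by simp
    also have "\<dots> = (\<Sum>i\<le>k. if i = 0 then \<Sum>j\<le>k. (x $ 2) ^ j * c 0 j else 0)"
      by (intro sum.cong) (auto simp: power_0_left)
    finally show ?thesis by simp
  qed
  \<comment> \<open>The factor \<open>(x $ 1) ^ 0\<close> keeps the shape in which
    \<open>pd_monomial_1\<close> and \<open>pd_monomial_2\<close> apply.\<close>
  define H :: "pt \<Rightarrow> real" where "H = (\<lambda>x. \<Sum>j\<le>k. (x $ 1) ^ 0 * (x $ 2) ^ (Suc j) * (c 0 j / of_nat (Suc j)))"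
  have "(\<lambda>x. \<Sum>j\<le>k. ((x $ 1) ^ 0 * (x $ 2) ^ (Suc j)) *\<^sub>R (c 0 j / of_nat (Suc j))) \<in> Pk (Suc k) UNIV"
    by (intro Pk_sum Pk_monomial) auto
  then have H: "H \<in> Pk (Suc k) UNIV" unfolding H_def real_scaleR_def .
  have H1: "pd 1 H x = 0" for x
    unfolding H_def by (subst pd_sum, blast intro: differentiable_monomial, subst pd_monomial_1, simp)
  have H2: "pd 2 H x = B x" for x
    unfolding H_def B0 by (subst pd_sum, blast intro: differentiable_monomial, subst pd_monomial_2)
      (intro sum.cong refl, simp del: of_nat_Suc)
  have "(\<lambda>x. F x + H x) \<in> Pk (Suc k) UNIV" using Pk_add[OF F(1) H] .
  moreover have "pd 1 (\<lambda>x. F x + H x) = A1" "pd 2 (\<lambda>x. F x + H x) = A2"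
    using F(2) by (auto simp: fun_eq_iff pd_add Pk_differentiable[OF F(1)] Pk_differentiable[OF H] H1 H2 B_def)
  ultimately show ?thesis using that by blast
qed

subsection \<open>Restriction to lines\<close>

lemma linepath_nth: "linepath a b s $ i = a $ i + s * (b $ i - a $ i)"
  by (simp add: linepath_def algebra_simps)

lemma Pk_linepath:
  fixes f :: "pt \<Rightarrow> real"
  assumes "f \<in> Pk k D"
  obtains p :: "real poly" where "degree p \<le> k" "\<And>s. linepath a b s \<in> D \<Longrightarrow> f (linepath a b s) = poly p s"
proof -
  obtain c where c: "\<forall>x\<in>D. f x = (\<Sum>i\<le>k. \<Sum>j\<le>k - i. ((x $ 1) ^ i * (x $ 2) ^ j) *\<^sub>R c i j)"
    using assms unfolding Pk_def by auto
  let ?m = "\<lambda>i. [:a $ i, b $ i - a $ i:]"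
  define p where "p = (\<Sum>i\<le>k. \<Sum>j\<le>k - i. Polynomial.smult (c i j) (?m 1 ^ i * ?m 2 ^ j))"
  have "degree (Polynomial.smult (c i j) (?m 1 ^ i * ?m 2 ^ j)) \<le> k" if "i + j \<le> k" for i j
  proof -
    have "degree (?m 1 ^ i) \<le> degree (?m 1) * i" "degree (?m 2 ^ j) \<le> degree (?m 2) * j"
      by (rule degree_power_le)+
    moreover have "degree (?m 1) * i \<le> 1 * i" "degree (?m 2) * j \<le> 1 * j"
      by (intro mult_right_mono; simp)+
    moreover have "degree (?m 1 ^ i * ?m 2 ^ j) \<le> degree (?m 1 ^ i) + degree (?m 2 ^ j)"
      by (rule degree_mult_le)
    moreover have "degree (Polynomial.smult (c i j) (?m 1 ^ i * ?m 2 ^ j)) \<le> degree (?m 1 ^ i * ?m 2 ^ j)"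
      by (rule degree_smult_le)
    ultimately show ?thesis using that by linarith
  qed
  then have "degree p \<le> k" unfolding p_def by (intro degree_sum_le) auto
  moreover have "f (linepath a b s) = poly p s" if "linepath a b s \<in> D" for s
    using c[rule_format, OF that] unfolding p_def
    by (simp add: poly_sum linepath_nth mult_ac)
  ultimately show ?thesis using that by blast
qed

text \<open>The parameter \<open>s\<close> is an affine function of the point, given by orthogonal
  projection, so substituting it for the variable does not raise the degree. With
  \<open>Pk_linepath\<close> this identifies \<open>Pk k\<close> on a segment with the univariate
  polynomials of degree at most \<open>k\<close>.\<close>

lemma Pk_segmentI:
  fixes f :: "pt \<Rightarrow> real"
  assumes "a \<noteq> b" "degree p \<le> k" "\<And>s. 0 \<le> s \<Longrightarrow> s \<le> 1 \<Longrightarrow> f (linepath a b s) = poly p s"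
  shows "f \<in> Pk k (closed_segment a b)"
proof -
  let ?s = "\<lambda>x. ((x - a) \<bullet> (b - a)) / ((b - a) \<bullet> (b - a))"
  have s: "?s = (\<lambda>x. ((b - a) $ 1 / ((b - a) \<bullet> (b - a))) * x $ 1 + (((b - a) $ 2 / ((b - a) \<bullet> (b - a))) * x $ 2
      - (a \<bullet> (b - a)) / ((b - a) \<bullet> (b - a))))"
    by (auto simp: inner_vec_def sum_2 field_simps add_divide_distrib diff_divide_distrib)
  have "?s \<in> Pk 1 (closed_segment a b)"
    unfolding s by (intro Pk_add Pk_diff Pk_const Pk_cmult Pk_coord) auto
  then have pw: "(\<lambda>x. (?s x) ^ i) \<in> Pk k (closed_segment a b)" if "i \<le> k" for i
    using Pk_mono[OF Pk_power] that by fastforce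
  have "(\<lambda>x. \<Sum>i\<le>degree p. coeff p i * ?s x ^ i) \<in> Pk k (closed_segment a b)"
    using assms(2) by (intro Pk_sum Pk_cmult pw) auto
  then show ?thesis
  proof (rule Pk_cong)
    fix x assume "x \<in> closed_segment a b"
    then obtain u where u: "0 \<le> u" "u \<le> 1" "x = linepath a b u"
      unfolding closed_segment_def linepath_def by auto
    have "x - a = u *\<^sub>R (b - a)" unfolding u(3) by (simp add: linepath_def algebra_simps)
    then have "?s x = u" using assms(1) by simp
    then show "(\<Sum>i\<le>degree p. coeff p i * ?s x ^ i) = f x"
      using assms(3)[OF u(1,2)] unfolding u(3)[symmetric] by (simp add: poly_altdef)
  qed
qed

lemma has_derivative_linepath: "(linepath a b has_derivative (\<lambda>h. h *\<^sub>R (b - a))) (at s)"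
  using has_vector_derivative_linepath_within[of a b s UNIV] by (simp add: has_vector_derivative_def)

lemma linepath_chain:
  assumes "f differentiable at (linepath a b s)"
  shows "((\<lambda>s. f (linepath a b s)) has_real_derivative
     (b - a) $ 1 * pd 1 f (linepath a b s) + (b - a) $ 2 * pd 2 f (linepath a b s)) (at s within S)"
proof -
  have "((\<lambda>s. f (linepath a b s)) has_real_derivative
     (b - a) $ 1 * pd 1 f (linepath a b s) + (b - a) $ 2 * pd 2 f (linepath a b s)) (at s)"
    using diff_chain_at[OF has_derivative_linepath has_derivative_pd[OF assms]]
    unfolding has_field_derivative_def o_def
    by (rule has_derivative_eq_rhs) (auto simp: algebra_simps)
  then show ?thesis by (rule has_field_derivative_at_within)
qed

subsection \<open>Triangles in barycentric coordinates\<close>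

text \<open>The determinant with columns \<open>u\<close> and \<open>v\<close>: twice the signed
  area of the triangle that they span.\<close>

definition cr :: "pt \<Rightarrow> pt \<Rightarrow> real" where
  "cr u v = u $ 1 * v $ 2 - u $ 2 * v $ 1"

text \<open>The barycentric coordinate that belongs to the last vertex \<open>c\<close>, as a
  quotient of signed areas. Those of \<open>a\<close> and \<open>b\<close> are
  \<open>bary b c a\<close> and \<open>bary c a b\<close>, so a fact is proved for one coordinate
  and rotated.\<close>

definition bary :: "pt \<Rightarrow> pt \<Rightarrow> pt \<Rightarrow> pt \<Rightarrow> real" where
  "bary a b c x = cr (b - a) (x - a) / cr (b - a) (c - a)"

text \<open>The vertices are listed without a choice of orientation, so that \<open>tri_rot\<close>
  and \<open>tri_swap\<close> can bring any vertex or edge into any position.\<close>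

definition tri :: "pt \<Rightarrow> pt \<Rightarrow> pt \<Rightarrow> pt set \<Rightarrow> bool" where
  "tri a b c K \<longleftrightarrow> K = convex hull {a, b, c} \<and> cr (b - a) (c - a) \<noteq> 0"

lemma cr_rot: "cr (c - b) (a - b) = cr (b - a) (c - a)"
  by (simp add: cr_def algebra_simps)

lemma cr_swap: "cr (a - b) (c - b) = - cr (b - a) (c - a)"
  by (simp add: cr_def algebra_simps)

lemma tri_rot: "tri a b c K \<Longrightarrow> tri b c a K"
  unfolding tri_def using cr_rot[of c b a] by (auto simp: insert_commute)

lemma tri_swap: "tri a b c K \<Longrightarrow> tri b a c K"
  unfolding tri_def using cr_swap[of a b c] by (auto simp: insert_commute)

lemma tri_distinct: "tri a b c K \<Longrightarrow> a \<noteq> b \<and> b \<noteq> c \<and> a \<noteq> c"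
  unfolding tri_def cr_def by auto

lemma bary_sum: "cr (b - a) (c - a) \<noteq> 0 \<Longrightarrow> bary b c a x + bary c a b x + bary a b c x = 1"
  unfolding bary_def cr_rot[of c b a] cr_rot[of a c b]
  by (simp add: add_divide_distrib[symmetric]) (simp add: cr_def algebra_simps)

lemma bary_affine: "bary a b c (u *\<^sub>R x + v *\<^sub>R y + w *\<^sub>R z) =
    u * bary a b c x + v * bary a b c y + w * bary a b c z" if "u + v + w = 1"
proof -
  have "cr (b - a) ((u *\<^sub>R x + v *\<^sub>R y + w *\<^sub>R z) - a) = cr (b - a) ((u *\<^sub>R x + v *\<^sub>R y + w *\<^sub>R z) - (u + v + w) *\<^sub>R a)"
    using that by simp
  also have "\<dots> = u * cr (b - a) (x - a) + v * cr (b - a) (y - a) + w * cr (b - a) (z - a)"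
    by (simp add: cr_def algebra_simps)
  finally show ?thesis unfolding bary_def by (simp add: add_divide_distrib)
qed

lemma bary_simps [simp]: "bary a b c a = 0" "bary a b c b = 0"
  by (simp_all add: bary_def cr_def)

lemma bary_self [simp]: "cr (b - a) (c - a) \<noteq> 0 \<Longrightarrow> bary a b c c = 1"
  by (simp add: bary_def)

text \<open>Cramer's rule: multiplied by the determinant, the claim is a polynomial identity in each
  coordinate.\<close>

lemma bary_expand:
  assumes "cr (b - a) (c - a) \<noteq> 0"
  shows "x = bary b c a x *\<^sub>R a + bary c a b x *\<^sub>R b + bary a b c x *\<^sub>R c"
proof -
  let ?d = "cr (b - a) (c - a)"
  let ?y = "cr (c - b) (x - b) *\<^sub>R a + cr (a - c) (x - c) *\<^sub>R b + cr (b - a) (x - a) *\<^sub>R c"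
  have "?d * x $ 1 = ?y $ 1" "?d * x $ 2 = ?y $ 2"
    unfolding cr_def vector_add_component vector_minus_component vector_scaleR_component real_scaleR_def
    by algebra+
  then have id: "?d * x $ i = ?y $ i" for i using exhaust_2[of i] by (elim disjE) (simp_all only:)
  have "(1 / ?d) *\<^sub>R ?y = x"
    using assms id by (simp add: vec_eq_iff divide_simps mult.commute)
  then show ?thesis
    using cr_rot[of c b a] cr_rot[of a c b] unfolding bary_def
    by (simp add: scaleR_add_right)
qed

lemma tri_eq:
  assumes "tri a b c K"
  shows "K = {x. 0 \<le> bary b c a x \<and> 0 \<le> bary c a b x \<and> 0 \<le> bary a b c x}"
proof -
  have d: "cr (b - a) (c - a) \<noteq> 0" using assms by (simp add: tri_def)
  have d': "cr (c - b) (a - b) \<noteq> 0" "cr (a - c) (b - c) \<noteq> 0"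
    using d cr_rot[of c b a] cr_rot[of a c b] by auto
  have K: "K = { u *\<^sub>R a + v *\<^sub>R b + w *\<^sub>R c | u v w. 0 \<le> u \<and> 0 \<le> v \<and> 0 \<le> w \<and> u + v + w = 1}"
    using assms convex_hull_3[of a b c] by (simp add: tri_def)
  show ?thesis
  proof (intro set_eqI iffI)
    fix x assume "x \<in> K"
    then obtain u v w where *: "x = u *\<^sub>R a + v *\<^sub>R b + w *\<^sub>R c" "0 \<le> u" "0 \<le> v" "0 \<le> w" "u + v + w = 1"
      using K by auto
    show "x \<in> {x. 0 \<le> bary b c a x \<and> 0 \<le> bary c a b x \<and> 0 \<le> bary a b c x}"
      using d d' *(2-4) by (simp add: *(1) bary_affine[OF *(5)])
  next
    fix x assume "x \<in> {x. 0 \<le> bary b c a x \<and> 0 \<le> bary c a b x \<and> 0 \<le> bary a b c x}"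
    then show "x \<in> K" unfolding K using bary_expand[OF d, of x] bary_sum[OF d, of x] by blast
  qed
qed

lemma continuous_bary [continuous_intros]: "continuous_on S (bary a b c)"
  unfolding bary_def cr_def by (cases "cr (b - a) (c - a) = 0")
    (auto intro!: continuous_intros simp: cr_def)

lemma open_bary_pos: "open {x. 0 < bary a b c x}"
  by (rule open_Collect_less) (auto intro: continuous_intros)

lemma bary_diff: "bary a b c (x + h) = bary a b c x + cr (b - a) h / cr (b - a) (c - a)"
  by (simp add: bary_def cr_def algebra_simps add_divide_distrib diff_divide_distrib)

lemma tri_interior:
  assumes "tri a b c K"
  shows "interior K = {x. 0 < bary b c a x \<and> 0 < bary c a b x \<and> 0 < bary a b c x}"
proof
  have "open {x. 0 < bary b c a x \<and> 0 < bary c a b x \<and> 0 < bary a b c x}"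
    by (intro open_Collect_conj open_bary_pos)
  then show "{x. 0 < bary b c a x \<and> 0 < bary c a b x \<and> 0 < bary a b c x} \<subseteq> interior K"
    using tri_eq[OF assms] by (intro interior_maximal) auto
  have gen: "0 < bary p q r x" if t: "tri p q r K" and x: "x \<in> interior K" for p q r x
  proof (rule ccontr)
    assume n: "\<not> 0 < bary p q r x"
    have d: "cr (q - p) (r - p) \<noteq> 0" using t by (simp add: tri_def)
    obtain e where e: "e > 0" "ball x e \<subseteq> K" using x mem_interior by blast
    \<comment> \<open>The shift by \<open>s *\<^sub>R (p - r)\<close> has length
      \<open>e / 2\<close>, so it stays in \<open>K\<close>, and it lowers the coordinate by exactly
      \<open>s\<close>.\<close>
    define s where "s = e / (2 * norm (p - r))"
    have pr: "norm (p - r) > 0" using tri_distinct[OF t] by auto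
    then have s: "s > 0" using e by (simp add: s_def)
    have "norm (s *\<^sub>R (p - r)) < e" using pr e by (simp add: s_def)
    then have "x + s *\<^sub>R (p - r) \<in> K" using e(2) by (auto simp: dist_norm)
    moreover have "bary p q r (x + s *\<^sub>R (p - r)) = bary p q r x - s"
    proof -
      have "cr (q - p) (s *\<^sub>R (p - r)) = - s * cr (q - p) (r - p)"
        by (simp add: cr_def algebra_simps)
      then show ?thesis using d by (simp add: bary_diff)
    qed
    moreover have "0 \<le> bary p q r y" if "y \<in> K" for y using tri_eq[OF t] that by auto
    ultimately have "0 \<le> bary p q r x - s" by metis
    then show False using n s by linarith
  qed
  show "interior K \<subseteq> {x. 0 < bary b c a x \<and> 0 < bary c a b x \<and> 0 < bary a b c x}"
    using gen[OF assms] gen[OF tri_rot[OF assms]] gen[OF tri_rot[OF tri_rot[OF assms]]] by auto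
qed

lemma tri_affine_independent:
  assumes "tri a b c K"
  shows "\<not> affine_dependent {a, b, c}"
proof
  assume dep: "affine_dependent {a, b, c}"
  have gen: False if t: "tri p q r K" and r: "r \<in> affine hull {p, q}" for p q r
  proof -
    obtain u v where uv: "r = u *\<^sub>R p + v *\<^sub>R q" "u + v = 1"
      using r unfolding affine_hull_2 by auto
    have u: "u = 1 - v" using uv by simp
    have r: "r - p = v *\<^sub>R (q - p)" unfolding uv(1) u by (simp add: algebra_simps)
    have "cr (q - p) (r - p) = 0" unfolding r by (simp add: cr_def algebra_simps)
    then show False using t by (simp add: tri_def)
  qed
  from dep obtain x where x: "x \<in> {a, b, c}" "x \<in> affine hull ({a, b, c} - {x})"
    unfolding affine_dependent_def by blast
  have d: "a \<noteq> b" "b \<noteq> c" "a \<noteq> c" using tri_distinct[OF assms] by auto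
  have "{a, b, c} - {a} = {b, c}" "{a, b, c} - {b} = {c, a}" "{a, b, c} - {c} = {a, b}"
    using d by auto
  then have "a \<in> affine hull {b, c} \<or> b \<in> affine hull {c, a} \<or> c \<in> affine hull {a, b}"
    using x by (metis empty_iff insert_iff)
  then show False
    using gen[OF assms] gen[OF tri_rot[OF assms]] gen[OF tri_rot[OF tri_rot[OF assms]]] by blast
qed

lemma simplex_2_tri:
  assumes "2 simplex K"
  obtains a b c where "tri a b c K"
proof -
  obtain C where C: "\<not> affine_dependent C" "int (card C) = 2 + 1" "K = convex hull C"
    using assms unfolding simplex_def by auto
  then have "card C = 3" by simp
  then obtain a b c where abc: "C = {a, b, c}" "a \<noteq> b" "b \<noteq> c" "a \<noteq> c"
    unfolding card_3_iff by auto
  have "cr (b - a) (c - a) \<noteq> 0"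
  proof
    assume z: "cr (b - a) (c - a) = 0"
    \<comment> \<open>The coefficient of the orthogonal projection of \<open>c - a\<close> onto the
      line of \<open>b - a\<close>. A vanishing determinant makes \<open>c - a\<close> equal to its
      projection.\<close>
    define t where "t = ((c - a) \<bullet> (b - a)) / ((b - a) \<bullet> (b - a))"
    have n: "(b - a) \<bullet> (b - a) \<noteq> 0" using abc by simp
    have "((b - a) \<bullet> (b - a)) *\<^sub>R (c - a) = ((c - a) \<bullet> (b - a)) *\<^sub>R (b - a)"
    proof -
      have z': "(b - a) $ 1 * (c - a) $ 2 = (b - a) $ 2 * (c - a) $ 1" using z by (simp add: cr_def)
      have "(p * p + q * q) * r = (r * p + s * q) * p \<and> (p * p + q * q) * s = (r * p + s * q) * q"
        if "p * s = q * r" for p q r s :: real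
      proof -
        have "q * (q * r) = q * (p * s)" "p * (p * s) = p * (q * r)" using that by simp_all
        then show ?thesis by (simp add: algebra_simps)
      qed
      from this[OF z'] show ?thesis
        by (simp only: vec_eq_iff forall_2 inner_vec_def sum_2 inner_real_def vector_scaleR_component real_scaleR_def)
    qed
    then have "((b - a) \<bullet> (b - a)) *\<^sub>R (c - a) = ((b - a) \<bullet> (b - a)) *\<^sub>R t *\<^sub>R (b - a)"
      using n by (simp add: t_def)
    then have "c - a = t *\<^sub>R (b - a)" by (rule scaleR_left_imp_eq[OF n])
    then have "c = (1 - t) *\<^sub>R a + t *\<^sub>R b" by (simp add: algebra_simps)
    then have "c \<in> affine hull {a, b}" unfolding affine_hull_2 by (intro CollectI exI conjI) auto
    moreover have "C - {c} = {a, b}" using abc by auto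
    ultimately have "affine_dependent C" unfolding affine_dependent_def abc(1) using abc by auto
    then show False using C by blast
  qed
  then show ?thesis using that C abc unfolding tri_def by blast
qed

lemma tri_extreme_point:
  assumes "tri a b c K"
  shows "x extreme_point_of K \<longleftrightarrow> x \<in> {a, b, c}"
  using extreme_point_of_convex_hull_affine_independent[OF tri_affine_independent[OF assms]] assms
  by (simp add: tri_def)

lemma tri_face_of:
  assumes "tri a b c K"
  shows "F face_of K \<longleftrightarrow> (\<exists>C\<subseteq>{a, b, c}. F = convex hull C)"
  using face_of_convex_hull_affine_independent[OF tri_affine_independent[OF assms]] assms
  by (simp add: tri_def)

text \<open>The faces of a simplex are the hulls of sets of vertices, and their dimension is one
  less than the number of vertices, so the edges correspond to the pairs.\<close>

lemma tri_edge_of: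
  assumes "tri a b c K"
  shows "e edge_of K \<longleftrightarrow> e \<in> {closed_segment a b, closed_segment b c, closed_segment c a}"
proof -
  have d: "a \<noteq> b" "b \<noteq> c" "a \<noteq> c" using tri_distinct[OF assms] by auto
  have ad: "aff_dim (convex hull C) = int (card C) - 1" if "C \<subseteq> {a, b, c}" for C
    using aff_dim_affine_independent[OF affine_independent_subset[OF tri_affine_independent[OF assms] that]]
    by (simp add: aff_dim_convex_hull)
  have "e edge_of K \<longleftrightarrow> (\<exists>C\<subseteq>{a, b, c}. e = convex hull C \<and> card C = 2)"
  proof
    assume "e edge_of K"
    then obtain C where "C \<subseteq> {a, b, c}" "e = convex hull C" "aff_dim e = 1"
      unfolding edge_of_def tri_face_of[OF assms] by blast
    then show "\<exists>C\<subseteq>{a, b, c}. e = convex hull C \<and> card C = 2" using ad[of C] by auto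
  next
    assume "\<exists>C\<subseteq>{a, b, c}. e = convex hull C \<and> card C = 2"
    then obtain C where "C \<subseteq> {a, b, c}" "e = convex hull C" "card C = 2" by blast
    then show "e edge_of K" unfolding edge_of_def tri_face_of[OF assms] using ad[of C] by auto
  qed
  also have "\<dots> \<longleftrightarrow> e \<in> {closed_segment a b, closed_segment b c, closed_segment c a}"
  proof
    assume "\<exists>C\<subseteq>{a, b, c}. e = convex hull C \<and> card C = 2"
    then obtain C where C: "C \<subseteq> {a, b, c}" "e = convex hull C" "card C = 2" by blast
    then obtain x y where "C = {x, y}" "x \<noteq> y" unfolding card_2_iff by auto
    then show "e \<in> {closed_segment a b, closed_segment b c, closed_segment c a}"
      using C unfolding segment_convex_hull by (auto simp: insert_commute[of c b] insert_commute[of b a] insert_commute[of a c])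
  next
    assume "e \<in> {closed_segment a b, closed_segment b c, closed_segment c a}"
    then consider "e = convex hull {a, b}" | "e = convex hull {b, c}" | "e = convex hull {c, a}"
      by (auto simp: segment_convex_hull)
    then show "\<exists>C\<subseteq>{a, b, c}. e = convex hull C \<and> card C = 2"
    proof cases
      case 1 then show ?thesis using d by (intro exI[of _ "{a, b}"]) auto
    next
      case 2 then show ?thesis using d by (intro exI[of _ "{b, c}"]) auto
    next
      case 3 then show ?thesis using d by (intro exI[of _ "{c, a}"]) auto
    qed
  qed
  finally show ?thesis .
qed

lemma edge_tri:
  assumes "2 simplex K" "e edge_of K"
  obtains a b c where "tri a b c K" "e = closed_segment a b"
proof -
  obtain a b c where t: "tri a b c K" using simplex_2_tri[OF assms(1)] .
  show ?thesis
    using assms(2) that t tri_rot[OF t] tri_rot[OF tri_rot[OF t]] unfolding tri_edge_of[OF t] by blast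
qed

lemma edge_point_tri:
  assumes "2 simplex K" "e edge_of K" "x extreme_point_of K" "x \<in> e"
  obtains b c where "tri x b c K" "e = closed_segment x b"
proof -
  obtain a b c where t: "tri a b c K" "e = closed_segment a b" using edge_tri[OF assms(1,2)] .
  have "x \<in> {a, b, c}" using tri_extreme_point[OF t(1)] assms(3) by simp
  moreover have "c \<notin> closed_segment a b"
  proof
    assume "c \<in> closed_segment a b"
    then have "c \<in> affine hull ({a, b, c} - {c})"
      using tri_distinct[OF t(1)] convex_hull_subset_affine_hull[of "{a, b}"]
      by (auto simp: segment_convex_hull insert_Diff_if)
    then show False using tri_affine_independent[OF t(1)] unfolding affine_dependent_def by blast
  qed
  ultimately have "x = a \<or> x = b" using assms(4) t(2) by auto
  then show ?thesis
  proof
    assume "x = a" then show ?thesis using that[of b c] t by simp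
  next
    assume "x = b"
    then show ?thesis using that[of a c] tri_swap[OF t(1)] t(2) closed_segment_commute[of a b] by simp
  qed
qed

lemma edge_imp_segment:
  fixes K :: "pt set"
  assumes "e edge_of K"  "2 simplex K"
  obtains a b where "a \<noteq> b" "e = closed_segment a b" "a extreme_point_of K" "b extreme_point_of K"
proof -
  obtain a b c where t: "tri a b c K" "e = closed_segment a b" using edge_tri[OF assms(2,1)] .
  show ?thesis using that[of a b] t tri_distinct[OF t(1)] tri_extreme_point[OF t(1)] by blast
qed

lemma finite_edges:
  fixes K :: "pt set"
  assumes "2 simplex K"
  shows "finite {e. e edge_of K}"
proof -
  obtain a b c where t: "tri a b c K" using simplex_2_tri[OF assms] .
  have "{e. e edge_of K} = {closed_segment a b, closed_segment b c, closed_segment c a}"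
    using tri_edge_of[OF t] by auto
  then show ?thesis by simp
qed

lemma sum_edges:
  assumes "tri a b c K"
  shows "(\<Sum>e | e edge_of K. f e) = f (closed_segment a b) + f (closed_segment b c) + f (closed_segment c a)"
proof -
  have "{e. e edge_of K} = {closed_segment a b, closed_segment b c, closed_segment c a}"
    using tri_edge_of[OF assms] by auto
  moreover have "closed_segment a b \<noteq> closed_segment b c" "closed_segment a b \<noteq> closed_segment c a"
    "closed_segment c a \<noteq> closed_segment b c"
    using tri_distinct[OF assms] by (auto simp: doubleton_eq_iff)
  ultimately show ?thesis by (simp add: insert_commute add.assoc)
qed

lemma tri_compact_convex: "tri a b c K \<Longrightarrow> compact K \<and> convex K"
  unfolding tri_def by (auto intro: finite_imp_compact_convex_hull)

lemma tri_in_bary_zero: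
  assumes t: "tri a b c K" and x: "x \<in> K" and z: "bary a b c x = 0"
  shows "x \<in> closed_segment a b"
proof -
  have d: "cr (b - a) (c - a) \<noteq> 0" using t by (simp add: tri_def)
  have "x = bary b c a x *\<^sub>R a + bary c a b x *\<^sub>R b" "bary b c a x + bary c a b x = 1"
    using bary_expand[OF d, of x] bary_sum[OF d, of x] z by auto
  moreover have "0 \<le> bary b c a x" "0 \<le> bary c a b x" using tri_eq[OF t] x by auto
  ultimately show ?thesis
    by (subst segment_convex_hull) (auto simp: convex_hull_2)
qed

lemma tri_boundary:
  fixes K :: "pt set"
  assumes K: "2 simplex K" and x: "x \<in> K" "x \<notin> interior K"
  obtains e where "e edge_of K" "x \<in> e"
proof -
  obtain a b c where t: "tri a b c K" using simplex_2_tri[OF K] .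
  note t2 = tri_rot[OF t] and t3 = tri_rot[OF tri_rot[OF t]]
  have "bary a b c x = 0 \<or> bary b c a x = 0 \<or> bary c a b x = 0"
    using x(2) x(1)[unfolded tri_eq[OF t]] unfolding tri_interior[OF t] by fastforce
  then have "x \<in> closed_segment a b \<or> x \<in> closed_segment b c \<or> x \<in> closed_segment c a"
    using tri_in_bary_zero[OF t x(1)] tri_in_bary_zero[OF t2 x(1)] tri_in_bary_zero[OF t3 x(1)] by blast
  then show ?thesis using that tri_edge_of[OF t] by blast
qed

lemma bary_segment_zero: "x \<in> closed_segment a b \<Longrightarrow> bary a b c x = 0"
proof -
  assume "x \<in> closed_segment a b"
  then obtain u where x: "x = (1 - u) *\<^sub>R a + u *\<^sub>R b" unfolding closed_segment_def by blast
  show ?thesis unfolding x bary_def cr_def by (simp add: algebra_simps)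
qed

lemma edge_disjoint_interior:
  fixes K :: "pt set"
  assumes "2 simplex K" "e edge_of K"
  shows "e \<inter> interior K = {}"
proof -
  obtain a b c where t: "tri a b c K" "e = closed_segment a b" using edge_tri[OF assms] .
  show ?thesis using bary_segment_zero unfolding t(2) tri_interior[OF t(1)] by fastforce
qed

lemma tri_interior_nonempty:
  fixes K :: "pt set"
  assumes "2 simplex K"
  shows "interior K \<noteq> {}" "closure (interior K) = K"
proof -
  obtain a b c where t: "tri a b c K" using simplex_2_tri[OF assms] .
  have d: "cr (b - a) (c - a) \<noteq> 0" "cr (c - b) (a - b) \<noteq> 0" "cr (a - c) (b - c) \<noteq> 0"
    using t tri_rot[OF t] tri_rot[OF tri_rot[OF t]] by (auto simp: tri_def)
  let ?m = "(1/3) *\<^sub>R a + (1/3) *\<^sub>R b + (1/3) *\<^sub>R c"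
  have m: "bary p q r ?m = (1/3) * bary p q r a + (1/3) * bary p q r b + (1/3) * bary p q r c" for p q r
    by (rule bary_affine) simp
  have "bary b c a ?m > 0" "bary c a b ?m > 0" "bary a b c ?m > 0"
    unfolding m using d by simp_all
  then have "?m \<in> interior K"
    unfolding tri_interior[OF t] by simp
  then show ne: "interior K \<noteq> {}" by blast
  then show "closure (interior K) = K"
    using convex_closure_interior[of K] tri_compact_convex[OF t] by (auto simp: compact_imp_closed)
qed

subsection \<open>The divergence theorem on a triangle\<close>

definition C1 :: "(pt \<Rightarrow> real) \<Rightarrow> bool" where
  "C1 f \<longleftrightarrow> (\<forall>x. f differentiable at x) \<and> (\<forall>i. continuous_on UNIV (pd i f))"

lemma C1_continuous_on: "C1 f \<Longrightarrow> continuous_on S f"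
  unfolding C1_def
  by (meson differentiable_imp_continuous_on differentiable_at_withinI differentiable_on_def)

lemma C1_differentiable: "C1 f \<Longrightarrow> f differentiable at x"
  unfolding C1_def by blast

lemma C1_continuous_pd: "C1 f \<Longrightarrow> continuous_on S (pd i f)"
  unfolding C1_def using continuous_on_subset by blast

lemma C1_Pk: "f \<in> Pk k UNIV \<Longrightarrow> C1 f"
  unfolding C1_def using Pk_differentiable Pk_continuous_on[OF Pk_pd] by blast

lemma C1_add:
  assumes "C1 f" "C1 g"
  shows "C1 (\<lambda>x. f x + g x)"
proof -
  have "pd i (\<lambda>x. f x + g x) = (\<lambda>x. pd i f x + pd i g x)" for i
    using assms by (auto simp: fun_eq_iff pd_add C1_differentiable)
  then show ?thesis using assms unfolding C1_def by (auto intro!: continuous_intros differentiable_add)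
qed

lemma C1_mult:
  assumes "C1 f" "C1 g"
  shows "C1 (\<lambda>x. f x * g x)"
proof -
  have "pd i (\<lambda>x. f x * g x) = (\<lambda>x. pd i f x * g x + f x * pd i g x)" for i
    using assms by (auto simp: fun_eq_iff pd_mult C1_differentiable)
  then show ?thesis using assms C1_continuous_on[OF assms(1), of UNIV] C1_continuous_on[OF assms(2), of UNIV]
    unfolding C1_def by (auto intro!: continuous_intros differentiable_mult)
qed

lemma C1_cmult: "C1 f \<Longrightarrow> C1 (\<lambda>x. c * f x)"
  by (rule C1_mult) (auto intro: C1_Pk[OF Pk_const])

lemma integrable_lborel_compact:
  fixes f :: "'a::euclidean_space \<Rightarrow> 'b::euclidean_space"
  assumes "compact S" "continuous_on S f"
  shows "f absolutely_integrable_on S"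
proof -
  have "integrable lborel (\<lambda>x. indicator S x *\<^sub>R f x)"
    by (rule borel_integrable_compact[OF assms])
  then have "integrable lebesgue (\<lambda>x. indicator S x *\<^sub>R f x)"
    by (subst integrable_completion) auto
  then show ?thesis by (simp add: set_integrable_def)
qed

lemma integrable_lebesgue_on_compact:
  fixes f :: "'a::euclidean_space \<Rightarrow> 'b::euclidean_space"
  assumes "compact S" "continuous_on S f"
  shows "integrable (lebesgue_on S) f"
  using integrable_lborel_compact[OF assms] assms(1)
  by (simp add: integrable_restrict_space set_integrable_def compact_imp_closed lmeasurable_compact fmeasurableD)

text \<open>Carries Lebesgue measure from \<open>real \<times> real\<close>, where Fubini is
  applied, to \<open>pt\<close>.\<close>

definition mk2 :: "real \<times> real \<Rightarrow> pt" where
  "mk2 p = fst p *\<^sub>R axis 1 1 + snd p *\<^sub>R axis 2 1"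

lemma mk2_nth [simp]: "mk2 p $ 1 = fst p" "mk2 p $ 2 = snd p"
  by (auto simp: mk2_def axis_def)

lemma continuous_on_mk2 [continuous_intros]: "continuous_on S mk2"
  unfolding mk2_def by (intro continuous_intros)

lemma measurable_mk2 [measurable]: "mk2 \<in> borel_measurable borel"
  by (intro borel_measurable_continuous_onI continuous_on_mk2)

lemma Basis_vec2: "(Basis :: pt set) = {axis 1 1, axis 2 1}"
  unfolding Basis_vec_def by (simp add: UNIV_2 insert_commute)

lemma axis_12_neq: "axis 1 (1::real) \<noteq> (axis 2 1 :: pt)"
  by (simp add: axis_eq_axis)

text \<open>Lebesgue measure is determined by its values on boxes, and a box pulls back to a product
  of two intervals.\<close>

lemma distr_mk2: "distr lborel borel mk2 = lborel"
proof (rule sym, rule lborel_eqI)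
  show "sets (distr lborel borel mk2) = sets borel" by simp
  fix l u :: pt assume le: "\<And>b. b \<in> Basis \<Longrightarrow> l \<bullet> b \<le> u \<bullet> b"
  have le': "l $ 1 \<le> u $ 1" "l $ 2 \<le> u $ 2"
    using le[of "axis 1 1"] le[of "axis 2 1"] unfolding Basis_vec2 by (auto simp: inner_axis)
  have "emeasure (distr lborel borel mk2) (box l u) = emeasure lborel (mk2 -` box l u \<inter> space lborel)"
    by (rule emeasure_distr) auto
  also have "mk2 -` box l u \<inter> space lborel = {l $ 1 <..< u $ 1} \<times> {l $ 2 <..< u $ 2}"
    by (auto simp: mem_box_cart forall_2)
  also have "emeasure lborel \<dots> = emeasure (lborel \<Otimes>\<^sub>M lborel) ({l $ 1 <..< u $ 1} \<times> {l $ 2 <..< u $ 2})"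
    by (simp add: lborel_prod)
  also have "\<dots> = emeasure lborel {l $ 1 <..< u $ 1} * emeasure lborel {l $ 2 <..< u $ 2}"
    by (rule lborel.emeasure_pair_measure_Times) auto
  also have "\<dots> = ennreal ((u $ 1 - l $ 1) * (u $ 2 - l $ 2))"
    using le' by (simp add: ennreal_mult)
  also have "\<dots> = (\<Prod>b\<in>Basis. (u - l) \<bullet> b)"
    unfolding Basis_vec2 using axis_12_neq by (simp add: inner_axis)
  finally show "emeasure (distr lborel borel mk2) (box l u) = (\<Prod>b\<in>Basis. (u - l) \<bullet> b)" .
qed

definition ref_tri :: "pt set" where
  "ref_tri = {x. 0 \<le> x $ 1 \<and> 0 \<le> x $ 2 \<and> x $ 1 + x $ 2 \<le> 1}"

lemma compact_ref_tri: "compact ref_tri"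
proof -
  have "closed ref_tri" unfolding ref_tri_def
    by (intro closed_Collect_conj closed_Collect_le continuous_intros)
  moreover have "ref_tri \<subseteq> cbox 0 1"
    by (auto simp: ref_tri_def mem_box_cart forall_2)
  ultimately show ?thesis
    using compact_Int_closed[OF compact_cbox, of ref_tri 0 1] by (simp add: Int_absorb1)
qed

text \<open>Fubini, and the fundamental theorem on the horizontal slices
  \<open>0 \<le> s \<le> 1 - t\<close>; the two terms come from the hypotenuse and from the leg on
  which the first coordinate is 0.\<close>

lemma integral_ref_tri_pd1:
  assumes "C1 f"
  shows "integral ref_tri (pd 1 f) =
    integral {0..1} (\<lambda>t. f (mk2 (1 - t, t))) - integral {0..1} (\<lambda>t. f (mk2 (0, t)))"
proof -
  let ?g = "\<lambda>x. indicator ref_tri x *\<^sub>R pd 1 f x"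
  have cont: "continuous_on S (pd 1 f)" for S using C1_continuous_pd[OF assms] .
  have int: "integrable lborel ?g"
    by (rule borel_integrable_compact[OF compact_ref_tri cont])
  have meas [measurable]: "?g \<in> borel_measurable borel" using borel_measurable_integrable[OF int] by simp
  then have meas' [measurable, simp]: "(\<lambda>x. indicat_real ref_tri x * pd 1 f x) \<in> borel_measurable borel"
    by simp
  have "integral ref_tri (pd 1 f) = integral\<^sup>L lborel ?g"
    using set_borel_integral_eq_integral(2)[of ref_tri "pd 1 f"] int
    by (simp add: set_integrable_def set_lebesgue_integral_def)
  also have "\<dots> = integral\<^sup>L (distr lborel borel mk2) ?g" by (simp add: distr_mk2)
  also have "\<dots> = integral\<^sup>L (lborel \<Otimes>\<^sub>M lborel) (\<lambda>p. ?g (mk2 p))"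
    by (subst integral_distr) (auto simp: lborel_prod)
  also have "\<dots> = (\<integral>t. (\<integral>s. ?g (mk2 (s, t)) \<partial>lborel) \<partial>lborel)"
  proof -
    have "integrable (distr lborel borel mk2) ?g" using int by (simp add: distr_mk2)
    then have "integrable (lborel \<Otimes>\<^sub>M lborel) (\<lambda>p. ?g (mk2 p))"
      by (subst (asm) integrable_distr_eq) (auto simp: lborel_prod)
    moreover have e: "(\<lambda>p. ?g (mk2 p)) = case_prod (\<lambda>s t. ?g (mk2 (s, t)))"
      by (rule ext) (simp only: split_paired_all case_prod_conv)
    ultimately have "integrable (lborel \<Otimes>\<^sub>M lborel) (case_prod (\<lambda>s t. ?g (mk2 (s, t))))"
      by (simp only:)
    from lborel_pair.integral_snd[OF this] show ?thesis unfolding e by (rule sym)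
  qed
  also have "\<dots> = (\<integral>t. indicator {0..1} t *\<^sub>R (f (mk2 (1 - t, t)) - f (mk2 (0, t))) \<partial>lborel)"
  proof (intro Bochner_Integration.integral_cong refl)
    fix t :: real
    show "(\<integral>s. ?g (mk2 (s, t)) \<partial>lborel) = indicator {0..1} t *\<^sub>R (f (mk2 (1 - t, t)) - f (mk2 (0, t)))"
    proof (cases "0 \<le> t \<and> t \<le> 1")
      case True
      have "(\<integral>s. ?g (mk2 (s, t)) \<partial>lborel) = (\<integral>s. indicator {0..1 - t} s *\<^sub>R pd 1 f (mk2 (s, t)) \<partial>lborel)"
        using True by (intro Bochner_Integration.integral_cong refl) (auto simp: ref_tri_def indicator_def)
      also have "\<dots> = f (mk2 (1 - t, t)) - f (mk2 (0, t))"
      proof (rule integral_FTC_Icc)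
        show "0 \<le> 1 - t" using True by simp
        show "continuous_on {0..1 - t} (\<lambda>s. pd 1 f (mk2 (s, t)))"
          by (rule continuous_on_compose2[OF cont[of UNIV]]) (auto intro!: continuous_intros continuous_on_compose2[OF continuous_on_mk2[of UNIV]])
        fix s
        have "((\<lambda>s. mk2 (s, t)) has_derivative (\<lambda>h. h *\<^sub>R axis 1 1)) (at s)"
          unfolding mk2_def fst_conv snd_conv by (auto intro!: derivative_eq_intros)
        from diff_chain_at[OF this has_derivative_pd[OF C1_differentiable[OF assms]]]
        have "((\<lambda>s. f (mk2 (s, t))) has_derivative (\<lambda>h. h *\<^sub>R pd 1 f (mk2 (s, t)))) (at s)"
          by (simp add: o_def axis_def)
        then show "((\<lambda>s. f (mk2 (s, t))) has_vector_derivative pd 1 f (mk2 (s, t))) (at s within {0..1 - t})"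
          unfolding has_vector_derivative_def by (rule has_derivative_at_withinI)
      qed
      finally show ?thesis using True by simp
    next
      case False
      then have "?g (mk2 (s, t)) = 0" for s by (auto simp: ref_tri_def indicator_def)
      then have "(\<integral>s. ?g (mk2 (s, t)) \<partial>lborel) = integral\<^sup>L lborel (\<lambda>s::real. 0)" by (simp only:)
      then have "(\<integral>s. ?g (mk2 (s, t)) \<partial>lborel) = 0" by (simp only: integral_zero)
      then show ?thesis using False by (auto simp: indicator_def)
    qed
  qed
  also have "\<dots> = integral {0..1} (\<lambda>t. f (mk2 (1 - t, t)) - f (mk2 (0, t)))"
  proof -
    have "continuous_on {0..1} (\<lambda>t. f (mk2 (1 - t, t)) - f (mk2 (0, t)))"
      by (intro continuous_intros continuous_on_compose2[OF C1_continuous_on[OF assms, of UNIV]]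
        continuous_on_compose2[OF continuous_on_mk2[of UNIV]]) auto
    then have "set_integrable lborel {0..1} (\<lambda>t. f (mk2 (1 - t, t)) - f (mk2 (0, t)))"
      unfolding set_integrable_def by (intro borel_integrable_compact) auto
    from set_borel_integral_eq_integral(2)[OF this] show ?thesis
      by (simp add: set_lebesgue_integral_def)
  qed
  also have "\<dots> = integral {0..1} (\<lambda>t. f (mk2 (1 - t, t))) - integral {0..1} (\<lambda>t. f (mk2 (0, t)))"
    by (intro Henstock_Kurzweil_Integration.integral_diff integrable_continuous_interval continuous_intros
        continuous_on_compose2[OF C1_continuous_on[OF assms, of UNIV]]
        continuous_on_compose2[OF continuous_on_mk2[of UNIV]]) auto
  finally show ?thesis .
qed

text \<open>Taken in the parameter of \<open>linepath\<close>, hence without the length of the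
  segment, which \<open>edge_inner\<close> multiplies in.\<close>

definition line_int :: "pt \<Rightarrow> pt \<Rightarrow> (pt \<Rightarrow> real) \<Rightarrow> real" where
  "line_int a b f = integral {0..1} (\<lambda>s. f (linepath a b s))"

lemma line_int_swap: "line_int b a f = line_int a b f"
proof -
  have "linepath b a = (\<lambda>s. linepath a b (1 - s))"
    by (auto simp: linepath_def algebra_simps)
  then have eq: "line_int b a f = integral {0..1} (\<lambda>s. f (linepath a b (1 - s)))"
    by (simp add: line_int_def)
  have refl: "((\<lambda>s. g (1 - s)) has_integral i) {0..1}" if "(g has_integral i) {0..1}" for g :: "real \<Rightarrow> real" and i
  proof -
    have "(\<lambda>x::real. 1 - x) ` {0..1} = {0..1}"
      by (auto simp: image_iff intro!: bexI[of _ "1 - _"])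
    then show ?thesis using has_integral_affinity01[OF that, of "-1" 1] by (simp add: algebra_simps)
  qed
  \<comment> \<open>Reflection preserves integrability in both directions; where it fails, both
    integrals have the default value 0.\<close>
  show ?thesis
  proof (cases "(\<lambda>s. f (linepath a b s)) integrable_on {0..1}")
    case True
    then show ?thesis
      unfolding eq line_int_def[of a b] using integral_unique[OF refl[OF integrable_integral[OF True]]] by simp
  next
    case False
    moreover have "\<not> (\<lambda>s. f (linepath a b (1 - s))) integrable_on {0..1}"
      using False refl[of "\<lambda>s. f (linepath a b (1 - s))"] unfolding integrable_on_def by auto
    ultimately show ?thesis unfolding eq line_int_def[of a b] by (simp add: not_integrable_integral)
  qed
qed

text \<open>The choice in \<open>edge_inner\<close> may return the end points in either order, but a
  segment determines them as a set, and reversal changes neither factor.\<close>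

lemma edge_inner_segment:
  assumes "a \<noteq> b"
  shows "edge_inner (closed_segment a b) f q = dist a b * line_int a b (\<lambda>x. f x * q x)"
proof -
  let ?P = "\<lambda>p. case p of (a', b') \<Rightarrow> closed_segment a b = closed_segment a' b'"
  obtain a' b' where s: "(SOME p. ?P p) = (a', b')" by fastforce
  have "?P (SOME p. ?P p)" by (rule someI[of ?P "(a, b)"]) simp
  then have "{a, b} = {a', b'}" unfolding s by simp
  then have "(a' = a \<and> b' = b) \<or> (a' = b \<and> b' = a)" by (auto simp: doubleton_eq_iff)
  then have "dist a' b' * line_int a' b' (\<lambda>x. f x * q x) = dist a b * line_int a b (\<lambda>x. f x * q x)"
    using line_int_swap[of b a] by (auto simp: dist_commute)
  then show ?thesis unfolding edge_inner_def s Let_def line_int_def by simp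
qed

lemma continuous_on_line: "continuous_on UNIV f \<Longrightarrow> continuous_on S (\<lambda>s. f (linepath a b s))"
  by (rule continuous_on_compose2[of UNIV f]) (auto intro: continuous_on_linepath)

lemma line_int_add:
  assumes "continuous_on UNIV f" "continuous_on UNIV g"
  shows "line_int a b (\<lambda>x. f x + g x) = line_int a b f + line_int a b g"
  unfolding line_int_def
  by (intro Henstock_Kurzweil_Integration.integral_add integrable_continuous_interval continuous_on_line assms)

lemma line_int_cmult: "line_int a b (\<lambda>x. c * f x) = c * line_int a b f"
  unfolding line_int_def by simp

lemma line_int_cong: "(\<And>x. x \<in> closed_segment a b \<Longrightarrow> f x = g x) \<Longrightarrow> line_int a b f = line_int a b g"
  unfolding line_int_def
  by (intro integral_cong) (auto simp: linepath_in_path)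

text \<open>The affine map \<open>A\<close> has the derivative \<open>b - a\<close> in the first
  coordinate direction, so the integrand becomes a multiple of \<open>pd 1\<close> on the reference
  triangle. There only the hypotenuse and one leg contribute; they are mapped to the edges from
  \<open>b\<close> to \<open>c\<close> and from \<open>a\<close> to \<open>c\<close>.\<close>

lemma integral_tri_dir:
  assumes t: "tri a b c K" and f: "C1 f"
  shows "integral K (\<lambda>x. (b - a) $ 1 * pd 1 f x + (b - a) $ 2 * pd 2 f x) =
     \<bar>cr (b - a) (c - a)\<bar> * (line_int b c f - line_int a c f)"
proof -
  define L where "L = (\<lambda>x::pt. x $ 1 *\<^sub>R (b - a) + x $ 2 *\<^sub>R (c - a))"
  define A where "A = (\<lambda>x. a + L x)"
  define F where "F = (\<lambda>x. f (A x))"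
  define D where "D = (\<lambda>x. (b - a) $ 1 * pd 1 f x + (b - a) $ 2 * pd 2 f x)"
  have linL: "linear L" unfolding L_def by (auto simp: linear_iff algebra_simps)
  have derA: "(A has_derivative L) (at x)" for x
    unfolding A_def by (auto intro!: derivative_eq_intros linear_imp_has_derivative[OF linL])
  have contA: "continuous_on S A" for S
    using derA has_derivative_continuous continuous_at_imp_continuous_on by blast
  have derF: "(F has_derivative (\<lambda>h. (L h) $ 1 * pd 1 f (A x) + (L h) $ 2 * pd 2 f (A x))) (at x)" for x
    using diff_chain_at[OF derA has_derivative_pd[OF C1_differentiable[OF f]]] by (simp add: F_def o_def)
  have pdF: "pd i F = (\<lambda>x. (L (axis i 1)) $ 1 * pd 1 f (A x) + (L (axis i 1)) $ 2 * pd 2 f (A x))" for i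
    using pd_eqI[OF derF] by blast
  have contfA: "continuous_on S (\<lambda>x. pd i f (A x))" for S i
    by (rule continuous_on_compose2[OF C1_continuous_pd[OF f, of UNIV] contA]) auto
  have "C1 F" unfolding C1_def
  proof (intro conjI allI)
    show "F differentiable at x" for x using derF differentiableI by blast
    show "continuous_on UNIV (pd i F)" for i unfolding pdF by (intro continuous_intros contfA)
  qed
  have pd1: "pd 1 F = (\<lambda>x. D (A x))" unfolding pdF D_def L_def by (simp add: axis_def)
  have K: "K = A ` ref_tri"
  proof -
    have "K = {a + u *\<^sub>R (b - a) + v *\<^sub>R (c - a) | u v.  0 \<le> u \<and> 0 \<le> v \<and> u + v \<le> 1}"
      using t convex_hull_3_alt[of a b c] by (simp add: tri_def)
    also have "\<dots> = A ` ref_tri"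
    proof (intro set_eqI iffI)
      fix y assume "y \<in> {a + u *\<^sub>R (b - a) + v *\<^sub>R (c - a) | u v.  0 \<le> u \<and> 0 \<le> v \<and> u + v \<le> 1}"
      then obtain u v where uv: "y = a + u *\<^sub>R (b - a) + v *\<^sub>R (c - a)" "0 \<le> u" "0 \<le> v" "u + v \<le> 1" by blast
      then have "mk2 (u, v) \<in> ref_tri" "y = A (mk2 (u, v))" by (auto simp: ref_tri_def L_def A_def)
      then show "y \<in> A ` ref_tri" by blast
    next
      fix y assume "y \<in> A ` ref_tri"
      then obtain z where "z \<in> ref_tri" "y = A z" by blast
      then show "y \<in> {a + u *\<^sub>R (b - a) + v *\<^sub>R (c - a) | u v.  0 \<le> u \<and> 0 \<le> v \<and> u + v \<le> 1}"
        unfolding ref_tri_def L_def A_def by (auto simp: add.assoc)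
    qed
    finally show ?thesis .
  qed
  have contD: "continuous_on S D" for S unfolding D_def
    by (intro continuous_intros C1_continuous_pd[OF f])
  have detL: "\<bar>det (matrix L)\<bar> = \<bar>cr (b - a) (c - a)\<bar>"
    by (simp add: det_2 matrix_def L_def axis_def cr_def algebra_simps)
  have inj: "inj_on A ref_tri"
  proof -
    have "det (matrix L) \<noteq> 0" using detL t by (auto simp: tri_def)
    then have "inj L" using det_nz_iff_inj[OF linL] by simp
    then show ?thesis unfolding A_def inj_on_def by auto
  qed
  have comp: "compact K" using tri_compact_convex[OF t] by simp
  have "integral K D = \<bar>det (matrix L)\<bar> * integral ref_tri (\<lambda>x. D (A x))"
  proof -
    \<comment> \<open>The scalar is written as a vector of \<open>real^1\<close>, the form in which
      the change of variables is applied, and is taken out again as its only component.\<close>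
    let ?G = "\<lambda>x. D x *\<^sub>R (axis 1 1 :: real^1)"
    have aiG: "?G absolutely_integrable_on K"
      by (rule integrable_lborel_compact[OF comp]) (intro continuous_intros contD)
    let ?H = "\<lambda>x. \<bar>det (matrix L)\<bar> *\<^sub>R ?G (A x)"
    have "?H absolutely_integrable_on ref_tri"
      by (rule integrable_lborel_compact[OF compact_ref_tri])
        (intro continuous_intros continuous_on_compose2[OF contD[of UNIV] contA] subset_UNIV)
    then have aiH: "?H integrable_on ref_tri" using set_lebesgue_integral_eq_integral(1) by blast
    have "integral (A ` ref_tri) ?G = integral ref_tri ?H"
      by (rule integral_change_of_variables)
        (use compact_ref_tri inj aiG in \<open>auto simp: K[symmetric] lmeasurable_compact fmeasurableD intro!: has_derivative_at_withinI derA\<close>)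
    then have "integral K ?G $ 1 = integral ref_tri ?H $ 1" by (simp add: K)
    moreover have "integral K ?G $ 1 = integral K (\<lambda>x. ?G x $ 1)"
      using integral_component_eq_cart[of ?G K 1] set_lebesgue_integral_eq_integral(1)[OF aiG] by simp
    moreover have "integral ref_tri ?H $ 1 = integral ref_tri (\<lambda>x. ?H x $ 1)"
      using integral_component_eq_cart[OF aiH, of 1] by simp
    ultimately show ?thesis by (simp add: axis_def)
  qed
  also have "integral ref_tri (\<lambda>x. D (A x)) = integral {0..1} (\<lambda>t. F (mk2 (1 - t, t))) - integral {0..1} (\<lambda>t. F (mk2 (0, t)))"
    using integral_ref_tri_pd1[OF \<open>C1 F\<close>] by (simp add: pd1)
  also have "integral {0..1} (\<lambda>t. F (mk2 (1 - t, t))) = line_int b c f"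
    unfolding line_int_def by (simp add: F_def A_def L_def linepath_def algebra_simps)
  also have "integral {0..1} (\<lambda>t. F (mk2 (0, t))) = line_int a c f"
    unfolding line_int_def by (simp add: F_def A_def L_def linepath_def algebra_simps)
  finally show ?thesis unfolding detL D_def .
qed

text \<open>\<open>nu K e n\<close> is \<open>1\<close> if the unit normal \<open>n\<close> of the edge \<open>e\<close> points out of \<open>K\<close> and \<open>- 1\<close> otherwise.\<close>

definition nu :: "pt set \<Rightarrow> pt set \<Rightarrow> pt \<Rightarrow> real" where
  "nu K e n = (if \<exists>y\<in>K. \<exists>x\<in>e. n \<bullet> (y - x) > 0 then -1 else 1)"

lemma unit_normal_segment:
  assumes "unit_normal (closed_segment a b) n"
  shows "norm n = 1" "n \<bullet> (b - a) = 0"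
  using assms unfolding unit_normal_def by auto

text \<open>A vector orthogonal to the unit vector \<open>n\<close> is \<open>l\<close> times the
  quarter turn of \<open>n\<close>. The modulus of \<open>l\<close> is \<open>norm u\<close>, and
  its sign follows from \<open>cr u v\<close> and the side on which \<open>v\<close> lies. This
  turns determinants along an edge into normal components.\<close>

lemma perp_unit:
  assumes n: "norm n = 1" "n \<bullet> u = 0" and d: "cr u v \<noteq> 0"
  shows "cr w u = - sgn (cr u v) * sgn (n \<bullet> v) * norm u * (w \<bullet> n)" and "n \<bullet> v \<noteq> 0"
proof -
  have n1: "n $ 1 * n $ 1 + n $ 2 * n $ 2 = 1"
    using n(1) by (simp add: norm_eq_1 inner_vec_def sum_2)
  have nu: "n $ 1 * u $ 1 + n $ 2 * u $ 2 = 0" using n(2) by (simp add: inner_vec_def sum_2)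
  define l where "l = n $ 1 * u $ 2 - n $ 2 * u $ 1"
  have u1: "u $ 1 = - l * n $ 2" and u2: "u $ 2 = l * n $ 1"
    using n1 nu unfolding l_def by algebra+
  have crw: "cr w u = l * (w \<bullet> n)" for w
    unfolding cr_def u1 u2 by (simp add: inner_vec_def sum_2 algebra_simps)
  have "u = l *\<^sub>R vector [- n $ 2, n $ 1]" using u1 u2 by (simp add: vec_eq_iff forall_2)
  moreover have "norm (vector [- n $ 2, n $ 1] :: pt) = 1"
    using n1 by (simp add: norm_eq_1 inner_vec_def sum_2 add.commute)
  ultimately have nl: "norm u = \<bar>l\<bar>" by (metis mult.right_neutral norm_scaleR)
  have cuv: "cr u v = - l * (n \<bullet> v)"
    using crw[of v] by (simp add: cr_def inner_commute algebra_simps)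
  show "n \<bullet> v \<noteq> 0" using d cuv by auto
  then have "sgn (n \<bullet> v) * sgn (n \<bullet> v) = 1" by (simp add: sgn_if)
  then have "- sgn (cr u v) * sgn (n \<bullet> v) = sgn l"
    unfolding cuv by (simp add: sgn_mult mult.assoc)
  then show "cr w u = - sgn (cr u v) * sgn (n \<bullet> v) * norm u * (w \<bullet> n)"
    unfolding crw nl by (simp add: sgn_mult_abs mult.assoc)
qed

text \<open>For \<open>x\<close> on the edge the barycentric expansion gives
  \<open>n \<bullet> (y - x)\<close> as \<open>bary a b c y\<close> times
  \<open>n \<bullet> (c - a)\<close>, so one sign is valid on all of \<open>K\<close>.\<close>

lemma nu_tri:
  assumes t: "tri a b c K" and n: "unit_normal (closed_segment a b) n"
  shows "nu K (closed_segment a b) n = - sgn (n \<bullet> (c - a))"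
proof -
  have d: "cr (b - a) (c - a) \<noteq> 0" using t by (simp add: tri_def)
  note un = unit_normal_segment[OF n]
  have nc: "n \<bullet> (c - a) \<noteq> 0" using perp_unit(2)[OF un d] .
  have inn: "n \<bullet> (y - x) = bary a b c y * (n \<bullet> (c - a))" if "x \<in> closed_segment a b" for x y
  proof -
    have x: "n \<bullet> x = n \<bullet> a"
    proof -
      have "n \<bullet> (x - a) = 0" using n that unfolding unit_normal_def by auto
      then show ?thesis by (simp add: inner_diff_right)
    qed
    have b: "n \<bullet> b = n \<bullet> a" using un(2) by (simp add: inner_diff_right)
    have "n \<bullet> y = n \<bullet> (bary b c a y *\<^sub>R a + bary c a b y *\<^sub>R b + bary a b c y *\<^sub>R c)"
      using bary_expand[OF d, of y] by simp
    also have "\<dots> = (bary b c a y + bary c a b y) * (n \<bullet> a) + bary a b c y * (n \<bullet> c)"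
      using b by (simp add: inner_add_right algebra_simps)
    also have "bary b c a y + bary c a b y = 1 - bary a b c y" using bary_sum[OF d, of y] by linarith
    finally show ?thesis using x by (simp add: inner_diff_right algebra_simps)
  qed
  have cK: "c \<in> K" using t by (simp add: tri_def hull_inc)
  show ?thesis
  proof (cases "n \<bullet> (c - a) > 0")
    case True
    then have "nu K (closed_segment a b) n = -1"
      unfolding nu_def using cK by (metis ends_in_segment(1))
    then show ?thesis using True by simp
  next
    case False
    have "n \<bullet> (y - x) \<le> 0" if "y \<in> K" "x \<in> closed_segment a b" for x y
    proof -
      have "0 \<le> bary a b c y" using tri_eq[OF t] that(1) by auto
      then show ?thesis unfolding inn[OF that(2)] using False by (simp add: mult_nonneg_nonpos)
    qed
    then have "nu K (closed_segment a b) n = 1" unfolding nu_def by force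
    then show ?thesis using False nc by simp
  qed
qed

text \<open>\<open>W z\<close> is the determinant of the field with \<open>z\<close>, the flux
  through a segment of direction \<open>z\<close>. With \<open>d = cr u v\<close>, the divergence
  times \<open>d\<close> is the derivative of \<open>W v\<close> along \<open>u\<close> minus that
  of \<open>W u\<close> along \<open>v\<close>, and each of the two falls under
  \<open>integral_tri_dir\<close>. Collecting the line integrals leaves one flux for each edge, in
  cyclic direction.\<close>

theorem divergence_triangle:
  assumes K: "2 simplex K" and w: "C1 w1" "C1 w2"
    and n: "\<And>e. e edge_of K \<Longrightarrow> unit_normal e (n e)"
  shows "integral K (\<lambda>x. pd 1 w1 x + pd 2 w2 x) =
     (\<Sum>e | e edge_of K. nu K e (n e) * edge_inner e (\<lambda>x. w1 x * n e $ 1 + w2 x * n e $ 2) (\<lambda>x. 1))"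
proof -
  obtain a b c where t: "tri a b c K" using simplex_2_tri[OF K] .
  note t2 = tri_rot[OF t] and t3 = tri_rot[OF tri_rot[OF t]]
  define u v where "u = b - a" and "v = c - a"
  define d where "d = cr u v"
  have d: "d \<noteq> 0" using t by (simp add: tri_def d_def u_def v_def)
  define W :: "pt \<Rightarrow> pt \<Rightarrow> real" where "W z = (\<lambda>x. w1 x * z $ 2 - w2 x * z $ 1)" for z
  have W1: "C1 (W z)" for z
    using C1_add[OF C1_cmult[OF w(1), of "z $ 2"] C1_cmult[OF w(2), of "- z $ 1"]]
    unfolding W_def by (simp add: mult.commute)
  have pdW: "pd i (W z) x = z $ 2 * pd i w1 x - z $ 1 * pd i w2 x" for i z x
    unfolding W_def
    by (subst pd_diff) (auto simp: mult.commute[of _ "z $ _"] pd_cmult C1_differentiable w intro!: differentiable_mult)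
  have cW: "continuous_on S (W z)" for z S using C1_continuous_on[OF W1] .
  have intg: "f integrable_on K" if "continuous_on UNIV f" for f :: "pt \<Rightarrow> real"
    using integrable_lborel_compact[of K f] tri_compact_convex[OF t] continuous_on_subset[OF that]
      set_lebesgue_integral_eq_integral(1) by blast
  have cpd: "continuous_on UNIV (pd i (W z))" for i z using C1_continuous_pd[OF W1] .
  let ?D1 = "\<lambda>x. u $ 1 * pd 1 (W v) x + u $ 2 * pd 2 (W v) x"
  let ?D2 = "\<lambda>x. v $ 1 * pd 1 (W u) x + v $ 2 * pd 2 (W u) x"
  have id: "d * (pd 1 w1 x + pd 2 w2 x) = ?D1 x - ?D2 x" for x
    unfolding pdW d_def cr_def by algebra
  have "d * integral K (\<lambda>x. pd 1 w1 x + pd 2 w2 x) = integral K (\<lambda>x. d * (pd 1 w1 x + pd 2 w2 x))"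
    by simp
  also have "\<dots> = integral K (\<lambda>x. ?D1 x - ?D2 x)" unfolding id ..
  also have "\<dots> = integral K ?D1 - integral K ?D2"
    by (intro Henstock_Kurzweil_Integration.integral_diff intg continuous_intros cpd)
  also have "integral K ?D1 = \<bar>d\<bar> * (line_int b c (W v) - line_int a c (W v))"
    unfolding u_def d_def v_def by (rule integral_tri_dir[OF t W1])
  also have "integral K ?D2 = \<bar>d\<bar> * (line_int c b (W u) - line_int a b (W u))"
  proof -
    have "tri a c b K" using tri_swap[OF t3] .
    from integral_tri_dir[OF this W1, of u] show ?thesis
      unfolding u_def[symmetric] v_def[symmetric] d_def by (simp add: cr_def abs_minus_commute mult.commute)
  qed
  also have "line_int c b (W u) = line_int b c (W u)" by (rule line_int_swap)
  also have "\<bar>d\<bar> * (line_int b c (W v) - line_int a c (W v)) - \<bar>d\<bar> * (line_int b c (W u) - line_int a b (W u))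
    = \<bar>d\<bar> * (line_int a b (W (b - a)) + line_int b c (W (c - b)) + line_int c a (W (a - c)))"
  proof -
    have "line_int b c (W (c - b)) = line_int b c (\<lambda>x. W v x + (-1) * W u x)"
      by (rule line_int_cong) (simp add: W_def u_def v_def algebra_simps)
    also have "\<dots> = line_int b c (W v) + (-1) * line_int b c (W u)"
    proof -
      have "continuous_on UNIV (\<lambda>x. (-1) * W u x)" by (intro continuous_intros cW)
      from line_int_add[OF cW this] show ?thesis by (simp only: line_int_cmult)
    qed
    finally have 1: "line_int b c (W (c - b)) = line_int b c (W v) - line_int b c (W u)" by simp
    have "line_int c a (W (a - c)) = line_int a c (\<lambda>x. (-1) * W v x)"
      unfolding line_int_swap[of c a] by (rule line_int_cong) (simp add: W_def v_def algebra_simps)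
    then have 2: "line_int c a (W (a - c)) = - line_int a c (W v)"
      unfolding line_int_cmult by simp
    show ?thesis unfolding 1 2 u_def[symmetric] by (simp add: algebra_simps)
  qed
  finally have main: "d * integral K (\<lambda>x. pd 1 w1 x + pd 2 w2 x) =
    \<bar>d\<bar> * (line_int a b (W (b - a)) + line_int b c (W (c - b)) + line_int c a (W (a - c)))" .
  \<comment> \<open>The factor \<open>sgn d\<close> is the orientation of the cyclic order of the
    vertices. Together with \<open>\<bar>d\<bar>\<close> it restores \<open>d\<close>, so either
    orientation gives the same formula.\<close>
  have edge: "line_int p q (W (q - p)) = sgn d * (nu K e (n e) * edge_inner e (\<lambda>x. w1 x * n e $ 1 + w2 x * n e $ 2) (\<lambda>x. 1))"
    if tt: "tri p q r K" and e: "e = closed_segment p q" and dd: "cr (q - p) (r - p) = d" for p q r e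
  proof -
    have "e edge_of K" using tri_edge_of[OF tt] e by simp
    then have ne: "unit_normal (closed_segment p q) (n e)" using n e by simp
    have "cr (q - p) (r - p) \<noteq> 0" using dd d by simp
    note pu = perp_unit[OF unit_normal_segment[OF ne] this]
    have "W (q - p) x = sgn d * (- sgn (n e \<bullet> (r - p))) * norm (q - p) * (w1 x * n e $ 1 + w2 x * n e $ 2)" for x
      using pu(1)[of "vector [w1 x, w2 x]"] unfolding dd W_def by (simp add: cr_def inner_vec_def sum_2)
    then have "line_int p q (W (q - p)) = line_int p q (\<lambda>x. (sgn d * (- sgn (n e \<bullet> (r - p))) * norm (q - p)) * (w1 x * n e $ 1 + w2 x * n e $ 2))"
      by presburger
    also have "\<dots> = sgn d * (- sgn (n e \<bullet> (r - p))) * norm (q - p) * line_int p q (\<lambda>x. w1 x * n e $ 1 + w2 x * n e $ 2)"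
      by (rule line_int_cmult)
    also have "\<dots> = sgn d * (nu K e (n e) * edge_inner e (\<lambda>x. w1 x * n e $ 1 + w2 x * n e $ 2) (\<lambda>x. 1))"
      using tri_distinct[OF tt] nu_tri[OF tt ne] unfolding e
      by (simp add: edge_inner_segment dist_norm norm_minus_commute)
    finally show ?thesis .
  qed
  have sd: "\<bar>d\<bar> * sgn d = d" by (simp add: abs_mult_sgn)
  have "d * integral K (\<lambda>x. pd 1 w1 x + pd 2 w2 x) = (\<bar>d\<bar> * sgn d) *
     (\<Sum>e | e edge_of K. nu K e (n e) * edge_inner e (\<lambda>x. w1 x * n e $ 1 + w2 x * n e $ 2) (\<lambda>x. 1))"
    unfolding main sum_edges[OF t]
    by (subst edge[OF t refl], simp add: d_def u_def v_def, subst edge[OF t2 refl],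
        simp add: d_def u_def v_def cr_rot[of c b a], subst edge[OF t3 refl],
        simp add: d_def u_def v_def cr_rot[of a c b] cr_rot[of c b a]) (simp add: algebra_simps)
  then show ?thesis using d unfolding sd by simp
qed

subsection \<open>Jordan domains in the plane\<close>

definition to_complex :: "pt \<Rightarrow> complex" where
  "to_complex x = Complex (x $ 1) (x $ 2)"

definition of_complex :: "complex \<Rightarrow> pt" where
  "of_complex z = vector [Re z, Im z]"

lemma of_to_complex [simp]: "of_complex (to_complex x) = x" "to_complex (of_complex z) = z"
  by (auto simp: of_complex_def to_complex_def vec_eq_iff forall_2)

lemma linear_to_complex: "linear to_complex"
  by (auto simp: linear_iff to_complex_def complex_eq_iff)

lemma linear_of_complex: "linear of_complex"
  by (auto simp: linear_iff of_complex_def vec_eq_iff forall_2)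

lemma continuous_on_to_complex: "continuous_on S to_complex"
  using linear_continuous_on linear_conv_bounded_linear linear_to_complex by blast

lemma continuous_on_of_complex: "continuous_on S of_complex"
  using linear_continuous_on linear_conv_bounded_linear linear_of_complex by blast

lemma inj_to_complex: "inj to_complex"
  by (metis injI of_to_complex(1))

lemma to_complex_image: "to_complex ` S = of_complex -` S"
  by (auto simp: image_iff) (metis of_to_complex(2))

lemma open_to_complex_image: "open (to_complex ` S) \<longleftrightarrow> open S"
proof
  assume "open (to_complex ` S)"
  then have "open (to_complex -` (to_complex ` S))"
    using open_vimage continuous_on_to_complex by blast
  then show "open S" by (simp add: inj_vimage_image_eq inj_to_complex)
next
  assume "open S"
  then show "open (to_complex ` S)"
    unfolding to_complex_image using open_vimage continuous_on_of_complex by blast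
qed

lemma connected_component_image:
  assumes "connected_component A x y" "continuous_on A h"
  shows "connected_component (h ` A) (h x) (h y)"
proof -
  obtain T where "connected T" "T \<subseteq> A" "x \<in> T" "y \<in> T"
    using assms(1) unfolding connected_component_def by blast
  then show ?thesis unfolding connected_component_def
    using connected_continuous_image[OF continuous_on_subset[OF assms(2)]] by blast
qed

lemma to_complex_Compl: "to_complex ` (- S) = - to_complex ` S"
  unfolding to_complex_image by auto

text \<open>A homeomorphism maps the components of the complement onto components, and a linear one
  preserves boundedness in both directions.\<close>

lemma inside_to_complex: "inside (to_complex ` S) = to_complex ` inside S"
proof -
  have cc: "connected_component_set (- to_complex ` S) (to_complex x) = to_complex ` connected_component_set (- S) x" for x
  proof (intro set_eqI iffI)
    fix z assume "z \<in> connected_component_set (- to_complex ` S) (to_complex x)"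
    then have "connected_component (of_complex ` (- to_complex ` S)) (of_complex (to_complex x)) (of_complex z)"
      using connected_component_image[OF _ continuous_on_of_complex] by blast
    moreover have "of_complex ` (- to_complex ` S) = - S"
      unfolding to_complex_Compl[symmetric] by (simp add: image_image)
    ultimately have "of_complex z \<in> connected_component_set (- S) x" by simp
    then show "z \<in> to_complex ` connected_component_set (- S) x"
      unfolding to_complex_image by simp
  next
    fix z assume "z \<in> to_complex ` connected_component_set (- S) x"
    then obtain y where y: "z = to_complex y" "connected_component (- S) x y" by auto
    then show "z \<in> connected_component_set (- to_complex ` S) (to_complex x)"
      using connected_component_image[OF y(2) continuous_on_to_complex] by (simp add: to_complex_Compl)
  qed
  have bd: "bounded (to_complex ` X) \<longleftrightarrow> bounded X" for X
  proof
    assume "bounded (to_complex ` X)"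
    then have "bounded (of_complex ` to_complex ` X)"
      using bounded_linear_image linear_conv_bounded_linear linear_of_complex by blast
    then show "bounded X" by (simp add: image_image)
  next
    assume "bounded X" then show "bounded (to_complex ` X)"
      using bounded_linear_image linear_conv_bounded_linear linear_to_complex by blast
  qed
  show ?thesis
  proof (intro set_eqI)
    fix z
    obtain x where z: "z = to_complex x" by (metis of_to_complex(2))
    have "z \<in> inside (to_complex ` S) \<longleftrightarrow> x \<in> inside S"
      unfolding inside_def z using cc[of x] bd[of "connected_component_set (- S) x"]
      by (simp add: inj_image_mem_iff inj_to_complex)
    then show "z \<in> inside (to_complex ` S) \<longleftrightarrow> z \<in> to_complex ` inside S"
      by (simp add: z inj_image_mem_iff inj_to_complex)
  qed
qed

text \<open>The Jordan curve theorem and the description of simply connected plane domains as discs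
  are applied in \<open>complex\<close> and carried over by the linear isomorphism
  \<open>to_complex\<close>. The frontier is negligible as a finite union of segments.\<close>

theorem polygon_domain_Jordan:
  assumes "polygon_domain \<Omega>"
  shows "open \<Omega>" "bounded \<Omega>" "\<Omega> \<noteq> {}" "connected \<Omega>" "interior (closure \<Omega>) \<subseteq> \<Omega>"
    "negligible (frontier \<Omega>)" "\<Omega> homeomorphic ball (0::complex) 1"
    "\<exists>g. simple_path g \<and> pathfinish g = pathstart g \<and> path_image g = frontier \<Omega>"
proof -
  obtain g S where g: "simple_path g" "pathfinish g = pathstart g"
    and S: "finite S" "\<forall>s\<in>S. \<exists>a b. s = closed_segment a b" "path_image g = \<Union>S"
    and \<Omega>: "\<Omega> = inside (path_image g)"
    using assms unfolding polygon_domain_def by blast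
  define c where "c = to_complex \<circ> g"
  have c: "simple_path c" "pathfinish c = pathstart c"
    using g simple_path_linear_image_eq[OF linear_to_complex inj_to_complex]
    by (auto simp: c_def pathfinish_def pathstart_def)
  have im: "path_image c = to_complex ` path_image g"
    unfolding c_def by (rule path_image_linear_image[OF linear_to_complex])
  have I: "inside (path_image c) = to_complex ` \<Omega>"
    unfolding im \<Omega> by (rule inside_to_complex)
  note J = Jordan_inside_outside[OF c, unfolded I]
  have opI: "open (to_complex ` \<Omega>)" and frI: "frontier (to_complex ` \<Omega>) = path_image c"
    and frO: "frontier (outside (path_image c)) = path_image c" and opO: "open (outside (path_image c))"
    and disj: "to_complex ` \<Omega> \<inter> outside (path_image c) = {}"
    using J by blast+
  show op: "open \<Omega>" using J open_to_complex_image by blast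
  have bk: "of_complex ` to_complex ` X = X" for X by (simp add: image_image)
  have "bounded (of_complex ` to_complex ` \<Omega>)"
    using J bounded_linear_image linear_conv_bounded_linear linear_of_complex by blast
  then show "bounded \<Omega>" by (simp add: bk)
  show "\<Omega> \<noteq> {}" using J by auto
  have "connected (of_complex ` to_complex ` \<Omega>)"
    using J connected_continuous_image continuous_on_of_complex by blast
  then show "connected \<Omega>" by (simp add: bk)
  have cl: "to_complex ` closure X = closure (to_complex ` X)" for X
    by (rule closure_injective_linear_image[OF linear_to_complex inj_to_complex])
  have fr: "frontier \<Omega> = path_image g"
  proof -
    have "frontier \<Omega> = closure \<Omega> - \<Omega>" using op by (simp add: frontier_def interior_open)
    then have "to_complex ` frontier \<Omega> = closure (to_complex ` \<Omega>) - to_complex ` \<Omega>"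
      by (simp add: image_set_diff inj_to_complex cl)
    also have "\<dots> = frontier (to_complex ` \<Omega>)"
      by (simp only: frontier_def interior_open[OF opI])
    also have "\<dots> = to_complex ` path_image g" using frI im by simp
    finally show ?thesis using inj_image_eq_iff[OF inj_to_complex] by blast
  qed
  show "\<exists>g. simple_path g \<and> pathfinish g = pathstart g \<and> path_image g = frontier \<Omega>"
    by (rule exI[of _ g]) (simp only: g fr)
  have "negligible s" if "s \<in> S" for s
  proof -
    from S(2) that have "\<exists>a b. s = closed_segment a b" by (rule bspec)
    then obtain a b where s: "s = closed_segment a b" by (elim exE)
    have "aff_dim s \<le> 1" unfolding s segment_convex_hull aff_dim_convex_hull
      by (simp only: aff_dim_2 split: if_split) simp
    then have "aff_dim s \<noteq> int (DIM(pt))" by simp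
    then have "interior s = {}" by (rule low_dim_interior)
    then show ?thesis using negligible_convex_interior[OF convex_closed_segment, of a b] by (simp only: s)
  qed
  then show "negligible (frontier \<Omega>)" unfolding fr S(3) using S(1) by (intro negligible_Union) auto
  show "interior (closure \<Omega>) \<subseteq> \<Omega>"
  proof
    fix x assume x: "x \<in> interior (closure \<Omega>)"
    show "x \<in> \<Omega>"
    proof (rule ccontr)
      assume "x \<notin> \<Omega>"
      moreover have "x \<in> closure \<Omega>" using x interior_subset by blast
      ultimately have "x \<in> frontier \<Omega>" using op by (simp add: frontier_def interior_open)
      then have "to_complex x \<in> frontier (outside (path_image c))"
        using frO im fr by blast
      \<comment> \<open>A frontier point is also approached from outside, so a neighbourhood of it
        inside \<open>closure \<Omega>\<close> would meet the open outside, which is disjoint from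
        \<open>\<Omega>\<close>.\<close>
      then have clo: "to_complex x \<in> closure (outside (path_image c))" by (simp add: frontier_def)
      have op2: "open (to_complex ` interior (closure \<Omega>))" by (simp add: open_to_complex_image)
      have ne: "to_complex ` interior (closure \<Omega>) \<inter> outside (path_image c) \<noteq> {}"
        using open_Int_closure_eq_empty[OF op2, of "outside (path_image c)"] clo x by blast
      have "to_complex ` interior (closure \<Omega>) \<subseteq> closure (to_complex ` \<Omega>)"
        unfolding cl[symmetric] using interior_subset by blast
      with ne have "closure (to_complex ` \<Omega>) \<inter> outside (path_image c) \<noteq> {}" by blast
      then have "to_complex ` \<Omega> \<inter> outside (path_image c) \<noteq> {}"
        using open_Int_closure_eq_empty[OF opO, of "to_complex ` \<Omega>"] by blast
      then show False using disj by blast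
    qed
  qed
  have "simply_connected (to_complex ` \<Omega>)"
    using simply_connected_inside_simple_path[OF c(1)] I by simp
  then have "to_complex ` \<Omega> homeomorphic ball (0::complex) 1"
    using simply_connected_eq_homeomorphic_to_disc J by blast
  moreover have "\<Omega> homeomorphic to_complex ` \<Omega>"
    using linear_homeomorphic_image[OF linear_to_complex inj_to_complex] .
  ultimately show "\<Omega> homeomorphic ball (0::complex) 1"
    using homeomorphic_trans by blast
qed

subsection \<open>Trivial monodromy\<close>

text \<open>A family of functions on balls, any two of which differ by a constant where both are
  defined, is glued along the radii of the disc; homeomorphic images of the disc inherit this.\<close>

definition section_on :: "('b::metric_space \<Rightarrow> 'b \<Rightarrow> real) \<Rightarrow> 'b set \<Rightarrow> ('b \<Rightarrow> real) \<Rightarrow> bool" where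
  "section_on f U F \<longleftrightarrow> (\<forall>x\<in>U. \<exists>\<delta>>0. \<exists>c. \<forall>z\<in>U \<inter> ball x \<delta>. F z = f x z + c)"

lemma section_onD:
  assumes "section_on f U F" "x \<in> U"
  obtains \<delta> c where "\<delta> > 0" "\<And>z. z \<in> U \<Longrightarrow> z \<in> ball x \<delta> \<Longrightarrow> F z = f x z + c"
  using assms unfolding section_on_def by blast

text \<open>Near each point both sections equal \<open>f x\<close> up to a constant, so their
  difference is locally constant.\<close>

lemma section_unique:
  assumes U: "connected U" and F: "section_on f U F" and G: "section_on f U G"
    and p: "p \<in> U" "q \<in> U"
  shows "F p - G p = F q - G q"
proof -
  have "(\<lambda>z. F z - G z) constant_on U"
  proof (rule locally_constant_imp_constant[OF U])
    fix x assume x: "x \<in> U"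
    obtain \<delta>1 c where c: "\<delta>1 > 0" "\<And>z. z \<in> U \<Longrightarrow> z \<in> ball x \<delta>1 \<Longrightarrow> F z = f x z + c" using section_onD[OF F x] by blast
    obtain \<delta>2 d where d: "\<delta>2 > 0" "\<And>z. z \<in> U \<Longrightarrow> z \<in> ball x \<delta>2 \<Longrightarrow> G z = f x z + d" using section_onD[OF G x] by blast
    show "\<exists>V. openin (top_of_set U) V \<and> x \<in> V \<and> (\<forall>z\<in>V. F z - G z = F x - G x)"
      using c d x by (intro exI[of _ "U \<inter> ball x (min \<delta>1 \<delta>2)"]) auto
  qed
  then show ?thesis using p unfolding constant_on_def by auto
qed

lemma section_restrict: "section_on f U F \<Longrightarrow> V \<subseteq> U \<Longrightarrow> section_on f V F"
  unfolding section_on_def by (metis IntD1 IntD2 IntI subsetD)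

lemma section_shift: "section_on f U F \<Longrightarrow> section_on f U (\<lambda>z. F z + c)"
  unfolding section_on_def by (metis add.assoc)

lemma section_glue:
  assumes op: "open U" "open V" and F: "section_on f U F" and G: "section_on f V G"
    and eq: "\<And>z. z \<in> U \<inter> V \<Longrightarrow> F z = G z"
  shows "section_on f (U \<union> V) (\<lambda>z. if z \<in> U then F z else G z)"
  unfolding section_on_def
proof
  let ?H = "\<lambda>z. if z \<in> U then F z else G z"
  fix x assume "x \<in> U \<union> V"
  then show "\<exists>\<delta>>0. \<exists>c. \<forall>z\<in>(U \<union> V) \<inter> ball x \<delta>. ?H z = f x z + c"
  proof
    assume x: "x \<in> U"
    obtain e where e: "e > 0" "ball x e \<subseteq> U" using op x openE by blast
    obtain d c where "d > 0" "\<And>z. z \<in> U \<Longrightarrow> z \<in> ball x d \<Longrightarrow> F z = f x z + c" using section_onD[OF F x] by blast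
    then show ?thesis using e by (intro exI[of _ "min d e"] conjI exI[of _ c]) auto
  next
    assume x: "x \<in> V"
    obtain e where e: "e > 0" "ball x e \<subseteq> V" using op x openE by blast
    obtain d c where d: "d > 0" "\<And>z. z \<in> V \<Longrightarrow> z \<in> ball x d \<Longrightarrow> G z = f x z + c" using section_onD[OF G x] by blast
    have HG: "?H z = G z" if "z \<in> V" for z using that eq by auto
    have "\<forall>z\<in>(U \<union> V) \<inter> ball x (min d e). ?H z = f x z + c"
    proof
      fix z assume "z \<in> (U \<union> V) \<inter> ball x (min d e)"
      then have "z \<in> V" "z \<in> ball x d" using e by auto
      then show "?H z = f x z + c" by (subst HG) (auto intro: d(2))
    qed
    moreover have "min d e > 0" using e d by simp
    ultimately show ?thesis by blast
  qed
qed

lemma section_base: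
  assumes r: "\<And>x. x \<in> S \<Longrightarrow> r x > 0"
    and f: "\<And>x y. x \<in> S \<Longrightarrow> y \<in> S \<Longrightarrow> \<exists>c. \<forall>z\<in>ball x (r x) \<inter> ball y (r y). f x z - f y z = c"
    and x: "x \<in> S" "ball x (r x) \<subseteq> S"
  shows "section_on f (ball x (r x)) (f x)"
  unfolding section_on_def
proof
  fix y assume "y \<in> ball x (r x)"
  then have y: "y \<in> S" using x by blast
  then obtain c where "\<forall>z\<in>ball x (r x) \<inter> ball y (r y). f x z - f y z = c" using f x by blast
  then have "\<forall>z\<in>ball x (r x) \<inter> ball y (r y). f x z = f y z + c" by force
  then show "\<exists>\<delta>>0. \<exists>c. \<forall>z\<in>ball x (r x) \<inter> ball y \<delta>. f x z = f y z + c" using r[OF y] by blast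
qed

text \<open>An open neighbourhood that is convex whenever \<open>A\<close> is. Convexity makes the
  overlap of two such sets connected, as \<open>section_unique\<close> requires.\<close>

definition thicken :: "'b::real_normed_vector set \<Rightarrow> real \<Rightarrow> 'b set" where
  "thicken A e = (\<Union>x\<in>A. ball x e)"

lemma thicken_convex:
  assumes "convex A"
  shows "convex (thicken A e)"
proof -
  have "thicken A e = (\<Union>x\<in>A. \<Union>y\<in>ball 0 e. {x + y})"
  proof (intro set_eqI iffI)
    fix z assume "z \<in> thicken A e"
    then obtain x where x: "x \<in> A" "dist x z < e" unfolding thicken_def by auto
    then have "z - x \<in> ball 0 e" by (simp add: dist_norm norm_minus_commute)
    moreover have "z \<in> {x + (z - x)}" by simp
    ultimately show "z \<in> (\<Union>x\<in>A. \<Union>y\<in>ball 0 e. {x + y})" using x(1) by blast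
  next
    fix z assume "z \<in> (\<Union>x\<in>A. \<Union>y\<in>ball 0 e. {x + y})"
    then obtain x y where "x \<in> A" "y \<in> ball 0 e" "z = x + y" by blast
    then show "z \<in> thicken A e" unfolding thicken_def by (auto intro!: bexI[of _ x] simp: dist_norm)
  qed
  then show ?thesis using convex_sums[OF assms convex_ball, of 0 e] by simp
qed

lemma thicken_open: "open (thicken A e)"
  unfolding thicken_def by auto

text \<open>With a Lebesgue number \<open>e\<close> of the cover, the segment is followed in short
  steps. The tube built so far is extended by a ball, whose section is shifted by a constant to
  match; the overlap of tube and ball is convex, so one constant suffices.\<close>

lemma section_along_segment:
  fixes p q :: "'b::euclidean_space"
  assumes r: "\<And>x. x \<in> S \<Longrightarrow> r x > 0 \<and> ball x (r x) \<subseteq> S"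
    and f: "\<And>x y. x \<in> S \<Longrightarrow> y \<in> S \<Longrightarrow> \<exists>c. \<forall>z\<in>ball x (r x) \<inter> ball y (r y). f x z - f y z = c"
    and seg: "closed_segment p q \<subseteq> S"
  shows "\<exists>F e. e > 0 \<and> section_on f (thicken (closed_segment p q) e) F"
proof -
  obtain e where e: "e > 0" "\<And>w. w \<in> closed_segment p q \<Longrightarrow> \<exists>G\<in>(\<lambda>y. ball y (r y)) ` S. ball w e \<subseteq> G"
  proof (rule Heine_Borel_lemma[of "closed_segment p q" "(\<lambda>y. ball y (r y)) ` S"])
    show "closed_segment p q \<subseteq> \<Union> ((\<lambda>y. ball y (r y)) ` S)" using seg r by fastforce
  qed auto
  \<comment> \<open>Steps shorter than \<open>e / 2\<close>: the neighbourhood of radius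
    \<open>e / 2\<close> of the next piece then lies in the ball of radius \<open>e\<close> about
    \<open>x k\<close>.\<close>
  obtain n :: nat where n: "dist p q / (e / 2) < real n" using reals_Archimedean2 by blast
  have n0: "n > 0" using n e(1) by (cases n) (auto simp: field_simps not_less intro: order_trans[OF _ zero_le_dist])
  define x where "x = (\<lambda>k. linepath p q (real k / real n))"
  have xin: "x k \<in> closed_segment p q" if "k \<le> n" for k
    unfolding x_def using that n0 by (intro linepath_in_path) auto
  have step: "dist (x k) w < e / 2" if "w \<in> closed_segment (x k) (x (Suc k))" for k w
  proof -
    have "dist (x k) w \<le> dist (x k) (x (Suc k))"
      using dist_in_closed_segment[OF that] by (simp add: dist_commute)
    also have "x (Suc k) - x k = (1 / real n) *\<^sub>R (q - p)"
      unfolding x_def linepath_def by (simp add: algebra_simps add_divide_distrib)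
    then have "dist (x k) (x (Suc k)) = dist p q / real n"
      by (simp add: dist_norm norm_minus_commute) (metis norm_minus_commute norm_scaleR abs_of_nonneg divide_inverse inverse_eq_divide mult.commute of_nat_0_le_iff zero_le_divide_1_iff)
    also have "\<dots> < e / 2" using n n0 e(1) by (simp add: field_simps)
    finally show ?thesis .
  qed
  have "\<exists>F. section_on f (thicken (closed_segment p (x k)) (e / 2)) F" if "k \<le> n" for k
    using that
  proof (induction k)
    case 0
    have "x 0 = p" by (simp add: x_def linepath_def)
    obtain y where y: "y \<in> S" "ball p e \<subseteq> ball y (r y)" using e(2)[of p] by auto
    have "section_on f (ball y (r y)) (f y)" using section_base[of S r f y] r f y by blast
    moreover have "thicken (closed_segment p (x 0)) (e / 2) \<subseteq> ball y (r y)"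
      using y(2) e(1) unfolding \<open>x 0 = p\<close> thicken_def by auto
    ultimately show ?case using section_restrict by blast
  next
    case (Suc k)
    let ?U = "thicken (closed_segment p (x k)) (e / 2)" and ?V = "ball (x k) e"
    obtain F where F: "section_on f ?U F" using Suc by auto
    obtain y where y: "y \<in> S" "?V \<subseteq> ball y (r y)" using e(2)[OF xin[of k]] Suc.prems by auto
    have "section_on f (ball y (r y)) (f y)" using section_base[of S r f y] r f y by blast
    then have G: "section_on f ?V (f y)" using y(2) section_restrict by blast
    have xU: "x k \<in> ?U" using e(1) by (auto simp: thicken_def intro!: bexI[of _ "x k"])
    \<comment> \<open>Shifted to agree with \<open>F\<close> at the single point \<open>x k\<close>;
      connectedness of the overlap does the rest.\<close>
    define G where "G = (\<lambda>z. f y z + (F (x k) - f y (x k)))"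
    have G': "section_on f ?V G" unfolding G_def using section_shift[OF G] .
    have conn: "connected (?U \<inter> ?V)"
      by (intro convex_connected convex_Int thicken_convex convex_ball convex_closed_segment)
    have "F z = G z" if "z \<in> ?U \<inter> ?V" for z
    proof -
      have "F z - G z = F (x k) - G (x k)"
        by (rule section_unique[OF conn section_restrict[OF F] section_restrict[OF G'] that]) (use xU e(1) in auto)
      then show ?thesis by (simp add: G_def)
    qed
    from section_glue[OF thicken_open open_ball F G' this]
    have "section_on f (?U \<union> ?V) (\<lambda>z. if z \<in> ?U then F z else G z)" .
    moreover have "thicken (closed_segment p (x (Suc k))) (e / 2) \<subseteq> ?U \<union> ?V"
    proof
      fix z assume "z \<in> thicken (closed_segment p (x (Suc k))) (e / 2)"
      then obtain w where w: "w \<in> closed_segment p (x (Suc k))" "dist w z < e / 2" unfolding thicken_def by auto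
      have "x k \<in> closed_segment p (x (Suc k))"
      proof -
        have "x k = linepath p (x (Suc k)) (real k / real (Suc k))"
        proof -
          have "x j = p + (real j / real n) *\<^sub>R (q - p)" for j
            by (simp add: x_def linepath_def algebra_simps)
          moreover have "linepath p (x (Suc k)) t = p + t *\<^sub>R (x (Suc k) - p)" for t
            by (simp add: linepath_def algebra_simps)
          ultimately show ?thesis by (simp del: of_nat_Suc)
        qed
        then show ?thesis using linepath_in_path[of "real k / real (Suc k)" p "x (Suc k)"] by simp
      qed
      then have "closed_segment p (x (Suc k)) = closed_segment p (x k) \<union> closed_segment (x k) (x (Suc k))"
        by (simp add: Un_closed_segment)
      then show "z \<in> ?U \<union> ?V"
        using w step[of w k] dist_triangle[of "x k" z w] by (force simp: thicken_def)
    qed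
    ultimately show ?case using section_restrict by blast
  qed
  from this[of n] have "\<exists>F. section_on f (thicken (closed_segment p q) (e / 2)) F"
    using n0 by (simp add: x_def linepath_def)
  then show ?thesis using e(1) half_gt_zero by blast
qed

text \<open>The sections along the radii from \<open>p\<close> agree on overlaps once they are
  normalised to vanish at \<open>p\<close>, since two tubes around radii meet in a convex set that
  contains \<open>p\<close>. The values \<open>H x\<close> at the ends of the radii therefore form a
  section.\<close>

lemma section_on_convex:
  fixes S :: "'b::euclidean_space set"
  assumes S: "convex S" "p \<in> S"
    and r: "\<And>x. x \<in> S \<Longrightarrow> r x > 0 \<and> ball x (r x) \<subseteq> S"
    and f: "\<And>x y. x \<in> S \<Longrightarrow> y \<in> S \<Longrightarrow> \<exists>c. \<forall>z\<in>ball x (r x) \<inter> ball y (r y). f x z - f y z = c"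
  shows "\<exists>F. section_on f S F"
proof -
  have "\<forall>x\<in>S. \<exists>F e. e > 0 \<and> section_on f (thicken (closed_segment p x) e) F"
    using section_along_segment[of S r f] r f S closed_segment_subset by metis
  then obtain F e where Fe: "\<And>x. x \<in> S \<Longrightarrow> e x > 0 \<and> section_on f (thicken (closed_segment p x) (e x)) (F x)"
    by metis
  define H where "H = (\<lambda>x. F x x - F x p)"
  have H: "H z = F x z - F x p" if "x \<in> S" "z \<in> S" "z \<in> thicken (closed_segment p x) (e x)" for x z
  proof -
    let ?A = "thicken (closed_segment p x) (e x)" and ?B = "thicken (closed_segment p z) (e z)"
    have "connected (?A \<inter> ?B)" by (intro convex_connected convex_Int thicken_convex convex_closed_segment)
    moreover have "section_on f (?A \<inter> ?B) (F x)" "section_on f (?A \<inter> ?B) (F z)"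
      using Fe that section_restrict by (meson inf_le1, meson inf_le2)
    moreover have "p \<in> ?A \<inter> ?B" using Fe[OF that(1)] Fe[OF that(2)] by (auto simp: thicken_def intro!: bexI[of _ p])
    moreover have "z \<in> ?B" using Fe[OF that(2)] unfolding thicken_def by (auto intro!: bexI[of _ z])
    then have "z \<in> ?A \<inter> ?B" using that(3) by blast
    ultimately have "F x p - F z p = F x z - F z z" by (rule section_unique)
    then show ?thesis unfolding H_def by linarith
  qed
  have "section_on f S H" unfolding section_on_def
  proof
    fix x assume x: "x \<in> S"
    let ?A = "thicken (closed_segment p x) (e x)"
    have xA: "x \<in> ?A" using Fe[OF x] unfolding thicken_def by (auto intro!: bexI[of _ x])
    obtain d1 where d1: "d1 > 0" "ball x d1 \<subseteq> ?A" using thicken_open xA openE by blast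
    obtain d2 c where d2: "d2 > 0" "\<And>z. z \<in> ?A \<Longrightarrow> z \<in> ball x d2 \<Longrightarrow> F x z = f x z + c"
      using section_onD[OF Fe[OF x, THEN conjunct2] xA] by blast
    have "H z = f x z + (c - F x p)" if "z \<in> S \<inter> ball x (min d1 d2)" for z
      using H[OF x, of z] d1 d2(2)[of z] that by auto
    then show "\<exists>\<delta>>0. \<exists>c. \<forall>z\<in>S \<inter> ball x \<delta>. H z = f x z + c"
      using d1 d2 by (intro exI[of _ "min d1 d2"]) auto
  qed
  then show ?thesis by blast
qed

text \<open>Gluing along radii needs convexity, so it is done on \<open>D\<close> and pulled back by
  \<open>h\<close>. Agreement up to constants survives the transport: continuity of \<open>k\<close>
  supplies radii \<open>r'\<close> whose balls are mapped into the given ones.\<close>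

theorem section_on_homeomorphic:
  fixes S :: "'a::euclidean_space set" and D :: "'b::euclidean_space set"
  assumes hom: "S homeomorphic D" and D: "convex D" "open D" and S: "open S" "S \<noteq> {}"
    and r: "\<And>x. x \<in> S \<Longrightarrow> r x > 0 \<and> ball x (r x) \<subseteq> S"
    and f: "\<And>x y. x \<in> S \<Longrightarrow> y \<in> S \<Longrightarrow> \<exists>c. \<forall>z\<in>ball x (r x) \<inter> ball y (r y). f x z - f y z = c"
  shows "\<exists>F. section_on f S F"
proof -
  obtain h k where hk: "homeomorphism S D h k" using hom unfolding homeomorphic_def by blast
  have kS: "k y \<in> S" if "y \<in> D" for y using hk that unfolding homeomorphism_def by auto
  have hD: "h x \<in> D" if "x \<in> S" for x using hk that unfolding homeomorphism_def by auto
  have kh: "k (h x) = x" if "x \<in> S" for x using hk that unfolding homeomorphism_def by auto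
  have "\<exists>d>0. ball y d \<subseteq> D \<and> k ` ball y d \<subseteq> ball (k y) (r (k y))" if y: "y \<in> D" for y
  proof -
    obtain d1 where d1: "d1 > 0" "ball y d1 \<subseteq> D" using D(2) y openE by blast
    have "continuous_on D k" using hk unfolding homeomorphism_def by blast
    then obtain d2 where d2: "d2 > 0" "\<And>z. z \<in> D \<Longrightarrow> dist z y < d2 \<Longrightarrow> dist (k z) (k y) < r (k y)"
      using y r[OF kS[OF y]] unfolding continuous_on_iff by blast
    have "k ` ball y (min d1 d2) \<subseteq> ball (k y) (r (k y))"
    proof
      fix w assume "w \<in> k ` ball y (min d1 d2)"
      then obtain z where z: "w = k z" "dist y z < d1" "dist y z < d2" by auto
      then have "z \<in> D" using d1 by auto
      then show "w \<in> ball (k y) (r (k y))" using d2(2)[of z] z by (simp add: dist_commute)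
    qed
    then show ?thesis using d1 d2 by (intro exI[of _ "min d1 d2"]) auto
  qed
  then obtain r' where r': "\<And>y. y \<in> D \<Longrightarrow> r' y > 0 \<and> ball y (r' y) \<subseteq> D \<and> k ` ball y (r' y) \<subseteq> ball (k y) (r (k y))"
    by metis
  obtain p where p: "p \<in> D" using S hD by blast
  have "\<exists>F. section_on (\<lambda>y z. f (k y) (k z)) D F"
  proof (rule section_on_convex[OF D(1) p])
    show "r' x > 0 \<and> ball x (r' x) \<subseteq> D" if "x \<in> D" for x using r' that by blast
    fix x y assume xy: "x \<in> D" "y \<in> D"
    obtain c where c: "\<forall>z\<in>ball (k x) (r (k x)) \<inter> ball (k y) (r (k y)). f (k x) z - f (k y) z = c"
      using f[OF kS[OF xy(1)] kS[OF xy(2)]] by blast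
    have "\<forall>z\<in>ball x (r' x) \<inter> ball y (r' y). f (k x) (k z) - f (k y) (k z) = c"
      using c r'[OF xy(1)] r'[OF xy(2)] by blast
    then show "\<exists>c. \<forall>z\<in>ball x (r' x) \<inter> ball y (r' y). f (k x) (k z) - f (k y) (k z) = c" by blast
  qed
  then obtain F where F: "section_on (\<lambda>y z. f (k y) (k z)) D F" by blast
  have "section_on f S (\<lambda>x. F (h x))" unfolding section_on_def
  proof
    fix x assume x: "x \<in> S"
    obtain d c where d: "d > 0" "\<And>z. z \<in> D \<Longrightarrow> z \<in> ball (h x) d \<Longrightarrow> F z = f (k (h x)) (k z) + c"
      using section_onD[OF F hD[OF x]] by blast
    have "continuous_on S h" using hk unfolding homeomorphism_def by blast
    then obtain e where e: "e > 0" "\<And>z. z \<in> S \<Longrightarrow> dist z x < e \<Longrightarrow> dist (h z) (h x) < d"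
      using x d(1) unfolding continuous_on_iff by blast
    have "F (h z) = f x z + c" if "z \<in> S \<inter> ball x e" for z
      using d(2)[of "h z"] e(2)[of z] that hD kh x by (auto simp: dist_commute)
    then show "\<exists>\<delta>>0. \<exists>c. \<forall>z\<in>S \<inter> ball x \<delta>. F (h z) = f x z + c" using e(1) by blast
  qed
  then show ?thesis by blast
qed

subsection \<open>Triangulated polygons\<close>

lemma face_two_points:
  fixes K :: "pt set"
  assumes K: "2 simplex K" and F: "F face_of K" and xy: "x \<in> F" "y \<in> F" "x \<noteq> y"
  shows "F = K \<or> F edge_of K"
proof (cases "F = K")
  case False
  have "aff_dim {x, y} \<le> aff_dim F" using xy by (intro aff_dim_subset) auto
  then have "1 \<le> aff_dim F" using xy(3) by simp
  moreover have "aff_dim F < aff_dim K" by (rule face_of_aff_dim_lt[OF convex_simplex[OF K] F False])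
  moreover have "aff_dim K = 2" by (rule aff_dim_simplex[OF K])
  ultimately show ?thesis using F unfolding edge_of_def by simp
qed simp

text \<open>The intersection of two faces is a face, here of dimension at least 1. A proper face of
  an edge has smaller dimension, so the intersection is all of either edge.\<close>

lemma edges_two_points:
  fixes K :: "pt set"
  assumes e: "e edge_of K" "f edge_of K" and xy: "x \<in> e \<inter> f" "y \<in> e \<inter> f" "x \<noteq> y"
  shows "e = f"
proof -
  have d: "aff_dim {x, y} = 1" using xy(3) by simp
  have "aff_dim {x, y} \<le> aff_dim (e \<inter> f)" using xy by (intro aff_dim_subset) auto
  then have d1: "1 \<le> aff_dim (e \<inter> f)" using d by simp
  have ef: "e \<inter> f face_of K" using e face_of_Int unfolding edge_of_def by blast
  have gen: "e' = e \<inter> f" if e': "e' edge_of K" and s: "e \<inter> f \<subseteq> e'" for e'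
  proof (rule ccontr)
    assume n: "e' \<noteq> e \<inter> f"
    have "e \<inter> f face_of e'"
      using face_of_subset[OF ef s edge_of_imp_subset[OF e']] .
    then have "aff_dim (e \<inter> f) < aff_dim e'"
      using n e' face_of_imp_convex unfolding edge_of_def by (intro face_of_aff_dim_lt) auto
    then show False using d1 e' unfolding edge_of_def by simp
  qed
  show ?thesis using gen[OF e(1)] gen[OF e(2)] by blast
qed

text \<open>At an inner point of the edge, and hence nearby, the other two barycentric coordinates
  are positive, so the third alone decides.\<close>

lemma tri_halfdisc:
  assumes t: "tri a b c K" and x: "x \<in> open_segment a b"
  obtains r where "r > 0" "\<And>y. dist x y < r \<Longrightarrow> y \<in> K \<longleftrightarrow> 0 \<le> bary a b c y"
    "\<And>y. dist x y < r \<Longrightarrow> y \<in> interior K \<longleftrightarrow> 0 < bary a b c y"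
proof -
  have ab: "a \<noteq> b" using x by auto
  have d: "cr (b - a) (c - a) \<noteq> 0" "cr (c - b) (a - b) \<noteq> 0" "cr (a - c) (b - c) \<noteq> 0"
    using t tri_rot[OF t] tri_rot[OF tri_rot[OF t]] by (auto simp: tri_def)
  obtain u where u: "x = (1 - u) *\<^sub>R a + u *\<^sub>R b" "0 < u" "u < 1" using x unfolding in_segment by blast
  have x3: "x = (1 - u) *\<^sub>R a + u *\<^sub>R b + 0 *\<^sub>R b" using u by simp
  have "bary b c a x = 1 - u" "bary c a b x = u"
    unfolding x3 by (subst bary_affine; use d in simp)+
  then have "x \<in> {y. 0 < bary b c a y} \<inter> {y. 0 < bary c a b y}" using u by simp
  then obtain r where r: "r > 0" "ball x r \<subseteq> {y. 0 < bary b c a y} \<inter> {y. 0 < bary c a b y}"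
    using openE[OF open_Int[OF open_bary_pos open_bary_pos]] by blast
  then have rr: "0 < bary b c a y \<and> 0 < bary c a b y" if "dist x y < r" for y using that by auto
  show ?thesis
  proof
    show "r > 0" by (rule r(1))
    show "y \<in> K \<longleftrightarrow> 0 \<le> bary a b c y" if "dist x y < r" for y
      using rr[OF that] unfolding tri_eq[OF t] by auto
    show "y \<in> interior K \<longleftrightarrow> 0 < bary a b c y" if "dist x y < r" for y
      using rr[OF that] unfolding tri_interior[OF t] by auto
  qed
qed

lemma bary_takes_signs:
  assumes "cr (b - a) (c - a) \<noteq> 0" and z: "bary a b c x = 0" and r: "r > 0"
  obtains y z where "dist x y < r" "0 < bary a b c y" "dist x z < r" "bary a b c z < 0"
proof -
  define s where "s = r / (2 * norm (c - a))"
  have "c - a \<noteq> 0" using assms(1) by (auto simp: cr_def)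
  then have n: "norm (c - a) > 0" by simp
  then have s: "s > 0" using r by (simp add: s_def)
  have d: "dist x (x + t *\<^sub>R (c - a)) < r" if "\<bar>t\<bar> = s" for t
    using n that r by (simp add: dist_norm s_def)
  have b: "bary a b c (x + t *\<^sub>R (c - a)) = t" for t
  proof -
    have "cr (b - a) (t *\<^sub>R (c - a)) = t * cr (b - a) (c - a)" by (simp add: cr_def algebra_simps)
    then show ?thesis using assms(1) z by (simp add: bary_diff)
  qed
  show ?thesis
    using that[of "x + s *\<^sub>R (c - a)" "x + (- s) *\<^sub>R (c - a)"] d[of s] d[of "-s"] b[of s] b[of "-s"] s by simp
qed

locale polygon_mesh =
  fixes \<Omega> :: "pt set" and T :: "pt set set"
  assumes polygon: "polygon_domain \<Omega>" and mesh: "conforming_mesh \<Omega> T"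
begin

lemmas domain = polygon_domain_Jordan[OF polygon]

lemma finite_T: "finite T" and simplex_T: "K \<in> T \<Longrightarrow> 2 simplex K" and cover: "\<Union>T = closure \<Omega>"
  using mesh unfolding conforming_mesh_def triangulation_def by auto

lemma face_T: "K \<in> T \<Longrightarrow> K' \<in> T \<Longrightarrow> K \<inter> K' face_of K \<and> K \<inter> K' face_of K'"
  using mesh unfolding conforming_mesh_def triangulation_def by (metis Int_commute)

lemma compact_T: "K \<in> T \<Longrightarrow> compact K" and convex_T: "K \<in> T \<Longrightarrow> convex K"
  using simplex_T compact_simplex convex_simplex by blast+

lemma closed_T: "K \<in> T \<Longrightarrow> closed K"
  using compact_T compact_imp_closed by blast

lemma subset_T: "K \<in> T \<Longrightarrow> K \<subseteq> closure \<Omega>"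
  using cover by blast

text \<open>A proper face misses the interior. The common face is proper in \<open>K\<close>:
  otherwise \<open>K\<close> would be a proper face of \<open>K'\<close> and yet contain interior
  points of \<open>K'\<close>.\<close>

lemma interior_disjoint:
  assumes "K \<in> T" "K' \<in> T" "K \<noteq> K'"
  shows "interior K \<inter> K' = {}"
proof -
  have F: "K \<inter> K' face_of K" "K \<inter> K' face_of K'" using face_T assms by auto
  have "K \<inter> K' \<noteq> K"
  proof
    assume e: "K \<inter> K' = K"
    then have "K' \<inter> K = K" by blast
    then have "K face_of K'" using F(2) e by simp
    then have "K \<inter> interior K' = {}" using face_of_disjoint_interior assms(3) by blast
    moreover have "interior K \<subseteq> interior K'" using e by (intro interior_mono) blast
    moreover have "interior K \<noteq> {}" using tri_interior_nonempty simplex_T assms(1) by blast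
    ultimately show False using interior_subset by blast
  qed
  then have "(K \<inter> K') \<inter> interior K = {}" using face_of_disjoint_interior F(1) by blast
  then show ?thesis using interior_subset by blast
qed

lemma interior_subset_domain: "K \<in> T \<Longrightarrow> interior K \<subseteq> \<Omega>"
  using domain(5) interior_mono[OF subset_T] by blast

lemma edge_shared:
  assumes K: "K \<in> T" "e edge_of K" and K': "K' \<in> T" and xy: "x \<in> e \<inter> K'" "y \<in> e \<inter> K'" "x \<noteq> y"
  shows "e edge_of K'"
proof (cases "K' = K")
  case False
  have F: "K \<inter> K' face_of K" "K \<inter> K' face_of K'" using face_T K K' by auto
  have eK: "e \<subseteq> K" using K edge_of_imp_subset by blast
  have "K \<inter> K' \<noteq> K" using interior_disjoint[OF K(1) K'] False tri_interior_nonempty[OF simplex_T[OF K(1)]]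
      interior_subset by blast
  moreover have "K \<inter> K' = K \<or> K \<inter> K' edge_of K"
    using face_two_points[OF simplex_T[OF K(1)] F(1), of x y] xy eK by blast
  ultimately have ed: "K \<inter> K' edge_of K" by blast
  have "e = K \<inter> K'"
    by (rule edges_two_points[OF K(2) ed _ _ xy(3)]) (use xy eK in auto)
  then show ?thesis using F(2) K(2) unfolding edge_of_def by simp
qed (use K in simp)

lemma triangles_share_edge:
  assumes K: "K \<in> T" "K' \<in> T" "K \<noteq> K'" and xy: "x \<in> K \<inter> K'" "y \<in> K \<inter> K'" "x \<noteq> y"
  obtains e where "e edge_of K" "e edge_of K'" "x \<in> e" "y \<in> e"
proof -
  have F: "K \<inter> K' face_of K" using face_T K by auto
  have "K \<inter> K' \<noteq> K" using interior_disjoint[OF K] tri_interior_nonempty[OF simplex_T[OF K(1)]]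
      interior_subset by blast
  then have ed: "K \<inter> K' edge_of K"
    using face_two_points[OF simplex_T[OF K(1)] F xy] by blast
  have "K \<inter> K' edge_of K'"
    by (rule edge_shared[OF K(1) ed K(2) _ _ xy(3)]) (use xy in auto)
  then show ?thesis using that ed xy by blast
qed

lemma small_ball:
  obtains r where "r > 0" "\<And>K. K \<in> T \<Longrightarrow> ball x r \<inter> K \<noteq> {} \<Longrightarrow> x \<in> K"
proof -
  have "closed (\<Union>{K \<in> T. x \<notin> K})" using finite_T closed_T by (intro closed_Union) auto
  then have "open (- \<Union>{K \<in> T. x \<notin> K})" by blast
  moreover have "x \<in> - \<Union>{K \<in> T. x \<notin> K}" by blast
  ultimately obtain r where "r > 0" "ball x r \<subseteq> - \<Union>{K \<in> T. x \<notin> K}" using openE by blast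
  then show ?thesis using that by blast
qed

lemma small_ball_domain:
  assumes "x \<in> \<Omega>"
  obtains r where "r > 0" "ball x r \<subseteq> \<Omega>" "\<And>K. K \<in> T \<Longrightarrow> ball x r \<inter> K \<noteq> {} \<Longrightarrow> x \<in> K"
proof -
  obtain r1 where r1: "r1 > 0" "\<And>K. K \<in> T \<Longrightarrow> ball x r1 \<inter> K \<noteq> {} \<Longrightarrow> x \<in> K" using small_ball[of x] by blast
  obtain r2 where r2: "r2 > 0" "ball x r2 \<subseteq> \<Omega>" using openE[OF domain(1) assms] .
  have s: "ball x (min r1 r2) \<subseteq> ball x r1" "ball x (min r1 r2) \<subseteq> ball x r2" by auto
  show ?thesis using that[of "min r1 r2"] r1 r2 s by (metis (no_types, lifting) disjoint_iff min_less_iff_conj subset_eq)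
qed

lemma domain_covered: "x \<in> \<Omega> \<Longrightarrow> \<exists>K\<in>T. x \<in> K"
  using cover closure_subset by blast

text \<open>A face that meets the relative interior of \<open>e\<close> contains \<open>e\<close>,
  in particular both of its end points.\<close>

lemma edge_point_rel_interior:
  assumes K: "K \<in> T" "e edge_of K" and x: "x \<in> rel_interior e" and K': "K' \<in> T" "x \<in> K'"
  shows "e edge_of K'"
proof (cases "K' = K")
  case False
  have F: "K \<inter> K' face_of K" using face_T K K' by auto
  have eK: "e \<subseteq> K" using K edge_of_imp_subset by blast
  have "x \<in> K \<inter> K'" using x K' eK rel_interior_subset by blast
  then have "e \<subseteq> K \<inter> K'" using subset_of_face_of[OF F eK] x by blast
  moreover obtain a b where ab: "a \<noteq> b" "e = closed_segment a b"
    using edge_imp_segment[OF K(2) simplex_T[OF K(1)]] by blast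
  ultimately show ?thesis
    using edge_shared[OF K K'(1), of a b] by auto
qed (use K in simp)

text \<open>Two triangles on the same side of \<open>e\<close> fill the same half-disc at the
  midpoint of \<open>e\<close>, so their interiors meet.\<close>

lemma edge_same_side:
  assumes K: "K \<in> T" "e edge_of K" and K': "K' \<in> T" "e edge_of K'"
    and n: "unit_normal e n" and nu: "nu K e n = nu K' e n"
  shows "K = K'"
proof (rule ccontr)
  assume ne: "K \<noteq> K'"
  obtain a b c where t: "tri a b c K" "e = closed_segment a b" using edge_tri[OF simplex_T[OF K(1)] K(2)] .
  obtain a' b' c' where t': "tri a' b' c' K'" "e = closed_segment a' b'" using edge_tri[OF simplex_T[OF K'(1)] K'(2)] .
  have "{a, b} = {a', b'}" using t(2) t'(2) closed_segment_eq by metis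
  then have t2: "tri a b c' K'" using t'(1) tri_swap[OF t'(1)] by (auto simp: doubleton_eq_iff)
  have ab: "a \<noteq> b" using tri_distinct[OF t(1)] by simp
  have d: "cr (b - a) (c - a) \<noteq> 0" "cr (b - a) (c' - a) \<noteq> 0" using t t2 by (auto simp: tri_def)
  have un: "unit_normal (closed_segment a b) n" using n t by simp
  note ul = unit_normal_segment[OF un]
  have nn: "sgn (n \<bullet> (c - a)) = sgn (n \<bullet> (c' - a))"
    using nu nu_tri[OF t(1) un] nu_tri[OF t2 un] t(2) by simp
  have "n \<bullet> n = 1" using ul(1) by (simp add: norm_eq_1)
  then have "cr n (b - a) = - sgn (cr (b - a) (c - a)) * sgn (n \<bullet> (c - a)) * norm (b - a)"
    "cr n (b - a) = - sgn (cr (b - a) (c' - a)) * sgn (n \<bullet> (c' - a)) * norm (b - a)"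
    using perp_unit(1)[OF ul d(1), of n] perp_unit(1)[OF ul d(2), of n] by auto
  then have "sgn (cr (b - a) (c - a)) = sgn (cr (b - a) (c' - a))"
    using nn ab perp_unit(2)[OF ul d(2)] by (auto simp: sgn_0_0)
  then have dd: "0 < bary a b c y \<longleftrightarrow> 0 < bary a b c' y" for y
    unfolding bary_def using d by (auto simp: zero_less_divide_iff sgn_if split: if_splits)
  define x where "x = midpoint a b"
  have x: "x \<in> open_segment a b" using ab unfolding x_def by simp
  obtain r where r: "r > 0" "\<And>y. dist x y < r \<Longrightarrow> y \<in> interior K \<longleftrightarrow> 0 < bary a b c y"
    using tri_halfdisc[OF t(1) x] by metis
  obtain r' where r': "r' > 0" "\<And>y. dist x y < r' \<Longrightarrow> y \<in> interior K' \<longleftrightarrow> 0 < bary a b c' y"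
    using tri_halfdisc[OF t2 x] by metis
  have x0: "bary a b c x = 0" using x bary_segment_zero open_closed_segment by blast
  have "min r r' > 0" using r r' by simp
  from bary_takes_signs[OF d(1) x0 this] obtain y where y: "dist x y < min r r'" "0 < bary a b c y" by blast
  then have "y \<in> interior K \<inter> interior K'" using r(2)[of y] r'(2)[of y] dd by auto
  then show False using interior_disjoint[OF K(1) K'(1) ne] interior_subset by blast
qed

lemma nu_cases: "nu K e n = 1 \<or> nu K e n = -1"
  by (simp add: nu_def)

text \<open>By \<open>edge_same_side\<close> the two triangles lie on opposite sides. Near an inner
  point of \<open>e\<close> their half-discs fill a disc in \<open>closure \<Omega>\<close>, and
  interior points of that closure lie in \<open>\<Omega>\<close>. A third triangle would share its
  side with one of the two.\<close>

lemma interior_edge: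
  assumes K: "K \<in> T" "e edge_of K" and K': "K' \<in> T" "e edge_of K'" and ne: "K \<noteq> K'"
  shows "rel_interior e \<subseteq> \<Omega>"
    and "unit_normal e n \<Longrightarrow> nu K e n = - nu K' e n"
    and "K'' \<in> T \<Longrightarrow> e edge_of K'' \<Longrightarrow> K'' = K \<or> K'' = K'"
proof -
  show opp: "nu K e n = - nu K' e n" if "unit_normal e n" for n
    using edge_same_side[OF K K' that] ne nu_cases[of K e n] nu_cases[of K' e n] by auto
  obtain a b c where t: "tri a b c K" "e = closed_segment a b" using edge_tri[OF simplex_T[OF K(1)] K(2)] .
  obtain a' b' c' where t': "tri a' b' c' K'" "e = closed_segment a' b'" using edge_tri[OF simplex_T[OF K'(1)] K'(2)] .
  have "{a, b} = {a', b'}" using t(2) t'(2) closed_segment_eq by metis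
  then have t2: "tri a b c' K'" using t'(1) tri_swap[OF t'(1)] by (auto simp: doubleton_eq_iff)
  have ab: "a \<noteq> b" using tri_distinct[OF t(1)] by simp
  have d: "cr (b - a) (c - a) \<noteq> 0" "cr (b - a) (c' - a) \<noteq> 0" using t t2 by (auto simp: tri_def)
  \<comment> \<open>The edge vector, turned by a right angle and normalised. Two of the claims
    mention no normal, so one is constructed.\<close>
  define n0 where "n0 = (1 / norm (b - a)) *\<^sub>R (vector [(b - a) $ 2, - (b - a) $ 1] :: pt)"
  have un: "unit_normal e n0"
  proof -
    have "norm (vector [u $ 2, - u $ 1] :: pt) = norm u" for u :: pt
      by (simp add: norm_eq inner_vec_def sum_2 add.commute)
    note nv = this[of "b - a"]
    have "norm n0 = 1" unfolding n0_def norm_scaleR nv using ab by simp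
    moreover have "n0 \<bullet> (y - x) = 0" if "x \<in> e" "y \<in> e" for x y
    proof -
      obtain u v where uv: "x = (1 - u) *\<^sub>R a + u *\<^sub>R b" "y = (1 - v) *\<^sub>R a + v *\<^sub>R b"
        using \<open>x \<in> e\<close> \<open>y \<in> e\<close> t(2) unfolding closed_segment_def by blast
      have yx: "y - x = (v - u) *\<^sub>R (b - a)" unfolding uv by (simp add: algebra_simps)
      have "((1 / m) *\<^sub>R vector [w $ 2, - w $ 1]) \<bullet> (k *\<^sub>R w) = 0" for m k and w :: pt
        by (simp add: inner_vec_def sum_2)
      then show ?thesis unfolding yx n0_def by blast
    qed
    ultimately show ?thesis unfolding unit_normal_def by blast
  qed
  show "K'' = K \<or> K'' = K'" if "K'' \<in> T" "e edge_of K''"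
    using edge_same_side[OF that K un] edge_same_side[OF that K' un] opp[OF un] nu_cases[of K'' e n0] nu_cases[of K e n0]
    by auto
  have un': "unit_normal (closed_segment a b) n0" using un t by simp
  note ul = unit_normal_segment[OF un']
  have nn: "sgn (n0 \<bullet> (c - a)) = - sgn (n0 \<bullet> (c' - a))"
    using opp[OF un] nu_tri[OF t(1) un'] nu_tri[OF t2 un'] t(2) by simp
  have "n0 \<bullet> n0 = 1" using ul(1) by (simp add: norm_eq_1)
  then have "cr n0 (b - a) = - sgn (cr (b - a) (c - a)) * sgn (n0 \<bullet> (c - a)) * norm (b - a)"
    "cr n0 (b - a) = - sgn (cr (b - a) (c' - a)) * sgn (n0 \<bullet> (c' - a)) * norm (b - a)"
    using perp_unit(1)[OF ul d(1), of n0] perp_unit(1)[OF ul d(2), of n0] by auto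
  then have "(sgn (cr (b - a) (c - a)) + sgn (cr (b - a) (c' - a))) * (sgn (n0 \<bullet> (c' - a)) * norm (b - a)) = 0"
    unfolding nn by (simp add: algebra_simps)
  moreover have "sgn (n0 \<bullet> (c' - a)) * norm (b - a) \<noteq> 0"
    using ab perp_unit(2)[OF ul d(2)] by (simp add: sgn_0_0)
  ultimately have sg: "sgn (cr (b - a) (c - a)) = - sgn (cr (b - a) (c' - a))"
    by (metis mult_eq_0_iff add_eq_0_iff2)
  then have dd: "0 \<le> bary a b c y \<or> 0 \<le> bary a b c' y" for y
    unfolding bary_def using d by (auto simp: zero_le_divide_iff sgn_if split: if_splits)
  show "rel_interior e \<subseteq> \<Omega>"
  proof
    fix x assume "x \<in> rel_interior e"
    then have x: "x \<in> open_segment a b" using t(2) ab by (simp add: rel_interior_closed_segment)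
    obtain r where r: "r > 0" "\<And>y. dist x y < r \<Longrightarrow> y \<in> K \<longleftrightarrow> 0 \<le> bary a b c y"
      using tri_halfdisc[OF t(1) x] by metis
    obtain r' where r': "r' > 0" "\<And>y. dist x y < r' \<Longrightarrow> y \<in> K' \<longleftrightarrow> 0 \<le> bary a b c' y"
      using tri_halfdisc[OF t2 x] by metis
    have "ball x (min r r') \<subseteq> K \<union> K'" using r(2) r'(2) dd by (auto simp: subset_iff)
    then have "ball x (min r r') \<subseteq> closure \<Omega>" using subset_T K K' by blast
    then have "x \<in> interior (closure \<Omega>)" using r(1) r'(1) mem_interior by (metis min_less_iff_conj)
    then show "x \<in> \<Omega>" using domain(5) by blast
  qed
qed

text \<open>If an inner point of \<open>e\<close> were in \<open>\<Omega>\<close>, points near it on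
  the far side of \<open>e\<close> would be covered by a triangle that contains the inner point and
  hence has \<open>e\<close> as an edge; by \<open>bd\<close> it is \<open>K\<close>, which lies on
  the near side. The end points follow by closure.\<close>

lemma boundary_edge:
  assumes K: "K \<in> T" "e edge_of K" and bd: "\<And>K'. K' \<in> T \<Longrightarrow> e edge_of K' \<Longrightarrow> K' = K"
  shows "e \<subseteq> frontier \<Omega>"
proof -
  obtain a b c where t: "tri a b c K" "e = closed_segment a b" using edge_tri[OF simplex_T[OF K(1)] K(2)] .
  have ab: "a \<noteq> b" using tri_distinct[OF t(1)] by simp
  have ri: "rel_interior e = open_segment a b" using t(2) ab by (simp add: rel_interior_closed_segment)
  have "open_segment a b \<subseteq> - \<Omega>"
  proof
    fix x assume x: "x \<in> open_segment a b"
    show "x \<in> - \<Omega>"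
    proof
      assume "x \<in> \<Omega>"
      then obtain r1 where r1: "r1 > 0" "ball x r1 \<subseteq> \<Omega>" "\<And>K. K \<in> T \<Longrightarrow> ball x r1 \<inter> K \<noteq> {} \<Longrightarrow> x \<in> K"
        by (rule small_ball_domain) blast
      obtain r where r: "r > 0" "\<And>y. dist x y < r \<Longrightarrow> y \<in> K \<longleftrightarrow> 0 \<le> bary a b c y"
        using tri_halfdisc[OF t(1) x] by metis
      have x0: "bary a b c x = 0" using x bary_segment_zero open_closed_segment by blast
      have d: "cr (b - a) (c - a) \<noteq> 0" using t by (auto simp: tri_def)
      have "min r r1 > 0" using r r1 by simp
      from bary_takes_signs[OF d x0 this] obtain y where y: "dist x y < min r r1" "bary a b c y < 0" by blast
      then have "y \<in> ball x r1" by simp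
      then obtain K' where K': "K' \<in> T" "y \<in> K'" using domain_covered r1(2) by blast
      then have "x \<in> K'" using r1(3)[of K'] \<open>y \<in> ball x r1\<close> by blast
      then have "e edge_of K'" using edge_point_rel_interior[OF K _ K'(1)] x ri by blast
      then have "K' = K" using bd K' by blast
      then show False using r(2)[of y] y K'(2) by auto
    qed
  qed
  then have "closure (open_segment a b) \<subseteq> closure (- \<Omega>)" by (rule closure_mono)
  then have "e \<subseteq> - \<Omega>" using t(2) ab domain(1) by (simp add: closed_Compl closure_closed)
  moreover have "e \<subseteq> closure \<Omega>" using K edge_of_imp_subset subset_T by blast
  ultimately show ?thesis using domain(1) by (auto simp: frontier_def interior_open)
qed

end

text \<open>The three open arms, pulled back along the curve, are disjoint intervals each of which
  accumulates at one of the two parameters of the centre.\<close>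

lemma no_triod_in_simple_closed_curve:
  fixes g :: "real \<Rightarrow> 'a::euclidean_space" and b :: "nat \<Rightarrow> 'a"
  assumes g: "simple_path g" "pathfinish g = pathstart g"
    and b: "\<And>i. i < 3 \<Longrightarrow> closed_segment a (b i) \<subseteq> path_image g" "\<And>i. i < 3 \<Longrightarrow> b i \<noteq> a"
    and disj: "\<And>i j. i < 3 \<Longrightarrow> j < 3 \<Longrightarrow> i \<noteq> j \<Longrightarrow> closed_segment a (b i) \<inter> closed_segment a (b j) \<subseteq> {a}"
  shows False
proof -
  have "a \<in> path_image g" using b(1)[of 0] by auto
  then obtain t0 where t0: "t0 \<in> {0..1}" "g t0 = a" unfolding path_image_def by blast
  \<comment> \<open>The curve is restarted at the centre, which then has only the parameters 0 and
    1, and \<open>h\<close> is injective in between.\<close>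
  define h where "h = shiftpath t0 g"
  have h: "simple_path h" "path_image h = path_image g" "h 0 = a" "h 1 = a"
    using g t0 simple_path_shiftpath[of g t0] path_image_shiftpath[of t0 g] pathstart_shiftpath[of t0 g]
      pathfinish_shiftpath[of t0 g] by (auto simp: h_def pathstart_def pathfinish_def)
  have cont: "continuous_on {0..1} h" using h(1) unfolding simple_path_def path_def by blast
  have inj: "s = t" if "s \<in> {0<..<1}" "t \<in> {0..1}" "h s = h t" for s t
    using h(1) that unfolding simple_path_def loop_free_def by force
  define P where "P = (\<lambda>i. {t \<in> {0<..<1}. h t \<in> closed_segment a (b i)})"
  have on: "t \<in> {0<..<1}" if "t \<in> {0..1}" "h t \<noteq> a" for t
    using that h(3,4) by (cases "t = 0"; cases "t = 1") auto
  have P_disj: "P i \<inter> P j = {}" if "i < 3" "j < 3" "i \<noteq> j" for i j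
  proof (rule ccontr)
    assume "P i \<inter> P j \<noteq> {}"
    then obtain t where t: "t \<in> {0<..<1}" "h t \<in> closed_segment a (b i) \<inter> closed_segment a (b j)"
      unfolding P_def by blast
    then have "h t = a" using disj[OF that] by blast
    then have "t = 0" using inj[OF t(1), of 0] h(3) by simp
    then show False using t by simp
  qed
  have pre: "\<exists>t\<in>P i. h t = a + u *\<^sub>R (b i - a)" if i: "i < 3" and u: "0 < u" "u \<le> 1" for i u
  proof -
    have "a + u *\<^sub>R (b i - a) \<in> closed_segment a (b i)"
      using u unfolding closed_segment_def by (intro CollectI exI[of _ u]) (auto simp: algebra_simps)
    moreover from this have "a + u *\<^sub>R (b i - a) \<in> h ` {0..1}"
      using b(1)[OF i] h(2) unfolding path_image_def by blast
    then obtain t where t: "t \<in> {0..1}" "h t = a + u *\<^sub>R (b i - a)" by (auto simp: image_iff)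
    moreover have "h t \<noteq> a" using t u b(2)[OF i] by simp
    ultimately show ?thesis using on[OF t(1)] unfolding P_def by auto
  qed
  have P_conn: "connected (P i)" if i: "i < 3" for i
  proof -
    \<comment> \<open>The arm without a neighbourhood of the centre. Its preimage \<open>Q n\<close>
      is compact, hence homeomorphic to the segment \<open>S n\<close> and connected. The sets
      \<open>Q n\<close> exhaust \<open>P i\<close> and share the parameter of
      \<open>b i\<close>.\<close>
    define S where "S = (\<lambda>n::nat. closed_segment (a + (1 / real (Suc n)) *\<^sub>R (b i - a)) (b i))"
    have Sform: "S n = (\<lambda>u. a + u *\<^sub>R (b i - a)) ` {1 / real (Suc n)..1}" for n
    proof -
      have lin: "linear (\<lambda>u::real. u *\<^sub>R (b i - a))" by (auto simp: linear_iff algebra_simps)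
      have "closed_segment (a + p *\<^sub>R (b i - a)) (a + q *\<^sub>R (b i - a)) =
          (\<lambda>u. a + u *\<^sub>R (b i - a)) ` closed_segment p q" for p q
        by (simp only: closed_segment_translation closed_segment_linear_image[OF lin] image_image)
      from this[of "1 / real (Suc n)" 1] show ?thesis
        by (simp add: S_def closed_segment_eq_real_ivl del: of_nat_Suc)
    qed
    define Q where "Q = (\<lambda>n. {t \<in> {0..1}. h t \<in> S n})"
    have QP: "Q n \<subseteq> P i" for n
    proof
      fix t assume t: "t \<in> Q n"
      then obtain u where u: "1 / real (Suc n) \<le> u" "u \<le> 1" "h t = a + u *\<^sub>R (b i - a)" "t \<in> {0..1}"
        unfolding Q_def Sform by auto
      have "0 < 1 / real (Suc n)" by simp
      then have u0: "0 < u" using u(1) by linarith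
      obtain t' where t': "t' \<in> P i" "h t' = h t" using pre[OF i u0 u(2)] u(3) by auto
      then have "t' = t" using inj[of t' t] u(4) unfolding P_def by auto
      then show "t \<in> P i" using t' by simp
    qed
    have Q_conn: "connected (Q n)" for n
    proof -
      have cQ: "compact (Q n)"
      proof -
        have "closed ({0..1} \<inter> h -` S n)"
          using continuous_closed_preimage[OF cont] by (simp add: S_def)
        moreover have "{0..1} \<inter> h -` S n = Q n" unfolding Q_def by auto
        ultimately have "closed (Q n)" by simp
        then have "compact ({0..1} \<inter> Q n)" by (rule compact_Int_closed[OF compact_Icc])
        moreover have "{0..1} \<inter> Q n = Q n" unfolding Q_def by blast
        ultimately show ?thesis by (simp only:)
      qed
      have im: "h ` Q n = S n"
      proof
        show "S n \<subseteq> h ` Q n"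
        proof
          fix y assume y: "y \<in> S n"
          then obtain u where u: "1 / real (Suc n) \<le> u" "u \<le> 1" "y = a + u *\<^sub>R (b i - a)" unfolding Sform by auto
          have "0 < 1 / real (Suc n)" by simp
          then have u0: "0 < u" using u(1) by linarith
          obtain t where "t \<in> P i" "h t = y" using pre[OF i u0 u(2)] u(3) by auto
          then show "y \<in> h ` Q n" using y unfolding P_def Q_def by auto
        qed
      qed (auto simp: Q_def)
      have "inj_on h (Q n)" using QP inj unfolding inj_on_def P_def Q_def by blast
      moreover have "continuous_on (Q n) h"
        by (rule continuous_on_subset[OF cont]) (auto simp: Q_def)
      ultimately have "\<exists>k. homeomorphism (Q n) (S n) h k"
        using homeomorphism_compact[OF cQ _ im] by (simp only:)
      then obtain k where k: "homeomorphism (Q n) (S n) h k" by (elim exE)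
      then have "Q n = k ` S n" "continuous_on (S n) k" unfolding homeomorphism_def by auto
      then show ?thesis using connected_continuous_image[of "S n" k] by (simp add: S_def)
    qed
    have "P i = (\<Union>n. Q n)"
    proof
      show "P i \<subseteq> (\<Union>n. Q n)"
      proof
        fix t assume t: "t \<in> P i"
        then obtain u where u: "0 \<le> u" "u \<le> 1" "h t = (1 - u) *\<^sub>R a + u *\<^sub>R b i"
          unfolding P_def closed_segment_def by auto
        have ht: "h t = a + u *\<^sub>R (b i - a)" using u(3) by (simp add: algebra_simps)
        have "h t \<noteq> a" using inj[of t 0] t h(3) unfolding P_def by auto
        then have "u > 0" using ht u(1) by (cases "u = 0") auto
        then obtain n where "1 / real (Suc n) < u" using nat_approx_posE by blast
        then have "h t \<in> S n" unfolding Sform ht using u by auto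
        then show "t \<in> (\<Union>n. Q n)" using t unfolding Q_def P_def by auto
      qed
    qed (use QP in blast)
    moreover have "\<Inter>(range Q) \<noteq> {}"
    proof -
      obtain t where t: "t \<in> P i" "h t = a + 1 *\<^sub>R (b i - a)" using pre[OF i, of 1] by auto
      have "t \<in> Q n" for n using t unfolding Q_def P_def S_def by auto
      then show ?thesis by blast
    qed
    ultimately show ?thesis using connected_Union[of "range Q"] Q_conn by auto
  qed
  have acc: "(\<forall>e>0. \<exists>t\<in>P i. t < e) \<or> (\<forall>e>0. \<exists>t\<in>P i. 1 - e < t)" if i: "i < 3" for i
  proof -
    have "\<forall>n. \<exists>t\<in>P i. h t = a + (1 / real (Suc n)) *\<^sub>R (b i - a)" using pre[OF i] by auto
    \<comment> \<open>Parameters of points of the arm that tend to the centre. A subsequential limit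
      is mapped to the centre, so it is 0 or 1.\<close>
    then obtain s where s: "\<And>n. s n \<in> P i" "\<And>n. h (s n) = a + (1 / real (Suc n)) *\<^sub>R (b i - a)" by metis
    have "s n \<in> {0..1}" for n using s(1)[of n] unfolding P_def by simp
    then have "\<forall>n. s n \<in> {0..1}" by blast
    then obtain l r where l: "l \<in> {0..1}" "strict_mono r" "(s \<circ> r) \<longlonglongrightarrow> l"
      using compact_Icc[of "0::real" 1] unfolding compact_eq_seq_compact_metric seq_compact_def by metis
    have "(\<lambda>n. h ((s \<circ> r) n)) \<longlonglongrightarrow> h l"
      by (rule continuous_on_tendsto_compose[OF cont l(3) l(1)]) (use \<open>\<forall>n. s n \<in> {0..1}\<close> in auto)
    moreover have "(\<lambda>n. h (s n)) \<longlonglongrightarrow> a + 0 *\<^sub>R (b i - a)"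
      unfolding s(2) using LIMSEQ_inverse_real_of_nat
      by (intro tendsto_intros) (simp add: inverse_eq_divide)
    then have "(\<lambda>n. h ((s \<circ> r) n)) \<longlonglongrightarrow> a + 0 *\<^sub>R (b i - a)"
      using LIMSEQ_subseq_LIMSEQ[OF _ l(2), of "\<lambda>n. h (s n)"] by (simp add: o_def)
    ultimately have "h l = a" using LIMSEQ_unique by fastforce
    then have lcase: "l = 0 \<or> l = 1" using on[OF l(1)] inj[of l 0] h(3) l(1) by force
    have near: "\<exists>t\<in>P i. \<bar>t - l\<bar> < e" if e: "e > 0" for e
    proof -
      obtain n where "dist ((s \<circ> r) n) l < e" using l(3) e unfolding lim_sequentially by blast
      then show ?thesis using s(1)[of "r n"] by (auto simp: dist_real_def)
    qed
    from lcase show ?thesis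
    proof
      assume l0: "l = 0"
      have "\<exists>t\<in>P i. t < e" if e: "e > 0" for e
        using near[OF e] unfolding l0 by (elim bexE) (rule bexI[rotated], assumption, linarith)
      then show ?thesis by blast
    next
      assume l1: "l = 1"
      have "\<exists>t\<in>P i. 1 - e < t" if e: "e > 0" for e
        using near[OF e] unfolding l1 by (elim bexE) (rule bexI[rotated], assumption, linarith)
      then show ?thesis by blast
    qed
  qed
  have not_both: False if ij: "i < 3" "j < 3" "i \<noteq> j"
    and a: "(\<forall>e>0. \<exists>t\<in>P i. t < e) \<and> (\<forall>e>0. \<exists>t\<in>P j. t < e) \<or>
            (\<forall>e>0. \<exists>t\<in>P i. 1 - e < t) \<and> (\<forall>e>0. \<exists>t\<in>P j. 1 - e < t)" for i j
  proof -
    \<comment> \<open>For \<open>p < q\<close>: if the second interval came arbitrarily close to 0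
      it would contain \<open>p\<close>, and if the first came arbitrarily close to 1 it would
      contain \<open>q\<close>.\<close>
    have gen: False if "i < 3" "j < 3" "i \<noteq> j" and p: "p \<in> P i" "q \<in> P j" "p < q"
        and a: "(\<forall>e>0. \<exists>t\<in>P j. t < e) \<or> (\<forall>e>0. \<exists>t\<in>P i. 1 - e < t)" for i j p q
      using a
    proof
      assume a: "\<forall>e>0. \<exists>t\<in>P j. t < e"
      have "p > 0" using p(1) unfolding P_def by auto
      then obtain q' where "q' \<in> P j" "q' < p" using a by blast
      then have "p \<in> P j" using connectedD_interval[OF P_conn[OF that(2)], of q' q p] p by auto
      then show False using P_disj[OF that(1-3)] p by blast
    next
      assume a: "\<forall>e>0. \<exists>t\<in>P i. 1 - e < t"
      have "1 - q > 0" using p(2) unfolding P_def by auto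
      then obtain p' where "p' \<in> P i" "1 - (1 - q) < p'" using a by blast
      then have "q \<in> P i" using connectedD_interval[OF P_conn[OF that(1)], of p p' q] p by auto
      then show False using P_disj[OF that(1-3)] p by blast
    qed
    obtain p q where pq: "p \<in> P i" "q \<in> P j" using pre[OF ij(1), of 1] pre[OF ij(2), of 1] by auto
    then have "p \<noteq> q" using P_disj[OF ij] by blast
    then consider "p < q" | "q < p" by linarith
    then show False
    proof cases
      case 1 then show ?thesis using gen[OF ij pq] a by blast
    next
      case 2 then show ?thesis using gen[OF ij(2) ij(1) _ pq(2) pq(1)] ij(3) a by blast
    qed
  qed
  show False
    using acc[of 0] acc[of 1] acc[of 2] not_both[of 0 1] not_both[of 0 2] not_both[of 1 2] by auto
qed

text \<open>Starlike about a point \<open>z\<close> opposite to \<open>b\<close>. If the segment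
  from \<open>z\<close> to \<open>y\<close> hit the slit, then \<open>y\<close> would lie on the ray
  from \<open>a\<close> through \<open>b\<close>, and because of \<open>r \<le> dist a b\<close>
  this ray runs inside the slit as long as it is in the ball.\<close>

lemma ball_minus_radius_connected:
  fixes a b :: "'a::euclidean_space"
  assumes ab: "a \<noteq> b" and r: "0 < r" "r \<le> dist a b"
  shows "connected (ball a r - closed_segment a b)"
proof -
  define u where "u = b - a"
  define z where "z = a - (r / (2 * norm u)) *\<^sub>R u"
  have nu: "norm u > 0" "r \<le> norm u" using ab r by (auto simp: u_def dist_norm norm_minus_commute)
  have seg: "y \<in> closed_segment a b" if "y \<in> ball a r" "y = a + s *\<^sub>R u" "0 \<le> s" for y s
  proof -
    have "s * norm u < r" using that by (simp add: dist_norm)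
    then have "s * norm u < 1 * norm u" using that(3) nu by linarith
    then have "s \<le> 1" using nu mult_less_cancel_right_pos by fastforce
    then show ?thesis using that(2,3) unfolding closed_segment_def u_def
      by (intro CollectI exI[of _ s]) (auto simp: algebra_simps)
  qed
  have c0: "r / (2 * norm u) > 0" using r nu by simp
  have zb: "z \<in> ball a r" using r nu by (simp add: z_def dist_norm)
  have zseg: "z \<notin> closed_segment a b"
  proof
    assume "z \<in> closed_segment a b"
    then obtain s where s: "0 \<le> s" "z = (1 - s) *\<^sub>R a + s *\<^sub>R b" unfolding closed_segment_def by blast
    have "z = a + s *\<^sub>R u" using s by (simp add: u_def algebra_simps)
    then have "s *\<^sub>R u = - ((r / (2 * norm u)) *\<^sub>R u)" unfolding z_def by simp
    then have "(s + r / (2 * norm u)) *\<^sub>R u = 0" by (simp add: scaleR_add_left)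
    then show False using c0 s nu by auto
  qed
  have "starlike (ball a r - closed_segment a b)"
    unfolding starlike_def
  proof (intro bexI[of _ z] ballI)
    show "z \<in> ball a r - closed_segment a b" using zb zseg by blast
    fix y assume y: "y \<in> ball a r - closed_segment a b"
    show "closed_segment z y \<subseteq> ball a r - closed_segment a b"
    proof
      fix w assume w: "w \<in> closed_segment z y"
      have wb: "w \<in> ball a r" using closed_segment_subset[OF zb _ convex_ball, of y] y w by blast
      moreover have "w \<notin> closed_segment a b"
      proof
        assume "w \<in> closed_segment a b"
        then obtain s where s: "0 \<le> s" "w = (1 - s) *\<^sub>R a + s *\<^sub>R b" unfolding closed_segment_def by blast
        have ws: "w = a + s *\<^sub>R u" using s by (simp add: u_def algebra_simps)
        obtain t where t: "0 \<le> t" "t \<le> 1" "w = (1 - t) *\<^sub>R z + t *\<^sub>R y" using w unfolding closed_segment_def by blast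
        have t0: "t \<noteq> 0" using t(3) zseg \<open>w \<in> closed_segment a b\<close> by auto
        have "t *\<^sub>R y = w - (1 - t) *\<^sub>R z" using t(3) by simp
        also have "\<dots> = t *\<^sub>R a + (s + (1 - t) * (r / (2 * norm u))) *\<^sub>R u"
          unfolding ws z_def by (simp add: algebra_simps)
        finally have "(1 / t) *\<^sub>R (t *\<^sub>R y) = (1 / t) *\<^sub>R (t *\<^sub>R a + (s + (1 - t) * (r / (2 * norm u))) *\<^sub>R u)" by simp
        then have "y = a + ((s + (1 - t) * (r / (2 * norm u))) / t) *\<^sub>R u"
          using t0 by (simp add: scaleR_add_right)
        moreover have "0 \<le> (s + (1 - t) * (r / (2 * norm u))) / t"
          by (intro divide_nonneg_nonneg add_nonneg_nonneg mult_nonneg_nonneg order.strict_implies_order[OF c0])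
            (use s(1) t(1,2) in linarith)+
        ultimately have "y \<in> closed_segment a b" using seg y by blast
        then show False using y by blast
      qed
      ultimately show "w \<in> ball a r - closed_segment a b" by blast
    qed
  qed
  then show ?thesis by (rule starlike_imp_connected)
qed

section \<open>Fans of triangles at a vertex and induction from the boundary\<close>

context polygon_mesh
begin

definition link :: "pt \<Rightarrow> pt set \<Rightarrow> pt set \<Rightarrow> bool" where
  "link a K K' \<longleftrightarrow> K \<in> T \<and> K' \<in> T \<and> (\<exists>e. e edge_of K \<and> e edge_of K' \<and> a \<in> e)"

text \<open>One class of the triangles at \<open>a\<close> under crossing edges that contain
  \<open>a\<close>; the aim is that there is only one class.\<close>

definition fan :: "pt \<Rightarrow> pt set \<Rightarrow> pt set set" where
  "fan a K = {K'. (link a)\<^sup>*\<^sup>* K K'}"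

lemma fan_self: "K \<in> fan a K"
  by (simp add: fan_def)

lemma fan_step: "K' \<in> fan a K \<Longrightarrow> link a K' K'' \<Longrightarrow> K'' \<in> fan a K"
  unfolding fan_def by (metis mem_Collect_eq rtranclp.rtrancl_into_rtrancl)

lemma fan_mem:
  assumes "K \<in> T" "a \<in> K" "K' \<in> fan a K"
  shows "K' \<in> T \<and> a \<in> K'"
proof -
  have "(link a)\<^sup>*\<^sup>* K K'" using assms(3) by (simp add: fan_def)
  then show ?thesis
  proof (induction rule: rtranclp_induct)
    case (step y z)
    then show ?case unfolding link_def using edge_of_imp_subset by blast
  qed (use assms in simp)
qed

lemma fan_sym:
  assumes "K' \<in> fan a K" "K' \<in> fan a L"
  shows "L \<in> fan a K"
proof -
  have "symp (link a)" unfolding link_def symp_def by blast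
  then have "symp ((link a)\<^sup>*\<^sup>*)" by (rule symp_rtranclp)
  then have "(link a)\<^sup>*\<^sup>* K' L" using assms(2) unfolding fan_def by (auto dest: sympD)
  then show ?thesis using assms(1) unfolding fan_def by auto
qed

definition boundary_edge_of :: "pt set \<Rightarrow> pt set \<Rightarrow> bool" where
  "boundary_edge_of K e \<longleftrightarrow> K \<in> T \<and> e edge_of K \<and> (\<forall>K'\<in>T. e edge_of K' \<longrightarrow> K' = K)"

lemma vertex_of_all:
  assumes "K \<in> T" "a extreme_point_of K" "K' \<in> T" "a \<in> K'"
  shows "a extreme_point_of K'"
proof -
  have "{a} face_of K" using assms(2) by (simp add: face_of_singleton)
  moreover have "a \<in> K" using assms(2) unfolding extreme_point_of_def by blast
  ultimately have "{a} face_of K \<inter> K'" using assms(4) face_of_subset[of "{a}" K "K \<inter> K'"] by simp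
  then have "{a} face_of K'" by (rule face_of_trans[OF _ conjunct2[OF face_T[OF assms(1,3)]]])
  then show ?thesis by (simp add: face_of_singleton)
qed

text \<open>In a small disc about \<open>a\<close>, slit along the segment to \<open>b\<close>, the
  union of the fan is closed. It is also open: around a point in \<open>\<Omega>\<close> all
  triangles are linked to the fan, and a point outside \<open>\<Omega>\<close> would lie on a
  boundary edge through \<open>a\<close>, which \<open>N\<close> puts into the slit. The slit disc
  is connected, so the fan covers it. Since the slit is an edge of the mesh, it misses the interiors
  of all triangles at \<open>a\<close>, and each of these is reached.\<close>

lemma fan_clopen:
  assumes K: "K \<in> T" "a extreme_point_of K" and ab: "a \<noteq> b"
    and e0: "K0 \<in> T" "closed_segment a b edge_of K0"
    and N: "\<And>K' e. K' \<in> fan a K \<Longrightarrow> boundary_edge_of K' e \<Longrightarrow> a \<in> e \<Longrightarrow> e \<subseteq> closed_segment a b"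
    and K': "K' \<in> T" "a \<in> K'"
  shows "K' \<in> fan a K"
proof -
  have aK: "a \<in> K" using K(2) unfolding extreme_point_of_def by blast
  define E where "E = {e. a \<notin> e \<and> (\<exists>K\<in>T. e edge_of K)}"
  have "finite E"
  proof -
    have "E \<subseteq> (\<Union>K\<in>T. {e. e edge_of K})" unfolding E_def by blast
    then show ?thesis using finite_T finite_edges simplex_T by (meson finite_UN finite_subset)
  qed
  moreover have "closed e" if "e \<in> E" for e
  proof -
    obtain K where "K \<in> T" "e edge_of K" using \<open>e \<in> E\<close> unfolding E_def by blast
    then obtain p q where "e = closed_segment p q" using edge_imp_segment simplex_T by metis
    then show ?thesis by simp
  qed
  ultimately have "closed (\<Union>E)" by (intro closed_Union) auto
  then have "open (- \<Union>E)" by blast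
  moreover have "a \<in> - \<Union>E" unfolding E_def by blast
  ultimately obtain r1 where r1: "r1 > 0" "ball a r1 \<subseteq> - \<Union>E" using openE by blast
  obtain r2 where r2: "r2 > 0" "\<And>K. K \<in> T \<Longrightarrow> ball a r2 \<inter> K \<noteq> {} \<Longrightarrow> a \<in> K" using small_ball[of a] by blast
  \<comment> \<open>The disc avoids all edges and triangles that do not contain \<open>a\<close>,
    and the slit reaches its rim.\<close>
  define r where "r = min (min r1 r2) (dist a b)"
  have r: "r > 0" "r \<le> dist a b" "ball a r \<subseteq> ball a r1" "ball a r \<subseteq> ball a r2"
    using r1 r2 ab by (auto simp: r_def)
  have rT: "a \<in> L" if "L \<in> T" "x \<in> L" "x \<in> ball a r" for L x using r2(2)[OF that(1)] that r(4) by blast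
  have rE: "a \<in> e" if "L \<in> T" "e edge_of L" "x \<in> e" "x \<in> ball a r" for L e x
    using r1(2) r(3) that unfolding E_def by blast
  define B where "B = ball a r - closed_segment a b"
  define X where "X = \<Union>(fan a K) \<inter> B"
  have fT: "L \<in> T \<and> a \<in> L" if "L \<in> fan a K" for L using fan_mem[OF K(1) aK that] .
  have connB: "connected B" unfolding B_def by (rule ball_minus_radius_connected[OF ab r(1,2)])
  have fanclosed: "closed (\<Union>(fan a K))"
    using fT finite_T closed_T by (intro closed_Union) (auto intro: finite_subset)
  have cl: "closedin (top_of_set B) X"
    unfolding X_def using fanclosed by (metis Int_commute closedin_closed_Int)
  have hit: "interior L \<inter> B \<noteq> {}" if L: "L \<in> T" "a \<in> L" for L
  proof -
    have "a \<in> closure (interior L)" using tri_interior_nonempty[OF simplex_T[OF L(1)]] L(2) by simp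
    then have "interior L \<inter> ball a r \<noteq> {}"
      using open_Int_closure_eq_empty[OF open_ball, of a r "interior L"] r(1) by (metis Int_commute centre_in_ball disjoint_iff)
    moreover have "closed_segment a b \<inter> interior L = {}"
    proof (cases "L = K0")
      case True then show ?thesis using edge_disjoint_interior[OF simplex_T[OF e0(1)] e0(2)] by simp
    next
      case False then show ?thesis using interior_disjoint[OF L(1) e0(1)] edge_of_imp_subset[OF e0(2)] by blast
    qed
    ultimately show ?thesis unfolding B_def by blast
  qed
  have op: "openin (top_of_set B) X"
    unfolding openin_contains_ball
  proof (intro conjI ballI)
    show "X \<subseteq> B" unfolding X_def by blast
    fix x assume "x \<in> X"
    then obtain L where L: "L \<in> fan a K" "x \<in> L" "x \<in> B" unfolding X_def by blast
    note LT = fT[OF L(1)]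
    have xb: "x \<in> ball a r" using L(3) unfolding B_def by blast
    have xa: "x \<noteq> a" using L(3) unfolding B_def by auto
    have xO: "x \<in> \<Omega>"
    proof (rule ccontr)
      assume n: "x \<notin> \<Omega>"
      then have "x \<notin> interior L" using interior_subset_domain LT by blast
      then obtain e where e: "e edge_of L" "x \<in> e" using tri_boundary[OF simplex_T L(2)] LT by blast
      have ae: "a \<in> e" using rE[OF _ e xb] LT by blast
      have aL: "a extreme_point_of L" using vertex_of_all[OF K] LT by blast
      obtain b' c' where t: "tri a b' c' L" "e = closed_segment a b'"
        using edge_point_tri[OF simplex_T e(1) aL ae] LT by blast
      have "boundary_edge_of L e"
      proof (rule ccontr)
        assume "\<not> boundary_edge_of L e"
        then obtain L' where L': "L' \<in> T" "e edge_of L'" "L' \<noteq> L" unfolding boundary_edge_of_def using LT e by blast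
        then have ri: "rel_interior e \<subseteq> \<Omega>" using interior_edge(1)[OF _ e(1) L'(1,2)] LT by blast
        have "x \<noteq> b'"
        proof
          assume "x = b'"
          then have "x \<in> closed_segment b' c'" by simp
          moreover have "closed_segment b' c' edge_of L" using tri_edge_of[OF t(1)] by simp
          ultimately have "a \<in> closed_segment b' c'" using rE xb LT by blast
          then have "bary b' c' a a = 0" by (rule bary_segment_zero)
          then show False using tri_rot[OF t(1)] by (simp add: tri_def)
        qed
        then have "x \<in> open_segment a b'" using e(2) xa t(2) by (simp add: open_segment_def)
        then have "x \<in> rel_interior e" using t tri_distinct[OF t(1)] by (simp add: rel_interior_closed_segment)
        then show False using ri n by blast
      qed
      then have "e \<subseteq> closed_segment a b" using N[OF L(1) _ ae] by blast
      then show False using e(2) L(3) unfolding B_def by blast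
    qed
    obtain d where d: "d > 0" "ball x d \<subseteq> \<Omega>" "\<And>K. K \<in> T \<Longrightarrow> ball x d \<inter> K \<noteq> {} \<Longrightarrow> x \<in> K"
      using small_ball_domain[OF xO] by blast
    have "ball x d \<inter> B \<subseteq> X"
    proof
      fix y assume y: "y \<in> ball x d \<inter> B"
      then obtain L' where L': "L' \<in> T" "y \<in> L'" using d(2) domain_covered by blast
      then have xL': "x \<in> L'" using d(3)[OF L'(1)] y by blast
      have aL': "a \<in> L'" using rT[OF L'(1) xL' xb] .
      have "L' \<in> fan a K"
      proof (cases "L' = L")
        case False
        obtain f where "f edge_of L" "f edge_of L'" "x \<in> f" "a \<in> f"
          using triangles_share_edge[of L L' x a] LT L' False xL' aL' L(2) xa by blast
        then have "link a L L'" unfolding link_def using LT L' by blast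
        then show ?thesis using fan_step L(1) by blast
      qed (use L in simp)
      then show "y \<in> X" unfolding X_def using L' y by blast
    qed
    then show "\<exists>e>0. ball x e \<inter> B \<subseteq> X" using d(1) by blast
  qed
  have "interior K \<inter> B \<subseteq> X" unfolding X_def using fan_self interior_subset by blast
  then have "X \<noteq> {}" using hit[OF K(1) aK] by blast
  then have "X = B" using connB cl op unfolding connected_clopen by blast
  then have sub: "B \<subseteq> \<Union>(fan a K)" unfolding X_def by blast
  obtain y where "y \<in> interior K'" "y \<in> B" using hit[OF K'] by blast
  then obtain L where L: "L \<in> fan a K" "y \<in> L" using sub by blast
  then have "interior K' \<inter> L \<noteq> {}" using \<open>y \<in> interior K'\<close> by blast
  then have "K' = L" using interior_disjoint[OF K'(1), of L] fT[OF L(1)] by blast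
  then show ?thesis using L(1) by simp
qed

text \<open>The contrapositive of \<open>fan_clopen\<close>, used twice: a slit along an arbitrary
  edge at \<open>a\<close> yields \<open>e1\<close>, and a slit along \<open>e1\<close> itself
  yields an \<open>e2\<close> not contained in it.\<close>

lemma fan_two_boundary_edges:
  assumes K: "K \<in> T" "a extreme_point_of K" and K': "K' \<in> T" "a \<in> K'" "K' \<notin> fan a K"
  obtains K1 e1 K2 e2 where "K1 \<in> fan a K" "K2 \<in> fan a K" "boundary_edge_of K1 e1" "boundary_edge_of K2 e2"
    "a \<in> e1" "a \<in> e2" "e1 \<noteq> e2"
proof -
  have edge_form: "\<exists>b. a \<noteq> b \<and> e = closed_segment a b" if L: "L \<in> T" "e edge_of L" "a \<in> e" for L e
  proof -
    have "a \<in> L" using L edge_of_imp_subset by blast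
    then have "a extreme_point_of L" using vertex_of_all[OF K L(1)] by blast
    then obtain b c where "tri a b c L" "e = closed_segment a b"
      using edge_point_tri[OF simplex_T[OF L(1)] L(2) _ L(3)] by blast
    then show ?thesis using tri_distinct by blast
  qed
  obtain p q s where t: "tri p q s K" using simplex_2_tri[OF simplex_T[OF K(1)]] .
  have "a \<in> {p, q, s}" using tri_extreme_point[OF t] K(2) by blast
  then obtain e where e: "e edge_of K" "a \<in> e"
    using tri_edge_of[OF t] by (metis ends_in_segment insertCI insertE singletonD)
  obtain b where b: "a \<noteq> b" "e = closed_segment a b" using edge_form[OF K(1) e] by blast
  obtain K1 e1 where 1: "K1 \<in> fan a K" "boundary_edge_of K1 e1" "a \<in> e1"
    using fan_clopen[OF K b(1) K(1) _ _ K'(1,2)] K'(3) e b by blast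
  obtain b1 where b1: "a \<noteq> b1" "e1 = closed_segment a b1"
    using edge_form[of K1 e1] 1 unfolding boundary_edge_of_def by blast
  have K1: "K1 \<in> T" "closed_segment a b1 edge_of K1" using 1 b1 unfolding boundary_edge_of_def by auto
  obtain K2 e2 where 2: "K2 \<in> fan a K" "boundary_edge_of K2 e2" "a \<in> e2" "\<not> e2 \<subseteq> closed_segment a b1"
    using fan_clopen[OF K b1(1) K1 _ K'(1,2)] K'(3) by blast
  then have "e1 \<noteq> e2" using b1 by blast
  then show ?thesis using that 1 2 by blast
qed

text \<open>A second fan at \<open>a\<close> would bring boundary edges different from the two of
  the first one. Three segments of \<open>frontier \<Omega>\<close> would then issue from
  \<open>a\<close> and form a triod.\<close>

theorem star_connected:
  assumes K: "K \<in> T" "a extreme_point_of K" and K': "K' \<in> T" "a \<in> K'"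
  shows "(link a)\<^sup>*\<^sup>* K K'"
proof (rule ccontr)
  assume "\<not> (link a)\<^sup>*\<^sup>* K K'"
  then have n: "K' \<notin> fan a K" by (simp add: fan_def)
  have aK: "a \<in> K" using K(2) unfolding extreme_point_of_def by blast
  have aK': "a extreme_point_of K'" using vertex_of_all[OF K K'] .
  have n': "K \<notin> fan a K'" using n fan_sym[OF fan_self] by blast
  obtain K1 e1 K2 e2 where 1: "K1 \<in> fan a K" "K2 \<in> fan a K" "boundary_edge_of K1 e1" "boundary_edge_of K2 e2"
    "a \<in> e1" "a \<in> e2" "e1 \<noteq> e2" by (rule fan_two_boundary_edges[OF K K' n])
  obtain K3 e3 K4 e4 where 34: "K3 \<in> fan a K'" "K4 \<in> fan a K'" "boundary_edge_of K3 e3" "boundary_edge_of K4 e4"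
    "a \<in> e3" "a \<in> e4" "e3 \<noteq> e4" by (rule fan_two_boundary_edges[OF K'(1) aK' K(1) aK n'])
  note 3 = 34(1,3,5)
  have dis: "e3 \<noteq> e" if "L \<in> fan a K" "boundary_edge_of L e" for L e
  proof
    assume "e3 = e"
    then have "L = K3" using that 3 unfolding boundary_edge_of_def by blast
    then have "K' \<in> fan a K" using fan_sym[OF that(1), of K'] 3(1) by blast
    then show False using n by blast
  qed
  define e where "e = (\<lambda>i::nat. if i = 0 then e1 else if i = 1 then e2 else e3)"
  define L where "L = (\<lambda>i::nat. if i = 0 then K1 else if i = 1 then K2 else K3)"
  have e: "boundary_edge_of (L i) (e i)" "a \<in> e i" for i using 1 3 by (auto simp: e_def L_def)
  have ne: "e i \<noteq> e j" if "i < 3" "j < 3" "i \<noteq> j" for i j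
    using that 1 dis[OF 1(1,3)] dis[OF 1(2,4)] by (auto simp: e_def)
  have eL: "L i \<in> T" "e i edge_of L i" for i using e[of i] unfolding boundary_edge_of_def by auto
  have form: "\<exists>b. a \<noteq> b \<and> e i = closed_segment a b" for i
  proof -
    have "a \<in> L i" using e(2) eL edge_of_imp_subset by blast
    then have "a extreme_point_of L i" using vertex_of_all[OF K eL(1)] by blast
    then obtain b c where "tri a b c (L i)" "e i = closed_segment a b"
      using edge_point_tri[OF simplex_T[OF eL(1)] eL(2) _ e(2)] by blast
    then show ?thesis using tri_distinct by blast
  qed
  then obtain b where b: "\<And>i. a \<noteq> b i" "\<And>i. e i = closed_segment a (b i)" by metis
  obtain g where g: "simple_path g" "pathfinish g = pathstart g" "path_image g = frontier \<Omega>" using domain(8) by blast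
  have bd: "e i \<subseteq> frontier \<Omega>" for i
    using boundary_edge[OF eL] e(1)[of i] unfolding boundary_edge_of_def by blast
  show False
  proof (rule no_triod_in_simple_closed_curve[OF g(1,2), of a b])
    show "closed_segment a (b i) \<subseteq> path_image g" for i using bd b g(3) by simp
    show "b i \<noteq> a" for i using b(1)[of i] by simp
    fix i j :: nat assume ij: "i < 3" "j < 3" "i \<noteq> j"
    show "closed_segment a (b i) \<inter> closed_segment a (b j) \<subseteq> {a}"
    proof
      fix y assume y: "y \<in> closed_segment a (b i) \<inter> closed_segment a (b j)"
      show "y \<in> {a}"
      proof (rule ccontr)
        assume "y \<notin> {a}"
        then have ya: "y \<noteq> a" by simp
        have yi: "y \<in> e i" "y \<in> e j" using y b by auto
        have "e i edge_of L j"
          using edge_shared[OF eL(1)[of i] eL(2)[of i] eL(1)[of j], of y a] yi e(2) eL(2)[of j] edge_of_imp_subset ya by blast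
        then have "e i = e j" using edges_two_points[OF _ eL(2)[of j], where e = "e i" and x = y and y = a] yi e(2) ya by blast
        then show False using ne[OF ij] by blast
      qed
    qed
  qed
qed

text \<open>Triangles that meet have a common vertex, an extreme point of their intersection. Hence
  the triangles with value \<open>f K\<close> and the others would cover the connected set
  \<open>closure \<Omega>\<close> by two disjoint closed sets.\<close>

lemma vertex_connected:
  assumes step: "\<And>K K' a. K \<in> T \<Longrightarrow> K' \<in> T \<Longrightarrow> a extreme_point_of K \<Longrightarrow> a extreme_point_of K' \<Longrightarrow> f K = f K'"
    and K: "K \<in> T" "K' \<in> T"
  shows "f K = f K'"
proof (rule ccontr)
  assume ne: "f K \<noteq> f K'"
  define A where "A = \<Union>{L \<in> T. f L = f K}"
  define B where "B = \<Union>{L \<in> T. f L \<noteq> f K}"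
  have cl: "closed A" "closed B" unfolding A_def B_def using finite_T closed_T by (auto intro!: closed_Union)
  have un: "A \<union> B = closure \<Omega>" unfolding A_def B_def using cover by blast
  have dis: "A \<inter> B = {}"
  proof (rule ccontr)
    assume "A \<inter> B \<noteq> {}"
    then obtain L L' where L: "L \<in> T" "f L = f K" "L' \<in> T" "f L' \<noteq> f K" "L \<inter> L' \<noteq> {}"
      unfolding A_def B_def by blast
    obtain v where v: "v extreme_point_of (L \<inter> L')"
      using extreme_point_exists_convex[of "L \<inter> L'"] compact_T convex_T L
      by (metis compact_Int convex_Int)
    then have "v extreme_point_of L" "v extreme_point_of L'"
      using extreme_point_of_face face_T[OF L(1,3)] by blast+
    then show False using step[OF L(1,3)] L(2,4) by simp
  qed
  have ne2: "A \<noteq> {}" "B \<noteq> {}"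
    using K ne tri_interior_nonempty[OF simplex_T] interior_subset unfolding A_def B_def by (blast, force)
  have conn: "connected (closure \<Omega>)" using domain(4) connected_imp_connected_closure by blast
  have "closure \<Omega> \<subseteq> A \<union> B" "A \<inter> B \<inter> closure \<Omega> = {}" "A \<inter> closure \<Omega> \<noteq> {}" "B \<inter> closure \<Omega> \<noteq> {}"
    using un dis ne2 by auto
  then show False using conn cl unfolding connected_closed by metis
qed

text \<open>If \<open>P\<close> failed somewhere, the union \<open>X\<close> of the bad triangles
  would be open away from the vertices, because across every edge of a bad triangle lies another bad
  one. But the plane without finitely many points is connected, while \<open>X\<close> is closed and
  bounded.\<close>

lemma edge_path_to_boundary:
  assumes base: "\<And>K e. boundary_edge_of K e \<Longrightarrow> P K"
    and step: "\<And>K K' e. K \<in> T \<Longrightarrow> K' \<in> T \<Longrightarrow> K \<noteq> K' \<Longrightarrow> e edge_of K \<Longrightarrow> e edge_of K' \<Longrightarrow> P K' \<Longrightarrow> P K"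
    and K: "K \<in> T"
  shows "P K"
proof (rule ccontr)
  assume "\<not> P K"
  define Q where "Q = {L \<in> T. \<not> P L}"
  define X where "X = \<Union>Q"
  define V where "V = {v. \<exists>L\<in>T. v extreme_point_of L}"
  have finV: "finite V"
  proof -
    have "finite {v. v extreme_point_of L}" if L: "L \<in> T" for L
    proof -
      obtain a b c where t: "tri a b c L" using simplex_2_tri[OF simplex_T[OF L]] .
      have "{v. v extreme_point_of L} = {a, b, c}" using tri_extreme_point[OF t] by blast
      then show ?thesis by simp
    qed
    moreover have "V = (\<Union>L\<in>T. {v. v extreme_point_of L})" unfolding V_def by blast
    ultimately show ?thesis using finite_T by simp
  qed
  have conn: "connected (UNIV - V)"
    using connected_open_delete_finite[of "UNIV :: pt set" V] finV connected_UNIV by simp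
  have clX: "closed X" unfolding X_def Q_def using finite_T closed_T by (intro closed_Union) auto
  have boundX: "bounded X"
    unfolding X_def Q_def using finite_T compact_T compact_imp_bounded by (intro bounded_Union) auto
  have cl: "closedin (top_of_set (UNIV - V)) (X \<inter> (UNIV - V))"
    using clX by (metis Int_commute closedin_closed_Int)
  have op: "openin (top_of_set (UNIV - V)) (X \<inter> (UNIV - V))"
    unfolding openin_contains_ball
  proof (intro conjI ballI)
    fix x assume "x \<in> X \<inter> (UNIV - V)"
    then obtain L where L: "L \<in> T" "\<not> P L" "x \<in> L" "x \<notin> V" unfolding X_def Q_def by blast
    have "\<exists>d>0. ball x d \<subseteq> X"
    proof (cases "x \<in> interior L")
      case True
      then obtain d where "d > 0" "ball x d \<subseteq> L" using mem_interior by blast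
      then show ?thesis unfolding X_def Q_def using L by blast
    next
      case False
      then obtain e where e: "e edge_of L" "x \<in> e" using tri_boundary[OF simplex_T[OF L(1)] L(3)] by blast
      obtain L' where L': "L' \<in> T" "e edge_of L'" "L' \<noteq> L"
        using base[of L e] L(1,2) e(1) unfolding boundary_edge_of_def by blast
      then have nP': "\<not> P L'" using step[OF L(1) L'(1) _ e(1) L'(2)] L(2) by blast
      obtain a b where ab: "a \<noteq> b" "e = closed_segment a b" "a extreme_point_of L" "b extreme_point_of L"
        using edge_imp_segment[OF e(1) simplex_T[OF L(1)]] by blast
      then have "x \<noteq> a" "x \<noteq> b" using L(1,4) unfolding V_def by auto
      then have xr: "x \<in> rel_interior e" using e(2) ab(1,2) by (simp add: rel_interior_closed_segment open_segment_def)
      then have "x \<in> \<Omega>" using interior_edge(1)[OF L(1) e(1) L'(1,2)] L'(3) by blast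
      then obtain d where d: "d > 0" "ball x d \<subseteq> \<Omega>" "\<And>K. K \<in> T \<Longrightarrow> ball x d \<inter> K \<noteq> {} \<Longrightarrow> x \<in> K"
        using small_ball_domain by blast
      have "ball x d \<subseteq> X"
      proof
        fix y assume y: "y \<in> ball x d"
        then obtain M where M: "M \<in> T" "y \<in> M" using d(2) domain_covered by blast
        then have "x \<in> M" using d(3) y by blast
        then have "e edge_of M" using edge_point_rel_interior[OF L(1) e(1) xr M(1)] by blast
        then have "M = L \<or> M = L'" using interior_edge(3)[OF L(1) e(1) L'(1,2) _ M(1)] L'(3) by blast
        then show "y \<in> X" unfolding X_def Q_def using M L L' nP' by blast
      qed
      then show ?thesis using d(1) by blast
    qed
    then show "\<exists>e>0. ball x e \<inter> (UNIV - V) \<subseteq> X \<inter> (UNIV - V)" by blast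
  qed simp
  have "X \<inter> (UNIV - V) \<noteq> {}"
  proof
    assume "X \<inter> (UNIV - V) = {}"
    then have "K \<subseteq> V" unfolding X_def Q_def using K \<open>\<not> P K\<close> by blast
    then have "finite (interior K)" using finV interior_subset finite_subset by metis
    then show False using tri_interior_nonempty[OF simplex_T[OF K]] finite_imp_not_open open_interior by blast
  qed
  then have "X \<inter> (UNIV - V) = UNIV - V" using conn cl op unfolding connected_clopen by blast
  then have "UNIV \<subseteq> X \<union> V" by blast
  then have "bounded (UNIV :: pt set)" using boundX finV finite_imp_bounded bounded_Un bounded_subset by metis
  then show False by simp
qed

end

subsection \<open>Test functions and the fundamental lemma of the calculus of variations\<close>

text \<open>The powers in the denominator make the family closed under differentiation up to linear
  combinations, also at 0.\<close>

definition flat :: "nat \<Rightarrow> real \<Rightarrow> real" where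
  "flat m x = (if x > 0 then exp (- 1 / x) / x ^ m else 0)"

lemma flat_tendsto_0: "((\<lambda>h. exp (- 1 / h) / h ^ m) \<longlongrightarrow> (0::real)) (at_right 0)"
proof -
  have "((\<lambda>h. (inverse h) ^ m / exp (inverse h)) \<longlongrightarrow> (0::real)) (at_right 0)"
    by (rule filterlim_compose[OF tendsto_power_div_exp_0 filterlim_inverse_at_top_right])
  moreover have "eventually (\<lambda>h::real. (inverse h) ^ m / exp (inverse h) = exp (- 1 / h) / h ^ m) (at_right 0)"
    by (rule eventually_at_rightI[of 0 1]) (auto simp: exp_minus field_simps)
  ultimately show ?thesis by (rule Lim_transform_eventually)
qed

lemma flat_deriv: "(flat m has_real_derivative (flat (m + 2) x - real m * flat (m + 1) x)) (at x)"
proof -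
  consider "x > 0" | "x < 0" | "x = 0" by linarith
  then show ?thesis
  proof cases
    case 1
    have "((\<lambda>x. exp (- 1 / x) / x ^ m) has_real_derivative
       exp (- 1 / x) / x ^ (m + 2) - real m * (exp (- 1 / x) / x ^ (m + 1))) (at x)"
    proof (cases m)
      case 0
      then show ?thesis using 1 by (auto intro!: derivative_eq_intros simp: power2_eq_square)
    next
      case (Suc k)
      have "((\<lambda>x. exp (- 1 / x) / x ^ m) has_real_derivative
         ((exp (- 1 / x) * (1 / x ^ 2)) * x ^ m - exp (- 1 / x) * (real m * x ^ (m - 1))) / (x ^ m * x ^ m)) (at x)"
        using 1 by (auto intro!: derivative_eq_intros simp: power2_eq_square)
      moreover have "((exp (- 1 / x) * (1 / x ^ 2)) * x ^ m - exp (- 1 / x) * (real m * x ^ (m - 1))) / (x ^ m * x ^ m)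
         = exp (- 1 / x) / x ^ (m + 2) - real m * (exp (- 1 / x) / x ^ (m + 1))"
        using 1 Suc by (simp add: field_simps power_add power2_eq_square)
      ultimately show ?thesis by simp
    qed
    then have "(flat m has_real_derivative exp (- 1 / x) / x ^ (m + 2) - real m * (exp (- 1 / x) / x ^ (m + 1))) (at x)"
      by (rule has_field_derivative_transform_within_open[of _ _ _ "{0<..}"]) (use 1 in \<open>auto simp: flat_def\<close>)
    then show ?thesis using 1 by (simp add: flat_def)
  next
    case 2
    have "((\<lambda>x. 0) has_real_derivative 0) (at x)" by simp
    then have "(flat m has_real_derivative 0) (at x)"
      by (rule has_field_derivative_transform_within_open[of _ _ _ "{..<0}"]) (use 2 in \<open>auto simp: flat_def\<close>)
    then show ?thesis using 2 by (simp add: flat_def)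
  next
    case 3
    \<comment> \<open>To the right of 0 the difference quotient is \<open>flat (m + 1)\<close>,
      which tends to 0; to the left it vanishes.\<close>
    have "((\<lambda>y. (flat m y - flat m 0) / (y - 0)) \<longlongrightarrow> 0) (at 0)"
    proof (rule filterlim_split_at)
      have "eventually (\<lambda>y. 0 = (flat m y - flat m 0) / (y - 0)) (at_left 0)"
        by (rule eventually_at_leftI[of "-1"]) (auto simp: flat_def)
      then show "((\<lambda>y. (flat m y - flat m 0) / (y - 0)) \<longlongrightarrow> 0) (at_left 0)"
        by (rule Lim_transform_eventually[OF tendsto_const])
      have "eventually (\<lambda>y. exp (- 1 / y) / y ^ (m + 1) = (flat m y - flat m 0) / (y - 0)) (at_right 0)"
        by (rule eventually_at_rightI[of 0 1]) (auto simp: flat_def)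
      then show "((\<lambda>y. (flat m y - flat m 0) / (y - 0)) \<longlongrightarrow> 0) (at_right 0)"
        by (rule Lim_transform_eventually[OF flat_tendsto_0])
    qed
    then show ?thesis unfolding 3 has_field_derivative_iff by (simp add: flat_def)
  qed
qed

text \<open>Contains the bumps and is closed under differentiation, which yields derivatives of
  every order without a formula for them. Only \<open>p\<close> and \<open>m\<close> change, the
  inner polynomial \<open>q\<close> is fixed.\<close>

inductive_set flat_class :: "real poly \<Rightarrow> (real \<Rightarrow> real) set" for q where
  flat_base: "(\<lambda>x. poly p x * flat m (poly q x)) \<in> flat_class q"
| flat_add: "f \<in> flat_class q \<Longrightarrow> g \<in> flat_class q \<Longrightarrow> (\<lambda>x. f x + g x) \<in> flat_class q"

lemma flat_class_deriv:
  assumes "f \<in> flat_class q"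
  shows "\<exists>f'\<in>flat_class q. \<forall>x. (f has_real_derivative f' x) (at x)"
  using assms
proof induction
  case (flat_base p m)
  let ?f' = "\<lambda>x. poly (pderiv p) x * flat m (poly q x) +
    (poly (p * pderiv q) x * flat (m + 2) (poly q x) + poly (- Polynomial.smult (real m) (p * pderiv q)) x * flat (m + 1) (poly q x))"
  have f1: "?f' \<in> flat_class q" by (intro flat_class.intros)
  have f2: "((\<lambda>x. poly p x * flat m (poly q x)) has_real_derivative ?f' x) (at x)" for x
  proof -
    have "((\<lambda>x. flat m (poly q x)) has_real_derivative
       (flat (m + 2) (poly q x) - real m * flat (m + 1) (poly q x)) * poly (pderiv q) x) (at x)"
      by (rule DERIV_chain2[OF flat_deriv poly_DERIV])
    from DERIV_mult[OF poly_DERIV[of p] this]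
    show ?thesis by (rule DERIV_cong) (simp add: algebra_simps)
  qed
  show ?case by (rule bexI[OF _ f1]) (intro allI f2)
next
  case (flat_add f g)
  then obtain f' g' where "f' \<in> flat_class q" "\<forall>x. (f has_real_derivative f' x) (at x)"
    "g' \<in> flat_class q" "\<forall>x. (g has_real_derivative g' x) (at x)" by blast
  then show ?case
    by (intro bexI[of _ "\<lambda>x. f' x + g' x"]) (auto intro: DERIV_add flat_class.flat_add)
qed

lemma tensor_derivative:
  assumes "\<And>x. (f has_real_derivative f' x) (at x)" "\<And>x. (g has_real_derivative g' x) (at x)"
  shows "((\<lambda>x::pt. f (x $ 1) * g (x $ 2)) has_derivative
     (\<lambda>h. h $ 1 * (f' (x $ 1) * g (x $ 2)) + h $ 2 * (f (x $ 1) * g' (x $ 2)))) (at x)"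
proof -
  have c: "((\<lambda>x::pt. x $ i) has_derivative (\<lambda>x. x $ i)) (at x)" for i
    by (rule bounded_linear.has_derivative[OF bounded_linear_vec_nth]) (rule has_derivative_ident)
  have "((\<lambda>x::pt. f (x $ 1)) has_derivative (\<lambda>h. f' (x $ 1) * h $ 1)) (at x)"
    using diff_chain_at[OF c[of 1] assms(1)[unfolded has_field_derivative_def]] by (simp add: o_def)
  moreover have "((\<lambda>x::pt. g (x $ 2)) has_derivative (\<lambda>h. g' (x $ 2) * h $ 2)) (at x)"
    using diff_chain_at[OF c[of 2] assms(2)[unfolded has_field_derivative_def]] by (simp add: o_def)
  ultimately show ?thesis
    by (rule has_derivative_eq_rhs[OF has_derivative_mult]) (auto simp: algebra_simps)
qed

lemma pds_Nil [simp]: "pds [] f = f" and pds_Cons [simp]: "pds (i # \<alpha>) f = pd i (pds \<alpha> f)"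
  by (simp_all add: pds_def)

lemma pds_append: "pds (\<alpha> @ \<beta>) f = pds \<alpha> (pds \<beta> f)"
  by (induction \<alpha>) auto

lemma pds_tensor:
  assumes "f \<in> flat_class q1" "g \<in> flat_class q2"
  shows "\<exists>f'\<in>flat_class q1. \<exists>g'\<in>flat_class q2. pds \<alpha> (\<lambda>x. f (x $ 1) * g (x $ 2)) = (\<lambda>x. f' (x $ 1) * g' (x $ 2))"
proof (induction \<alpha>)
  case (Cons i \<alpha>)
  then obtain f1 g1 where fg: "f1 \<in> flat_class q1" "g1 \<in> flat_class q2"
    "pds \<alpha> (\<lambda>x. f (x $ 1) * g (x $ 2)) = (\<lambda>x. f1 (x $ 1) * g1 (x $ 2))" by blast
  obtain f' where f': "f' \<in> flat_class q1" "\<And>x. (f1 has_real_derivative f' x) (at x)"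
    using flat_class_deriv[OF fg(1)] by blast
  obtain g' where g': "g' \<in> flat_class q2" "\<And>x. (g1 has_real_derivative g' x) (at x)"
    using flat_class_deriv[OF fg(2)] by blast
  note d = tensor_derivative[of f1 f' g1 g', OF f'(2) g'(2)]
  show ?case
  proof (cases "i = 1")
    case True
    then have "pds (i # \<alpha>) (\<lambda>x. f (x $ 1) * g (x $ 2)) = (\<lambda>x. f' (x $ 1) * g1 (x $ 2))"
      using pd_eqI[OF d] by (auto simp: fg(3) axis_def)
    then show ?thesis using f' fg by blast
  next
    case False
    then have "i = 2" using exhaust_2[of i] by auto
    then have "pds (i # \<alpha>) (\<lambda>x. f (x $ 1) * g (x $ 2)) = (\<lambda>x. f1 (x $ 1) * g' (x $ 2))"
      using pd_eqI[OF d] by (auto simp: fg(3) axis_def)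
    then show ?thesis using g' fg by blast
  qed
qed (use assms in auto)

lemma test_fun_tensor:
  assumes fg: "f \<in> flat_class q1" "g \<in> flat_class q2"
    and supp: "\<And>x. f (x $ 1) * g (x $ 2) \<noteq> 0 \<Longrightarrow> x \<in> C" and C: "compact C" "C \<subseteq> U"
  shows "test_fun U (\<lambda>x. f (x $ 1) * g (x $ 2))"
  unfolding test_fun_def
proof (intro conjI allI)
  let ?\<phi> = "\<lambda>x::pt. f (x $ 1) * g (x $ 2)"
  fix \<alpha>
  obtain f1 g1 where 1: "f1 \<in> flat_class q1" "g1 \<in> flat_class q2" "pds \<alpha> ?\<phi> = (\<lambda>x. f1 (x $ 1) * g1 (x $ 2))"
    using pds_tensor[OF fg] by blast
  obtain f' where "\<And>x. (f1 has_real_derivative f' x) (at x)" using flat_class_deriv[OF 1(1)] by blast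
  moreover obtain g' where "\<And>x. (g1 has_real_derivative g' x) (at x)" using flat_class_deriv[OF 1(2)] by blast
  ultimately have "pds \<alpha> ?\<phi> differentiable at x" for x
    unfolding 1(3) using tensor_derivative[of f1 f' g1 g'] differentiableI by blast
  then show "pds \<alpha> ?\<phi> differentiable_on UNIV" by (simp add: differentiable_on_def)
next
  let ?\<phi> = "\<lambda>x::pt. f (x $ 1) * g (x $ 2)"
  have s: "closure {x. ?\<phi> x \<noteq> 0} \<subseteq> C"
    using supp compact_imp_closed[OF C(1)] by (intro closure_minimal) auto
  then show "closure {x. ?\<phi> x \<noteq> 0} \<subseteq> U" using C by blast
  have e: "C \<inter> closure {x. ?\<phi> x \<noteq> 0} = closure {x. ?\<phi> x \<noteq> 0}" using s by blast
  show "compact (closure {x. ?\<phi> x \<noteq> 0})"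
    using compact_Int_closed[OF C(1) closed_closure, of "{x. ?\<phi> x \<noteq> 0}"] by (simp only: e)
qed

lemma test_fun_support: "test_fun U \<phi> \<Longrightarrow> x \<notin> U \<Longrightarrow> \<phi> x = 0"
  using closure_subset[of "{x. \<phi> x \<noteq> 0}"] unfolding test_fun_def by auto

lemma test_fun_mono: "test_fun U \<phi> \<Longrightarrow> U \<subseteq> V \<Longrightarrow> test_fun V \<phi>"
  unfolding test_fun_def by blast

lemma test_fun_differentiable: "test_fun U \<phi> \<Longrightarrow> \<phi> differentiable at x"
  unfolding test_fun_def differentiable_on_def
  by (metis UNIV_I pds_Nil)

lemma test_fun_pd:
  assumes "test_fun U \<phi>"
  shows "test_fun U (pd i \<phi>)"
proof -
  have sub: "closure {x. pd i \<phi> x \<noteq> 0} \<subseteq> closure {x. \<phi> x \<noteq> 0}"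
  proof (rule closure_minimal)
    show "{x. pd i \<phi> x \<noteq> 0} \<subseteq> closure {x. \<phi> x \<noteq> 0}"
    proof (rule subsetI, rule ccontr)
      fix x assume x: "x \<in> {x. pd i \<phi> x \<noteq> 0}" "x \<notin> closure {x. \<phi> x \<noteq> 0}"
      have "((\<lambda>x. 0) has_derivative (\<lambda>h. 0)) (at x)" by simp
      then have "(\<phi> has_derivative (\<lambda>h. 0)) (at x)"
        by (rule has_derivative_transform_within_open[of _ _ _ _ "- closure {x. \<phi> x \<noteq> 0}"])
          (use x(2) closure_subset[of "{x. \<phi> x \<noteq> 0}"] in auto)
      then show False using x(1) pd_eqI by fastforce
    qed
  qed simp
  then have e: "closure {x. \<phi> x \<noteq> 0} \<inter> closure {x. pd i \<phi> x \<noteq> 0} = closure {x. pd i \<phi> x \<noteq> 0}" by blast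
  have "compact (closure {x. \<phi> x \<noteq> 0})" using assms unfolding test_fun_def by blast
  from compact_Int_closed[OF this closed_closure, of "{x. pd i \<phi> x \<noteq> 0}"]
  have "compact (closure {x. pd i \<phi> x \<noteq> 0})" by (simp only: e)
  moreover have "pds \<alpha> (pd i \<phi>) differentiable_on UNIV" for \<alpha>
  proof -
    have "pds (\<alpha> @ [i]) \<phi> differentiable_on UNIV" using assms unfolding test_fun_def by blast
    then show ?thesis by (simp add: pds_append)
  qed
  ultimately show ?thesis using sub assms unfolding test_fun_def by blast
qed

lemma test_fun_continuous: "test_fun U \<phi> \<Longrightarrow> continuous_on S \<phi>"
  by (meson continuous_at_imp_continuous_on differentiable_imp_continuous_within test_fun_differentiable)

lemma test_fun_C1: "test_fun U \<phi> \<Longrightarrow> C1 \<phi>"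
  unfolding C1_def using test_fun_differentiable test_fun_continuous[OF test_fun_pd] by blast

text \<open>For \<open>a < b\<close> positive exactly between \<open>a\<close> and \<open>b\<close>,
  and tending to the indicator of the open interval as \<open>k\<close> grows; \<open>Suc\<close>
  keeps the scaling factor positive.\<close>

definition bump :: "nat \<Rightarrow> real \<Rightarrow> real \<Rightarrow> real \<Rightarrow> real" where
  "bump k a b x = flat 0 (real (Suc k) * ((x - a) * (b - x)))"

lemma bump_flat_class: "\<exists>q. bump k a b \<in> flat_class q"
proof -
  let ?q = "Polynomial.smult (real (Suc k)) ([:- a, 1:] * [:b, - 1:])"
  have "bump k a b = (\<lambda>x. poly 1 x * flat 0 (poly ?q x))"
    by (auto simp: bump_def fun_eq_iff algebra_simps)
  then show ?thesis using flat_class.flat_base[of 1 0 ?q] by metis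
qed

lemma bump_nonzero: "bump k a b x \<noteq> 0 \<Longrightarrow> a < b \<Longrightarrow> a < x \<and> x < b"
  unfolding bump_def flat_def by (auto simp: zero_less_mult_iff split: if_splits)

lemma bump_bounds: "0 \<le> bump k a b x" "bump k a b x \<le> 1"
  by (auto simp: bump_def flat_def)

lemma bump_limit:
  assumes "a < b"
  shows "(\<lambda>k. bump k a b x) \<longlonglongrightarrow> (if a < x \<and> x < b then 1 else 0)"
proof (cases "a < x \<and> x < b")
  case True
  define c where "c = (x - a) * (b - x)"
  have c: "c > 0" using True by (simp add: c_def)
  have "bump k a b x = exp (- ((1 / c) * inverse (real (Suc k))))" for k
  proof -
    have "real (Suc k) * c > 0" using c by (intro mult_pos_pos) auto
    then show ?thesis unfolding bump_def c_def[symmetric] flat_def by (simp add: divide_simps mult.commute)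
  qed
  moreover have "(\<lambda>k. exp (- ((1 / c) * inverse (real (Suc k))))) \<longlonglongrightarrow> exp (- ((1 / c) * 0))"
    by (intro tendsto_intros LIMSEQ_inverse_real_of_nat)
  ultimately show ?thesis using True by simp
next
  case False
  then have "bump k a b x = 0" for k using bump_nonzero[OF _ assms] by blast
  then show ?thesis using False by auto
qed

lemma AE_lebesgue_on: "S \<in> sets lebesgue \<Longrightarrow> (AE x in lebesgue_on S. P x) \<longleftrightarrow> (AE x in lebesgue. x \<in> S \<longrightarrow> P x)"
  by (rule AE_restrict_space_iff) simp

lemma AE_negligible: "negligible N \<Longrightarrow> AE x in lebesgue. x \<notin> N"
  using AE_not_in negligible_iff_null_sets by blast

text \<open>Products of bumps are test functions with values in the unit interval that converge to
  the indicator of the box, so dominated convergence applies.\<close>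

lemma integral_box_zero:
  fixes h :: "pt \<Rightarrow> real"
  assumes U: "U \<in> sets lebesgue" and h: "integrable (lebesgue_on U) h"
    and z: "\<And>\<phi>. test_fun U \<phi> \<Longrightarrow> integral\<^sup>L (lebesgue_on U) (\<lambda>x. h x * \<phi> x) = 0"
    and ab: "cbox a b \<subseteq> U" "a $ 1 < b $ 1" "a $ 2 < b $ 2"
  shows "integral\<^sup>L lebesgue (\<lambda>x. indicator (box a b) x * (indicator U x * h x)) = 0"
proof -
  define \<phi> where "\<phi> = (\<lambda>k (x::pt). bump k (a $ 1) (b $ 1) (x $ 1) * bump k (a $ 2) (b $ 2) (x $ 2))"
  have supp: "x \<in> cbox a b" if "\<phi> k x \<noteq> 0" for k x
    using that bump_nonzero[OF _ ab(2)] bump_nonzero[OF _ ab(3)]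
    by (fastforce simp: \<phi>_def mem_box_cart forall_2 less_imp_le)
  have tf: "test_fun U (\<phi> k)" for k
  proof -
    obtain q1 q2 where "bump k (a $ 1) (b $ 1) \<in> flat_class q1" "bump k (a $ 2) (b $ 2) \<in> flat_class q2"
      using bump_flat_class by blast
    from test_fun_tensor[OF this _ compact_cbox ab(1)] supp show ?thesis unfolding \<phi>_def by blast
  qed
  let ?h = "\<lambda>x. indicator U x * h x"
  have hi: "integrable lebesgue ?h" using h U by (simp add: integrable_restrict_space)
  have m\<phi>: "\<phi> k \<in> borel_measurable lebesgue" for k
  proof -
    have "\<phi> k \<in> borel_measurable borel" using test_fun_continuous[OF tf] by (rule borel_measurable_continuous_onI)
    then show ?thesis by (simp add: measurable_completion)
  qed
  have lim: "(\<lambda>k. \<phi> k x) \<longlonglongrightarrow> indicator (box a b) x" for x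
  proof -
    have "(\<lambda>k. \<phi> k x) \<longlonglongrightarrow> (if a $ 1 < x $ 1 \<and> x $ 1 < b $ 1 then 1 else 0) * (if a $ 2 < x $ 2 \<and> x $ 2 < b $ 2 then 1 else 0)"
      unfolding \<phi>_def by (intro tendsto_mult bump_limit ab)
    also have "(if a $ 1 < x $ 1 \<and> x $ 1 < b $ 1 then 1 else 0) * (if a $ 2 < x $ 2 \<and> x $ 2 < b $ 2 then 1 else 0)
      = (indicator (box a b) x :: real)" by (auto simp: indicator_def mem_box_cart forall_2)
    finally show ?thesis .
  qed
  have "(\<lambda>k. integral\<^sup>L lebesgue (\<lambda>x. \<phi> k x * ?h x)) \<longlonglongrightarrow> integral\<^sup>L lebesgue (\<lambda>x. indicator (box a b) x * ?h x)"
  proof (rule integral_dominated_convergence[where w = "\<lambda>x. norm (?h x)"])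
    show "(\<lambda>x. indicat_real (box a b) x * ?h x) \<in> borel_measurable lebesgue"
      by (rule borel_measurable_times[OF borel_measurable_indicator borel_measurable_integrable[OF hi]]) simp
    show "(\<lambda>x. \<phi> k x * ?h x) \<in> borel_measurable lebesgue" for k
      by (rule borel_measurable_times[OF m\<phi> borel_measurable_integrable[OF hi]])
    show "integrable lebesgue (\<lambda>x. norm (?h x))" using hi by (rule integrable_norm)
    show "AE x in lebesgue. (\<lambda>k. \<phi> k x * ?h x) \<longlonglongrightarrow> indicator (box a b) x * ?h x"
      by (intro AE_I2 tendsto_mult_right lim)
    show "AE x in lebesgue. norm (\<phi> k x * ?h x) \<le> norm (?h x)" for k
    proof (rule AE_I2)
      fix x
      have "0 \<le> \<phi> k x" "\<phi> k x \<le> 1" unfolding \<phi>_def using bump_bounds by (auto intro: mult_le_one)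
      then have "\<bar>\<phi> k x\<bar> \<le> 1" by linarith
      from mult_right_mono[OF this abs_ge_zero, of "?h x"]
      show "norm (\<phi> k x * ?h x) \<le> norm (?h x)" by (simp add: abs_mult)
    qed
  qed
  moreover have "integral\<^sup>L lebesgue (\<lambda>x. \<phi> k x * ?h x) = 0" for k
  proof -
    have "integral\<^sup>L (lebesgue_on U) (\<lambda>x. h x * \<phi> k x) = integral\<^sup>L lebesgue (\<lambda>x. indicator U x *\<^sub>R (h x * \<phi> k x))"
      using U by (intro integral_restrict_space) simp
    then show ?thesis using z[OF tf[of k]] by (simp add: mult_ac)
  qed
  ultimately have "(\<lambda>k::nat. 0) \<longlonglongrightarrow> integral\<^sup>L lebesgue (\<lambda>x. indicator (box a b) x * ?h x)" by simp
  then show ?thesis by (simp only: LIMSEQ_const_iff)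
qed

text \<open>The integral vanishes over every box inside \<open>box c d\<close>. Boxes are stable
  under intersection and generate the Borel sets, so it vanishes over all Borel sets, and a density
  with this property is zero.\<close>

lemma AE_zero_box:
  fixes h :: "pt \<Rightarrow> real"
  assumes U: "U \<in> sets lebesgue" and h: "integrable (lebesgue_on U) h"
    and z: "\<And>\<phi>. test_fun U \<phi> \<Longrightarrow> integral\<^sup>L (lebesgue_on U) (\<lambda>x. h x * \<phi> x) = 0"
    and cd: "cbox c d \<subseteq> U"
  shows "AE x in lebesgue. x \<in> box c d \<longrightarrow> h x = 0"
proof -
  let ?H = "\<lambda>x. indicator (box c d) x * (indicator U x * h x)"
  have hi: "integrable lebesgue (\<lambda>x. indicator U x * h x)" using h U by (simp add: integrable_restrict_space)
  then have Hi: "integrable lebesgue ?H"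
    using integrable_mult_indicator[of "box c d" lebesgue "\<lambda>x. indicator U x * h x"] by simp
  obtain H' where H'1: "H' \<in> borel_measurable lborel" "AE x in lborel. ?H x = H' x"
    using completion_ex_borel_measurable_real[OF borel_measurable_integrable[OF Hi]] by blast
  note H' = H'1(1) AE_completion[OF H'1(2)]
  have H'm: "H' \<in> borel_measurable lebesgue" using H'(1) by (rule measurable_completion)
  have H'i: "integrable lborel H'"
  proof -
    have "integrable lebesgue H'"
      by (subst integrable_cong_AE[OF H'm borel_measurable_integrable[OF Hi]]) (use H'(2) Hi in \<open>auto elim: eventually_mono\<close>)
    then show ?thesis using integrable_completion[OF H'(1)] by simp
  qed
  have int: "set_lebesgue_integral lborel A H' = integral\<^sup>L lebesgue (\<lambda>x. indicator A x * ?H x)" if A: "A \<in> sets borel" for A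
  proof -
    have mA: "(\<lambda>x. indicator A x *\<^sub>R H' x) \<in> borel_measurable lborel" using A H'(1) by simp
    have "set_lebesgue_integral lborel A H' = integral\<^sup>L lebesgue (\<lambda>x. indicator A x *\<^sub>R H' x)"
      unfolding set_lebesgue_integral_def by (rule integral_completion[OF mA, symmetric])
    also have "\<dots> = integral\<^sup>L lebesgue (\<lambda>x. indicator A x * ?H x)"
    proof (rule integral_cong_AE)
      show "(\<lambda>x. indicator A x *\<^sub>R H' x) \<in> borel_measurable lebesgue" using mA by (rule measurable_completion)
      show "(\<lambda>x. indicator A x * ?H x) \<in> borel_measurable lebesgue"
        by (rule borel_measurable_times[OF borel_measurable_indicator borel_measurable_integrable[OF Hi]]) (use A in simp)
      show "AE x in lebesgue. indicator A x *\<^sub>R H' x = indicator A x * ?H x"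
        using H'(2) by (auto elim: eventually_mono)
    qed
    finally show ?thesis .
  qed
  have bx: "integral\<^sup>L lebesgue (\<lambda>x. indicator (box l u) x * ?H x) = 0" for l u
  proof -
    define a :: pt where "a = (\<chi> i. max (l $ i) (c $ i))"
    define b :: pt where "b = (\<chi> i. min (u $ i) (d $ i))"
    have "box l u \<inter> box c d = box a b"
      by (auto simp: a_def b_def mem_box_cart)
    then have e: "(\<lambda>x. indicator (box l u) x * ?H x) = (\<lambda>x. indicator (box a b) x * (indicator U x * h x))"
      by (auto simp: fun_eq_iff indicator_def)
    show ?thesis
    proof (cases "a $ 1 < b $ 1 \<and> a $ 2 < b $ 2")
      case True
      have sub: "cbox a b \<subseteq> cbox c d" by (auto simp: a_def b_def mem_box_cart)
      show ?thesis unfolding e by (rule integral_box_zero[OF U h z]) (use cd True sub in auto)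
    next
      case False
      then have "box a b = {}" using order.strict_trans by (fastforce simp: mem_box_cart forall_2)
      then show ?thesis unfolding e by simp
    qed
  qed
  have "set_lebesgue_integral lborel A H' = 0" if "A \<in> sets lborel" for A
  proof -
    let ?E = "range (\<lambda>(a, b). box a b :: pt set)"
    have A: "A \<in> sigma_sets UNIV ?E" using that by (simp add: borel_eq_box)
    have stab: "Int_stable ?E" by (auto simp: Int_stable_def box_Int_box)
    have bor: "sigma_sets UNIV ?E = sets borel" by (simp add: borel_eq_box)
    have all: "set_lebesgue_integral lborel UNIV H' = 0"
    proof -
      have "integral\<^sup>L lebesgue (\<lambda>x. indicator (box c d) x * ?H x) = integral\<^sup>L lebesgue (\<lambda>x. indicator UNIV x * ?H x)"
        by (rule arg_cong[where f = "integral\<^sup>L lebesgue"]) (auto simp: indicator_def)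
      then show ?thesis using int[of UNIV] bx[of c d] by simp
    qed
    have si: "set_integrable lborel B H'" if "B \<in> sets borel" for B
      unfolding set_integrable_def using H'i that by (intro integrable_mult_indicator) auto
    have sub: "?E \<subseteq> Pow UNIV" by simp
    from stab sub A show ?thesis
    proof (induction rule: sigma_sets_induct_disjoint)
      case (basic A) then show ?case using int bx by auto
    next
      case empty then show ?case by (simp add: set_lebesgue_integral_def)
    next
      case (compl A)
      then have Ab: "A \<in> sets borel" using bor by simp
      have "set_lebesgue_integral lborel (A \<union> (UNIV - A)) H' = set_lebesgue_integral lborel A H' + set_lebesgue_integral lborel (UNIV - A) H'"
        using Ab by (intro set_integral_Un si) auto
      then show ?case using all compl by simp
    next
      case (union A)
      then have Ab: "A i \<in> sets borel" for i using bor by auto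
      have "set_lebesgue_integral lborel (\<Union>i. A i) H' = (\<Sum>i. set_lebesgue_integral lborel (A i) H')"
        using union(1) Ab by (intro lebesgue_integral_countable_add si) (auto simp: disjoint_family_on_def)
      then show ?case using union(3) by simp
    qed
  qed
  then have "AE x in lborel. H' x = 0" by (intro sigma_finite_measure.density_zero[OF sigma_finite_lborel] H'i)
  then have "AE x in lebesgue. H' x = 0" by (rule AE_completion)
  then show ?thesis using H'(2)
    by eventually_elim (use cd box_subset_cbox[of c d] in \<open>auto simp: indicator_def split: if_splits\<close>)
qed

theorem fundamental_lemma:
  fixes h :: "pt \<Rightarrow> real"
  assumes U: "open U" and h: "integrable (lebesgue_on U) h"
    and z: "\<And>\<phi>. test_fun U \<phi> \<Longrightarrow> integral\<^sup>L (lebesgue_on U) (\<lambda>x. h x * \<phi> x) = 0"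
  shows "AE x in lebesgue. x \<in> U \<longrightarrow> h x = 0"
proof -
  have Us: "U \<in> sets lebesgue" using U by simp
  obtain D where D: "countable D" "D \<subseteq> Pow U" "\<And>X. X \<in> D \<Longrightarrow> \<exists>a b. X = cbox a b" "\<Union>D = U"
    using open_countable_Union_open_cbox[OF U] by metis
  have "AE x in lebesgue. x \<in> X \<longrightarrow> h x = 0" if X: "X \<in> D" for X
  proof -
    obtain a b where ab: "X = cbox a b" using D(3)[OF X] by blast
    have ab': "cbox a b \<subseteq> U" using D(2) X ab by blast
    have "AE x in lebesgue. x \<in> box a b \<longrightarrow> h x = 0"
      by (rule AE_zero_box[OF Us h z ab'])
    with AE_negligible[OF negligible_frontier_interval[of a b]]
    show ?thesis unfolding ab by eventually_elim blast
  qed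
  then have "AE x in lebesgue. \<forall>X\<in>D. x \<in> X \<longrightarrow> h x = 0" by (rule AE_ball_countable'[OF _ D(1)])
  then show ?thesis by eventually_elim (use D(4) in blast)
qed

subsection \<open>Piecewise defined functions and integration by parts\<close>

lemma L2_mult_integrable:
  fixes f g :: "pt \<Rightarrow> real"
  assumes "f \<in> L2_space S" "g \<in> L2_space S"
  shows "integrable (lebesgue_on S) (\<lambda>x. f x * g x)"
proof (rule Bochner_Integration.integrable_bound)
  show "integrable (lebesgue_on S) (\<lambda>x. (norm (f x))\<^sup>2 + (norm (g x))\<^sup>2)"
    using assms unfolding L2_space_def by auto
  show "(\<lambda>x. f x * g x) \<in> borel_measurable (lebesgue_on S)"
    using assms unfolding L2_space_def by (auto intro: borel_measurable_times)
  have "\<bar>a * b\<bar> \<le> a\<^sup>2 + b\<^sup>2" for a b :: real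
  proof -
    have "2 * (\<bar>a\<bar> * \<bar>b\<bar>) \<le> a\<^sup>2 + b\<^sup>2" using sum_squares_bound[of "\<bar>a\<bar>" "\<bar>b\<bar>"] by simp
    moreover have "0 \<le> \<bar>a\<bar> * \<bar>b\<bar>" by simp
    ultimately show ?thesis unfolding abs_mult by linarith
  qed
  then show "AE x in lebesgue_on S. norm (f x * g x) \<le> norm ((norm (f x))\<^sup>2 + (norm (g x))\<^sup>2)"
    by (intro AE_I2) simp
qed

lemma L2_diff:
  fixes f g :: "pt \<Rightarrow> real"
  assumes "f \<in> L2_space S" "g \<in> L2_space S"
  shows "(\<lambda>x. f x - g x) \<in> L2_space S"
proof -
  have m: "(\<lambda>x. f x - g x) \<in> borel_measurable (lebesgue_on S)"
    using assms unfolding L2_space_def by (auto intro: borel_measurable_diff)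
  have "integrable (lebesgue_on S) (\<lambda>x. (norm (f x - g x))\<^sup>2)"
  proof (rule Bochner_Integration.integrable_bound)
    show "integrable (lebesgue_on S) (\<lambda>x. 2 * (norm (f x))\<^sup>2 + 2 * (norm (g x))\<^sup>2)"
      using assms unfolding L2_space_def by auto
    show "(\<lambda>x. (norm (f x - g x))\<^sup>2) \<in> borel_measurable (lebesgue_on S)"
      using m by measurable
    have "(a - b)\<^sup>2 \<le> 2 * a\<^sup>2 + 2 * b\<^sup>2" for a b :: real
      using zero_le_power2[of "a + b"] by (simp add: power2_eq_square algebra_simps)
    then show "AE x in lebesgue_on S. norm ((norm (f x - g x))\<^sup>2) \<le> norm (2 * (norm (f x))\<^sup>2 + 2 * (norm (g x))\<^sup>2)"
      by (intro AE_I2) simp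
  qed
  then show ?thesis using m unfolding L2_space_def by blast
qed

locale oriented_mesh = polygon_mesh +
  fixes n t :: "pt set \<Rightarrow> pt"
  assumes normal: "\<And>K e. K \<in> T \<Longrightarrow> e edge_of K \<Longrightarrow> unit_normal e (n e)"
    and tangent: "\<And>K e. K \<in> T \<Longrightarrow> e edge_of K \<Longrightarrow> unit_tangent e (t e)"
begin

lemma domain_sets: "\<Omega> \<in> sets lebesgue"
  using domain(1) by simp

lemma T_sets: "K \<in> T \<Longrightarrow> K \<in> sets lebesgue"
  using compact_T lmeasurable_compact fmeasurableD by blast

text \<open>The frontier of a convex set is negligible. Interiors are preferred from here on because
  they are disjoint and lie in \<open>\<Omega>\<close>.\<close>

lemma AE_triangle:
  assumes "K \<in> T"
  shows "(AE x in lebesgue_on K. P x) \<longleftrightarrow> (AE x in lebesgue. x \<in> interior K \<longrightarrow> P x)"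
proof -
  have "AE x in lebesgue. x \<notin> frontier K"
    using AE_negligible negligible_convex_frontier convex_T[OF assms] by blast
  then have "(AE x in lebesgue. x \<in> K \<longrightarrow> P x) \<longleftrightarrow> (AE x in lebesgue. x \<in> interior K \<longrightarrow> P x)"
  proof (intro iffI)
    assume a: "AE x in lebesgue. x \<in> K \<longrightarrow> P x"
    then show "AE x in lebesgue. x \<in> interior K \<longrightarrow> P x"
      by eventually_elim (use interior_subset in blast)
  next
    assume f: "AE x in lebesgue. x \<notin> frontier K" and a: "AE x in lebesgue. x \<in> interior K \<longrightarrow> P x"
    from f a show "AE x in lebesgue. x \<in> K \<longrightarrow> P x"
      by eventually_elim (use closure_subset[of K] in \<open>auto simp: frontier_def\<close>)
  qed
  then show ?thesis using AE_lebesgue_on[OF T_sets[OF assms]] by simp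
qed

lemma AE_partition: "AE x in lebesgue. (x \<in> \<Omega> \<longrightarrow> (\<exists>K\<in>T. x \<in> interior K))"
proof -
  have "AE x in lebesgue. \<forall>K\<in>T. x \<notin> frontier K"
    using AE_negligible negligible_convex_frontier convex_T finite_T
    by (intro AE_ball_countable') (auto intro: countable_finite)
  then show ?thesis
    by eventually_elim (use domain_covered closure_subset in \<open>fastforce simp: frontier_def\<close>)
qed

lemma AE_domain: "(AE x in lebesgue_on \<Omega>. P x) \<longleftrightarrow> (\<forall>K\<in>T. AE x in lebesgue_on K. P x)"
proof
  assume "AE x in lebesgue_on \<Omega>. P x"
  then have "AE x in lebesgue. x \<in> \<Omega> \<longrightarrow> P x" using AE_lebesgue_on[OF domain_sets] by simp
  then have "AE x in lebesgue. x \<in> interior K \<longrightarrow> P x" if "K \<in> T" for K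
    by eventually_elim (use interior_subset_domain[OF that] in blast)
  then show "\<forall>K\<in>T. AE x in lebesgue_on K. P x" using AE_triangle by blast
next
  assume "\<forall>K\<in>T. AE x in lebesgue_on K. P x"
  then have "AE x in lebesgue. \<forall>K\<in>T. x \<in> interior K \<longrightarrow> P x"
    using AE_triangle finite_T by (intro AE_ball_countable') (auto intro: countable_finite)
  with AE_partition have "AE x in lebesgue. x \<in> \<Omega> \<longrightarrow> P x" by eventually_elim blast
  then show "AE x in lebesgue_on \<Omega>. P x" using AE_lebesgue_on[OF domain_sets] by simp
qed

text \<open>A global representative of piecewise data. At most one term is nonzero, as interiors are
  disjoint; edges and the exterior receive 0.\<close>

definition pw :: "(pt set \<Rightarrow> pt \<Rightarrow> 'a::real_vector) \<Rightarrow> pt \<Rightarrow> 'a" where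
  "pw p x = (\<Sum>K\<in>T. indicat_real (interior K) x *\<^sub>R p K x)"

lemma pw_interior:
  assumes "K \<in> T" "x \<in> interior K"
  shows "pw p x = p K x"
proof -
  have "indicat_real (interior L) x *\<^sub>R p L x = (if L = K then p K x else 0)" if "L \<in> T" for L
    using assms interior_disjoint[OF that assms(1)] interior_subset by (auto simp: indicator_def)
  then have "pw p x = (\<Sum>L\<in>T. if L = K then p K x else 0)" unfolding pw_def by (intro sum.cong) auto
  then show ?thesis using finite_T assms(1) by simp
qed

lemma pw_AE: "K \<in> T \<Longrightarrow> AE x in lebesgue_on K. pw p x = p K x"
  unfolding AE_triangle by (intro AE_I2 impI pw_interior)

lemma pw_measurable:
  assumes "\<And>K. K \<in> T \<Longrightarrow> continuous_on UNIV (p K)"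
  shows "(\<lambda>x. pw p x :: 'a::euclidean_space) \<in> borel_measurable lebesgue"
proof -
  have "(\<lambda>x. pw p x) \<in> borel_measurable borel"
    unfolding pw_def using assms
    by (intro borel_measurable_sum borel_measurable_scaleR borel_measurable_indicator borel_measurable_continuous_onI) auto
  then show ?thesis by (simp add: measurable_completion)
qed

lemma AE_pw:
  assumes "\<And>K. K \<in> T \<Longrightarrow> AE x in lebesgue_on K. v x = p K x"
  shows "AE x in lebesgue. pw p x = indicator \<Omega> x *\<^sub>R v x"
proof -
  have "AE x in lebesgue_on \<Omega>. v x = pw p x"
    unfolding AE_domain
  proof
    fix K assume "K \<in> T"
    from assms[OF this] pw_AE[OF this, of p] show "AE x in lebesgue_on K. v x = pw p x" by eventually_elim simp
  qed
  then have "AE x in lebesgue. x \<in> \<Omega> \<longrightarrow> v x = pw p x" unfolding AE_lebesgue_on[OF domain_sets] .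
  then show ?thesis
  proof eventually_elim
    fix x assume a: "x \<in> \<Omega> \<longrightarrow> v x = pw p x"
    show "pw p x = indicator \<Omega> x *\<^sub>R v x"
    proof (cases "x \<in> \<Omega>")
      case False
      then have "pw p x = 0" unfolding pw_def using interior_subset_domain by (intro sum.neutral) (auto simp: indicator_def)
      then show ?thesis using False by simp
    qed (use a in simp)
  qed
qed

text \<open>Almost everywhere on \<open>\<Omega>\<close> the function is \<open>pw F\<close>, a
  finite sum of functions continuous on compact triangles; its measurability is obtained in the same
  way.\<close>

lemma integral_piecewise:
  fixes f :: "pt \<Rightarrow> real"
  assumes F: "\<And>K. K \<in> T \<Longrightarrow> continuous_on UNIV (F K)" and fF: "\<And>K. K \<in> T \<Longrightarrow> AE x in lebesgue_on K. f x = F K x"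
  shows "integrable (lebesgue_on \<Omega>) f" "integral\<^sup>L (lebesgue_on \<Omega>) f = (\<Sum>K\<in>T. integral K (F K))"
proof -
  have FK: "integrable lebesgue (\<lambda>x. indicat_real (interior K) x *\<^sub>R F K x)"
    "integral\<^sup>L lebesgue (\<lambda>x. indicat_real (interior K) x *\<^sub>R F K x) = integral K (F K)" if K: "K \<in> T" for K
  proof -
    have i: "integrable (lebesgue_on K) (F K)"
      using integrable_lebesgue_on_compact[OF compact_T[OF K]] continuous_on_subset[OF F[OF K]] by blast
    then have j: "integrable lebesgue (\<lambda>x. indicat_real K x *\<^sub>R F K x)" using T_sets[OF K] by (simp add: integrable_restrict_space)
    have e: "(\<lambda>x. indicat_real (interior K) x *\<^sub>R (indicat_real K x *\<^sub>R F K x)) = (\<lambda>x. indicat_real (interior K) x *\<^sub>R F K x)"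
      using interior_subset[of K] by (auto simp: indicator_def fun_eq_iff)
    have "interior K \<in> sets lebesgue" by simp
    from integrable_mult_indicator[OF this j]
    show k: "integrable lebesgue (\<lambda>x. indicat_real (interior K) x *\<^sub>R F K x)" unfolding e .
    have "AE x in lebesgue. x \<notin> frontier K"
      using AE_negligible negligible_convex_frontier convex_T[OF K] by blast
    then have "AE x in lebesgue. indicat_real (interior K) x *\<^sub>R F K x = indicat_real K x *\<^sub>R F K x"
      by eventually_elim (use closure_subset[of K] interior_subset[of K] in \<open>auto simp: indicator_def frontier_def\<close>)
    then have "integral\<^sup>L lebesgue (\<lambda>x. indicat_real (interior K) x *\<^sub>R F K x) = integral\<^sup>L lebesgue (\<lambda>x. indicat_real K x *\<^sub>R F K x)"
      by (rule integral_cong_AE[OF borel_measurable_integrable[OF k] borel_measurable_integrable[OF j]])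
    also have "\<dots> = integral\<^sup>L (lebesgue_on K) (F K)" using T_sets[OF K] by (simp add: integral_restrict_space)
    also have "\<dots> = integral K (F K)" by (rule lebesgue_integral_eq_integral[OF i T_sets[OF K]])
    finally show "integral\<^sup>L lebesgue (\<lambda>x. indicat_real (interior K) x *\<^sub>R F K x) = integral K (F K)" .
  qed
  have pwi: "integrable lebesgue (pw F)" "integral\<^sup>L lebesgue (pw F) = (\<Sum>K\<in>T. integral K (F K))"
    unfolding pw_def[abs_def] using FK by (auto intro!: Bochner_Integration.integrable_sum)
  have ae: "AE x in lebesgue. pw F x = indicator \<Omega> x *\<^sub>R f x" by (rule AE_pw[OF fF])
  have m: "(\<lambda>x. indicator \<Omega> x *\<^sub>R f x) \<in> borel_measurable lebesgue"
    by (rule borel_measurable_AE[OF borel_measurable_integrable[OF pwi(1)] ae])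
  have ae2: "AE x in lebesgue. indicator \<Omega> x *\<^sub>R f x = pw F x"
    using ae by eventually_elim (rule sym)
  show "integrable (lebesgue_on \<Omega>) f"
    using integrable_cong_AE[OF m borel_measurable_integrable[OF pwi(1)] ae2] pwi(1) domain_sets
    by (simp add: integrable_restrict_space)
  show "integral\<^sup>L (lebesgue_on \<Omega>) f = (\<Sum>K\<in>T. integral K (F K))"
    using integral_cong_AE[OF m borel_measurable_integrable[OF pwi(1)] ae2] domain_sets pwi(2)
    by (simp add: integral_restrict_space)
qed

lemma L2_piecewise:
  fixes v :: "pt \<Rightarrow> 'a::euclidean_space"
  assumes p: "\<And>K. K \<in> T \<Longrightarrow> continuous_on UNIV (p K)" and vp: "\<And>K. K \<in> T \<Longrightarrow> AE x in lebesgue_on K. v x = p K x"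
  shows "v \<in> L2_space \<Omega>"
proof -
  have ae: "AE x in lebesgue. pw p x = indicator \<Omega> x *\<^sub>R v x" by (rule AE_pw[OF vp])
  have "(\<lambda>x. indicator \<Omega> x *\<^sub>R v x) \<in> borel_measurable lebesgue"
    by (rule borel_measurable_AE[OF pw_measurable[OF p] ae])
  then have m: "v \<in> borel_measurable (lebesgue_on \<Omega>)"
    using domain_sets by (simp add: borel_measurable_restrict_space_iff)
  have "integrable (lebesgue_on \<Omega>) (\<lambda>x. (norm (v x))\<^sup>2)"
  proof (rule integral_piecewise(1)[where F = "\<lambda>K x. (norm (p K x))\<^sup>2"])
    show "continuous_on UNIV (\<lambda>x. (norm (p K x))\<^sup>2)" if "K \<in> T" for K using p[OF that] by (intro continuous_intros)
    show "AE x in lebesgue_on K. (norm (v x))\<^sup>2 = (norm (p K x))\<^sup>2" if "K \<in> T" for K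
      using vp[OF that] by eventually_elim simp
  qed
  then show ?thesis using m unfolding L2_space_def by blast
qed

lemma L2_continuous: "continuous_on UNIV f \<Longrightarrow> (f :: pt \<Rightarrow> 'a::euclidean_space) \<in> L2_space \<Omega>"
  by (rule L2_piecewise[of "\<lambda>K. f"]) auto

lemma L2_integrable:
  fixes f :: "pt \<Rightarrow> real"
  assumes "f \<in> L2_space \<Omega>"
  shows "integrable (lebesgue_on \<Omega>) f"
  using L2_mult_integrable[OF assms L2_continuous[OF continuous_on_const[of _ 1]]] by simp

lemma L2_component: 
  fixes f :: "pt \<Rightarrow> 'a::euclidean_space ^ 'n"
  assumes "f \<in> L2_space \<Omega>"
  shows "(\<lambda>x. f x $ i) \<in> L2_space \<Omega>"
proof -
  have m: "(\<lambda>x. f x $ i) \<in> borel_measurable (lebesgue_on \<Omega>)"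
    using assms unfolding L2_space_def
    by (auto intro: borel_measurable_continuous_on[OF continuous_on_component])
  have "integrable (lebesgue_on \<Omega>) (\<lambda>x. (norm (f x $ i))\<^sup>2)"
  proof (rule Bochner_Integration.integrable_bound)
    show "integrable (lebesgue_on \<Omega>) (\<lambda>x. (norm (f x))\<^sup>2)" using assms unfolding L2_space_def by auto
    show "(\<lambda>x. (norm (f x $ i))\<^sup>2) \<in> borel_measurable (lebesgue_on \<Omega>)" using m by measurable
    show "AE x in lebesgue_on \<Omega>. norm ((norm (f x $ i))\<^sup>2) \<le> norm ((norm (f x))\<^sup>2)"
      by (intro AE_I2) (simp add: Finite_Cartesian_Product.norm_nth_le power_mono)
  qed
  then show ?thesis using m unfolding L2_space_def by blast
qed

lemma test_fun_frontier: "test_fun \<Omega> \<phi> \<Longrightarrow> x \<in> frontier \<Omega> \<Longrightarrow> \<phi> x = 0"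
  using test_fun_support domain(1) by (metis frontier_def DiffD2 interior_open)

text \<open>\<open>divergence_triangle\<close> is summed and the terms are sorted by edges. An edge
  of two triangles occurs twice, with opposite \<open>nu\<close> and, by \<open>nc\<close>, the same
  normal component; a boundary edge lies where \<open>\<phi>\<close> vanishes.\<close>

theorem integration_by_parts:
  assumes w: "\<And>K. K \<in> T \<Longrightarrow> C1 (w1 K) \<and> C1 (w2 K)"
    and nc: "\<And>K K' e x. K \<in> T \<Longrightarrow> K' \<in> T \<Longrightarrow> e edge_of K \<Longrightarrow> e edge_of K' \<Longrightarrow> x \<in> e \<Longrightarrow>
        w1 K x * n e $ 1 + w2 K x * n e $ 2 = w1 K' x * n e $ 1 + w2 K' x * n e $ 2"
    and \<phi>: "C1 \<phi>" "\<And>x. x \<in> frontier \<Omega> \<Longrightarrow> \<phi> x = 0"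
  shows "(\<Sum>K\<in>T. integral K (\<lambda>x. w1 K x * pd 1 \<phi> x + w2 K x * pd 2 \<phi> x + (pd 1 (w1 K) x + pd 2 (w2 K) x) * \<phi> x)) = 0"
proof -
  define I where "I = (\<lambda>K e. edge_inner e (\<lambda>x. (w1 K x * \<phi> x) * n e $ 1 + (w2 K x * \<phi> x) * n e $ 2) (\<lambda>x. 1))"
  have edge_ab: "\<exists>a b. a \<noteq> b \<and> e = closed_segment a b" if "K \<in> T" "e edge_of K" for K e
    using edge_imp_segment[OF that(2) simplex_T[OF that(1)]] by metis
  have Icong: "I K e = I K' e" if e: "K \<in> T" "e edge_of K" "K' \<in> T" "e edge_of K'" for K K' e
  proof -
    obtain a b where ab: "a \<noteq> b" "e = closed_segment a b" using edge_ab[OF e(1,2)] by blast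
    have "w1 K x * \<phi> x * n e $ 1 + w2 K x * \<phi> x * n e $ 2 = w1 K' x * \<phi> x * n e $ 1 + w2 K' x * \<phi> x * n e $ 2"
      if "x \<in> closed_segment a b" for x
    proof -
      have "\<phi> x * (w1 K x * n e $ 1 + w2 K x * n e $ 2) = \<phi> x * (w1 K' x * n e $ 1 + w2 K' x * n e $ 2)"
        using nc[OF e(1,3,2,4)] that ab(2) by simp
      then show ?thesis by (simp add: algebra_simps)
    qed
    then show ?thesis unfolding I_def ab(2) edge_inner_segment[OF ab(1)]
      by (intro arg_cong[where f = "\<lambda>z. dist a b * z"] line_int_cong) (simp add: ab(2))
  qed
  have Izero: "I K e = 0" if e: "K \<in> T" "e edge_of K" "e \<subseteq> frontier \<Omega>" for K e
  proof -
    obtain a b where ab: "a \<noteq> b" "e = closed_segment a b" using edge_ab[OF e(1,2)] by blast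
    have "I K e = dist a b * line_int a b (\<lambda>x. 0)"
      unfolding I_def ab(2) edge_inner_segment[OF ab(1)]
      by (intro arg_cong[where f = "\<lambda>z. dist a b * z"] line_int_cong) (use \<phi>(2) e(3) ab(2) in auto)
    then show ?thesis by (simp add: line_int_def)
  qed
  have div: "integral K (\<lambda>x. w1 K x * pd 1 \<phi> x + w2 K x * pd 2 \<phi> x + (pd 1 (w1 K) x + pd 2 (w2 K) x) * \<phi> x)
     = (\<Sum>e | e edge_of K. nu K e (n e) * I K e)" if K: "K \<in> T" for K
  proof -
    have c: "C1 (\<lambda>x. w1 K x * \<phi> x)" "C1 (\<lambda>x. w2 K x * \<phi> x)" using w[OF K] \<phi>(1) C1_mult by auto
    have "(\<lambda>x. w1 K x * pd 1 \<phi> x + w2 K x * pd 2 \<phi> x + (pd 1 (w1 K) x + pd 2 (w2 K) x) * \<phi> x)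
      = (\<lambda>x. pd 1 (\<lambda>x. w1 K x * \<phi> x) x + pd 2 (\<lambda>x. w2 K x * \<phi> x) x)"
      using w[OF K] \<phi>(1) by (auto simp: fun_eq_iff pd_mult C1_differentiable algebra_simps)
    then show ?thesis using divergence_triangle[OF simplex_T[OF K] c normal[OF K]] by (simp add: I_def)
  qed
  define E where "E = (\<Union>K\<in>T. {e. e edge_of K})"
  have finE: "finite E" unfolding E_def using finite_T finite_edges simplex_T by blast
  have "(\<Sum>K\<in>T. \<Sum>e | e edge_of K. nu K e (n e) * I K e) = (\<Sum>K\<in>T. \<Sum>e | e \<in> E \<and> e edge_of K. nu K e (n e) * I K e)"
    by (intro sum.cong refl) (auto simp: E_def)
  also have "\<dots> = (\<Sum>e\<in>E. \<Sum>K | K \<in> T \<and> e edge_of K. nu K e (n e) * I K e)"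
    by (rule sum.swap_restrict[OF finite_T finE])
  also have "\<dots> = 0"
  proof (rule sum.neutral, rule ballI)
    fix e assume "e \<in> E"
    then obtain K where K: "K \<in> T" "e edge_of K" unfolding E_def by blast
    show "(\<Sum>K | K \<in> T \<and> e edge_of K. nu K e (n e) * I K e) = 0"
    proof (cases "\<exists>K'\<in>T. e edge_of K' \<and> K' \<noteq> K")
      case True
      then obtain K' where K': "K' \<in> T" "e edge_of K'" "K \<noteq> K'" by blast
      have "{K \<in> T. e edge_of K} = {K, K'}"
        using interior_edge(3)[OF K K'] K K' by blast
      moreover have "nu K e (n e) = - nu K' e (n e)" using interior_edge(2)[OF K K' normal[OF K]] .
      moreover have "I K e = I K' e" using Icong[OF K K'(1,2)] .
      ultimately show ?thesis using K'(3) by simp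
    next
      case False
      then have "e \<subseteq> frontier \<Omega>" using boundary_edge[OF K] by blast
      then show ?thesis using Izero by (intro sum.neutral) auto
    qed
  qed
  finally show ?thesis using div by simp
qed

lemma integration_by_parts_local:
  assumes K: "K \<in> T" and w: "C1 w1" "C1 w2" and \<phi>: "test_fun (interior K) \<phi>"
  shows "integral K (\<lambda>x. w1 x * pd 1 \<phi> x + w2 x * pd 2 \<phi> x) = - integral K (\<lambda>x. (pd 1 w1 x + pd 2 w2 x) * \<phi> x)"
proof -
  have \<phi>1: "C1 \<phi>" using test_fun_C1[OF \<phi>] .
  have c: "C1 (\<lambda>x. w1 x * \<phi> x)" "C1 (\<lambda>x. w2 x * \<phi> x)" using w \<phi>1 C1_mult by auto
  have i: "f integrable_on K" if "continuous_on UNIV f" for f :: "pt \<Rightarrow> real"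
    using integrable_lborel_compact[OF compact_T[OF K]] continuous_on_subset[OF that]
      set_lebesgue_integral_eq_integral(1) by blast
  note cont = C1_continuous_on[OF w(1)] C1_continuous_on[OF w(2)] C1_continuous_on[OF \<phi>1]
    C1_continuous_pd[OF w(1)] C1_continuous_pd[OF w(2)] C1_continuous_pd[OF \<phi>1]
  have "integral K (\<lambda>x. w1 x * pd 1 \<phi> x + w2 x * pd 2 \<phi> x) + integral K (\<lambda>x. (pd 1 w1 x + pd 2 w2 x) * \<phi> x)
    = integral K (\<lambda>x. pd 1 (\<lambda>x. w1 x * \<phi> x) x + pd 2 (\<lambda>x. w2 x * \<phi> x) x)"
    using w \<phi>1 by (subst Henstock_Kurzweil_Integration.integral_add[symmetric])
      (auto intro!: i continuous_intros cont simp: pd_mult C1_differentiable algebra_simps)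
  also have "\<dots> = (\<Sum>e | e edge_of K. nu K e (n e) * edge_inner e (\<lambda>x. (w1 x * \<phi> x) * n e $ 1 + (w2 x * \<phi> x) * n e $ 2) (\<lambda>x. 1))"
    by (rule divergence_triangle[OF simplex_T[OF K] c normal[OF K]])
  also have "\<dots> = 0"
  proof (intro sum.neutral ballI)
    fix e assume "e \<in> {e. e edge_of K}"
    then have e: "e edge_of K" by simp
    obtain a b where ab: "a \<noteq> b" "e = closed_segment a b" using edge_imp_segment[OF e simplex_T[OF K]] by metis
    have "\<phi> x = 0" if "x \<in> e" for x
      using test_fun_support[OF \<phi>] edge_disjoint_interior[OF simplex_T[OF K] e] that by blast
    then have "line_int a b (\<lambda>x. (w1 x * \<phi> x * n e $ 1 + w2 x * \<phi> x * n e $ 2) * 1) = line_int a b (\<lambda>x. 0)"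
      by (intro line_int_cong) (simp add: ab(2))
    then have "edge_inner e (\<lambda>x. (w1 x * \<phi> x) * n e $ 1 + (w2 x * \<phi> x) * n e $ 2) (\<lambda>x. 1) = 0"
      unfolding ab(2) edge_inner_segment[OF ab(1)] by (simp add: line_int_def)
    then show "nu K e (n e) * edge_inner e (\<lambda>x. (w1 x * \<phi> x) * n e $ 1 + (w2 x * \<phi> x) * n e $ 2) (\<lambda>x. 1) = 0" by simp
  qed
  finally show ?thesis by linarith
qed

lemma integral_local:
  fixes f F :: "pt \<Rightarrow> real"
  assumes K: "K \<in> T" and F: "continuous_on UNIV F" and ae: "AE x in lebesgue_on K. f x = F x"
    and z: "\<And>x. x \<notin> interior K \<Longrightarrow> f x = 0" "\<And>x. x \<notin> interior K \<Longrightarrow> F x = 0"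
  shows "integral\<^sup>L (lebesgue_on \<Omega>) f = integral K F"
proof -
  have "integral\<^sup>L (lebesgue_on \<Omega>) f = (\<Sum>L\<in>T. integral L (if L = K then F else (\<lambda>x. 0)))"
  proof (rule integral_piecewise(2)[where F = "\<lambda>L. if L = K then F else (\<lambda>x. 0)"])
    fix L assume L: "L \<in> T"
    show "continuous_on UNIV (if L = K then F else (\<lambda>x. 0))" using F by simp
    show "AE x in lebesgue_on L. f x = (if L = K then F else (\<lambda>x. 0)) x"
    proof (cases "L = K")
      case False
      then have "f x = 0" if "x \<in> interior L" for x
        using z(1) interior_disjoint[OF K L] that interior_subset by blast
      then show ?thesis using False unfolding AE_triangle[OF L] by simp
    next
      case True
      show ?thesis unfolding True using ae by simp
    qed
  qed
  also have "\<dots> = (\<Sum>L\<in>T. if L = K then integral K F else 0)" by (intro sum.cong) auto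
  finally show ?thesis using finite_T K by simp
qed

lemma AE_zero_on_triangle:
  assumes K: "K \<in> T" and h: "h \<in> L2_space \<Omega>"
    and z: "\<And>\<phi>. test_fun (interior K) \<phi> \<Longrightarrow> integral\<^sup>L (lebesgue_on \<Omega>) (\<lambda>x. h x * \<phi> x) = 0"
  shows "AE x in lebesgue_on K. h x = (0::real)"
  unfolding AE_triangle[OF K]
proof (rule fundamental_lemma)
  let ?U = "interior K"
  have sub: "?U \<subseteq> \<Omega>" using interior_subset_domain[OF K] .
  have Us: "?U \<in> sets lebesgue" by simp
  show "open ?U" by simp
  have "integrable lebesgue (\<lambda>x. indicator \<Omega> x *\<^sub>R h x)"
    using L2_integrable[OF h] domain_sets by (simp add: integrable_restrict_space)
  from integrable_mult_indicator[OF Us this]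
  have i: "integrable lebesgue (\<lambda>x. indicator ?U x *\<^sub>R (indicator \<Omega> x *\<^sub>R h x))" .
  have e: "(\<lambda>x. indicat_real ?U x *\<^sub>R (indicat_real \<Omega> x *\<^sub>R h x)) = (\<lambda>x. indicator ?U x *\<^sub>R h x)"
    using sub by (auto simp: indicator_def fun_eq_iff)
  show "integrable (lebesgue_on ?U) h" using i Us unfolding e by (simp add: integrable_restrict_space)
  fix \<phi> assume \<phi>: "test_fun ?U \<phi>"
  have e: "(\<lambda>x. indicat_real ?U x *\<^sub>R (h x * \<phi> x)) = (\<lambda>x. indicator \<Omega> x *\<^sub>R (h x * \<phi> x))"
    using test_fun_support[OF \<phi>] sub by (auto simp: indicator_def fun_eq_iff)
  have "integral\<^sup>L (lebesgue_on ?U) (\<lambda>x. h x * \<phi> x) = integral\<^sup>L (lebesgue_on \<Omega>) (\<lambda>x. h x * \<phi> x)"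
    using arg_cong[OF e, of "integral\<^sup>L lebesgue"] Us domain_sets by (simp add: integral_restrict_space)
  then show "integral\<^sup>L (lebesgue_on ?U) (\<lambda>x. h x * \<phi> x) = 0" using z[OF \<phi>] by simp
qed

lemma AE_eq_on_triangle:
  assumes K: "K \<in> T" and g: "g \<in> L2_space \<Omega>" and q: "continuous_on UNIV q"
    and z: "\<And>\<phi>. test_fun (interior K) \<phi> \<Longrightarrow> integral\<^sup>L (lebesgue_on \<Omega>) (\<lambda>x. g x * \<phi> x) = integral K (\<lambda>x. q x * \<phi> x)"
  shows "AE x in lebesgue_on K. g x = (q x::real)"
proof -
  have "AE x in lebesgue_on K. g x - q x = 0"
  proof (rule AE_zero_on_triangle[OF K L2_diff[OF g L2_continuous[OF q]]])
    fix \<phi> assume \<phi>: "test_fun (interior K) \<phi>"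
    have \<phi>2: "\<phi> \<in> L2_space \<Omega>" using L2_continuous test_fun_continuous[OF \<phi>] by blast
    have "integral\<^sup>L (lebesgue_on \<Omega>) (\<lambda>x. (g x - q x) * \<phi> x) =
        integral\<^sup>L (lebesgue_on \<Omega>) (\<lambda>x. g x * \<phi> x) - integral\<^sup>L (lebesgue_on \<Omega>) (\<lambda>x. q x * \<phi> x)"
      using L2_mult_integrable[OF g \<phi>2] L2_mult_integrable[OF L2_continuous[OF q] \<phi>2]
      by (simp add: left_diff_distrib)
    also have "integral\<^sup>L (lebesgue_on \<Omega>) (\<lambda>x. q x * \<phi> x) = integral K (\<lambda>x. q x * \<phi> x)"
      using test_fun_support[OF \<phi>] by (intro integral_local[OF K])
        (auto intro!: continuous_intros q test_fun_continuous[OF \<phi>])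
    finally show "integral\<^sup>L (lebesgue_on \<Omega>) (\<lambda>x. (g x - q x) * \<phi> x) = 0" using z[OF \<phi>] by simp
  qed
  then show ?thesis by eventually_elim simp
qed

lemma pd_move:
  assumes K: "K \<in> T" and p: "C1 p" and \<phi>: "test_fun (interior K) \<phi>"
  shows "integral K (\<lambda>x. p x * pd i \<phi> x) = - integral K (\<lambda>x. pd i p x * \<phi> x)"
proof -
  have z: "C1 (\<lambda>x. 0)" by (rule C1_Pk[OF Pk_const])
  have "i = 1 \<or> i = 2" using exhaust_2 by blast
  then show ?thesis
    using integration_by_parts_local[OF K p z \<phi>] integration_by_parts_local[OF K z p \<phi>] by auto
qed

text \<open>Test functions supported inside \<open>K\<close> see only the polynomial
  \<open>p\<close>. Both derivatives move onto \<open>p\<close> without edge terms, and the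
  fundamental lemma identifies \<open>g\<close>.\<close>

lemma weak_deriv_on_triangle:
  assumes K: "K \<in> T" and p: "p \<in> Pk k UNIV" "AE x in lebesgue_on K. v x = p x" and g: "weak_deriv \<Omega> [i, j] v g"
  shows "AE x in lebesgue_on K. g x = pd i (pd j p) x"
proof (rule AE_eq_on_triangle[OF K])
  show "g \<in> L2_space \<Omega>" using g unfolding weak_deriv_def by blast
  have pj: "pd i p \<in> Pk (k - 1) UNIV" using Pk_pd[OF p(1)] .
  show "continuous_on UNIV (pd i (pd j p))" using Pk_continuous_on[OF Pk_pd[OF Pk_pd[OF p(1)]]] .
  fix \<phi> assume \<phi>: "test_fun (interior K) \<phi>"
  note \<phi>j = test_fun_pd[OF \<phi>] and \<phi>ij = test_fun_pd[OF test_fun_pd[OF \<phi>]]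
  have \<phi>\<Omega>: "test_fun \<Omega> \<phi>" using test_fun_mono[OF \<phi> interior_subset_domain[OF K]] .
  have "integral\<^sup>L (lebesgue_on \<Omega>) (\<lambda>x. g x * \<phi> x) = integral\<^sup>L (lebesgue_on \<Omega>) (\<lambda>x. v x * pd i (pd j \<phi>) x)"
    using g \<phi>\<Omega> unfolding weak_deriv_def by simp
  also have "\<dots> = integral K (\<lambda>x. p x * pd i (pd j \<phi>) x)"
  proof (rule integral_local[OF K])
    show "continuous_on UNIV (\<lambda>x. p x * pd i (pd j \<phi>) x)"
      by (intro continuous_intros Pk_continuous_on[OF p(1)] test_fun_continuous[OF \<phi>ij])
    show "AE x in lebesgue_on K. v x * pd i (pd j \<phi>) x = p x * pd i (pd j \<phi>) x"
      using p(2) by eventually_elim simp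
  qed (use test_fun_support[OF \<phi>ij] in auto)
  also have "\<dots> = - integral K (\<lambda>x. pd i p x * pd j \<phi> x)" by (rule pd_move[OF K C1_Pk[OF p(1)] \<phi>j])
  also have "\<dots> = integral K (\<lambda>x. pd j (pd i p) x * \<phi> x)"
    using pd_move[OF K C1_Pk[OF pj] \<phi>, of j] by simp
  finally show "integral\<^sup>L (lebesgue_on \<Omega>) (\<lambda>x. g x * \<phi> x) = integral K (\<lambda>x. pd i (pd j p) x * \<phi> x)"
    by (simp add: Pk_pd_commute[OF p(1), of i j])
qed

end

section \<open>Weak derivatives and weak divergence of piecewise polynomials\<close>

lemma div_field_nth: "div_field \<tau> x $ i = pd 1 (\<lambda>y. \<tau> y $ i $ 1) x + pd 2 (\<lambda>y. \<tau> y $ i $ 2) x"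
  by (simp add: div_field_def sum_2)

lemma Pk_entry: "\<sigma> \<in> Pk k D \<Longrightarrow> (\<lambda>x. \<sigma> x $ i $ j :: real) \<in> Pk k D"
  using Pk_vec_iff[of \<sigma>] Pk_vec_iff[of "\<lambda>x. \<sigma> x $ i"] by blast

lemma Pk_div_entry: "\<sigma> \<in> Pk k UNIV \<Longrightarrow> (\<lambda>x. div_field \<sigma> x $ i) \<in> Pk (k - 1) UNIV"
  unfolding div_field_nth by (intro Pk_add Pk_pd Pk_entry)

context oriented_mesh
begin

lemma integrable_triangle: "K \<in> T \<Longrightarrow> continuous_on UNIV f \<Longrightarrow> (f :: pt \<Rightarrow> real) integrable_on K"
  using integrable_lborel_compact[OF compact_T] continuous_on_subset[of UNIV f K]
    set_lebesgue_integral_eq_integral(1) by blast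

lemma sum_pd_move:
  assumes u: "\<And>K. K \<in> T \<Longrightarrow> C1 (u K)"
    and m: "\<And>K K' e x. K \<in> T \<Longrightarrow> K' \<in> T \<Longrightarrow> e edge_of K \<Longrightarrow> e edge_of K' \<Longrightarrow> x \<in> e \<Longrightarrow> u K x = u K' x"
    and \<phi>: "C1 \<phi>" "\<And>x. x \<in> frontier \<Omega> \<Longrightarrow> \<phi> x = 0"
  shows "(\<Sum>K\<in>T. integral K (\<lambda>x. u K x * pd i \<phi> x)) = - (\<Sum>K\<in>T. integral K (\<lambda>x. pd i (u K) x * \<phi> x))"
proof -
  have z: "C1 (\<lambda>x. 0)" by (rule C1_Pk[OF Pk_const])
  have "(\<Sum>K\<in>T. integral K (\<lambda>x. u K x * pd i \<phi> x + pd i (u K) x * \<phi> x)) = 0"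
  proof (cases "i = 1")
    case True
    have "(\<Sum>K\<in>T. integral K (\<lambda>x. u K x * pd 1 \<phi> x + 0 * pd 2 \<phi> x + (pd 1 (u K) x + pd 2 (\<lambda>x. 0) x) * \<phi> x)) = 0"
    proof (rule integration_by_parts[where ?w2.0 = "\<lambda>K x. 0"])
      show "C1 (u K) \<and> C1 (\<lambda>x. 0)" if "K \<in> T" for K using u[OF that] z by blast
      show "u K x * n e $ 1 + 0 * n e $ 2 = u K' x * n e $ 1 + 0 * n e $ 2"
        if "K \<in> T" "K' \<in> T" "e edge_of K" "e edge_of K'" "x \<in> e" for K K' e x
        using m[OF that] by simp
    qed (fact \<phi>)+
    then show ?thesis by (simp add: True)
  next
    case False
    then have i: "i = 2" using exhaust_2[of i] by auto
    have "(\<Sum>K\<in>T. integral K (\<lambda>x. 0 * pd 1 \<phi> x + u K x * pd 2 \<phi> x + (pd 1 (\<lambda>x. 0) x + pd 2 (u K) x) * \<phi> x)) = 0"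
    proof (rule integration_by_parts[where ?w1.0 = "\<lambda>K x. 0"])
      show "C1 (\<lambda>x. 0) \<and> C1 (u K)" if "K \<in> T" for K using u[OF that] z by blast
      show "0 * n e $ 1 + u K x * n e $ 2 = 0 * n e $ 1 + u K' x * n e $ 2"
        if "K \<in> T" "K' \<in> T" "e edge_of K" "e edge_of K'" "x \<in> e" for K K' e x
        using m[OF that] by simp
    qed (fact \<phi>)+
    then show ?thesis by (simp add: i)
  qed
  moreover have "integral K (\<lambda>x. u K x * pd i \<phi> x + pd i (u K) x * \<phi> x) =
      integral K (\<lambda>x. u K x * pd i \<phi> x) + integral K (\<lambda>x. pd i (u K) x * \<phi> x)" if K: "K \<in> T" for K
    by (intro Henstock_Kurzweil_Integration.integral_add integrable_triangle[OF K] continuous_intros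
      C1_continuous_on[OF u[OF K]] C1_continuous_pd[OF u[OF K]] C1_continuous_on[OF \<phi>(1)] C1_continuous_pd[OF \<phi>(1)])
  ultimately show ?thesis by (simp add: sum.distrib)
qed

text \<open>Two integrations by parts: the edge terms of the first cancel by the continuity of
  \<open>p\<close>, those of the second by the continuity of the gradient.\<close>

lemma weak_deriv_piecewise:
  assumes p: "\<And>K. K \<in> T \<Longrightarrow> p K \<in> Pk k UNIV"
    and m0: "\<And>K K' e x. K \<in> T \<Longrightarrow> K' \<in> T \<Longrightarrow> e edge_of K \<Longrightarrow> e edge_of K' \<Longrightarrow> x \<in> e \<Longrightarrow> p K x = p K' x"
    and m1: "\<And>K K' e x i. K \<in> T \<Longrightarrow> K' \<in> T \<Longrightarrow> e edge_of K \<Longrightarrow> e edge_of K' \<Longrightarrow> x \<in> e \<Longrightarrow> pd i (p K) x = pd i (p K') x"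
    and v: "\<And>K. K \<in> T \<Longrightarrow> AE x in lebesgue_on K. v x = p K x"
  shows "(\<And>K. K \<in> T \<Longrightarrow> AE x in lebesgue_on K. g x = pd i (pd j (p K)) x) \<Longrightarrow> weak_deriv \<Omega> [i, j] v g"
    and "v \<in> H2_space \<Omega>"
proof -
  have pc: "continuous_on UNIV (p K)" "continuous_on UNIV (pd i (p K))" "continuous_on UNIV (pd i (pd j (p K)))"
    if "K \<in> T" for K i j
    using Pk_continuous_on p[OF that] Pk_pd by blast+
  have v2: "v \<in> L2_space \<Omega>" by (rule L2_piecewise[OF pc(1) v])
  have gen: "integral\<^sup>L (lebesgue_on \<Omega>) (\<lambda>x. f x * \<phi> x) = (\<Sum>K\<in>T. integral K (\<lambda>x. F K x * \<phi> x))"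
    if F: "\<And>K. K \<in> T \<Longrightarrow> continuous_on UNIV (F K)" "\<And>K. K \<in> T \<Longrightarrow> AE x in lebesgue_on K. f x = F K x"
      and \<phi>: "continuous_on UNIV \<phi>" for f \<phi> :: "pt \<Rightarrow> real" and F
  proof (rule integral_piecewise(2)[where F = "\<lambda>K x. F K x * \<phi> x"])
    show "continuous_on UNIV (\<lambda>x. F K x * \<phi> x)" if "K \<in> T" for K using F(1)[OF that] \<phi> by (intro continuous_intros)
    show "AE x in lebesgue_on K. f x * \<phi> x = F K x * \<phi> x" if "K \<in> T" for K
      using F(2)[OF that] by eventually_elim simp
  qed
  have w1: "weak_deriv \<Omega> [i] v (pw (\<lambda>K. pd i (p K)))" for i
    unfolding weak_deriv_def
  proof (intro conjI allI impI)
    show "pw (\<lambda>K. pd i (p K)) \<in> L2_space \<Omega>"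
      by (rule L2_piecewise[where p = "\<lambda>K. pd i (p K)"]) (use pc pw_AE in auto)
    fix \<phi> assume \<phi>: "test_fun \<Omega> \<phi>"
    have "integral\<^sup>L (lebesgue_on \<Omega>) (\<lambda>x. v x * pd i \<phi> x) = (\<Sum>K\<in>T. integral K (\<lambda>x. p K x * pd i \<phi> x))"
      by (rule gen[OF pc(1) v test_fun_continuous[OF test_fun_pd[OF \<phi>]]])
    also have "\<dots> = - (\<Sum>K\<in>T. integral K (\<lambda>x. pd i (p K) x * \<phi> x))"
      by (rule sum_pd_move[OF C1_Pk[OF p] m0 test_fun_C1[OF \<phi>] test_fun_frontier[OF \<phi>]])
    also have "(\<Sum>K\<in>T. integral K (\<lambda>x. pd i (p K) x * \<phi> x)) = integral\<^sup>L (lebesgue_on \<Omega>) (\<lambda>x. pw (\<lambda>K. pd i (p K)) x * \<phi> x)"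
      by (rule gen[symmetric]) (use pc pw_AE test_fun_continuous[OF \<phi>] in auto)
    finally show "integral\<^sup>L (lebesgue_on \<Omega>) (\<lambda>x. v x * pds [i] \<phi> x) =
      (- 1) ^ length [i] * integral\<^sup>L (lebesgue_on \<Omega>) (\<lambda>x. pw (\<lambda>K. pd i (p K)) x * \<phi> x)" by simp
  qed (rule v2)
  have w2: "weak_deriv \<Omega> [i, j] v g" if g: "\<And>K. K \<in> T \<Longrightarrow> AE x in lebesgue_on K. g x = pd i (pd j (p K)) x" for i j g
    unfolding weak_deriv_def
  proof (intro conjI allI impI)
    show "g \<in> L2_space \<Omega>" by (rule L2_piecewise[OF pc(3) g])
    fix \<phi> assume \<phi>: "test_fun \<Omega> \<phi>"
    note \<phi>j = test_fun_pd[OF \<phi>, of j]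
    have "integral\<^sup>L (lebesgue_on \<Omega>) (\<lambda>x. v x * pd i (pd j \<phi>) x) = (\<Sum>K\<in>T. integral K (\<lambda>x. p K x * pd i (pd j \<phi>) x))"
      by (rule gen[OF pc(1) v test_fun_continuous[OF test_fun_pd[OF \<phi>j]]])
    also have "\<dots> = - (\<Sum>K\<in>T. integral K (\<lambda>x. pd i (p K) x * pd j \<phi> x))"
      by (rule sum_pd_move[OF C1_Pk[OF p] m0 test_fun_C1[OF \<phi>j] test_fun_frontier[OF \<phi>j]])
    also have "(\<Sum>K\<in>T. integral K (\<lambda>x. pd i (p K) x * pd j \<phi> x)) = - (\<Sum>K\<in>T. integral K (\<lambda>x. pd j (pd i (p K)) x * \<phi> x))"
      by (rule sum_pd_move[OF C1_Pk[OF Pk_pd[OF p]] m1 test_fun_C1[OF \<phi>] test_fun_frontier[OF \<phi>]])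
    also have "(\<Sum>K\<in>T. integral K (\<lambda>x. pd j (pd i (p K)) x * \<phi> x)) = (\<Sum>K\<in>T. integral K (\<lambda>x. pd i (pd j (p K)) x * \<phi> x))"
      by (intro sum.cong refl) (simp add: Pk_pd_commute[OF p, of _ j i])
    also have "\<dots> = integral\<^sup>L (lebesgue_on \<Omega>) (\<lambda>x. g x * \<phi> x)"
      by (rule gen[OF pc(3) g test_fun_continuous[OF \<phi>], symmetric])
    finally show "integral\<^sup>L (lebesgue_on \<Omega>) (\<lambda>x. v x * pds [i, j] \<phi> x) =
      (- 1) ^ length [i, j] * integral\<^sup>L (lebesgue_on \<Omega>) (\<lambda>x. g x * \<phi> x)" by simp
  qed (rule v2)
  show "(\<And>K. K \<in> T \<Longrightarrow> AE x in lebesgue_on K. g x = pd i (pd j (p K)) x) \<Longrightarrow> weak_deriv \<Omega> [i, j] v g"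
    by (rule w2)
  have "\<exists>g. weak_deriv \<Omega> \<alpha> v g" if \<alpha>: "length \<alpha> \<le> 2" for \<alpha>
  proof -
    consider "\<alpha> = []" | i where "\<alpha> = [i]" | i j where "\<alpha> = [i, j]"
      using \<alpha> by (cases \<alpha>; cases "tl \<alpha>"; cases "tl (tl \<alpha>)") auto
    then show ?thesis
    proof cases
      case 1
      have "weak_deriv \<Omega> [] v v" using v2 by (simp add: weak_deriv_def)
      then show ?thesis unfolding 1 by (intro exI[of _ v])
    next
      case 2 show ?thesis unfolding 2 by (rule exI, rule w1)
    next
      case (3 i j)
      show ?thesis unfolding 3 by (rule exI[of _ "pw (\<lambda>K. pd i (pd j (p K)))"], rule w2, rule pw_AE)
    qed
  qed
  then show "v \<in> H2_space \<Omega>" using v2 unfolding H2_space_def by blast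
qed

text \<open>Each row of \<open>\<sigma>\<close> is a vector field for
  \<open>integration_by_parts\<close>, and its normal component on \<open>e\<close> is the
  corresponding entry of the traction.\<close>

lemma weak_div_piecewise:
  assumes \<sigma>: "\<And>K. K \<in> T \<Longrightarrow> \<sigma> K \<in> Pk k UNIV"
    and m: "\<And>K K' e x. K \<in> T \<Longrightarrow> K' \<in> T \<Longrightarrow> e edge_of K \<Longrightarrow> e edge_of K' \<Longrightarrow> x \<in> e \<Longrightarrow> \<sigma> K x *v n e = \<sigma> K' x *v n e"
    and \<tau>: "\<tau> \<in> L2_space \<Omega>" "\<And>K. K \<in> T \<Longrightarrow> AE x in lebesgue_on K. \<tau> x = \<sigma> K x"
    and q: "q \<in> L2_space \<Omega>" "\<And>K. K \<in> T \<Longrightarrow> AE x in lebesgue_on K. q x = div_field (\<sigma> K) x"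
  shows "weak_div \<Omega> \<tau> q"
  unfolding weak_div_def
proof (intro conjI allI impI \<tau>(1) q(1))
  fix \<phi> i assume \<phi>: "test_fun \<Omega> \<phi>"
  have c: "C1 (\<lambda>x. \<sigma> K x $ i $ j)" if "K \<in> T" for K j using C1_Pk Pk_entry \<sigma>[OF that] by blast
  note cont = C1_continuous_on[OF c] C1_continuous_pd[OF c] test_fun_continuous[OF \<phi>] test_fun_continuous[OF test_fun_pd[OF \<phi>]]
  have A: "integral\<^sup>L (lebesgue_on \<Omega>) (\<lambda>x. \<Sum>j\<in>UNIV. \<tau> x $ i $ j * pd j \<phi> x) =
      (\<Sum>K\<in>T. integral K (\<lambda>x. \<sigma> K x $ i $ 1 * pd 1 \<phi> x + \<sigma> K x $ i $ 2 * pd 2 \<phi> x))"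
  proof (rule integral_piecewise(2))
    fix K assume K: "K \<in> T"
    show "continuous_on UNIV (\<lambda>x. \<sigma> K x $ i $ 1 * pd 1 \<phi> x + \<sigma> K x $ i $ 2 * pd 2 \<phi> x)"
      by (intro continuous_on_add continuous_on_mult cont K)
    show "AE x in lebesgue_on K. (\<Sum>j\<in>UNIV. \<tau> x $ i $ j * pd j \<phi> x) = \<sigma> K x $ i $ 1 * pd 1 \<phi> x + \<sigma> K x $ i $ 2 * pd 2 \<phi> x"
      using \<tau>(2)[OF K] by eventually_elim (simp add: sum_2)
  qed
  have B: "integral\<^sup>L (lebesgue_on \<Omega>) (\<lambda>x. q x $ i * \<phi> x) =
      (\<Sum>K\<in>T. integral K (\<lambda>x. (pd 1 (\<lambda>x. \<sigma> K x $ i $ 1) x + pd 2 (\<lambda>x. \<sigma> K x $ i $ 2) x) * \<phi> x))"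
  proof (rule integral_piecewise(2))
    fix K assume K: "K \<in> T"
    show "continuous_on UNIV (\<lambda>x. (pd 1 (\<lambda>x. \<sigma> K x $ i $ 1) x + pd 2 (\<lambda>x. \<sigma> K x $ i $ 2) x) * \<phi> x)"
      by (intro continuous_on_add continuous_on_mult cont K)
    show "AE x in lebesgue_on K. q x $ i * \<phi> x = (pd 1 (\<lambda>x. \<sigma> K x $ i $ 1) x + pd 2 (\<lambda>x. \<sigma> K x $ i $ 2) x) * \<phi> x"
      using q(2)[OF K] by eventually_elim (simp add: div_field_nth)
  qed
  have "(\<Sum>K\<in>T. integral K (\<lambda>x. \<sigma> K x $ i $ 1 * pd 1 \<phi> x + \<sigma> K x $ i $ 2 * pd 2 \<phi> x +
     (pd 1 (\<lambda>x. \<sigma> K x $ i $ 1) x + pd 2 (\<lambda>x. \<sigma> K x $ i $ 2) x) * \<phi> x)) = 0"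
  proof (rule integration_by_parts[where ?w1.0 = "\<lambda>K x. \<sigma> K x $ i $ 1" and ?w2.0 = "\<lambda>K x. \<sigma> K x $ i $ 2"])
    fix K K' e x assume a: "K \<in> T" "K' \<in> T" "e edge_of K" "e edge_of K'" "x \<in> e"
    have "(\<sigma> K x *v n e) $ i = (\<sigma> K' x *v n e) $ i" using m[OF a] by simp
    then show "\<sigma> K x $ i $ 1 * n e $ 1 + \<sigma> K x $ i $ 2 * n e $ 2 = \<sigma> K' x $ i $ 1 * n e $ 1 + \<sigma> K' x $ i $ 2 * n e $ 2"
      by (simp add: matrix_vector_mult_def sum_2)
  qed (use c test_fun_C1[OF \<phi>] test_fun_frontier[OF \<phi>] in auto)
  moreover have "integral K (\<lambda>x. \<sigma> K x $ i $ 1 * pd 1 \<phi> x + \<sigma> K x $ i $ 2 * pd 2 \<phi> x +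
     (pd 1 (\<lambda>x. \<sigma> K x $ i $ 1) x + pd 2 (\<lambda>x. \<sigma> K x $ i $ 2) x) * \<phi> x) =
     integral K (\<lambda>x. \<sigma> K x $ i $ 1 * pd 1 \<phi> x + \<sigma> K x $ i $ 2 * pd 2 \<phi> x) +
     integral K (\<lambda>x. (pd 1 (\<lambda>x. \<sigma> K x $ i $ 1) x + pd 2 (\<lambda>x. \<sigma> K x $ i $ 2) x) * \<phi> x)" if K: "K \<in> T" for K
    by (intro Henstock_Kurzweil_Integration.integral_add integrable_triangle[OF K] continuous_on_add continuous_on_mult cont K)
  ultimately show "integral\<^sup>L (lebesgue_on \<Omega>) (\<lambda>x. \<Sum>j\<in>UNIV. \<tau> x $ i $ j * pd j \<phi> x) =
     - integral\<^sup>L (lebesgue_on \<Omega>) (\<lambda>x. q x $ i * \<phi> x)"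
    unfolding A B by (simp add: sum.distrib)
qed

lemma weak_div_on_triangle:
  assumes K: "K \<in> T" and \<sigma>: "\<sigma> \<in> Pk k UNIV" "AE x in lebesgue_on K. \<tau> x = \<sigma> x" and w: "weak_div \<Omega> \<tau> q"
  shows "AE x in lebesgue_on K. q x = div_field \<sigma> x"
proof -
  have "AE x in lebesgue_on K. q x $ i = div_field \<sigma> x $ i" for i
  proof (rule AE_eq_on_triangle[OF K])
    show "(\<lambda>x. q x $ i) \<in> L2_space \<Omega>" using w L2_component unfolding weak_div_def by blast
    show "continuous_on UNIV (\<lambda>x. div_field \<sigma> x $ i)" using Pk_continuous_on[OF Pk_div_entry[OF \<sigma>(1)]] .
    fix \<phi> assume \<phi>: "test_fun (interior K) \<phi>"
    have \<phi>\<Omega>: "test_fun \<Omega> \<phi>" using test_fun_mono[OF \<phi> interior_subset_domain[OF K]] .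
    have c: "C1 (\<lambda>x. \<sigma> x $ i $ j)" for j using C1_Pk Pk_entry \<sigma> by blast
    note cont = C1_continuous_on[OF c] C1_continuous_pd[OF c] test_fun_continuous[OF \<phi>] test_fun_continuous[OF test_fun_pd[OF \<phi>]]
    have "integral\<^sup>L (lebesgue_on \<Omega>) (\<lambda>x. q x $ i * \<phi> x) = - integral\<^sup>L (lebesgue_on \<Omega>) (\<lambda>x. \<Sum>j\<in>UNIV. \<tau> x $ i $ j * pd j \<phi> x)"
      using w \<phi>\<Omega> unfolding weak_div_def by simp
    also have "integral\<^sup>L (lebesgue_on \<Omega>) (\<lambda>x. \<Sum>j\<in>UNIV. \<tau> x $ i $ j * pd j \<phi> x) =
      integral K (\<lambda>x. \<sigma> x $ i $ 1 * pd 1 \<phi> x + \<sigma> x $ i $ 2 * pd 2 \<phi> x)"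
    proof (rule integral_local[OF K])
      show "continuous_on UNIV (\<lambda>x. \<sigma> x $ i $ 1 * pd 1 \<phi> x + \<sigma> x $ i $ 2 * pd 2 \<phi> x)"
        by (intro continuous_on_add continuous_on_mult cont)
      show "AE x in lebesgue_on K. (\<Sum>j\<in>UNIV. \<tau> x $ i $ j * pd j \<phi> x) = \<sigma> x $ i $ 1 * pd 1 \<phi> x + \<sigma> x $ i $ 2 * pd 2 \<phi> x"
        using \<sigma>(2) by eventually_elim (simp add: sum_2)
    qed (use test_fun_support[OF test_fun_pd[OF \<phi>]] in auto)
    also have "\<dots> = - integral K (\<lambda>x. (pd 1 (\<lambda>x. \<sigma> x $ i $ 1) x + pd 2 (\<lambda>x. \<sigma> x $ i $ 2) x) * \<phi> x)"
      by (rule integration_by_parts_local[OF K c c \<phi>])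
    finally show "integral\<^sup>L (lebesgue_on \<Omega>) (\<lambda>x. q x $ i * \<phi> x) = integral K (\<lambda>x. div_field \<sigma> x $ i * \<phi> x)"
      by (simp add: div_field_nth)
  qed
  then have "AE x in lebesgue_on K. \<forall>i\<in>UNIV. q x $ i = div_field \<sigma> x $ i"
    by (intro AE_ball_countable') (auto intro: countable_finite)
  then show ?thesis by eventually_elim (simp add: vec_eq_iff)
qed

end

section \<open>Gluing of local potentials\<close>

context polygon_mesh
begin

text \<open>The increment \<open>g K z - g K x\<close> is the same for all triangles that contain
  both points, because the derivatives along shared edges agree. Near each point of
  \<open>\<Omega>\<close> this defines a local function, two of these differ by a constant, and
  \<open>section_on_homeomorphic\<close> glues them to \<open>F\<close>. Then \<open>F - g K\<close>
  is constant on the interior of \<open>K\<close>, and this constant is \<open>c K\<close>.\<close>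

theorem global_potential:
  assumes g: "\<And>K. K \<in> T \<Longrightarrow> C1 (g K)"
    and tan: "\<And>K K' e x a b. K \<in> T \<Longrightarrow> K' \<in> T \<Longrightarrow> e edge_of K \<Longrightarrow> e edge_of K' \<Longrightarrow> x \<in> e \<Longrightarrow> a \<in> e \<Longrightarrow> b \<in> e \<Longrightarrow>
      (b - a) $ 1 * pd 1 (g K) x + (b - a) $ 2 * pd 2 (g K) x = (b - a) $ 1 * pd 1 (g K') x + (b - a) $ 2 * pd 2 (g K') x"
  shows "\<exists>c. \<forall>K\<in>T. \<forall>K'\<in>T. \<forall>e x. e edge_of K \<longrightarrow> e edge_of K' \<longrightarrow> x \<in> e \<longrightarrow> g K x + c K = g K' x + c K'"
proof -
  have D: "g K y - g K x = g K' y - g K' x" if K: "K \<in> T" "K' \<in> T" and xy: "x \<in> K \<inter> K'" "y \<in> K \<inter> K'" for K K' x y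
  proof (cases "K = K' \<or> x = y")
    case False
    then obtain e where e: "e edge_of K" "e edge_of K'" "x \<in> e" "y \<in> e"
      using triangles_share_edge[OF K _ xy] by blast
    obtain a b where "e = closed_segment a b" using edge_imp_segment[OF e(1) simplex_T[OF K(1)]] by metis
    then have seg: "closed_segment x y \<subseteq> e" using e(3,4) by (simp add: subset_closed_segment)
    have "((\<lambda>s. g K (linepath x y s) - g K' (linepath x y s)) has_real_derivative 0) (at s within {0..1})" if s: "s \<in> {0..1}" for s
    proof -
      have le: "linepath x y s \<in> e" using seg linepath_in_path[OF s] by blast
      have "((\<lambda>s. g K (linepath x y s) - g K' (linepath x y s)) has_real_derivative
         ((y - x) $ 1 * pd 1 (g K) (linepath x y s) + (y - x) $ 2 * pd 2 (g K) (linepath x y s)) -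
         ((y - x) $ 1 * pd 1 (g K') (linepath x y s) + (y - x) $ 2 * pd 2 (g K') (linepath x y s))) (at s within {0..1})"
        by (intro DERIV_diff linepath_chain C1_differentiable g K)
      then show ?thesis using tan[OF K e(1,2) le e(3,4)] by simp
    qed
    then have "\<exists>c. \<forall>s\<in>{0..1}. g K (linepath x y s) - g K' (linepath x y s) = c"
      by (intro has_field_derivative_zero_constant) auto
    then have "g K (linepath x y 0) - g K' (linepath x y 0) = g K (linepath x y 1) - g K' (linepath x y 1)" by force
    then show ?thesis by (simp add: linepath_0' linepath_1')
  qed auto
  have "\<exists>r>0. ball x r \<subseteq> \<Omega> \<and> (\<forall>K\<in>T. ball x r \<inter> K \<noteq> {} \<longrightarrow> x \<in> K)" if "x \<in> \<Omega>" for x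
    by (rule small_ball_domain[OF that]) blast
  then obtain r where r: "\<And>x. x \<in> \<Omega> \<Longrightarrow> r x > 0 \<and> ball x (r x) \<subseteq> \<Omega>"
    and rK: "\<And>x K. x \<in> \<Omega> \<Longrightarrow> K \<in> T \<Longrightarrow> ball x (r x) \<inter> K \<noteq> {} \<Longrightarrow> x \<in> K" by metis
  \<comment> \<open>By \<open>D\<close> the choice of the triangle is immaterial.\<close>
  define f where "f = (\<lambda>x z. let K = (SOME K. K \<in> T \<and> x \<in> K \<and> z \<in> K) in g K z - g K x)"
  have f: "f x z = g K z - g K x" if K: "K \<in> T" "x \<in> K" "z \<in> K" for x z K
  proof -
    let ?L = "SOME K. K \<in> T \<and> x \<in> K \<and> z \<in> K"
    have "?L \<in> T \<and> x \<in> ?L \<and> z \<in> ?L" by (rule someI[of "\<lambda>K. K \<in> T \<and> x \<in> K \<and> z \<in> K" K]) (use K in blast)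
    then show ?thesis unfolding f_def Let_def using D[of ?L K x z] K by simp
  qed
  have fc: "\<exists>c. \<forall>z\<in>ball x (r x) \<inter> ball y (r y). f x z - f y z = c" if xy: "x \<in> \<Omega>" "y \<in> \<Omega>" for x y
  proof (cases "ball x (r x) \<inter> ball y (r y) = {}")
    case False
    then obtain z0 where z0: "z0 \<in> ball x (r x)" "z0 \<in> ball y (r y)" by blast
    obtain K0 where K0: "K0 \<in> T" "z0 \<in> K0" using r[OF xy(1)] z0(1) domain_covered by blast
    have K0xy: "x \<in> K0" "y \<in> K0" using rK[OF xy(1) K0(1)] rK[OF xy(2) K0(1)] z0 K0(2) by blast+
    have "f x z - f y z = g K0 y - g K0 x" if z: "z \<in> ball x (r x) \<inter> ball y (r y)" for z
    proof -
      obtain K where K: "K \<in> T" "z \<in> K" using r[OF xy(1)] z domain_covered by blast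
      have Kxy: "x \<in> K" "y \<in> K" using rK[OF xy(1) K(1)] rK[OF xy(2) K(1)] z K(2) by blast+
      have "f x z - f y z = g K y - g K x" using f[OF K(1) Kxy(1) K(2)] f[OF K(1) Kxy(2) K(2)] by simp
      then show ?thesis using D[OF K(1) K0(1), of x y] Kxy K0xy by simp
    qed
    then show ?thesis by blast
  qed auto
  have "\<exists>F. section_on f \<Omega> F"
    by (rule section_on_homeomorphic[OF domain(7) convex_ball open_ball domain(1,3) r fc])
  then obtain F where F: "section_on f \<Omega> F" by blast
  have Fg: "\<exists>\<delta>>0. \<exists>d. \<forall>K\<in>T. x \<in> K \<longrightarrow> (\<forall>z\<in>interior K \<inter> ball x \<delta>. F z - g K z = d - g K x)" if x: "x \<in> \<Omega>" for x
  proof -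
    obtain \<delta> d where d: "\<delta> > 0" "\<And>z. z \<in> \<Omega> \<Longrightarrow> z \<in> ball x \<delta> \<Longrightarrow> F z = f x z + d" using section_onD[OF F x] by blast
    have "F z - g K z = d - g K x" if K: "K \<in> T" "x \<in> K" "z \<in> interior K" "z \<in> ball x \<delta>" for K z
    proof -
      have "z \<in> \<Omega>" "z \<in> K" using interior_subset_domain[OF K(1)] interior_subset[of K] K(3) by blast+
      then show ?thesis using d(2)[of z] K(4) f[OF K(1,2), of z] by simp
    qed
    then show ?thesis using d(1) by blast
  qed
  have "\<exists>c. \<forall>z\<in>interior K. F z - g K z = c" if K: "K \<in> T" for K
  proof -
    have "(\<lambda>z. F z - g K z) constant_on interior K"
    proof (rule locally_constant_imp_constant)
      show "connected (interior K)" using convex_T[OF K] by (simp add: convex_connected)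
      fix x assume x: "x \<in> interior K"
      then have xO: "x \<in> \<Omega>" "x \<in> K" using interior_subset_domain[OF K] interior_subset by blast+
      obtain \<delta> d where d: "\<delta> > 0" "\<And>z. z \<in> interior K \<inter> ball x \<delta> \<Longrightarrow> F z - g K z = d - g K x"
        using Fg[OF xO(1)] K xO(2) by blast
      then show "\<exists>V. openin (top_of_set (interior K)) V \<and> x \<in> V \<and> (\<forall>z\<in>V. F z - g K z = F x - g K x)"
        using x d(2)[of x] by (intro exI[of _ "interior K \<inter> ball x \<delta>"]) auto
    qed
    then show ?thesis unfolding constant_on_def by auto
  qed
  then obtain c where c: "\<And>K z. K \<in> T \<Longrightarrow> z \<in> interior K \<Longrightarrow> F z - g K z = c K" by metis
  show ?thesis
  proof (intro exI[of _ c] ballI allI impI)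
    fix K K' e x assume a: "K \<in> T" "K' \<in> T" "e edge_of K" "e edge_of K'" "x \<in> e"
    show "g K x + c K = g K' x + c K'"
    proof (cases "K = K'")
      case False
      obtain p q where pq: "p \<noteq> q" "e = closed_segment p q" using edge_imp_segment[OF a(3) simplex_T[OF a(1)]] by metis
      have ri: "rel_interior e = open_segment p q" using pq by (simp add: rel_interior_closed_segment)
      have eK: "e \<subseteq> K" "e \<subseteq> K'" using a edge_of_imp_subset by blast+
      have "g K y + c K = g K' y + c K'" if y: "y \<in> open_segment p q" for y
      proof -
        have yO: "y \<in> \<Omega>" using interior_edge(1)[OF a(1,3,2,4) False] y ri by blast
        have yK: "y \<in> K" "y \<in> K'" using y eK pq(2) open_closed_segment by blast+
        obtain \<delta> d where d: "\<delta> > 0" "\<And>L z. L \<in> T \<Longrightarrow> y \<in> L \<Longrightarrow> z \<in> interior L \<inter> ball y \<delta> \<Longrightarrow> F z - g L z = d - g L y"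
          using Fg[OF yO] by blast
        have "c L = d - g L y" if L: "L \<in> T" "y \<in> L" for L
        proof -
          have "y \<in> closure (interior L)" using tri_interior_nonempty[OF simplex_T[OF L(1)]] L(2) by simp
          then obtain z where "z \<in> interior L" "dist z y < \<delta>" using d(1) unfolding closure_approachable by blast
          then show ?thesis using d(2)[OF L, of z] c[OF L(1), of z] by (simp add: dist_commute)
        qed
        then show ?thesis using a(1,2) yK by simp
      qed
      \<comment> \<open>End points of the edge may lie on the frontier, where \<open>F\<close> gives
        no information; they are reached by continuity.\<close>
      moreover have "closed {y. g K y + c K = g K' y + c K'}"
        by (intro closed_Collect_eq continuous_intros C1_continuous_on g a)
      ultimately have "closure (open_segment p q) \<subseteq> {y. g K y + c K = g K' y + c K'}"
        by (intro closure_minimal) auto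
      then show ?thesis using a(5) pq by auto
    qed simp
  qed
qed

end

subsection \<open>Unisolvence on an edge\<close>

lemma poly_expand3: "degree p \<le> 3 \<Longrightarrow> p = [:coeff p 0, coeff p 1, coeff p 2, coeff p 3:]"
  by (rule poly_eqI) (auto simp: coeff_pCons coeff_eq_0 numeral_eq_Suc split: nat.splits)

lemma poly_expand5: "degree p \<le> 5 \<Longrightarrow> p = [:coeff p 0, coeff p 1, coeff p 2, coeff p 3, coeff p 4, coeff p 5:]"
  by (rule poly_eqI) (auto simp: coeff_pCons coeff_eq_0 numeral_eq_Suc split: nat.splits)

text \<open>The data at 0 remove the three lowest coefficients, and the data at 1 are a regular
  system for the other three.\<close>

lemma hermite_quintic:
  fixes p :: "real poly"
  assumes d: "degree p \<le> 5" and z: "poly p 0 = 0" "poly (pderiv p) 0 = 0" "poly (pderiv (pderiv p)) 0 = 0"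
    "poly p 1 = 0" "poly (pderiv p) 1 = 0" "poly (pderiv (pderiv p)) 1 = 0"
  shows "p = 0"
proof -
  obtain c0 c1 c2 c3 c4 c5 where p: "p = [:c0, c1, c2, c3, c4, c5:]" using poly_expand5[OF d] by blast
  have "c0 = 0" "c1 = 0" "c2 = 0" "c3 + c4 + c5 = 0" "3 * c3 + 4 * c4 + 5 * c5 = 0" "6 * c3 + 12 * c4 + 20 * c5 = 0"
    using z unfolding p by (simp_all add: pderiv_pCons algebra_simps)
  then have "c0 = 0 \<and> c1 = 0 \<and> c2 = 0 \<and> c3 = 0 \<and> c4 = 0 \<and> c5 = 0" by linarith
  then show ?thesis unfolding p by simp
qed

lemma hermite_cubic:
  fixes p :: "real poly"
  assumes d: "degree p \<le> 3" and z: "poly p 0 = 0" "poly (pderiv p) 0 = 0" "poly p 1 = 0" "poly (pderiv p) 1 = 0"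
  shows "p = 0"
proof -
  obtain c0 c1 c2 c3 where p: "p = [:c0, c1, c2, c3:]" using poly_expand3[OF d] by blast
  have "c0 = 0" "c1 = 0" "c2 + c3 = 0" "2 * c2 + 3 * c3 = 0"
    using z unfolding p by (simp_all add: pderiv_pCons algebra_simps)
  then have "c0 = 0 \<and> c1 = 0 \<and> c2 = 0 \<and> c3 = 0" by linarith
  then show ?thesis unfolding p by simp
qed

lemma integral_pderiv: "integral {0..1} (poly (pderiv F)) = poly F 1 - poly F (0::real)"
proof (rule integral_unique, rule fundamental_theorem_of_calculus)
  show "(poly F has_vector_derivative poly (pderiv F) x) (at x within {0..1})" for x
    using poly_DERIV[of F x] has_field_derivative_at_within has_real_derivative_iff_has_vector_derivative by blast
qed simp

lemma integral_poly4: "integral {0..1} (poly [:a, b, c, d, e:]) = a + b / 2 + c / 3 + d / 4 + e / (5::real)"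
  using integral_pderiv[of "[:0, a, b / 2, c / 3, d / 4, e / 5:]"] by (simp add: pderiv_pCons)

lemma moments_cubic:
  fixes p :: "real poly"
  assumes d: "degree p \<le> 3" and z: "poly p 0 = 0" "poly p 1 = 0"
    "integral {0..1} (\<lambda>s. poly p s) = 0" "integral {0..1} (\<lambda>s. poly p s * s) = 0"
  shows "p = 0"
proof -
  obtain c0 c1 c2 c3 where p: "p = [:c0, c1, c2, c3:]" using poly_expand3[OF d] by blast
  have "p = [:c0, c1, c2, c3, 0:]" unfolding p by simp
  then have "integral {0..1} (poly p) = c0 + c1 / 2 + c2 / 3 + c3 / 4 + 0 / 5" using integral_poly4 by metis
  then have 1: "c0 + c1 / 2 + c2 / 3 + c3 / 4 = 0" using z(3) by simp
  have "(\<lambda>s. poly p s * s) = poly [:0, c0, c1, c2, c3:]" unfolding p by (auto simp: algebra_simps)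
  then have 2: "c0 / 2 + c1 / 3 + c2 / 4 + c3 / 5 = 0" using z(4) by (simp only: integral_poly4)
  have "c0 = 0" "c0 + c1 + c2 + c3 = 0" using z(1,2) unfolding p by (simp_all add: add.assoc)
  then have "c0 = 0 \<and> c1 = 0 \<and> c2 = 0 \<and> c3 = 0" using 1 2 by linarith
  then show ?thesis unfolding p by simp
qed

lemma moments_quadratic:
  fixes p :: "real poly"
  assumes d: "degree p \<le> 2" and z: "poly p 0 = 0" "poly p 1 = 0" "integral {0..1} (\<lambda>s. poly p s) = 0"
  shows "p = 0"
proof -
  obtain c0 c1 c2 c3 where p: "p = [:c0, c1, c2, c3:]" and "c3 = coeff p 3"
    using poly_expand3[of p] d by (metis le_trans numeral_le_iff semiring_norm(69) semiring_norm(71) semiring_norm(68) semiring_norm(72))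
  then have c3: "c3 = 0" using d by (simp add: coeff_eq_0)
  have "p = [:c0, c1, c2, c3, 0:]" unfolding p by simp
  then have "integral {0..1} (poly p) = c0 + c1 / 2 + c2 / 3 + c3 / 4 + 0 / 5" using integral_poly4 by metis
  then have 1: "c0 + c1 / 2 + c2 / 3 + c3 / 4 = 0" using z(3) by simp
  have "c0 = 0" "c0 + c1 + c2 + c3 = 0" using z(1,2) unfolding p by (simp_all add: add.assoc)
  then have "c0 = 0 \<and> c1 = 0 \<and> c2 = 0 \<and> c3 = 0" using 1 c3 by linarith
  then show ?thesis unfolding p by simp
qed

lemma poly_eq_on_interval:
  fixes p q :: "real poly"
  assumes "\<And>s. 0 \<le> s \<Longrightarrow> s \<le> 1 \<Longrightarrow> poly p s = poly q s"
  shows "p = q"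
proof (rule ccontr)
  assume "p \<noteq> q"
  then have "finite {s. poly (p - q) s = 0}" by (intro poly_roots_finite) simp
  moreover have "{0..1} \<subseteq> {s. poly (p - q) s = 0}" using assms by auto
  ultimately have "finite {0..1::real}" using finite_subset by blast
  then show False by (simp add: infinite_Icc)
qed

text \<open>Agrees with \<open>dir_deriv\<close> on differentiable functions, but as a combination
  of \<open>pd\<close> it inherits the polynomial lemmas directly.\<close>

definition dird :: "pt \<Rightarrow> (pt \<Rightarrow> real) \<Rightarrow> pt \<Rightarrow> real" where
  "dird u f x = u $ 1 * pd 1 f x + u $ 2 * pd 2 f x"

lemma dir_deriv_dird: "f differentiable at x \<Longrightarrow> dir_deriv w f x = dird w f x"
  unfolding dir_deriv_def dird_def by (rule frechet_derivative_pd)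

lemma Pk_dird: "f \<in> Pk k UNIV \<Longrightarrow> dird u f \<in> Pk (k - 1) UNIV"
  unfolding dird_def[abs_def] by (intro Pk_add Pk_cmult Pk_pd)

lemma Pk_line_poly:
  fixes f :: "pt \<Rightarrow> real"
  assumes f: "f \<in> Pk k UNIV"
  obtains P where "degree P \<le> k" "\<And>s. f (linepath a b s) = poly P s"
    "\<And>s. dird (b - a) f (linepath a b s) = poly (pderiv P) s"
proof -
  obtain P where P: "degree P \<le> k" "\<And>s. linepath a b s \<in> UNIV \<Longrightarrow> f (linepath a b s) = poly P s"
    by (rule Pk_linepath[OF f, of a b]) blast
  have "dird (b - a) f (linepath a b s) = poly (pderiv P) s" for s
  proof (rule DERIV_unique)
    show "((\<lambda>s. f (linepath a b s)) has_real_derivative dird (b - a) f (linepath a b s)) (at s)"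
      unfolding dird_def by (rule linepath_chain[OF Pk_differentiable[OF f]])
    have "(\<lambda>s. f (linepath a b s)) = poly P" using P(2) by auto
    then show "((\<lambda>s. f (linepath a b s)) has_real_derivative poly (pderiv P) s) (at s)" by (simp add: poly_DERIV)
  qed
  then show ?thesis using that P by simp
qed

lemma segment_linepathE:
  assumes "x \<in> closed_segment a b"
  obtains s where "0 \<le> s" "s \<le> 1" "x = linepath a b s"
  using assms unfolding closed_segment_def linepath_def by auto

lemma Pk_segment_poly:
  fixes f :: "pt \<Rightarrow> real"
  assumes "f \<in> Pk k (closed_segment a b)"
  obtains P where "degree P \<le> k" "\<And>s. 0 \<le> s \<Longrightarrow> s \<le> 1 \<Longrightarrow> f (linepath a b s) = poly P s"
  by (rule Pk_linepath[OF assms, of a b]) (auto simp: linepath_in_path)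

lemma orthogonal_zero:
  fixes g n u :: pt
  assumes "norm n = 1" "n \<bullet> u = 0" "u \<noteq> 0" "n \<bullet> g = 0" "u \<bullet> g = 0"
  shows "g = 0"
proof -
  have n1: "n $ 1 * n $ 1 + n $ 2 * n $ 2 = 1" using assms(1) by (simp add: norm_eq_1 inner_vec_def sum_2)
  have e: "n $ 1 * u $ 1 + n $ 2 * u $ 2 = 0" "n $ 1 * g $ 1 + n $ 2 * g $ 2 = 0" "u $ 1 * g $ 1 + u $ 2 * g $ 2 = 0"
    using assms by (simp_all add: inner_vec_def sum_2)
  define l m where "l = n $ 1 * u $ 2 - n $ 2 * u $ 1" and "m = n $ 1 * g $ 2 - n $ 2 * g $ 1"
  have u: "u $ 1 = - l * n $ 2" "u $ 2 = l * n $ 1" using n1 e(1) unfolding l_def by algebra+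
  have g: "g $ 1 = - m * n $ 2" "g $ 2 = m * n $ 1" using n1 e(2) unfolding m_def by algebra+
  have "l * m * (n $ 1 * n $ 1 + n $ 2 * n $ 2) = 0" using e(3) unfolding u g by (simp add: algebra_simps)
  then have "l = 0 \<or> m = 0" using n1 by simp
  moreover have "l \<noteq> 0" using assms(3) u by (auto simp: vec_eq_iff forall_2)
  ultimately show ?thesis using g by (simp add: vec_eq_iff forall_2)
qed

lemma unit_tangent_segment:
  assumes "unit_tangent (closed_segment a b) t" "a \<noteq> b"
  obtains \<kappa> where "\<kappa> \<noteq> 0" "t = \<kappa> *\<^sub>R (b - a)" "norm t = 1"
proof -
  obtain x y where xy: "x \<in> closed_segment a b" "y \<in> closed_segment a b" "x \<noteq> y" "t = sgn (y - x)"
    using assms(1) unfolding unit_tangent_def by blast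
  obtain r s where rs: "x = linepath a b r" "y = linepath a b s" using xy(1,2) segment_linepathE by metis
  have d: "y - x = (s - r) *\<^sub>R (b - a)" unfolding rs linepath_def by (simp add: algebra_simps)
  define N where "N = norm (y - x)"
  have "N \<noteq> 0" using xy(3) by (simp add: N_def)
  have "t = inverse N *\<^sub>R (y - x)" unfolding xy(4) N_def by (simp add: sgn_div_norm divide_inverse)
  then have t: "t = ((s - r) / N) *\<^sub>R (b - a)" unfolding d by (simp add: divide_inverse mult.commute)
  have "s - r \<noteq> 0" using d xy(3) by auto
  then have "(s - r) / N \<noteq> 0" using \<open>N \<noteq> 0\<close> by simp
  moreover have "norm t = 1" using xy(3) unfolding xy(4) norm_sgn by simp
  ultimately show ?thesis using t that by blast
qed

text \<open>The trace has six vanishing Hermite data, so \<open>q\<close> and its derivative along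
  the edge vanish. For the cubic normal derivative the end values come from the gradients and the
  end slopes from the second derivatives at the vertices.\<close>

lemma bell_edge:
  assumes q: "q \<in> Pk 5 UNIV" and n: "unit_normal (closed_segment a b) n" and ab: "a \<noteq> b"
    and nd: "dir_deriv n q \<in> Pk 3 (closed_segment a b)"
    and z: "\<And>y. y \<in> {a, b} \<Longrightarrow> q y = 0" "\<And>y i. y \<in> {a, b} \<Longrightarrow> pd i q y = 0"
      "\<And>y i j. y \<in> {a, b} \<Longrightarrow> pd i (pd j q) y = 0"
    and x: "x \<in> closed_segment a b"
  shows "q x = 0" "pd i q x = 0"
proof -
  let ?u = "b - a"
  have q4: "pd i q \<in> Pk 4 UNIV" for i using Pk_pd[OF q] by simp
  have ends: "linepath a b 0 = a" "linepath a b 1 = b" by (auto simp: linepath_def)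
  have dz: "dird w q y = 0" "dird w (dird w' q) y = 0" if "y \<in> {a, b}" for y w w'
  proof -
    show "dird w q y = 0" using z(2)[OF that] by (simp add: dird_def)
    have "pd i (dird w' q) y = w' $ 1 * pd i (pd 1 q) y + w' $ 2 * pd i (pd 2 q) y" for i
      unfolding dird_def[abs_def]
      by (subst pd_add) (auto simp: pd_cmult Pk_differentiable[OF q4] intro!: differentiable_mult)
    then show "dird w (dird w' q) y = 0" using z(3)[OF that] by (simp add: dird_def[of w])
  qed
  obtain P where P: "degree P \<le> 5" "\<And>s. q (linepath a b s) = poly P s" "\<And>s. dird ?u q (linepath a b s) = poly (pderiv P) s"
    by (rule Pk_line_poly[OF q, of a b]) blast
  have duq: "dird ?u q \<in> Pk 4 UNIV" using Pk_dird[OF q] by simp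
  obtain P1 where P1: "\<And>s. dird ?u q (linepath a b s) = poly P1 s" "\<And>s. dird ?u (dird ?u q) (linepath a b s) = poly (pderiv P1) s"
    by (rule Pk_line_poly[OF duq, of a b]) blast
  have "P1 = pderiv P" by (rule poly_eq_on_interval) (use P1 P in metis)
  then have P2: "dird ?u (dird ?u q) (linepath a b s) = poly (pderiv (pderiv P)) s" for s using P1 by simp
  have "P = 0"
    by (rule hermite_quintic[OF P(1)])
      (use P(2,3)[of 0] P(2,3)[of 1] P2[of 0] P2[of 1] z(1) dz in \<open>auto simp: ends\<close>)
  then have q0: "q (linepath a b s) = 0" and u0: "dird ?u q (linepath a b s) = 0" for s using P by auto
  \<comment> \<open>A priori of degree 4; agreement with the cubic \<open>M\<close> on the segment
    lowers the degree of \<open>N\<close>.\<close>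
  have dnq: "dird n q \<in> Pk 4 UNIV" using Pk_dird[OF q] by simp
  obtain N where N: "\<And>s. dird n q (linepath a b s) = poly N s" "\<And>s. dird ?u (dird n q) (linepath a b s) = poly (pderiv N) s"
    by (rule Pk_line_poly[OF dnq, of a b]) blast
  obtain M where M: "degree M \<le> 3" "\<And>s. 0 \<le> s \<Longrightarrow> s \<le> 1 \<Longrightarrow> dir_deriv n q (linepath a b s) = poly M s"
    by (rule Pk_segment_poly[OF nd]) blast
  have "N = M" by (rule poly_eq_on_interval) (use N M(2) dir_deriv_dird[OF Pk_differentiable[OF q]] in metis)
  then have dN: "degree N \<le> 3" using M by simp
  have "N = 0"
    by (rule hermite_cubic[OF dN]) (use N(1,2)[of 0] N(1,2)[of 1] dz in \<open>auto simp: ends\<close>)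
  then have n0: "dird n q (linepath a b s) = 0" for s using N by simp
  obtain s where s: "x = linepath a b s" using segment_linepathE[OF x] by metis
  show "q x = 0" unfolding s by (rule q0)
  have "vector [pd 1 q x, pd 2 q x] = (0 :: pt)"
    by (rule orthogonal_zero[OF unit_normal_segment[OF n]])
      (use n0[of s] u0[of s] ab in \<open>auto simp: s dird_def inner_vec_def sum_2\<close>)
  then show "pd i q x = 0" using exhaust_2[of i] by (auto simp: vec_eq_iff forall_2)
qed

lemma pd_zero_on_segment:
  assumes f: "f \<in> Pk k UNIV" and z: "\<And>x. x \<in> closed_segment a b \<Longrightarrow> f x = 0" and x: "x \<in> closed_segment a b"
  shows "dird (b - a) f x = (0::real)"
proof -
  obtain P where P: "\<And>s. f (linepath a b s) = poly P s" "\<And>s. dird (b - a) f (linepath a b s) = poly (pderiv P) s"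
    by (rule Pk_line_poly[OF f, of a b]) blast
  have "P = 0" by (rule poly_eq_on_interval) (use P(1) z linepath_in_path in \<open>metis atLeastAtMost_iff poly_0\<close>)
  then show ?thesis using P(2) segment_linepathE[OF x] by (metis pderiv_0 poly_0)
qed

text \<open>The parameter of \<open>linepath a b\<close> as a function of the point; it serves as
  the weight of the first moment along an edge.\<close>

definition aff :: "pt \<Rightarrow> pt \<Rightarrow> pt \<Rightarrow> real" where
  "aff a b x = ((x - a) \<bullet> (b - a)) / ((b - a) \<bullet> (b - a))"

lemma aff_linepath: "a \<noteq> b \<Longrightarrow> aff a b (linepath a b s) = s"
proof -
  assume "a \<noteq> b"
  have e: "linepath a b s - a = s *\<^sub>R (b - a)" by (simp add: linepath_def algebra_simps)
  show ?thesis unfolding aff_def e using \<open>a \<noteq> b\<close> by simp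
qed

lemma Pk_aff: "1 \<le> k \<Longrightarrow> aff a b \<in> Pk k D"
proof -
  assume k: "1 \<le> k"
  have "aff a b = (\<lambda>x. ((b - a) $ 1 / ((b - a) \<bullet> (b - a))) * x $ 1 + (((b - a) $ 2 / ((b - a) \<bullet> (b - a))) * x $ 2
      - (a \<bullet> (b - a)) / ((b - a) \<bullet> (b - a))))"
    by (auto simp: aff_def inner_vec_def sum_2 field_simps add_divide_distrib diff_divide_distrib)
  then show ?thesis by (simp only:) (intro Pk_add Pk_diff Pk_const Pk_cmult Pk_coord k)
qed

lemma traction_edge:
  assumes d: "d \<in> Pk 3 UNIV" and n: "unit_normal (closed_segment a b) n" and t: "unit_tangent (closed_segment a b) t"
    and ab: "a \<noteq> b"
    and td: "(\<lambda>x. t \<bullet> (d x *v n)) \<in> Pk 2 (closed_segment a b)"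
    and z: "d a *v n = 0" "d b *v n = 0"
    and mom: "line_int a b (\<lambda>x. (n \<bullet> (d x *v n)) * 1) = 0" "line_int a b (\<lambda>x. (n \<bullet> (d x *v n)) * aff a b x) = 0"
      "line_int a b (\<lambda>x. (t \<bullet> (d x *v n)) * 1) = 0"
    and x: "x \<in> closed_segment a b"
  shows "d x *v n = (0 :: pt)"
proof -
  have ends: "linepath a b 0 = a" "linepath a b 1 = b" by (auto simp: linepath_def)
  have "(\<lambda>x. n \<bullet> (d x *v n)) = (\<lambda>x. (\<Sum>i\<in>UNIV. n $ i * (\<Sum>j\<in>UNIV. n $ j * d x $ i $ j)))"
    by (auto simp: inner_vec_def matrix_vector_mult_def sum_2 algebra_simps)
  also have "\<dots> \<in> Pk 3 UNIV" by (intro Pk_sum Pk_cmult Pk_entry d)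
  finally have nd: "(\<lambda>x. n \<bullet> (d x *v n)) \<in> Pk 3 UNIV" .
  obtain P where P: "degree P \<le> 3" "\<And>s. n \<bullet> (d (linepath a b s) *v n) = poly P s"
    by (rule Pk_line_poly[OF nd, of a b]) blast
  have "P = 0"
  proof (rule moments_cubic[OF P(1)])
    show "poly P 0 = 0" "poly P 1 = 0" using P(2)[of 0] P(2)[of 1] z by (auto simp: ends)
    show "integral {0..1} (\<lambda>s. poly P s) = 0" using mom(1) by (simp add: line_int_def P(2))
    show "integral {0..1} (\<lambda>s. poly P s * s) = 0" using mom(2) by (simp add: line_int_def P(2) aff_linepath[OF ab])
  qed
  obtain M where M: "degree M \<le> 2" "\<And>s. 0 \<le> s \<Longrightarrow> s \<le> 1 \<Longrightarrow> t \<bullet> (d (linepath a b s) *v n) = poly M s"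
    by (rule Pk_segment_poly[OF td]) blast
  have "M = 0"
  proof (rule moments_quadratic[OF M(1)])
    show "poly M 0 = 0" "poly M 1 = 0" using M(2)[of 0] M(2)[of 1] z by (auto simp: ends)
    have "integral {0..1} (\<lambda>s. poly M s) = line_int a b (\<lambda>x. (t \<bullet> (d x *v n)) * 1)"
      unfolding line_int_def by (intro integral_cong) (simp add: M(2))
    then show "integral {0..1} (\<lambda>s. poly M s) = 0" using mom(3) by simp
  qed
  obtain s where s: "0 \<le> s" "s \<le> 1" "x = linepath a b s" using segment_linepathE[OF x] by metis
  obtain \<kappa> where k: "\<kappa> \<noteq> 0" "t = \<kappa> *\<^sub>R (b - a)" by (rule unit_tangent_segment[OF t ab])
  show ?thesis
  proof (rule orthogonal_zero[OF unit_normal_segment[OF n]])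
    show "n \<bullet> (d x *v n) = 0" using P(2)[of s] \<open>P = 0\<close> s(3) by simp
    show "(b - a) \<bullet> (d x *v n) = 0" using M(2)[OF s(1,2)] \<open>M = 0\<close> s(3) k by simp
  qed (use ab in simp)
qed

subsection \<open>The Airy operator on polynomials\<close>

definition airyp :: "(pt \<Rightarrow> real) \<Rightarrow> pt \<Rightarrow> real^2^2" where
  "airyp p x = vector [vector [pd 2 (pd 2 p) x, - pd 1 (pd 2 p) x], vector [- pd 1 (pd 2 p) x, pd 1 (pd 1 p) x]]"

lemma airyp_nth [simp]: "airyp p x $ 1 $ 1 = pd 2 (pd 2 p) x" "airyp p x $ 1 $ 2 = - pd 1 (pd 2 p) x"
  "airyp p x $ 2 $ 1 = - pd 1 (pd 2 p) x" "airyp p x $ 2 $ 2 = pd 1 (pd 1 p) x"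
  by (simp_all add: airyp_def)

lemma Pk_matrixI:
  fixes \<sigma> :: "pt \<Rightarrow> real^2^2"
  assumes "\<And>i j. (\<lambda>x. \<sigma> x $ i $ j) \<in> Pk k D"
  shows "\<sigma> \<in> Pk k D"
  using assms Pk_vec_iff[of \<sigma>] Pk_vec_iff[of "\<lambda>x. \<sigma> x $ _"] by blast

lemma Pk_airyp: 
  assumes p: "p \<in> Pk 5 UNIV"
  shows "airyp p \<in> Pk 3 UNIV"
proof (rule Pk_matrixI)
  have h: "pd i (pd j p) \<in> Pk 3 UNIV" for i j using Pk_pd[OF Pk_pd[OF p]] by simp
  show "(\<lambda>x. airyp p x $ i $ j) \<in> Pk 3 UNIV" for i j
    using exhaust_2[of i] exhaust_2[of j] h Pk_uminus[OF h] by auto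
qed

lemma transpose_airyp: "transpose (airyp p x) = airyp p x"
  by (simp add: vec_eq_iff forall_2 transpose_def)

lemma div_airyp:
  assumes p: "p \<in> Pk 5 UNIV"
  shows "div_field (airyp p) x = 0"
proof -
  have h: "pd i (pd j p) differentiable at x" for i j x using Pk_differentiable[OF Pk_pd[OF Pk_pd[OF p]]] .
  have c: "pd 1 (pd 2 (pd i p)) = pd 2 (pd 1 (pd i p))" for i using Pk_pd_commute[OF Pk_pd[OF p]] .
  have c2: "pd 1 (pd 2 p) = pd 2 (pd 1 p)" using Pk_pd_commute[OF p] .
  have "div_field (airyp p) x $ 1 = 0"
    unfolding div_field_nth by (simp add: pd_uminus h c c2)
  moreover have "div_field (airyp p) x $ 2 = 0"
    unfolding div_field_nth by (simp add: pd_uminus h c c2[symmetric]) (simp add: c c2)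
  ultimately show ?thesis by (simp add: vec_eq_iff forall_2)
qed

text \<open>\<open>airyp p\<close> is the trace of the Hessian times the identity, minus the
  Hessian. The first term drops out between orthogonal vectors.\<close>

lemma airyp_tn:
  assumes p: "p \<in> Pk 5 UNIV" and n: "norm n = 1" and t: "t \<bullet> n = 0"
  shows "t \<bullet> (airyp p x *v n) = - dird t (dird n p) x"
proof -
  have h: "pd i p differentiable at x" for i x using Pk_differentiable[OF Pk_pd[OF p]] .
  have c2: "pd 2 (pd 1 p) = pd 1 (pd 2 p)" using Pk_pd_commute[OF p] .
  have e: "pd i (dird n p) x = n $ 1 * pd i (pd 1 p) x + n $ 2 * pd i (pd 2 p) x" for i
    unfolding dird_def[abs_def] by (subst pd_add) (auto simp: pd_cmult h intro!: differentiable_mult)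
  have nn: "n $ 1 * n $ 1 + n $ 2 * n $ 2 = 1" using n by (simp add: norm_eq_1 inner_vec_def sum_2)
  have tn: "t $ 1 * n $ 1 + t $ 2 * n $ 2 = 0" using t by (simp add: inner_vec_def sum_2)
  have "t $ 1 * (c * n1 + (- b) * n2) + t $ 2 * ((- b) * n1 + a * n2) = - (t $ 1 * (n1 * a + n2 * b) + t $ 2 * (n1 * b + n2 * c))"
    if "t $ 1 * n1 + t $ 2 * n2 = 0" for a b c n1 n2 :: real
  proof -
    have "(t $ 1 * n1 + t $ 2 * n2) * (a + c) = 0" using that by simp
    then show ?thesis by (simp add: algebra_simps)
  qed
  from this[OF tn, of "pd 2 (pd 2 p) x" "pd 1 (pd 2 p) x" "pd 1 (pd 1 p) x"]
  show ?thesis by (simp add: inner_vec_def matrix_vector_mult_def sum_2 dird_def[of t] e c2)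
qed

text \<open>By \<open>airyp_tn\<close> the shear is a nonzero multiple of the derivative of
  \<open>dird n p\<close> along the edge, and differentiating a polynomial lowers its degree by one.
  This ties the Bell condition to the reduced shear of \<open>Sigma_r\<close>.\<close>

lemma Bell_airyp:
  assumes p: "p \<in> Pk 5 UNIV" and ab: "a \<noteq> b"
    and n: "unit_normal (closed_segment a b) n" and t: "unit_tangent (closed_segment a b) t"
  shows "dir_deriv n p \<in> Pk 3 (closed_segment a b) \<longleftrightarrow> (\<lambda>x. t \<bullet> (airyp p x *v n)) \<in> Pk 2 (closed_segment a b)"
proof -
  obtain \<kappa> where k: "\<kappa> \<noteq> 0" "t = \<kappa> *\<^sub>R (b - a)" by (rule unit_tangent_segment[OF t ab])
  note un = unit_normal_segment[OF n]
  have tn: "t \<bullet> n = 0" using un(2) k by (simp add: inner_commute)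
  have dnp: "dird n p \<in> Pk 4 UNIV" using Pk_dird[OF p] by simp
  obtain N where N: "\<And>s. dird n p (linepath a b s) = poly N s" "\<And>s. dird (b - a) (dird n p) (linepath a b s) = poly (pderiv N) s"
    by (rule Pk_line_poly[OF dnp, of a b]) blast
  have dd: "dir_deriv n p (linepath a b s) = poly N s" for s using dir_deriv_dird[OF Pk_differentiable[OF p]] N by simp
  have tt: "t \<bullet> (airyp p (linepath a b s) *v n) = poly (Polynomial.smult (- \<kappa>) (pderiv N)) s" for s
  proof -
    have "dird t (dird n p) (linepath a b s) = \<kappa> * dird (b - a) (dird n p) (linepath a b s)"
      unfolding k(2) dird_def[of "\<kappa> *\<^sub>R (b - a)"] dird_def[of "b - a"] by (simp add: algebra_simps)
    then show ?thesis unfolding airyp_tn[OF p un(1) tn] N by (simp add: N(2))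
  qed
  have dN: "degree (Polynomial.smult (- \<kappa>) (pderiv N)) = degree N - 1" using k(1) by (simp add: degree_pderiv)
  show ?thesis
  proof
    assume "dir_deriv n p \<in> Pk 3 (closed_segment a b)"
    then obtain M where M: "degree M \<le> 3" "\<And>s. 0 \<le> s \<Longrightarrow> s \<le> 1 \<Longrightarrow> dir_deriv n p (linepath a b s) = poly M s"
      by (rule Pk_segment_poly) blast
    have "N = M" by (rule poly_eq_on_interval) (use dd M(2) in metis)
    then have dN2: "degree (Polynomial.smult (- \<kappa>) (pderiv N)) \<le> 2" using M unfolding dN by simp
    show "(\<lambda>x. t \<bullet> (airyp p x *v n)) \<in> Pk 2 (closed_segment a b)"
      by (rule Pk_segmentI[OF ab dN2]) (rule tt)
  next
    assume "(\<lambda>x. t \<bullet> (airyp p x *v n)) \<in> Pk 2 (closed_segment a b)"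
    then obtain M where M: "degree M \<le> 2" "\<And>s. 0 \<le> s \<Longrightarrow> s \<le> 1 \<Longrightarrow> t \<bullet> (airyp p (linepath a b s) *v n) = poly M s"
      by (rule Pk_segment_poly) blast
    have "Polynomial.smult (- \<kappa>) (pderiv N) = M" by (rule poly_eq_on_interval) (use tt M(2) in metis)
    then have "degree N - 1 \<le> 2" using M dN by metis
    then have "degree N \<le> 3" by linarith
    then show "dir_deriv n p \<in> Pk 3 (closed_segment a b)" by (intro Pk_segmentI[OF ab, of N]) (auto simp: dd)
  qed
qed

lemma zero_in_RM: "(\<lambda>x. 0) \<in> RM"
  unfolding RM_def by (intro CollectI exI[of _ 0]) simp

lemma Pk_pd_zero_imp_const:
  fixes f :: "pt \<Rightarrow> real"
  assumes f: "f \<in> Pk k UNIV" and z: "\<And>i x. pd i f x = 0"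
  shows "f x = f y"
proof -
  have "\<exists>c. \<forall>x\<in>UNIV. f x = c"
    by (rule has_derivative_zero_constant) (use has_derivative_pd[OF Pk_differentiable[OF f]] z in auto)
  then show ?thesis by (metis UNIV_I)
qed

lemma Pk_0_const:
  fixes f :: "pt \<Rightarrow> real"
  assumes "f \<in> Pk 0 UNIV"
  obtains c where "f = (\<lambda>x. c)"
proof -
  obtain c where "f = (\<lambda>x. \<Sum>i\<le>0. \<Sum>j\<le>0 - i. (x $ 1) ^ i * (x $ 2) ^ j * c i j)"
    by (rule Pk_UNIV_E[OF assms])
  then have "f = (\<lambda>x. c 0 0)" by simp
  then show ?thesis by (rule that)
qed

lemma Pk_hessian_zero_imp_affine:
  fixes f :: "pt \<Rightarrow> real"
  assumes f: "f \<in> Pk k UNIV" and z: "\<And>i j x. pd i (pd j f) x = 0"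
  shows "f x = f a + (x $ 1 - a $ 1) * pd 1 f a + (x $ 2 - a $ 2) * pd 2 f a"
proof -
  have c: "pd i f x = pd i f a" for i x by (rule Pk_pd_zero_imp_const[OF Pk_pd[OF f]]) (rule z)
  define c1 c2 where "c1 = pd 1 f a" and "c2 = pd 2 f a"
  let ?q = "\<lambda>x. f x - (c1 * x $ 1 + c2 * x $ 2)"
  have k: "f \<in> Pk (Suc k) UNIV" by (rule Pk_mono[OF f]) simp
  have qk: "?q \<in> Pk (Suc k) UNIV" by (intro Pk_diff k Pk_add Pk_cmult Pk_coord) auto
  have dq: "pd i ?q y = 0" for i y
  proof -
    have l: "(\<lambda>x. c1 * x $ 1 + c2 * x $ 2) \<in> Pk 1 UNIV" by (intro Pk_add Pk_cmult Pk_coord) auto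
    have "pd i ?q y = pd i f y - pd i (\<lambda>x. c1 * x $ 1 + c2 * x $ 2) y"
      by (rule pd_diff[OF Pk_differentiable[OF f] Pk_differentiable[OF l]])
    also have "pd i (\<lambda>x. c1 * x $ 1 + c2 * x $ 2) y = c1 * pd i (\<lambda>x. x $ 1) y + c2 * pd i (\<lambda>x. x $ 2) y"
      by (subst pd_add) (auto simp: pd_cmult intro!: differentiable_mult)
    finally show ?thesis using c[of i y] exhaust_2[of i] by (auto simp: c1_def c2_def)
  qed
  have "?q x = ?q a" by (rule Pk_pd_zero_imp_const[OF qk dq])
  then show ?thesis by (simp add: c1_def c2_def algebra_simps)
qed

text \<open>Two vectors orthogonal to a nonzero \<open>u\<close> are parallel. It passes between
  derivatives of a gradient along an edge and the traction, in both directions.\<close>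

lemma rotate_orthogonal:
  fixes u n :: pt
  assumes "u \<noteq> 0" "n $ 1 * u $ 1 + n $ 2 * u $ 2 = 0" "u $ 1 * h1 + u $ 2 * h2 = 0"
  shows "n $ 1 * h2 - n $ 2 * h1 = 0"
proof -
  have "u $ 1 * (n $ 1 * h2 - n $ 2 * h1) = 0" "u $ 2 * (n $ 1 * h2 - n $ 2 * h1) = 0"
    using assms(2,3) by algebra+
  moreover have "u $ 1 \<noteq> 0 \<or> u $ 2 \<noteq> 0" using assms(1) by (simp add: vec_eq_iff forall_2)
  ultimately show ?thesis by auto
qed

lemma Pk_zero_on_open:
  fixes f :: "pt \<Rightarrow> real"
  assumes f: "f \<in> Pk k UNIV" and S: "open S" "S \<noteq> {}" "\<And>x. x \<in> S \<Longrightarrow> f x = 0"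
  shows "f x = 0"
proof -
  obtain a r where a: "a \<in> S" "r > 0" "ball a r \<subseteq> S" using S(1,2) open_contains_ball by blast
  \<comment> \<open>Small enough for \<open>b\<close> to lie in the ball. Then \<open>x\<close> is
    the point with parameter \<open>1 / m\<close> on the same line, where the polynomial is known
    from the unit interval.\<close>
  define m where "m = r / (norm (x - a) + 1)"
  define b where "b = a + m *\<^sub>R (x - a)"
  have p: "norm (x - a) + 1 > 0" using norm_ge_zero[of "x - a"] by linarith
  then have m: "m > 0" using a(2) by (simp add: m_def)
  have "m * norm (x - a) < m * (norm (x - a) + 1)" using m by simp
  also have "\<dots> = r" using p by (simp add: m_def)
  finally have "dist a b < r" using m by (simp add: b_def dist_norm)
  then have ab: "closed_segment a b \<subseteq> ball a r" using a(2) by (intro closed_segment_subset) auto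
  obtain P where P: "\<And>s. f (linepath a b s) = poly P s" by (rule Pk_line_poly[OF f, of a b]) blast
  have "P = 0"
  proof (rule poly_eq_on_interval)
    fix s :: real assume "0 \<le> s" "s \<le> 1"
    then have "linepath a b s \<in> S" using ab a(3) linepath_in_path[of s a b] by auto
    then have "f (linepath a b s) = 0" by (rule S(3))
    then show "poly P s = poly 0 s" unfolding P by simp
  qed
  moreover have "x = linepath a b (1 / m)" using m by (simp add: linepath_def b_def algebra_simps)
  ultimately show ?thesis using P by simp
qed

section \<open>Families of shape functions and the global spaces\<close>

context oriented_mesh
begin

lemma Pk_AE_zero:
  fixes f :: "pt \<Rightarrow> real"
  assumes K: "K \<in> T" and f: "f \<in> Pk k UNIV" and z: "AE x in lebesgue_on K. f x = 0"
  shows "f x = 0"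
proof (rule Pk_zero_on_open[OF f])
  show "open (interior K)" "interior K \<noteq> {}" using tri_interior_nonempty simplex_T[OF K] by auto
  have o: "open (interior K \<inter> {x. f x \<noteq> 0})"
    by (intro open_Int open_interior open_Collect_neq Pk_continuous_on[OF f] continuous_intros)
  have l: "interior K \<inter> {x. f x \<noteq> 0} \<in> sets lebesgue" by (intro sets_completionI_sets) (simp add: o borel_open)
  have "AE x in lebesgue. x \<in> interior K \<longrightarrow> f x = 0" using z unfolding AE_triangle[OF K] .
  then have "AE x in lebesgue. x \<notin> interior K \<inter> {x. f x \<noteq> 0}" by eventually_elim auto
  then have "negligible (interior K \<inter> {x. f x \<noteq> 0})"
    using AE_iff_null_sets[of "interior K \<inter> {x. f x \<noteq> 0}" lebesgue] l
    unfolding negligible_iff_null_sets by blast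
  then have "interior K \<inter> {x. f x \<noteq> 0} = {}" using open_not_negligible[OF o] by blast
  then show "f x = 0" if "x \<in> interior K" for x using that by blast
qed

text \<open>The polynomial half of \<open>Wh\<close>, freed from representatives and from
  \<open>H2_space\<close>; \<open>airy_bell_family\<close> recovers the Sobolev regularity.
  \<open>sigma_family\<close> plays the same part for \<open>Sigma_h\<close>.\<close>

definition bell_family :: "(pt set \<Rightarrow> pt \<Rightarrow> real) \<Rightarrow> bool" where
  "bell_family p \<longleftrightarrow> (\<forall>K\<in>T. p K \<in> Bell n K) \<and>
     (\<forall>K\<in>T. \<forall>K'\<in>T. \<forall>a. a extreme_point_of K \<and> a extreme_point_of K' \<longrightarrow>
        p K a = p K' a \<and>
        (\<forall>i. pd i (p K) a = pd i (p K') a) \<and>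
        (\<forall>i j. pd i (pd j (p K)) a = pd i (pd j (p K')) a))"

definition sigma_family :: "(pt set \<Rightarrow> pt \<Rightarrow> real^2^2) \<Rightarrow> bool" where
  "sigma_family \<sigma> \<longleftrightarrow> (\<forall>K\<in>T. \<sigma> K \<in> Sigma_r n t K) \<and>
     (\<forall>K\<in>T. \<forall>K'\<in>T. \<forall>a. a extreme_point_of K \<and> a extreme_point_of K' \<longrightarrow> \<sigma> K a = \<sigma> K' a) \<and>
     (\<forall>K\<in>T. \<forall>K'\<in>T. \<forall>e. e edge_of K \<and> e edge_of K' \<longrightarrow>
        (\<forall>q\<in>Pk 1 e. edge_inner e (\<lambda>x. n e \<bullet> (\<sigma> K x *v n e)) q =
                      edge_inner e (\<lambda>x. n e \<bullet> (\<sigma> K' x *v n e)) q) \<and>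
        (\<forall>q\<in>Pk 0 e. edge_inner e (\<lambda>x. t e \<bullet> (\<sigma> K x *v n e)) q =
                      edge_inner e (\<lambda>x. t e \<bullet> (\<sigma> K' x *v n e)) q))"

lemma bell_familyD:
  assumes "bell_family p"
  shows "K \<in> T \<Longrightarrow> p K \<in> Pk 5 UNIV" "K \<in> T \<Longrightarrow> e edge_of K \<Longrightarrow> dir_deriv (n e) (p K) \<in> Pk 3 e"
    "K \<in> T \<Longrightarrow> K' \<in> T \<Longrightarrow> a extreme_point_of K \<Longrightarrow> a extreme_point_of K' \<Longrightarrow> p K a = p K' a"
    "K \<in> T \<Longrightarrow> K' \<in> T \<Longrightarrow> a extreme_point_of K \<Longrightarrow> a extreme_point_of K' \<Longrightarrow> pd i (p K) a = pd i (p K') a"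
    "K \<in> T \<Longrightarrow> K' \<in> T \<Longrightarrow> a extreme_point_of K \<Longrightarrow> a extreme_point_of K' \<Longrightarrow> pd i (pd j (p K)) a = pd i (pd j (p K')) a"
  using assms unfolding bell_family_def Bell_def by blast+

lemma sigma_familyD:
  assumes "sigma_family \<sigma>"
  shows "K \<in> T \<Longrightarrow> \<sigma> K \<in> Pk 3 UNIV" "K \<in> T \<Longrightarrow> transpose (\<sigma> K x) = \<sigma> K x" "K \<in> T \<Longrightarrow> div_field (\<sigma> K) \<in> RM"
    "K \<in> T \<Longrightarrow> e edge_of K \<Longrightarrow> (\<lambda>x. t e \<bullet> (\<sigma> K x *v n e)) \<in> Pk 2 e"
    "K \<in> T \<Longrightarrow> K' \<in> T \<Longrightarrow> a extreme_point_of K \<Longrightarrow> a extreme_point_of K' \<Longrightarrow> \<sigma> K a = \<sigma> K' a"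
    "K \<in> T \<Longrightarrow> K' \<in> T \<Longrightarrow> e edge_of K \<Longrightarrow> e edge_of K' \<Longrightarrow> q \<in> Pk 1 e \<Longrightarrow>
       edge_inner e (\<lambda>x. n e \<bullet> (\<sigma> K x *v n e)) q = edge_inner e (\<lambda>x. n e \<bullet> (\<sigma> K' x *v n e)) q"
    "K \<in> T \<Longrightarrow> K' \<in> T \<Longrightarrow> e edge_of K \<Longrightarrow> e edge_of K' \<Longrightarrow> q \<in> Pk 0 e \<Longrightarrow>
       edge_inner e (\<lambda>x. t e \<bullet> (\<sigma> K x *v n e)) q = edge_inner e (\<lambda>x. t e \<bullet> (\<sigma> K' x *v n e)) q"
proof -
  note c = assms[unfolded sigma_family_def]
  note r = c[THEN conjunct1, rule_format, unfolded Sigma_r_def mem_Collect_eq]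
  show "K \<in> T \<Longrightarrow> \<sigma> K \<in> Pk 3 UNIV" "K \<in> T \<Longrightarrow> transpose (\<sigma> K x) = \<sigma> K x" "K \<in> T \<Longrightarrow> div_field (\<sigma> K) \<in> RM"
    "K \<in> T \<Longrightarrow> e edge_of K \<Longrightarrow> (\<lambda>x. t e \<bullet> (\<sigma> K x *v n e)) \<in> Pk 2 e" using r by simp_all
  show "K \<in> T \<Longrightarrow> K' \<in> T \<Longrightarrow> a extreme_point_of K \<Longrightarrow> a extreme_point_of K' \<Longrightarrow> \<sigma> K a = \<sigma> K' a"
    by (rule c[THEN conjunct2, THEN conjunct1, rule_format, OF _ _ conjI])
  note e = c[THEN conjunct2, THEN conjunct2, rule_format, OF _ _ conjI]
  show "edge_inner e (\<lambda>x. n e \<bullet> (\<sigma> K x *v n e)) q = edge_inner e (\<lambda>x. n e \<bullet> (\<sigma> K' x *v n e)) q"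
    if "K \<in> T" "K' \<in> T" "e edge_of K" "e edge_of K'" "q \<in> Pk 1 e"
    by (rule e[THEN conjunct1, THEN bspec, OF that])
  show "edge_inner e (\<lambda>x. t e \<bullet> (\<sigma> K x *v n e)) q = edge_inner e (\<lambda>x. t e \<bullet> (\<sigma> K' x *v n e)) q"
    if "K \<in> T" "K' \<in> T" "e edge_of K" "e edge_of K'" "q \<in> Pk 0 e"
    by (rule e[THEN conjunct2, THEN bspec, OF that])
qed

lemma shared_edge:
  assumes "K \<in> T" "K' \<in> T" "e edge_of K" "e edge_of K'"
  obtains a b where "a \<noteq> b" "e = closed_segment a b"
    "\<forall>y\<in>{a, b}. y extreme_point_of K" "\<forall>y\<in>{a, b}. y extreme_point_of K'"
proof -
  obtain a b where ab: "a \<noteq> b" "e = closed_segment a b" "a extreme_point_of K" "b extreme_point_of K"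
    by (rule edge_imp_segment[OF assms(3) simplex_T[OF assms(1)]])
  have "e \<subseteq> K'" using assms(4) unfolding edge_of_def by (blast dest: face_of_imp_subset)
  then have "a \<in> K'" "b \<in> K'" using ab(2) by auto
  then have "a extreme_point_of K'" "b extreme_point_of K'" using vertex_of_all assms(1,2) ab(3,4) by blast+
  then show ?thesis using that ab by blast
qed

lemma bell_family_edge:
  assumes p: "bell_family p" and K: "K \<in> T" "K' \<in> T" "e edge_of K" "e edge_of K'" and x: "x \<in> e"
  shows "p K x = p K' x" "pd i (p K) x = pd i (p K') x"
proof -
  obtain a b where ab: "a \<noteq> b" "e = closed_segment a b"
    "\<forall>y\<in>{a, b}. y extreme_point_of K" "\<forall>y\<in>{a, b}. y extreme_point_of K'"
    by (rule shared_edge[OF K])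
  let ?q = "\<lambda>x. p K x - p K' x"
  note pk = bell_familyD(1)[OF p K(1)] bell_familyD(1)[OF p K(2)]
  have q: "?q \<in> Pk 5 UNIV" by (intro Pk_diff pk)
  have dq: "pd i ?q = (\<lambda>x. pd i (p K) x - pd i (p K') x)" for i
    by (rule ext) (intro pd_diff Pk_differentiable[OF pk(1)] Pk_differentiable[OF pk(2)])
  have ddq: "pd i (pd j ?q) = (\<lambda>x. pd i (pd j (p K)) x - pd i (pd j (p K')) x)" for i j
    unfolding dq by (rule ext) (intro pd_diff Pk_differentiable[OF Pk_pd[OF pk(1)]] Pk_differentiable[OF Pk_pd[OF pk(2)]])
  have "dir_deriv (n e) ?q = (\<lambda>x. dir_deriv (n e) (p K) x - dir_deriv (n e) (p K') x)"
    by (rule ext) (simp add: dir_deriv_dird[OF Pk_differentiable[OF q]] dir_deriv_dird[OF Pk_differentiable[OF pk(1)]]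
      dir_deriv_dird[OF Pk_differentiable[OF pk(2)]] dird_def dq algebra_simps)
  then have nd: "dir_deriv (n e) ?q \<in> Pk 3 e"
    by (simp only:) (intro Pk_diff bell_familyD(2)[OF p K(1,3)] bell_familyD(2)[OF p K(2,4)])
  note v = bell_familyD(3,4,5)[OF p K(1,2) bspec[OF ab(3)] bspec[OF ab(4)]]
  have z: "?q y = 0" "pd i ?q y = 0" "pd i (pd j ?q) y = 0" if "y \<in> {a, b}" for y i j
  proof -
    show "?q y = 0" using v(1)[OF that that] by simp
    show "pd i ?q y = 0" unfolding dq using v(2)[OF that that] by simp
    show "pd i (pd j ?q) y = 0" unfolding ddq using v(3)[OF that that] by simp
  qed
  note be = bell_edge[OF q normal[OF K(1,3), unfolded ab(2)] ab(1) nd[unfolded ab(2)] z, unfolded ab(2)[symmetric]]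
  show "p K x = p K' x" using be(1)[OF _ _ _ x] by simp
  show "pd i (p K) x = pd i (p K') x" using be(2)[OF _ _ _ x] unfolding dq by simp
qed

lemma airyp_mult: "(airyp p x *v m) $ 1 = pd 2 (pd 2 p) x * m $ 1 - pd 1 (pd 2 p) x * m $ 2"
  "(airyp p x *v m) $ 2 = - pd 1 (pd 2 p) x * m $ 1 + pd 1 (pd 1 p) x * m $ 2"
  by (simp_all add: matrix_vector_mult_def sum_2)

text \<open>The jump of the gradient vanishes on \<open>e\<close>, hence so does its derivative
  along \<open>e\<close>: the jump of the Hessian annihilates the tangent. Turned by a right angle,
  the jump of the Airy tensor annihilates the normal.\<close>

lemma bell_family_traction:
  assumes p: "bell_family p" and K: "K \<in> T" "K' \<in> T" "e edge_of K" "e edge_of K'" and x: "x \<in> e"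
  shows "airyp (p K) x *v n e = airyp (p K') x *v n e"
proof -
  obtain a b where ab: "a \<noteq> b" "e = closed_segment a b" by (rule shared_edge[OF K])
  note pk = bell_familyD(1)[OF p K(1)] bell_familyD(1)[OF p K(2)]
  let ?h = "\<lambda>j i. pd j (pd i (p K)) x - pd j (pd i (p K')) x"
  have h: "(b - a) $ 1 * ?h 1 i + (b - a) $ 2 * ?h 2 i = 0" for i
  proof -
    let ?f = "\<lambda>x. pd i (p K) x - pd i (p K') x"
    have f: "?f \<in> Pk 4 UNIV" using Pk_diff[OF Pk_pd[OF pk(1)] Pk_pd[OF pk(2)]] by simp
    have "dird (b - a) ?f x = 0"
      by (rule pd_zero_on_segment[OF f]) (use bell_family_edge(2)[OF p K] x ab in auto)
    moreover have "pd j ?f x = ?h j i" for j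
      by (intro pd_diff Pk_differentiable[OF Pk_pd[OF pk(1)]] Pk_differentiable[OF Pk_pd[OF pk(2)]])
    ultimately show ?thesis by (simp add: dird_def)
  qed
  have sym: "pd 2 (pd 1 (p K)) = pd 1 (pd 2 (p K))" "pd 2 (pd 1 (p K')) = pd 1 (pd 2 (p K'))"
    using Pk_pd_commute pk by blast+
  have nb: "n e $ 1 * (b - a) $ 1 + n e $ 2 * (b - a) $ 2 = 0"
    using unit_normal_segment(2)[OF normal[OF K(1,3), unfolded ab(2)]] unfolding ab(2)[symmetric] by (simp add: inner_vec_def sum_2)
  have ba: "b - a \<noteq> 0" using ab by simp
  have "n e $ 1 * ?h 2 2 - n e $ 2 * ?h 1 2 = 0" "n e $ 1 * ?h 2 1 - n e $ 2 * ?h 1 1 = 0"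
    by (rule rotate_orthogonal[OF ba nb h])+
  then show ?thesis by (simp add: vec_eq_iff forall_2 airyp_mult sym algebra_simps)
qed

lemma matrix_form_linear:
  fixes A B :: "real^2^2"
  shows "w \<bullet> ((A - B) *v m) = w \<bullet> (A *v m) - w \<bullet> (B *v m)"
  by (simp add: matrix_vector_mult_diff_rdistrib inner_diff_right)

lemma Pk_form: "\<sigma> \<in> Pk k D \<Longrightarrow> (\<lambda>x. w \<bullet> (\<sigma> x *v m) :: real) \<in> Pk k D" for \<sigma> :: "pt \<Rightarrow> real^2^2"
proof -
  assume s: "\<sigma> \<in> Pk k D"
  have "(\<lambda>x. w \<bullet> (\<sigma> x *v m)) = (\<lambda>x. (\<Sum>i\<in>UNIV. w $ i * (\<Sum>j\<in>UNIV. m $ j * \<sigma> x $ i $ j)))"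
    by (auto simp: inner_vec_def matrix_vector_mult_def sum_2 algebra_simps)
  also have "\<dots> \<in> Pk k D" by (intro Pk_sum Pk_cmult Pk_entry s)
  finally show ?thesis .
qed

text \<open>The difference of the two pieces has vanishing data on \<open>e\<close>: its values at
  the ends, its normal moments against 1 and \<open>aff a b\<close>, and its tangential mean. These
  are the hypotheses of \<open>traction_edge\<close>.\<close>

lemma sigma_family_traction:
  assumes s: "sigma_family \<sigma>" and K: "K \<in> T" "K' \<in> T" "e edge_of K" "e edge_of K'" and x: "x \<in> e"
  shows "\<sigma> K x *v n e = \<sigma> K' x *v n e"
proof -
  obtain a b where ab: "a \<noteq> b" "e = closed_segment a b"
    "\<forall>y\<in>{a, b}. y extreme_point_of K" "\<forall>y\<in>{a, b}. y extreme_point_of K'"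
    by (rule shared_edge[OF K])
  let ?d = "\<lambda>x. \<sigma> K x - \<sigma> K' x"
  note sk = sigma_familyD(1)[OF s K(1)] sigma_familyD(1)[OF s K(2)]
  have d: "?d \<in> Pk 3 UNIV" by (intro Pk_diff sk)
  have td: "(\<lambda>x. t e \<bullet> (?d x *v n e)) \<in> Pk 2 e"
    unfolding matrix_form_linear by (intro Pk_diff sigma_familyD(4)[OF s K(1,3)] sigma_familyD(4)[OF s K(2,4)])
  have v: "?d y = 0" if "y \<in> {a, b}" for y using sigma_familyD(5)[OF s K(1,2) bspec[OF ab(3) that] bspec[OF ab(4) that]] by simp
  have mom: "line_int a b (\<lambda>x. (w \<bullet> (?d x *v n e)) * q x) = 0"
    if q: "q \<in> Pk 1 UNIV" and eq: "edge_inner e (\<lambda>x. w \<bullet> (\<sigma> K x *v n e)) q = edge_inner e (\<lambda>x. w \<bullet> (\<sigma> K' x *v n e)) q" for w q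
  proof -
    have c: "continuous_on UNIV (\<lambda>x. (w \<bullet> (\<sigma> K x *v n e)) * q x)" "continuous_on UNIV (\<lambda>x. (w \<bullet> (\<sigma> K' x *v n e)) * q x)"
      by (intro continuous_on_mult Pk_continuous_on[OF q] Pk_continuous_on[OF Pk_form[OF sk(1)]] Pk_continuous_on[OF Pk_form[OF sk(2)]])+
    have "line_int a b (\<lambda>x. (w \<bullet> (\<sigma> K x *v n e)) * q x) = line_int a b (\<lambda>x. (w \<bullet> (\<sigma> K' x *v n e)) * q x)"
      using eq ab(1) unfolding ab(2) edge_inner_segment[OF ab(1)] by simp
    moreover have "(\<lambda>x. (w \<bullet> (?d x *v n e)) * q x) = (\<lambda>x. (w \<bullet> (\<sigma> K x *v n e)) * q x + (-1) * ((w \<bullet> (\<sigma> K' x *v n e)) * q x))"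
      unfolding matrix_form_linear by (auto simp: algebra_simps)
    moreover have "line_int a b (\<lambda>x. (w \<bullet> (\<sigma> K x *v n e)) * q x + (-1) * ((w \<bullet> (\<sigma> K' x *v n e)) * q x)) =
       line_int a b (\<lambda>x. (w \<bullet> (\<sigma> K x *v n e)) * q x) + (-1) * line_int a b (\<lambda>x. (w \<bullet> (\<sigma> K' x *v n e)) * q x)"
      unfolding line_int_cmult[symmetric] by (rule line_int_add[OF c(1) continuous_on_mult[OF continuous_on_const c(2)]])
    ultimately show ?thesis by simp
  qed
  have "?d x *v n e = 0"
  proof (rule traction_edge[OF d normal[OF K(1,3), unfolded ab(2)] tangent[OF K(1,3), unfolded ab(2)] ab(1) td[unfolded ab(2)], unfolded ab(2)[symmetric]])
    show "?d a *v n e = 0" "?d b *v n e = 0" using v by auto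
    show "line_int a b (\<lambda>x. (n e \<bullet> (?d x *v n e)) * 1) = 0"
      by (rule mom) (auto intro!: Pk_const sigma_familyD(6)[OF s K])
    show "line_int a b (\<lambda>x. (n e \<bullet> (?d x *v n e)) * aff a b x) = 0"
      by (rule mom) (auto intro!: Pk_aff sigma_familyD(6)[OF s K])
    show "line_int a b (\<lambda>x. (t e \<bullet> (?d x *v n e)) * 1) = 0"
      by (rule mom) (auto intro!: Pk_const sigma_familyD(7)[OF s K])
  qed (rule x)
  then show ?thesis by (simp add: matrix_vector_mult_diff_rdistrib)
qed

text \<open>The vertex values agree because all second derivatives do, and the moments agree because
  the tractions do so pointwise.\<close>

lemma airyp_sigma_family:
  assumes p: "bell_family p"
  shows "sigma_family (\<lambda>K. airyp (p K))"
  unfolding sigma_family_def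
proof (intro conjI ballI allI impI)
  fix K assume K: "K \<in> T"
  note pk = bell_familyD(1)[OF p K]
  have "div_field (airyp (p K)) \<in> RM"
  proof -
    have "div_field (airyp (p K)) = (\<lambda>x. 0)" by (rule ext) (rule div_airyp[OF pk])
    then show ?thesis using zero_in_RM by simp
  qed
  moreover have "(\<lambda>x. t e \<bullet> (airyp (p K) x *v n e)) \<in> Pk 2 e" if e: "e edge_of K" for e
  proof -
    obtain a b where ab: "a \<noteq> b" "e = closed_segment a b" by (rule edge_imp_segment[OF e simplex_T[OF K]])
    show ?thesis
      using Bell_airyp[OF pk ab(1) normal[OF K e, unfolded ab(2)] tangent[OF K e, unfolded ab(2)]] bell_familyD(2)[OF p K e]
      unfolding ab(2)[symmetric] by blast
  qed
  ultimately show "airyp (p K) \<in> Sigma_r n t K" unfolding Sigma_r_def using Pk_airyp[OF pk] transpose_airyp by blast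
next
  fix K K' a assume K: "K \<in> T" "K' \<in> T" "a extreme_point_of K \<and> a extreme_point_of K'"
  have "pd i (pd j (p K)) a = pd i (pd j (p K')) a" for i j using bell_familyD(5)[OF p] K by blast
  then show "airyp (p K) a = airyp (p K') a" by (simp add: airyp_def)
next
  fix K K' e and q :: "pt \<Rightarrow> real" assume K: "K \<in> T" "K' \<in> T" "e edge_of K \<and> e edge_of K'"
  note K12 = K(1,2) conjunct1[OF K(3)] conjunct2[OF K(3)]
  obtain a b where ab: "a \<noteq> b" "e = closed_segment a b" by (rule shared_edge[OF K12])
  have hw: "w \<bullet> (airyp (p K) x *v n e) * q x = w \<bullet> (airyp (p K') x *v n e) * q x" if "x \<in> e" for x w
    using bell_family_traction[OF p K12 that] by simp
  have "edge_inner e (\<lambda>x. w \<bullet> (airyp (p K) x *v n e)) q = edge_inner e (\<lambda>x. w \<bullet> (airyp (p K') x *v n e)) q" for w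
    unfolding ab(2) edge_inner_segment[OF ab(1)] by (intro arg_cong[where f = "times (dist a b)"] line_int_cong hw[unfolded ab(2)])
  then show "edge_inner e (\<lambda>x. n e \<bullet> (airyp (p K) x *v n e)) q = edge_inner e (\<lambda>x. n e \<bullet> (airyp (p K') x *v n e)) q"
    "edge_inner e (\<lambda>x. t e \<bullet> (airyp (p K) x *v n e)) q = edge_inner e (\<lambda>x. t e \<bullet> (airyp (p K') x *v n e)) q" by auto
qed

text \<open>\<open>bell_family_edge\<close> provides the continuity under which piecewise
  derivatives are weak derivatives; conversely the weak derivatives are determined on each
  triangle.\<close>

lemma airy_bell_family:
  assumes p: "bell_family p" and v: "\<And>K. K \<in> T \<Longrightarrow> AE x in lebesgue_on K. v x = p K x"
  shows "v \<in> Wh n \<Omega> T"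
    and "weak_airy \<Omega> v \<tau> \<longleftrightarrow> (\<forall>K\<in>T. AE x in lebesgue_on K. \<tau> x = airyp (p K) x)"
proof -
  have m: "p K x = p K' x" "pd i (p K) x = pd i (p K') x"
    if "K \<in> T" "K' \<in> T" "e edge_of K" "e edge_of K'" "x \<in> e" for K K' e x i
    by (rule bell_family_edge[OF p that])+
  note pk = bell_familyD(1)[OF p]
  have wd: "(\<And>K. K \<in> T \<Longrightarrow> AE x in lebesgue_on K. g x = pd i (pd j (p K)) x) \<Longrightarrow> weak_deriv \<Omega> [i, j] v g"
    "v \<in> H2_space \<Omega>" for g i j
    by (rule weak_deriv_piecewise(1)[where p = p, OF pk m v]; assumption)
      (rule weak_deriv_piecewise(2)[where p = p, OF pk m v]; assumption)
  have "v \<in> H2_space \<Omega>" by (rule wd(2))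
  moreover have "\<forall>K\<in>T. p K \<in> Bell n K \<and> (AE x in lebesgue_on K. v x = p K x)"
    using conjunct1[OF p[unfolded bell_family_def]] v by simp
  ultimately show "v \<in> Wh n \<Omega> T"
    unfolding Wh_def mem_Collect_eq by (intro conjI exI[of _ p] conjunct2[OF p[unfolded bell_family_def]])
  show "weak_airy \<Omega> v \<tau> \<longleftrightarrow> (\<forall>K\<in>T. AE x in lebesgue_on K. \<tau> x = airyp (p K) x)"
  proof
    assume w: "weak_airy \<Omega> v \<tau>"
    show "\<forall>K\<in>T. AE x in lebesgue_on K. \<tau> x = airyp (p K) x"
    proof
      fix K assume K: "K \<in> T"
      note wt = weak_deriv_on_triangle[OF K bell_familyD(1)[OF p K] v[OF K]]
      note w' = w[unfolded weak_airy_def]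
      have "AE x in lebesgue_on K. \<tau> x $ 1 $ 1 = pd 2 (pd 2 (p K)) x" "AE x in lebesgue_on K. - \<tau> x $ 1 $ 2 = pd 1 (pd 2 (p K)) x"
        "AE x in lebesgue_on K. - \<tau> x $ 2 $ 1 = pd 1 (pd 2 (p K)) x" "AE x in lebesgue_on K. \<tau> x $ 2 $ 2 = pd 1 (pd 1 (p K)) x"
        by (rule wt, use w' in blast)+
      then show "AE x in lebesgue_on K. \<tau> x = airyp (p K) x"
        by eventually_elim (auto simp: vec_eq_iff forall_2)
    qed
  next
    assume a: "\<forall>K\<in>T. AE x in lebesgue_on K. \<tau> x = airyp (p K) x"
    then have *: "AE x in lebesgue_on K. \<tau> x = airyp (p K) x" if "K \<in> T" for K using that by blast
    have h: "AE x in lebesgue_on K. h (\<tau> x) = h (airyp (p K) x)" if "K \<in> T" for K and h :: "real^2^2 \<Rightarrow> real"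
      using *[OF that] by eventually_elim simp
    have wda: "weak_deriv \<Omega> [i, j] v g" if "\<And>K. K \<in> T \<Longrightarrow> AE x in lebesgue_on K. g x = pd i (pd j (p K)) x" for i j g
      by (rule wd(1)) (rule that)
    have "weak_deriv \<Omega> [2,2] v (\<lambda>x. \<tau> x $ 1 $ 1)" using h[of _ "\<lambda>m. m $ 1 $ 1"] by (intro wda) simp
    moreover have "weak_deriv \<Omega> [1,2] v (\<lambda>x. - \<tau> x $ 1 $ 2)" using h[of _ "\<lambda>m. - m $ 1 $ 2"] by (intro wda) simp
    moreover have "weak_deriv \<Omega> [1,2] v (\<lambda>x. - \<tau> x $ 2 $ 1)" using h[of _ "\<lambda>m. - m $ 2 $ 1"] by (intro wda) simp
    moreover have "weak_deriv \<Omega> [1,1] v (\<lambda>x. \<tau> x $ 2 $ 2)" using h[of _ "\<lambda>m. m $ 2 $ 2"] by (intro wda) simp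
    ultimately show "weak_airy \<Omega> v \<tau>" unfolding weak_airy_def by blast
  qed
qed

lemma Wh_bell_family:
  assumes "v \<in> Wh n \<Omega> T"
  obtains p where "bell_family p" "\<And>K. K \<in> T \<Longrightarrow> AE x in lebesgue_on K. v x = p K x"
proof -
  obtain p where 1: "\<forall>K\<in>T. p K \<in> Bell n K \<and> (AE x in lebesgue_on K. v x = p K x)"
    and 2: "\<forall>K\<in>T. \<forall>K'\<in>T. \<forall>a. a extreme_point_of K \<and> a extreme_point_of K' \<longrightarrow>
        p K a = p K' a \<and> (\<forall>i. pd i (p K) a = pd i (p K') a) \<and> (\<forall>i j. pd i (pd j (p K)) a = pd i (pd j (p K')) a)"
    using assms unfolding Wh_def mem_Collect_eq by (elim conjE exE)
  have "bell_family p" unfolding bell_family_def using 1 by (intro conjI 2) simp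
  then show ?thesis by (rule that) (use 1 in simp)
qed

lemma Sigma_h_sigma_family:
  assumes "\<tau> \<in> Sigma_h n t \<Omega> T"
  obtains \<sigma> where "sigma_family \<sigma>" "\<And>K. K \<in> T \<Longrightarrow> AE x in lebesgue_on K. \<tau> x = \<sigma> K x"
proof -
  obtain \<sigma> where 1: "\<forall>K\<in>T. \<sigma> K \<in> Sigma_r n t K \<and> (AE x in lebesgue_on K. \<tau> x = \<sigma> K x)"
    and 2: "\<forall>K\<in>T. \<forall>K'\<in>T. \<forall>a. a extreme_point_of K \<and> a extreme_point_of K' \<longrightarrow> \<sigma> K a = \<sigma> K' a"
    and 3: "\<forall>K\<in>T. \<forall>K'\<in>T. \<forall>e. e edge_of K \<and> e edge_of K' \<longrightarrow>
        (\<forall>q\<in>Pk 1 e. edge_inner e (\<lambda>x. n e \<bullet> (\<sigma> K x *v n e)) q = edge_inner e (\<lambda>x. n e \<bullet> (\<sigma> K' x *v n e)) q) \<and>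
        (\<forall>q\<in>Pk 0 e. edge_inner e (\<lambda>x. t e \<bullet> (\<sigma> K x *v n e)) q = edge_inner e (\<lambda>x. t e \<bullet> (\<sigma> K' x *v n e)) q)"
    using assms unfolding Sigma_h_def mem_Collect_eq by (elim conjE exE)
  have "sigma_family \<sigma>" unfolding sigma_family_def using 1 by (intro conjI 2 3) simp
  then show ?thesis by (rule that) (use 1 in simp)
qed

lemma continuous_on_matrix: 
  fixes \<sigma> :: "pt \<Rightarrow> real^2^2"
  assumes "\<sigma> \<in> Pk k UNIV"
  shows "continuous_on UNIV \<sigma>"
proof -
  have "continuous_on UNIV (\<lambda>x. \<chi> i j. \<sigma> x $ i $ j)"
    by (intro continuous_on_vec_lambda Pk_continuous_on[OF Pk_entry[OF assms]])
  then show ?thesis by simp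
qed

lemma sigma_family_Sigma_h:
  assumes s: "sigma_family \<sigma>" and \<tau>: "\<And>K. K \<in> T \<Longrightarrow> AE x in lebesgue_on K. \<tau> x = \<sigma> K x"
  shows "\<tau> \<in> Sigma_h n t \<Omega> T"
    and "(\<And>K. K \<in> T \<Longrightarrow> AE x in lebesgue_on K. q x = div_field (\<sigma> K) x) \<Longrightarrow> weak_div \<Omega> \<tau> q"
proof -
  have L: "\<tau> \<in> L2_space \<Omega>" by (rule L2_piecewise[OF continuous_on_matrix[OF sigma_familyD(1)[OF s]] \<tau>])
  have "AE x in lebesgue_on K. transpose (\<tau> x) = \<tau> x" if K: "K \<in> T" for K
    using \<tau>[OF K] by eventually_elim (simp add: sigma_familyD(2)[OF s K])
  then have "AE x in lebesgue_on \<Omega>. transpose (\<tau> x) = \<tau> x" unfolding AE_domain by blast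
  moreover have "\<forall>K\<in>T. \<sigma> K \<in> Sigma_r n t K \<and> (AE x in lebesgue_on K. \<tau> x = \<sigma> K x)"
    using conjunct1[OF s[unfolded sigma_family_def]] \<tau> by simp
  ultimately show "\<tau> \<in> Sigma_h n t \<Omega> T"
    unfolding Sigma_h_def mem_Collect_eq
    by (intro conjI exI[of _ \<sigma>] L conjunct1[OF conjunct2[OF s[unfolded sigma_family_def]]]
      conjunct2[OF conjunct2[OF s[unfolded sigma_family_def]]])
  assume q: "\<And>K. K \<in> T \<Longrightarrow> AE x in lebesgue_on K. q x = div_field (\<sigma> K) x"
  have c: "continuous_on UNIV (div_field (\<sigma> K))" if K: "K \<in> T" for K
  proof -
    have "continuous_on UNIV (\<lambda>x. \<chi> i. div_field (\<sigma> K) x $ i)"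
      by (intro continuous_on_vec_lambda Pk_continuous_on[OF Pk_div_entry[OF sigma_familyD(1)[OF s K]]])
    then show ?thesis by simp
  qed
  show "weak_div \<Omega> \<tau> q"
  proof (rule weak_div_piecewise[where \<sigma> = \<sigma>, OF sigma_familyD(1)[OF s] _ L \<tau> L2_piecewise[OF c q] q])
    show "\<sigma> K x *v n e = \<sigma> K' x *v n e"
      if "K \<in> T" "K' \<in> T" "e edge_of K" "e edge_of K'" "x \<in> e" for K K' e x
      by (rule sigma_family_traction[OF s that])
  qed
qed

end

section \<open>Kernel and range of the Airy operator\<close>

context oriented_mesh
begin

lemma airyp_zero_imp_hessian_zero:
  assumes p: "p \<in> Pk k UNIV" and z: "\<And>x. airyp p x = 0"
  shows "pd i (pd j p) x = 0"
proof -
  have "airyp p x $ 1 $ 1 = 0" "airyp p x $ 1 $ 2 = 0" "airyp p x $ 2 $ 2 = 0" using z by simp_all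
  moreover have "pd 2 (pd 1 p) = pd 1 (pd 2 p)" using Pk_pd_commute[OF p] .
  ultimately show ?thesis using exhaust_2[of i] exhaust_2[of j] by auto
qed

lemma Pk_1_family:
  assumes p: "p \<in> Pk 1 UNIV"
  shows "bell_family (\<lambda>K. p)" "airyp p x = 0"
proof -
  have h: "pd i (pd j p) x = 0" for i j x
  proof -
    have "pd j p \<in> Pk 0 UNIV" using Pk_pd[OF p] by simp
    then obtain c where "pd j p = (\<lambda>x. c)" by (rule Pk_0_const)
    then show ?thesis by simp
  qed
  show "airyp p x = 0" by (simp add: vec_eq_iff forall_2 h)
  have "p \<in> Pk 5 UNIV" by (rule Pk_mono[OF p]) simp
  moreover have "dir_deriv w p \<in> Pk 3 D" for w D
  proof -
    have "dir_deriv w p = dird w p" by (rule ext) (rule dir_deriv_dird[OF Pk_differentiable[OF p]])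
    moreover have "dird w p \<in> Pk 0 UNIV" using Pk_dird[OF p] by simp
    ultimately have "dir_deriv w p \<in> Pk 3 UNIV" using Pk_mono by force
    then show ?thesis by (rule Pk_subset) simp
  qed
  ultimately show "bell_family (\<lambda>K. p)" unfolding bell_family_def Bell_def by simp
qed

text \<open>A vanishing Airy tensor leaves an affine function on each triangle. Affine functions
  with the same value and gradient at a shared vertex coincide, and \<open>vertex_connected\<close>
  spreads this over the mesh.\<close>

lemma airy_kernel: "{v \<in> Wh n \<Omega> T. weak_airy \<Omega> v (\<lambda>x. 0)} = P1_space \<Omega>"
proof (intro subset_antisym subsetI)
  fix v assume "v \<in> P1_space \<Omega>"
  then obtain p where p: "p \<in> Pk 1 UNIV" "AE x in lebesgue_on \<Omega>. v x = p x" unfolding P1_space_def by blast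
  have "AE x in lebesgue_on K. v x = p x" if "K \<in> T" for K using p(2) that unfolding AE_domain by blast
  note a = airy_bell_family[OF Pk_1_family(1)[OF p(1)] this]
  have "weak_airy \<Omega> v (\<lambda>x. 0)" by (subst a(2)) (simp_all add: Pk_1_family(2)[OF p(1)])
  moreover have "v \<in> Wh n \<Omega> T" by (rule a(1))
  ultimately show "v \<in> {v \<in> Wh n \<Omega> T. weak_airy \<Omega> v (\<lambda>x. 0)}" by simp
next
  fix v assume "v \<in> {v \<in> Wh n \<Omega> T. weak_airy \<Omega> v (\<lambda>x. 0)}"
  then have v: "v \<in> Wh n \<Omega> T" "weak_airy \<Omega> v (\<lambda>x. 0)" by auto
  obtain p where p: "bell_family p" "\<And>K. K \<in> T \<Longrightarrow> AE x in lebesgue_on K. v x = p K x" by (rule Wh_bell_family[OF v(1)]) blast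
  note pk = bell_familyD(1)[OF p(1)]
  have ae: "AE x in lebesgue_on K. 0 = airyp (p K) x" if K: "K \<in> T" for K
  proof -
    have "weak_airy \<Omega> v (\<lambda>x. 0) \<longleftrightarrow> (\<forall>K\<in>T. AE x in lebesgue_on K. 0 = airyp (p K) x)"
      by (rule airy_bell_family(2)[OF p])
    then show ?thesis using v(2) K by simp
  qed
  have z: "airyp (p K) x = 0" if K: "K \<in> T" for K x
  proof -
    have "airyp (p K) x $ i $ j = 0" for i j
    proof (rule Pk_AE_zero[OF K Pk_entry[OF Pk_airyp[OF pk[OF K]]]])
      show "AE x in lebesgue_on K. airyp (p K) x $ i $ j = 0" using ae[OF K] by eventually_elim (metis zero_index)
    qed
    then show ?thesis by (simp add: vec_eq_iff)
  qed
  have aff: "p K x = p K a + (x $ 1 - a $ 1) * pd 1 (p K) a + (x $ 2 - a $ 2) * pd 2 (p K) a" if K: "K \<in> T" for K x a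
    by (rule Pk_hessian_zero_imp_affine[OF pk[OF K] airyp_zero_imp_hessian_zero[OF pk[OF K] z[OF K]]])
  have eq: "p K = p K'" if K: "K \<in> T" "K' \<in> T" for K K'
  proof (rule vertex_connected[of p, OF _ K])
    fix K K' a assume K: "K \<in> T" "K' \<in> T" "a extreme_point_of K" "a extreme_point_of K'"
    show "p K = p K'"
    proof
      fix x show "p K x = p K' x"
        unfolding aff[OF K(1), of x a] aff[OF K(2), of x a]
        using bell_familyD(3)[OF p(1) K] bell_familyD(4)[OF p(1) K] by simp
    qed
  qed
  show "v \<in> P1_space \<Omega>"
  proof (cases "T = {}")
    case True
    have "(\<lambda>x. 0) \<in> Pk 1 UNIV" by (rule Pk_const)
    moreover have "AE x in lebesgue_on \<Omega>. v x = 0" unfolding AE_domain using True by simp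
    ultimately show ?thesis unfolding P1_space_def mem_Collect_eq by (intro bexI[of _ "\<lambda>x. 0"])
  next
    case False
    then obtain K where K: "K \<in> T" by blast
    have "p K = (\<lambda>x. p K 0 + (pd 1 (p K) 0 * x $ 1 + pd 2 (p K) 0 * x $ 2))"
      by (rule ext, rule trans[OF aff[OF K, of _ 0]]) (simp add: algebra_simps)
    also have "\<dots> \<in> Pk 1 UNIV" by (intro Pk_add Pk_const Pk_cmult Pk_coord) auto
    finally have "p K \<in> Pk 1 UNIV" .
    moreover have "AE x in lebesgue_on K'. v x = p K x" if "K' \<in> T" for K' using p(2)[OF that] unfolding eq[OF K that] .
    then have "AE x in lebesgue_on \<Omega>. v x = p K x" unfolding AE_domain by blast
    ultimately show ?thesis unfolding P1_space_def mem_Collect_eq by (intro bexI[of _ "p K"])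
  qed
qed

text \<open>The rows of a symmetric divergence-free tensor become curl-free when turned by a right
  angle. Their potentials \<open>G1\<close> and \<open>G2\<close> are the future partial
  derivatives. Their constants are adjusted by \<open>global_potential\<close> before the second
  integration, and a third use of it glues the functions themselves.\<close>

lemma sigma_family_potential:
  assumes s: "sigma_family \<sigma>" and dz: "\<And>K x. K \<in> T \<Longrightarrow> div_field (\<sigma> K) x = 0"
  obtains p where "bell_family p" "\<And>K x. K \<in> T \<Longrightarrow> airyp (p K) x = \<sigma> K x"
proof -
  note sk = sigma_familyD(1)[OF s]
  have sym: "\<sigma> K x $ 2 $ 1 = \<sigma> K x $ 1 $ 2" if K: "K \<in> T" for K x
    using arg_cong[OF sigma_familyD(2)[OF s K, of x], of "\<lambda>m. m $ 1 $ 2"] by (simp add: transpose_def)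
  have dz1: "pd 1 (\<lambda>x. \<sigma> K x $ 1 $ 1) x + pd 2 (\<lambda>x. \<sigma> K x $ 1 $ 2) x = 0" 
    and dz2: "pd 1 (\<lambda>x. \<sigma> K x $ 1 $ 2) x + pd 2 (\<lambda>x. \<sigma> K x $ 2 $ 2) x = 0" if K: "K \<in> T" for K x
    using arg_cong[OF dz[OF K, of x], of "\<lambda>m. m $ 1"] arg_cong[OF dz[OF K, of x], of "\<lambda>m. m $ 2"]
    by (simp_all add: div_field_nth sym[OF K])
  define P where "P K G \<longleftrightarrow> fst G \<in> Pk 4 UNIV \<and> snd G \<in> Pk 4 UNIV \<and> pd 1 (fst G) = (\<lambda>x. \<sigma> K x $ 2 $ 2) \<and> pd 2 (fst G) = (\<lambda>x. - \<sigma> K x $ 1 $ 2) \<and>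
      pd 1 (snd G) = (\<lambda>x. - \<sigma> K x $ 1 $ 2) \<and> pd 2 (snd G) = (\<lambda>x. \<sigma> K x $ 1 $ 1)" for K G
  have "\<exists>G. P K G" if K: "K \<in> T" for K
  proof -
    note e = Pk_entry[OF sk[OF K]]
    have c1: "pd 2 (\<lambda>x. \<sigma> K x $ 2 $ 2) x = pd 1 (\<lambda>x. - \<sigma> K x $ 1 $ 2) x"
      and c2: "pd 2 (\<lambda>x. - \<sigma> K x $ 1 $ 2) x = pd 1 (\<lambda>x. \<sigma> K x $ 1 $ 1) x" for x
      using dz1[OF K, of x] dz2[OF K, of x] by (simp_all add: pd_uminus[OF Pk_differentiable[OF e]])
    obtain g1 where g1: "g1 \<in> Pk (Suc 3) UNIV" "pd 1 g1 = (\<lambda>x. \<sigma> K x $ 2 $ 2)" "pd 2 g1 = (\<lambda>x. - \<sigma> K x $ 1 $ 2)"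
      by (rule Pk_potential[OF e Pk_uminus[OF e] c1])
    obtain g2 where g2: "g2 \<in> Pk (Suc 3) UNIV" "pd 1 g2 = (\<lambda>x. - \<sigma> K x $ 1 $ 2)" "pd 2 g2 = (\<lambda>x. \<sigma> K x $ 1 $ 1)"
      by (rule Pk_potential[OF Pk_uminus[OF e] e c2])
    show ?thesis unfolding P_def using g1 g2 by (intro exI[of _ "(g1, g2)"]) simp
  qed
  then have "\<forall>K\<in>T. \<exists>G. P K G" by blast
  then obtain G where G0: "\<forall>K\<in>T. P K (G K)" by (drule_tac bchoice) (elim exE)
  define G1 G2 where "G1 K = fst (G K)" and "G2 K = snd (G K)" for K
  have G: "\<And>K. K \<in> T \<Longrightarrow> G1 K \<in> Pk 4 UNIV" "\<And>K. K \<in> T \<Longrightarrow> G2 K \<in> Pk 4 UNIV"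
    "\<And>K. K \<in> T \<Longrightarrow> pd 1 (G1 K) = (\<lambda>x. \<sigma> K x $ 2 $ 2)" "\<And>K. K \<in> T \<Longrightarrow> pd 2 (G1 K) = (\<lambda>x. - \<sigma> K x $ 1 $ 2)"
    "\<And>K. K \<in> T \<Longrightarrow> pd 1 (G2 K) = (\<lambda>x. - \<sigma> K x $ 1 $ 2)" "\<And>K. K \<in> T \<Longrightarrow> pd 2 (G2 K) = (\<lambda>x. \<sigma> K x $ 1 $ 1)"
    using G0 by (simp_all add: P_def G1_def G2_def)
  \<comment> \<open>The derivatives of \<open>G1\<close> and \<open>G2\<close> along a shared edge,
    expressed by \<open>\<sigma>\<close>; their agreement is the continuity of the traction, turned
    by a right angle.\<close>
  have tan: "(b - a) $ 1 * \<sigma> K x $ 2 $ 2 - (b - a) $ 2 * \<sigma> K x $ 1 $ 2 = (b - a) $ 1 * \<sigma> K' x $ 2 $ 2 - (b - a) $ 2 * \<sigma> K' x $ 1 $ 2"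
      "(b - a) $ 1 * \<sigma> K x $ 1 $ 2 - (b - a) $ 2 * \<sigma> K x $ 1 $ 1 = (b - a) $ 1 * \<sigma> K' x $ 1 $ 2 - (b - a) $ 2 * \<sigma> K' x $ 1 $ 1"
    if K: "K \<in> T" "K' \<in> T" "e edge_of K" "e edge_of K'" and x: "x \<in> e" and ab: "a \<in> e" "b \<in> e" for K K' e x a b
  proof -
    have un: "norm (n e) = 1" "n e \<bullet> (b - a) = 0" using normal[OF K(1,3)] ab unfolding unit_normal_def by auto
    then have ne: "n e \<noteq> 0" and nb: "(b - a) $ 1 * n e $ 1 + (b - a) $ 2 * n e $ 2 = 0"
      by (auto simp: inner_vec_def sum_2 algebra_simps)
    have tr: "\<sigma> K x *v n e = \<sigma> K' x *v n e" by (rule sigma_family_traction[OF s K x])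
    have "n e $ 1 * (\<sigma> K x $ 1 $ 2 - \<sigma> K' x $ 1 $ 2) + n e $ 2 * (\<sigma> K x $ 2 $ 2 - \<sigma> K' x $ 2 $ 2) = 0"
      using arg_cong[OF tr, of "\<lambda>v. v $ 2"] by (simp add: matrix_vector_mult_def sum_2 sym[OF K(1)] sym[OF K(2)] algebra_simps)
    from rotate_orthogonal[OF ne nb this]
    show "(b - a) $ 1 * \<sigma> K x $ 2 $ 2 - (b - a) $ 2 * \<sigma> K x $ 1 $ 2 = (b - a) $ 1 * \<sigma> K' x $ 2 $ 2 - (b - a) $ 2 * \<sigma> K' x $ 1 $ 2"
      by (simp add: algebra_simps)
    have "n e $ 1 * (\<sigma> K x $ 1 $ 1 - \<sigma> K' x $ 1 $ 1) + n e $ 2 * (\<sigma> K x $ 1 $ 2 - \<sigma> K' x $ 1 $ 2) = 0"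
      using arg_cong[OF tr, of "\<lambda>v. v $ 1"] by (simp add: matrix_vector_mult_def sum_2 algebra_simps)
    from rotate_orthogonal[OF ne nb this]
    show "(b - a) $ 1 * \<sigma> K x $ 1 $ 2 - (b - a) $ 2 * \<sigma> K x $ 1 $ 1 = (b - a) $ 1 * \<sigma> K' x $ 1 $ 2 - (b - a) $ 2 * \<sigma> K' x $ 1 $ 1"
      by (simp add: algebra_simps)
  qed
  have "\<exists>c. \<forall>K\<in>T. \<forall>K'\<in>T. \<forall>e x. e edge_of K \<longrightarrow> e edge_of K' \<longrightarrow> x \<in> e \<longrightarrow> G1 K x + c K = G1 K' x + c K'"
    (is "\<exists>c. ?P c")
  proof (rule global_potential)
    show "C1 (G1 K)" if "K \<in> T" for K using C1_Pk[OF G(1)[OF that]] .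
    fix K K' e x a b assume K: "K \<in> T" "K' \<in> T" "e edge_of K" "e edge_of K'" "x \<in> e" "a \<in> e" "b \<in> e"
    show "(b - a) $ 1 * pd 1 (G1 K) x + (b - a) $ 2 * pd 2 (G1 K) x = (b - a) $ 1 * pd 1 (G1 K') x + (b - a) $ 2 * pd 2 (G1 K') x"
      using tan(1)[OF K] by (simp add: G K)
  qed
  then obtain c1 where "?P c1" by (elim exE)
  note c1 = this[rule_format]
  have "\<exists>c. \<forall>K\<in>T. \<forall>K'\<in>T. \<forall>e x. e edge_of K \<longrightarrow> e edge_of K' \<longrightarrow> x \<in> e \<longrightarrow> G2 K x + c K = G2 K' x + c K'"
    (is "\<exists>c. ?P c")
  proof (rule global_potential)
    show "C1 (G2 K)" if "K \<in> T" for K using C1_Pk[OF G(2)[OF that]] .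
    fix K K' e x a b assume K: "K \<in> T" "K' \<in> T" "e edge_of K" "e edge_of K'" "x \<in> e" "a \<in> e" "b \<in> e"
    show "(b - a) $ 1 * pd 1 (G2 K) x + (b - a) $ 2 * pd 2 (G2 K) x = (b - a) $ 1 * pd 1 (G2 K') x + (b - a) $ 2 * pd 2 (G2 K') x"
      using tan(2)[OF K] by (simp add: G K)
  qed
  then obtain c2 where "?P c2" by (elim exE)
  note c2 = this[rule_format]
  define g1 g2 where "g1 K x = G1 K x + c1 K" and "g2 K x = G2 K x + c2 K" for K x
  have g: "g1 K \<in> Pk 4 UNIV" "g2 K \<in> Pk 4 UNIV" if "K \<in> T" for K
    unfolding g1_def[abs_def] g2_def[abs_def] by (intro Pk_add Pk_const G that)+
  have dg: "pd i (g1 K) = pd i (G1 K)" "pd i (g2 K) = pd i (G2 K)" if K: "K \<in> T" for K i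
    unfolding g1_def[abs_def] g2_def[abs_def]
    by (rule ext, simp add: pd_add[OF Pk_differentiable[OF G(1)[OF K]]] pd_add[OF Pk_differentiable[OF G(2)[OF K]]])+
  have "\<exists>q. q \<in> Pk 5 UNIV \<and> pd 1 q = g1 K \<and> pd 2 q = g2 K" if K: "K \<in> T" for K
  proof -
    \<comment> \<open>Both sides are \<open>- \<sigma> K x $ 1 $ 2\<close>, thanks to the symmetry
      of \<open>\<sigma>\<close>.\<close>
    have c: "pd 2 (g1 K) x = pd 1 (g2 K) x" for x by (simp add: dg G K)
    obtain q where "q \<in> Pk (Suc 4) UNIV" "pd 1 q = g1 K" "pd 2 q = g2 K"
      by (rule Pk_potential[OF g[OF K] c])
    then show ?thesis by (intro exI[of _ q]) simp
  qed
  then have "\<forall>K\<in>T. \<exists>q. q \<in> Pk 5 UNIV \<and> pd 1 q = g1 K \<and> pd 2 q = g2 K" by blast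
  then obtain Q where Q0: "\<forall>K\<in>T. Q K \<in> Pk 5 UNIV \<and> pd 1 (Q K) = g1 K \<and> pd 2 (Q K) = g2 K"
    by (drule_tac bchoice) (elim exE)
  have Q: "\<And>K. K \<in> T \<Longrightarrow> Q K \<in> Pk 5 UNIV" "\<And>K. K \<in> T \<Longrightarrow> pd 1 (Q K) = g1 K" "\<And>K. K \<in> T \<Longrightarrow> pd 2 (Q K) = g2 K"
    using Q0 by simp_all
  have gm: "g1 K x = g1 K' x" "g2 K x = g2 K' x" if "K \<in> T" "K' \<in> T" "e edge_of K" "e edge_of K'" "x \<in> e" for K K' e x
    unfolding g1_def g2_def by (rule c1[OF that] c2[OF that])+
  have "\<exists>c. \<forall>K\<in>T. \<forall>K'\<in>T. \<forall>e x. e edge_of K \<longrightarrow> e edge_of K' \<longrightarrow> x \<in> e \<longrightarrow> Q K x + c K = Q K' x + c K'"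
    (is "\<exists>c. ?P c")
  proof (rule global_potential)
    show "C1 (Q K)" if "K \<in> T" for K using C1_Pk[OF Q(1)[OF that]] .
    fix K K' e x a b assume K: "K \<in> T" "K' \<in> T" "e edge_of K" "e edge_of K'" "x \<in> e" "a \<in> e" "b \<in> e"
    show "(b - a) $ 1 * pd 1 (Q K) x + (b - a) $ 2 * pd 2 (Q K) x = (b - a) $ 1 * pd 1 (Q K') x + (b - a) $ 2 * pd 2 (Q K') x"
      using gm[OF K(1-5)] by (simp add: Q K)
  qed
  then obtain c where "?P c" by (elim exE)
  note c = this[rule_format]
  define p where "p K x = Q K x + c K" for K x
  have pk: "p K \<in> Pk 5 UNIV" if "K \<in> T" for K unfolding p_def[abs_def] by (intro Pk_add Pk_const Q that)
  have dp: "pd 1 (p K) = g1 K" "pd 2 (p K) = g2 K" if K: "K \<in> T" for K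
    unfolding p_def[abs_def]
    by (rule ext, simp add: pd_add[OF Pk_differentiable[OF Q(1)[OF K]]] Q K)+
  have ap: "airyp (p K) x = \<sigma> K x" if K: "K \<in> T" for K x
    by (simp add: vec_eq_iff forall_2 dp dg G K sym)
  \<comment> \<open>Triangles that share only a vertex are compared along a chain of edges through
    it.\<close>
  have star: "F K a = F K' a"
    if F: "\<And>K K' e x. K \<in> T \<Longrightarrow> K' \<in> T \<Longrightarrow> e edge_of K \<Longrightarrow> e edge_of K' \<Longrightarrow> x \<in> e \<Longrightarrow> F K x = F K' x"
      and K: "K \<in> T" "K' \<in> T" "a extreme_point_of K" "a extreme_point_of K'" for F :: "pt set \<Rightarrow> pt \<Rightarrow> real" and K K' a
  proof -
    have "a \<in> K'" using K(4) by (simp add: extreme_point_of_def)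
    then have "(link a)\<^sup>*\<^sup>* K K'" using star_connected K by blast
    then show ?thesis
    proof (induction rule: rtranclp_induct)
      case (step L L')
      then obtain e where "L \<in> T" "L' \<in> T" "e edge_of L" "e edge_of L'" "a \<in> e" unfolding link_def by blast
      then have "F L a = F L' a" by (rule F)
      then show ?case using step.IH by simp
    qed simp
  qed
  have "bell_family p"
    unfolding bell_family_def
  proof (intro conjI ballI allI impI)
    fix K assume K: "K \<in> T"
    have "dir_deriv (n e) (p K) \<in> Pk 3 e" if e: "e edge_of K" for e
    proof -
      obtain a b where ab: "a \<noteq> b" "e = closed_segment a b" by (rule edge_imp_segment[OF e simplex_T[OF K]])
      show ?thesis
        using Bell_airyp[OF pk[OF K] ab(1) normal[OF K e, unfolded ab(2)] tangent[OF K e, unfolded ab(2)]]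
          sigma_familyD(4)[OF s K e] unfolding ab(2)[symmetric] ap[OF K] by blast
    qed
    then show "p K \<in> Bell n K" unfolding Bell_def using pk[OF K] by simp
  next
    fix K K' a assume "K \<in> T" "K' \<in> T" "a extreme_point_of K \<and> a extreme_point_of K'"
    then have K: "K \<in> T" "K' \<in> T" "a extreme_point_of K" "a extreme_point_of K'" by auto
    show "p K a = p K' a" by (rule star[OF _ K]) (unfold p_def, rule c)
    have "g1 K a = g1 K' a" by (rule star[OF gm(1) K])
    moreover have "g2 K a = g2 K' a" by (rule star[OF gm(2) K])
    ultimately show "pd i (p K) a = pd i (p K') a" for i using exhaust_2[of i] by (auto simp: dp K)
    \<comment> \<open>Second derivatives are entries of \<open>\<sigma>\<close> up to sign, and
      these are single-valued at vertices.\<close>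
    show "pd i (pd j (p K)) a = pd i (pd j (p K')) a" for i j
      using exhaust_2[of i] exhaust_2[of j] sigma_familyD(5)[OF s K] by (auto simp: dp dg G K)
  qed
  then show ?thesis using ap that by blast
qed

lemma div_bell_family:
  assumes "bell_family p" "K \<in> T"
  shows "div_field (airyp (p K)) x = 0"
  by (rule div_airyp[OF bell_familyD(1)[OF assms]])

lemma Pk_div_AE_zero:
  assumes K: "K \<in> T" and s: "\<sigma> \<in> Pk k UNIV" and z: "AE x in lebesgue_on K. 0 = div_field \<sigma> x"
  shows "div_field \<sigma> x = 0"
proof -
  have "div_field \<sigma> x $ i = 0" for i
  proof (rule Pk_AE_zero[OF K Pk_div_entry[OF s]])
    show "AE x in lebesgue_on K. div_field \<sigma> x $ i = 0" using z by eventually_elim (metis zero_index)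
  qed
  then show ?thesis by (simp add: vec_eq_iff)
qed

lemma airy_range: "{\<tau>. \<exists>v\<in>Wh n \<Omega> T. weak_airy \<Omega> v \<tau>} = {\<tau> \<in> Sigma_h n t \<Omega> T. weak_div \<Omega> \<tau> (\<lambda>x. 0)}"
proof (intro subset_antisym subsetI)
  fix \<tau> assume "\<tau> \<in> {\<tau>. \<exists>v\<in>Wh n \<Omega> T. weak_airy \<Omega> v \<tau>}"
  then obtain v where v: "v \<in> Wh n \<Omega> T" "weak_airy \<Omega> v \<tau>" by auto
  obtain p where p: "bell_family p" "\<And>K. K \<in> T \<Longrightarrow> AE x in lebesgue_on K. v x = p K x" by (rule Wh_bell_family[OF v(1)]) blast
  have ae: "AE x in lebesgue_on K. \<tau> x = airyp (p K) x" if K: "K \<in> T" for K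
  proof -
    have "weak_airy \<Omega> v \<tau> \<longleftrightarrow> (\<forall>K\<in>T. AE x in lebesgue_on K. \<tau> x = airyp (p K) x)"
      by (rule airy_bell_family(2)[OF p])
    then show ?thesis using v(2) K by simp
  qed
  note sh = sigma_family_Sigma_h[where \<sigma> = "\<lambda>K. airyp (p K)", OF airyp_sigma_family[OF p(1)] ae]
  have "\<tau> \<in> Sigma_h n t \<Omega> T" by (rule sh(1))
  moreover have "weak_div \<Omega> \<tau> (\<lambda>x. 0)" by (rule sh(2)) (simp_all add: div_bell_family[OF p(1)])
  ultimately show "\<tau> \<in> {\<tau> \<in> Sigma_h n t \<Omega> T. weak_div \<Omega> \<tau> (\<lambda>x. 0)}" by simp
next
  fix \<tau> assume "\<tau> \<in> {\<tau> \<in> Sigma_h n t \<Omega> T. weak_div \<Omega> \<tau> (\<lambda>x. 0)}"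
  then have t: "\<tau> \<in> Sigma_h n t \<Omega> T" "weak_div \<Omega> \<tau> (\<lambda>x. 0)" by auto
  obtain \<sigma> where s: "sigma_family \<sigma>" "\<And>K. K \<in> T \<Longrightarrow> AE x in lebesgue_on K. \<tau> x = \<sigma> K x"
    by (rule Sigma_h_sigma_family[OF t(1)]) blast
  have dz: "div_field (\<sigma> K) x = 0" if K: "K \<in> T" for K x
    by (rule Pk_div_AE_zero[OF K sigma_familyD(1)[OF s(1) K] weak_div_on_triangle[OF K sigma_familyD(1)[OF s(1) K] s(2)[OF K] t(2)]])
  obtain p where p: "bell_family p" "\<And>K x. K \<in> T \<Longrightarrow> airyp (p K) x = \<sigma> K x"
    by (rule sigma_family_potential[OF s(1) dz]) blast+
  note a = airy_bell_family[OF p(1) pw_AE]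
  have "pw p \<in> Wh n \<Omega> T" by (rule a(1))
  moreover have "weak_airy \<Omega> (pw p) \<tau>" using s(2) by (subst a(2)) (simp_all add: p(2))
  ultimately show "\<tau> \<in> {\<tau>. \<exists>v\<in>Wh n \<Omega> T. weak_airy \<Omega> v \<tau>}" by blast
qed

lemma weak_airy_exists: "v \<in> Wh n \<Omega> T \<Longrightarrow> \<exists>\<tau>. weak_airy \<Omega> v \<tau>"
proof -
  assume "v \<in> Wh n \<Omega> T"
  then obtain p where p: "bell_family p" "\<And>K. K \<in> T \<Longrightarrow> AE x in lebesgue_on K. v x = p K x" by (rule Wh_bell_family) blast
  have "weak_airy \<Omega> v (pw (\<lambda>K. airyp (p K)))"
    by (rule iffD2[OF airy_bell_family(2)[OF p] ballI[OF pw_AE]])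
  then show ?thesis by blast
qed

lemma weak_div_exists: "\<tau> \<in> Sigma_h n t \<Omega> T \<Longrightarrow> \<exists>q. weak_div \<Omega> \<tau> q"
proof -
  assume "\<tau> \<in> Sigma_h n t \<Omega> T"
  then obtain \<sigma> where s: "sigma_family \<sigma>" "\<And>K. K \<in> T \<Longrightarrow> AE x in lebesgue_on K. \<tau> x = \<sigma> K x"
    by (rule Sigma_h_sigma_family) blast
  have "weak_div \<Omega> \<tau> (pw (\<lambda>K. div_field (\<sigma> K)))" by (rule sigma_family_Sigma_h(2)[OF s pw_AE])
  then show ?thesis by blast
qed

lemma weak_div_in_Vh:
  assumes t: "\<tau> \<in> Sigma_h n t \<Omega> T" and w: "weak_div \<Omega> \<tau> q"
  shows "q \<in> Vh \<Omega> T"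
proof -
  obtain \<sigma> where s: "sigma_family \<sigma>" "\<And>K. K \<in> T \<Longrightarrow> AE x in lebesgue_on K. \<tau> x = \<sigma> K x"
    by (rule Sigma_h_sigma_family[OF t]) blast
  have "\<exists>r\<in>RM. AE x in lebesgue_on K. q x = r x" if K: "K \<in> T" for K
    using weak_div_on_triangle[OF K sigma_familyD(1)[OF s(1) K] s(2)[OF K] w] sigma_familyD(3)[OF s(1) K] by blast
  moreover have "q \<in> L2_space \<Omega>" using w unfolding weak_div_def by (elim conjE)
  ultimately show ?thesis unfolding Vh_def by simp
qed

end

section \<open>Rigid motions\<close>

definition rot :: "pt \<Rightarrow> pt" where
  "rot x = vector [x $ 2, - (x $ 1)]"

lemma rot_nth [simp]: "rot x $ 1 = x $ 2" "rot x $ 2 = - x $ 1"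
  by (simp_all add: rot_def)

lemma rot_linear: "rot (x + y) = rot x + rot y" "rot (s *\<^sub>R x) = s *\<^sub>R rot x"
  by (simp_all add: vec_eq_iff forall_2)

lemma RM_iff: "f \<in> RM \<longleftrightarrow> (\<exists>a b. f = (\<lambda>x. a + b *\<^sub>R rot x))"
  by (auto simp: RM_def rot_def)

lemma Pk_RM: "r \<in> RM \<Longrightarrow> (\<lambda>x. r x $ i) \<in> Pk 1 D"
proof -
  assume "r \<in> RM"
  then obtain a b where r: "r = (\<lambda>x. a + b *\<^sub>R rot x)" unfolding RM_iff by blast
  show ?thesis unfolding r using exhaust_2[of i]
    by (auto intro!: Pk_add Pk_const Pk_cmult Pk_coord Pk_uminus)
qed

lemma RM_diff: "r \<in> RM \<Longrightarrow> r' \<in> RM \<Longrightarrow> (\<lambda>x. r x - r' x) \<in> RM"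
  unfolding RM_iff
proof (elim exE)
  fix a b a' b' assume "r = (\<lambda>x. a + b *\<^sub>R rot x)" "r' = (\<lambda>x. a' + b' *\<^sub>R rot x)"
  then have "(\<lambda>x. r x - r' x) = (\<lambda>x. (a - a') + (b - b') *\<^sub>R rot x)" by (auto simp: algebra_simps)
  then show "\<exists>a b. (\<lambda>x. r x - r' x) = (\<lambda>x. a + b *\<^sub>R rot x)" by blast
qed

lemma Pk_bary: "1 \<le> k \<Longrightarrow> bary a b c \<in> Pk k D"
proof -
  assume k: "1 \<le> k"
  have "bary a b c = (\<lambda>x. (1 / cr (b - a) (c - a)) * ((b - a) $ 1 * (x $ 2 - a $ 2) - (b - a) $ 2 * (x $ 1 - a $ 1)))"
    by (rule ext) (simp add: bary_def cr_def)
  then show ?thesis by (simp only:) (intro Pk_cmult Pk_diff Pk_coord k Pk_const)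
qed

text \<open>Bubbles are differentiated through their barycentric coordinates, which are affine in
  \<open>s\<close> along a line, and not through their Cartesian form.\<close>

lemma dird_eqI:
  assumes f: "f \<in> Pk k UNIV" and d: "((\<lambda>s. f (x + s *\<^sub>R m)) has_real_derivative D) (at 0)"
  shows "dird m f x = D"
proof (rule DERIV_unique[OF _ d])
  have l: "linepath x (x + m) s = x + s *\<^sub>R m" for s by (simp add: linepath_def algebra_simps)
  show "((\<lambda>s. f (x + s *\<^sub>R m)) has_real_derivative dird m f x) (at 0)"
    using linepath_chain[OF Pk_differentiable[OF f], of x "x + m" 0 UNIV] unfolding l dird_def by simp
qed

subsection \<open>Quadratics and bubbles in affine coordinates\<close>

lemma Pk_2_affine_coords:
  fixes f :: "pt \<Rightarrow> real"
  assumes "f \<in> Pk 2 UNIV"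
  obtains p0 p1 p2 p3 p4 p5 where
    "\<And>X Y. f (a + X *\<^sub>R u + Y *\<^sub>R v) = p0 + p1 * X + p2 * Y + p3 * X * X + p4 * X * Y + p5 * Y * Y"
proof -
  obtain c where f: "f = (\<lambda>x. \<Sum>i\<le>2. \<Sum>j\<le>2 - i. (x $ 1) ^ i * (x $ 2) ^ j * c i j)"
    by (rule Pk_UNIV_E[OF assms])
  define g where "g x y = c 0 0 + c 1 0 * x + c 0 1 * y + c 2 0 * x * x + c 1 1 * x * y + c 0 2 * y * y" for x y :: real
  have fg: "f x = g (x $ 1) (x $ 2)" for x
    unfolding f g_def by (simp add: numeral_2_eq_2 algebra_simps)
  let ?a = "a $ 1" and ?b = "a $ 2" and ?u = "u $ 1" and ?w = "u $ 2" and ?v = "v $ 1" and ?z = "v $ 2"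
  have "f (a + X *\<^sub>R u + Y *\<^sub>R v) = g ?a ?b +
      (c 1 0 * ?u + c 0 1 * ?w + 2 * c 2 0 * ?a * ?u + c 1 1 * (?a * ?w + ?b * ?u) + 2 * c 0 2 * ?b * ?w) * X +
      (c 1 0 * ?v + c 0 1 * ?z + 2 * c 2 0 * ?a * ?v + c 1 1 * (?a * ?z + ?b * ?v) + 2 * c 0 2 * ?b * ?z) * Y +
      (c 2 0 * ?u * ?u + c 1 1 * ?u * ?w + c 0 2 * ?w * ?w) * X * X +
      (2 * c 2 0 * ?u * ?v + c 1 1 * (?u * ?z + ?v * ?w) + 2 * c 0 2 * ?w * ?z) * X * Y +
      (c 2 0 * ?v * ?v + c 1 1 * ?v * ?z + c 0 2 * ?z * ?z) * Y * Y" for X Y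
    unfolding fg g_def by (simp add: algebra_simps)
  then show ?thesis by (rule that)
qed

text \<open>The hypothesis expresses orthogonality of \<open>p u + q v\<close>, up to constants, to the rotation of
  the reference triangle; the coefficients solve the resulting linear system.\<close>

lemma bubble_coefficients:
  fixes p0 :: real
  assumes "- p1 + 2 * p2 - 4/5 * p3 + 1/5 * p4 + 8/5 * p5 - 2 * q1 + q2 - 8/5 * q3 - 1/5 * q4 + 4/5 * q5 = 0"
  obtains a0 a1 a2 b0 b1 b2 c0 c1 c2 k1 k2 where
    "\<And>X Y. p0 + p1 * X + p2 * Y + p3 * X * X + p4 * X * Y + p5 * Y * Y =
       k1 + ((1 - 2 * X - Y) * (a0 + a1 * X + a2 * Y) + X * (1 - X - Y) * a1) - ((X - Y) * (c0 + c1 * X + c2 * Y) + X * Y * (c2 - c1))"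
    "\<And>X Y. q0 + q1 * X + q2 * Y + q3 * X * X + q4 * X * Y + q5 * Y * Y =
       k2 + ((1 - X - 2 * Y) * (b0 + b1 * X + b2 * Y) + Y * (1 - X - Y) * b2) + ((X - Y) * (c0 + c1 * X + c2 * Y) + X * Y * (c2 - c1))"
proof -
  \<comment> \<open>Nine unknown coefficients face ten nonconstant ones on the left-hand sides; the
    hypothesis expresses one of these, \<open>q2\<close>, by the others.\<close>
  have q2: "q2 = p1 - 2 * p2 + 4/5 * p3 - 1/5 * p4 - 8/5 * p5 + 2 * q1 + 8/5 * q3 + 1/5 * q4 - 4/5 * q5"
    using assms by (simp add: field_simps)
  define a0 a1 a2 b0 b1 b2 c0 c1 c2 where
    "a0 = -1/3*p1 + -1/3*p2 + -1/6*p3 + -1/12*p4 + -1/6*p5" and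
    "a1 = -2/5*p3 + 1/10*p4 + -1/5*p5 + -3/10*q3 + 3/20*q4 + -1/10*q5" and
    "a2 = 3/10*p3 + -9/20*p4 + -1/10*p5 + 3/5*q3 + -3/10*q4 + 1/5*q5" and
    "b0 = -1/3*p1 + 2/3*p2 + -4/15*p3 + 1/15*p4 + 8/15*p5 + -1*q1 + -7/10*q3 + -3/20*q4 + 1/10*q5" and
    "b1 = 1/5*p3 + -3/10*p4 + 3/5*p5 + -1/10*q3 + -9/20*q4 + 3/10*q5" and
    "b2 = -1/10*p3 + 3/20*p4 + -3/10*p5 + -1/5*q3 + 1/10*q4 + -2/5*q5" and
    "c0 = -1/3*p1 + 2/3*p2 + -7/15*p3 + 11/30*p4 + -1/15*p5 + -3/5*q3 + 3/10*q4 + -1/5*q5" and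
    "c1 = 1/5*p3 + -3/10*p4 + 3/5*p5 + 9/10*q3 + -9/20*q4 + 3/10*q5" and
    "c2 = 3/10*p3 + -9/20*p4 + 9/10*p5 + 3/5*q3 + -3/10*q4 + 1/5*q5"
  note defs = this
  show ?thesis
  \<comment> \<open>The constants compensate for what the bubbles contribute at
    \<open>X = Y = 0\<close>, namely \<open>a0\<close> and \<open>b0\<close>.\<close>
  proof (rule that[where ?a0.0 = a0 and ?a1.0 = a1 and ?a2.0 = a2 and ?b0.0 = b0 and ?b1.0 = b1 and ?b2.0 = b2
      and ?c0.0 = c0 and ?c1.0 = c1 and ?c2.0 = c2 and ?k1.0 = "p0 - a0" and ?k2.0 = "q0 - b0"])
    show "p0 + p1 * X + p2 * Y + p3 * X * X + p4 * X * Y + p5 * Y * Y =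
       p0 - a0 + ((1 - 2 * X - Y) * (a0 + a1 * X + a2 * Y) + X * (1 - X - Y) * a1) - ((X - Y) * (c0 + c1 * X + c2 * Y) + X * Y * (c2 - c1))" for X Y
      unfolding defs by (simp add: field_simps)
    show "q0 + q1 * X + q2 * Y + q3 * X * X + q4 * X * Y + q5 * Y * Y =
       q0 - b0 + ((1 - X - 2 * Y) * (b0 + b1 * X + b2 * Y) + Y * (1 - X - Y) * b2) + ((X - Y) * (c0 + c1 * X + c2 * Y) + X * Y * (c2 - c1))" for X Y
      unfolding defs q2 by (simp add: field_simps)
  qed
qed

text \<open>The quarter turn in the basis \<open>u\<close>, \<open>v\<close>, so that rigid motions
  and divergences of bubbles are compared in the same coordinates.\<close>

lemma rot_affine_coords:
  assumes "cr u v \<noteq> 0"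
  shows "rot u = ((u \<bullet> v) / cr u v) *\<^sub>R u + (- (u \<bullet> u) / cr u v) *\<^sub>R v"
    "rot v = ((v \<bullet> v) / cr u v) *\<^sub>R u + (- (u \<bullet> v) / cr u v) *\<^sub>R v"
  using assms by (simp_all add: vec_eq_iff forall_2 inner_vec_def sum_2 divide_simps) (simp_all add: cr_def algebra_simps)

lemma cramer: "cr u v \<noteq> 0 \<Longrightarrow> f = (cr f v / cr u v) *\<^sub>R u + (cr u f / cr u v) *\<^sub>R v"
  by (simp add: vec_eq_iff forall_2 divide_simps) (simp add: cr_def algebra_simps)

lemma bary_move:
  assumes "cr (b - a) (c - a) \<noteq> 0"
  shows "bary c a b (x + s *\<^sub>R (b - a)) = bary c a b x + s" "bary a b c (x + s *\<^sub>R (b - a)) = bary a b c x"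
    "bary c a b (x + s *\<^sub>R (c - a)) = bary c a b x" "bary a b c (x + s *\<^sub>R (c - a)) = bary a b c x + s"
    "bary c a b (x + s *\<^sub>R (c - b)) = bary c a b x - s" "bary a b c (x + s *\<^sub>R (c - b)) = bary a b c x + s"
proof -
  have D: "cr (a - c) (b - c) = cr (b - a) (c - a)" using cr_rot by metis
  have e: "cr (a - c) (s *\<^sub>R (b - a)) = s * cr (b - a) (c - a)" "cr (b - a) (s *\<^sub>R (b - a)) = 0" "cr (a - c) (s *\<^sub>R (c - a)) = 0"
    "cr (b - a) (s *\<^sub>R (c - a)) = s * cr (b - a) (c - a)" "cr (a - c) (s *\<^sub>R (c - b)) = - s * cr (b - a) (c - a)"
    "cr (b - a) (s *\<^sub>R (c - b)) = s * cr (b - a) (c - a)"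
    by (simp_all add: cr_def algebra_simps)
  show "bary c a b (x + s *\<^sub>R (b - a)) = bary c a b x + s" "bary a b c (x + s *\<^sub>R (b - a)) = bary a b c x"
    "bary c a b (x + s *\<^sub>R (c - a)) = bary c a b x" "bary a b c (x + s *\<^sub>R (c - a)) = bary a b c x + s"
    "bary c a b (x + s *\<^sub>R (c - b)) = bary c a b x - s" "bary a b c (x + s *\<^sub>R (c - b)) = bary a b c x + s"
    using assms unfolding bary_diff D e by simp_all
qed

text \<open>The correction is a sum of dyads of the three edge directions. A dyad annihilates the
  normal of its own edge, and its coefficient contains the two barycentric factors that vanish on
  the other edges, so the traction is zero. The divergence of such a term is the derivative of its
  coefficient along the direction, times the direction. Fitting \<open>div_field S\<close> modulo
  rigid motions thus becomes the scalar system of \<open>bubble_coefficients\<close> in the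
  coordinates \<open>X\<close> and \<open>Y\<close>.\<close>

lemma bubble_correction:
  fixes S :: "pt \<Rightarrow> real^2^2"
  assumes tri: "tri a b c K" and S: "S \<in> Pk 3 UNIV"
  obtains B where "B \<in> Pk 3 UNIV" "\<And>x. transpose (B x) = B x"
    "\<And>e n x. e edge_of K \<Longrightarrow> unit_normal e n \<Longrightarrow> x \<in> e \<Longrightarrow> B x *v n = 0"
    "\<And>y. y extreme_point_of K \<Longrightarrow> B y = 0"
    "(\<lambda>x. div_field S x - div_field B x) \<in> RM"
proof -
  define u v w where "u = b - a" and "v = c - a" and "w = c - b"
  have w: "w = v - u" by (simp add: u_def v_def w_def)
  have D: "cr (b - a) (c - a) \<noteq> 0" using tri by (simp add: tri_def)
  then have Duv: "cr u v \<noteq> 0" by (simp add: u_def v_def)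
  define X Y where "X = bary c a b" and "Y = bary a b c"
  have Z: "bary b c a x = 1 - X x - Y x" for x using bary_sum[OF D, of x] by (simp add: X_def Y_def)
  have xe: "x = a + X x *\<^sub>R u + Y x *\<^sub>R v" for x
    using bary_expand[OF D, of x] unfolding Z X_def[symmetric] Y_def[symmetric] by (simp add: u_def v_def algebra_simps)
  have mv: "X (x + s *\<^sub>R u) = X x + s" "Y (x + s *\<^sub>R u) = Y x" "X (x + s *\<^sub>R v) = X x" "Y (x + s *\<^sub>R v) = Y x + s"
    "X (x + s *\<^sub>R w) = X x - s" "Y (x + s *\<^sub>R w) = Y x + s" for x s
    unfolding X_def Y_def u_def v_def w_def by (rule bary_move[OF D])+
  have PXY: "X \<in> Pk 1 UNIV" "Y \<in> Pk 1 UNIV" unfolding X_def Y_def by (rule Pk_bary, simp)+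
  let ?f = "div_field S"
  define f1 f2 where "f1 x = cr (?f x) v / cr u v" and "f2 x = cr u (?f x) / cr u v" for x
  have fe: "?f x = f1 x *\<^sub>R u + f2 x *\<^sub>R v" for x unfolding f1_def f2_def by (rule cramer[OF Duv])
  have dS: "(\<lambda>x. ?f x $ i) \<in> Pk 2 UNIV" for i using Pk_div_entry[OF S] by simp
  have "f1 = (\<lambda>x. (v $ 2 / cr u v) * ?f x $ 1 - (v $ 1 / cr u v) * ?f x $ 2)"
    by (rule ext) (simp add: f1_def cr_def[of _ v] diff_divide_distrib mult.commute)
  then have f1k: "f1 \<in> Pk 2 UNIV" by (simp only:) (intro Pk_diff Pk_cmult dS)
  have "f2 = (\<lambda>x. (u $ 1 / cr u v) * ?f x $ 2 - (u $ 2 / cr u v) * ?f x $ 1)"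
    by (rule ext) (simp add: f2_def cr_def[of u "div_field S _"] diff_divide_distrib)
  then have f2k: "f2 \<in> Pk 2 UNIV" by (simp only:) (intro Pk_diff Pk_cmult dS)
  obtain p0 p1 p2 p3 p4 p5 where p: "\<And>X Y. f1 (a + X *\<^sub>R u + Y *\<^sub>R v) = p0 + p1 * X + p2 * Y + p3 * X * X + p4 * X * Y + p5 * Y * Y"
    by (rule Pk_2_affine_coords[OF f1k, of a u v]) blast
  obtain q0 q1 q2 q3 q4 q5 where q: "\<And>X Y. f2 (a + X *\<^sub>R u + Y *\<^sub>R v) = q0 + q1 * X + q2 * Y + q3 * X * X + q4 * X * Y + q5 * Y * Y"
    by (rule Pk_2_affine_coords[OF f2k, of a u v]) blast
  define A B C where "A = (u \<bullet> v) / cr u v" and "B = - (u \<bullet> u) / cr u v" and "C = (v \<bullet> v) / cr u v"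
  have ru: "rot u = A *\<^sub>R u + B *\<^sub>R v" and rv: "rot v = C *\<^sub>R u + (- A) *\<^sub>R v"
    using rot_affine_coords[OF Duv] by (simp_all add: A_def B_def C_def)
  \<comment> \<open>Up to the factor \<open>1 / cr u v\<close> the number \<open>C - B - A\<close>
    is the positive definite form
    \<open>u \<bullet> u - u \<bullet> v + v \<bullet> v\<close>.\<close>
  have "u \<noteq> 0" using Duv by (auto simp: cr_def)
  then have "u \<bullet> u > 0" by simp
  moreover have "v \<bullet> v \<ge> 0" "2 * (u \<bullet> v) \<le> v \<bullet> v + u \<bullet> u"
    using inner_ge_zero[of "v - u"] by (simp_all add: inner_diff inner_commute)
  ultimately have "v \<bullet> v + u \<bullet> u - u \<bullet> v > 0" by linarith
  moreover have "C - B - A = (v \<bullet> v + u \<bullet> u - u \<bullet> v) / cr u v" by (simp add: A_def B_def C_def add_divide_distrib diff_divide_distrib)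
  ultimately have den: "C - B - A \<noteq> 0" using Duv by simp
  \<comment> \<open>\<open>L\<close> is the defect in the hypothesis of
    \<open>bubble_coefficients\<close>. A unit rotation contributes \<open>2 * (C - B - A)\<close>
    to it, so removing \<open>\<beta>\<close> times the rotation restores compatibility.\<close>
  define L where "L = - p1 + 2 * p2 - 4/5 * p3 + 1/5 * p4 + 8/5 * p5 - 2 * q1 + q2 - 8/5 * q3 - 1/5 * q4 + 4/5 * q5"
  define \<beta> where "\<beta> = L / (2 * (C - B - A))"
  have \<beta>: "\<beta> * (2 * (C - B - A)) = L" using den by (simp add: \<beta>_def)
  have cond: "- (p1 - \<beta> * A) + 2 * (p2 - \<beta> * C) - 4/5 * p3 + 1/5 * p4 + 8/5 * p5 - 2 * (q1 - \<beta> * B) + (q2 + \<beta> * A)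
     - 8/5 * q3 - 1/5 * q4 + 4/5 * q5 = 0" using \<beta> by (simp add: L_def algebra_simps)
  obtain a0 a1 a2 b0 b1 b2 c0 c1 c2 k1 k2 where ab1:
    "\<And>X Y. p0 + (p1 - \<beta> * A) * X + (p2 - \<beta> * C) * Y + p3 * X * X + p4 * X * Y + p5 * Y * Y =
       k1 + ((1 - 2 * X - Y) * (a0 + a1 * X + a2 * Y) + X * (1 - X - Y) * a1) - ((X - Y) * (c0 + c1 * X + c2 * Y) + X * Y * (c2 - c1))"
   and ab2: "\<And>X Y. q0 + (q1 - \<beta> * B) * X + (q2 + \<beta> * A) * Y + q3 * X * X + q4 * X * Y + q5 * Y * Y =
       k2 + ((1 - X - 2 * Y) * (b0 + b1 * X + b2 * Y) + Y * (1 - X - Y) * b2) + ((X - Y) * (c0 + c1 * X + c2 * Y) + X * Y * (c2 - c1))"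
    by (rule bubble_coefficients[OF cond]) blast
  define g1 g2 g3 where "g1 x = X x * (1 - X x - Y x) * (a0 + a1 * X x + a2 * Y x)"
    and "g2 x = Y x * (1 - X x - Y x) * (b0 + b1 * X x + b2 * Y x)"
    and "g3 x = X x * Y x * (c0 + c1 * X x + c2 * Y x)" for x
  have g: "g1 \<in> Pk 3 UNIV" "g2 \<in> Pk 3 UNIV" "g3 \<in> Pk 3 UNIV"
  proof -
    have l: "(\<lambda>x. d0 + d1 * X x + d2 * Y x) \<in> Pk 1 UNIV" "(\<lambda>x. 1 - X x - Y x) \<in> Pk 1 UNIV" for d0 d1 d2
      by (intro Pk_add Pk_diff Pk_const Pk_cmult PXY)+
    have m: "(\<lambda>x. h1 x * h2 x * h3 x) \<in> Pk 3 UNIV" if "h1 \<in> Pk 1 UNIV" "h2 \<in> Pk 1 UNIV" "h3 \<in> Pk 1 UNIV" for h1 h2 h3 :: "pt \<Rightarrow> real"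
      by (rule Pk_multI[OF Pk_multI[OF that(1,2), of 2] that(3)]) simp_all
    show "g1 \<in> Pk 3 UNIV" "g2 \<in> Pk 3 UNIV" "g3 \<in> Pk 3 UNIV"
      unfolding g1_def[abs_def] g2_def[abs_def] g3_def[abs_def] by (intro m l PXY)+
  qed
  have d1: "dird u g1 x = (1 - 2 * X x - Y x) * (a0 + a1 * X x + a2 * Y x) + X x * (1 - X x - Y x) * a1" for x
    by (rule dird_eqI[OF g(1)]) (auto simp: g1_def mv algebra_simps intro!: derivative_eq_intros)
  have d2: "dird v g2 x = (1 - X x - 2 * Y x) * (b0 + b1 * X x + b2 * Y x) + Y x * (1 - X x - Y x) * b2" for x
    by (rule dird_eqI[OF g(2)]) (auto simp: g2_def mv algebra_simps intro!: derivative_eq_intros)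
  have d3: "dird w g3 x = (X x - Y x) * (c0 + c1 * X x + c2 * Y x) + X x * Y x * (c2 - c1)" for x
    by (rule dird_eqI[OF g(3)]) (auto simp: g3_def mv algebra_simps intro!: derivative_eq_intros)
  define M :: "pt \<Rightarrow> real^2^2" where
    "M x = (\<chi> i j. (u $ i * u $ j) * g1 x + (v $ i * v $ j) * g2 x + (w $ i * w $ j) * g3 x)" for x
  have Mn: "M x *v n = (g1 x * (u \<bullet> n)) *\<^sub>R u + (g2 x * (v \<bullet> n)) *\<^sub>R v + (g3 x * (w \<bullet> n)) *\<^sub>R w" for x n
    by (simp add: M_def vec_eq_iff forall_2 matrix_vector_mult_def inner_vec_def sum_2 algebra_simps)
  show ?thesis
  proof (rule that[of M])
    show "M \<in> Pk 3 UNIV" by (rule Pk_matrixI) (simp add: M_def, intro Pk_add Pk_cmult g)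
    show "transpose (M x) = M x" for x by (simp add: M_def vec_eq_iff transpose_def mult.commute)
    have dM: "div_field M x = dird u g1 x *\<^sub>R u + dird v g2 x *\<^sub>R v + dird w g3 x *\<^sub>R w" for x
    proof -
      have dd: "g1 differentiable at x" "g2 differentiable at x" "g3 differentiable at x" for x
        using Pk_differentiable g by blast+
      have "pd k (\<lambda>y. M y $ i $ j) x = (u $ i * u $ j) * pd k g1 x + (v $ i * v $ j) * pd k g2 x + (w $ i * w $ j) * pd k g3 x" for i j k
        unfolding M_def by (simp add: pd_add pd_cmult dd differentiable_add differentiable_mult)
      then show ?thesis by (simp add: vec_eq_iff forall_2 div_field_nth dird_def algebra_simps)
    qed
    have "?f x - div_field M x = (k1 *\<^sub>R u + k2 *\<^sub>R v - \<beta> *\<^sub>R rot a) + \<beta> *\<^sub>R rot x" for x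
    proof -
      have 1: "f1 x = p0 + p1 * X x + p2 * Y x + p3 * X x * X x + p4 * X x * Y x + p5 * Y x * Y x"
        using p[of "X x" "Y x"] xe[of x] by simp
      have 2: "f2 x = q0 + q1 * X x + q2 * Y x + q3 * X x * X x + q4 * X x * Y x + q5 * Y x * Y x"
        using q[of "X x" "Y x"] xe[of x] by simp
      have "f1 x - \<beta> * A * X x - \<beta> * C * Y x = k1 + dird u g1 x - dird w g3 x"
        unfolding d1 d3 1 using ab1[of "X x" "Y x"] by (simp add: algebra_simps)
      then have e1: "f1 x = k1 + dird u g1 x - dird w g3 x + \<beta> * (X x * A + Y x * C)" by (simp add: algebra_simps)
      have "f2 x - \<beta> * B * X x + \<beta> * A * Y x = k2 + dird v g2 x + dird w g3 x"
        unfolding d2 d3 2 using ab2[of "X x" "Y x"] by (simp add: algebra_simps)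
      then have e2: "f2 x = k2 + dird v g2 x + dird w g3 x + \<beta> * (X x * B - Y x * A)" by (simp add: algebra_simps)
      have "rot x = rot a + X x *\<^sub>R rot u + Y x *\<^sub>R rot v" by (subst xe[of x]) (simp add: rot_linear)
      then have rx: "rot x = rot a + (X x * A + Y x * C) *\<^sub>R u + (X x * B - Y x * A) *\<^sub>R v"
        unfolding ru rv by (simp add: algebra_simps)
      show ?thesis unfolding fe dM e1 e2 rx w by (simp add: algebra_simps)
    qed
    then have "(\<lambda>x. ?f x - div_field M x) = (\<lambda>x. (k1 *\<^sub>R u + k2 *\<^sub>R v - \<beta> *\<^sub>R rot a) + \<beta> *\<^sub>R rot x)" by (rule ext)
    then show "(\<lambda>x. ?f x - div_field M x) \<in> RM" unfolding RM_iff by blast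
    show "M y = 0" if "y extreme_point_of K" for y
    proof -
      have "X a = 0" "Y a = 0" "X b = 1" "Y b = 0" "X c = 0" "Y c = 1"
        using mv(1,2)[of a 1] mv(3,4)[of a 1] by (simp_all add: u_def v_def X_def Y_def)
      then have "g1 y = 0 \<and> g2 y = 0 \<and> g3 y = 0"
        using that unfolding tri_extreme_point[OF tri] by (auto simp: g1_def g2_def g3_def)
      then show ?thesis by (simp add: M_def vec_eq_iff)
    qed
    show "M x *v n = 0" if e: "e edge_of K" and n: "unit_normal e n" and x: "x \<in> e" for e n x
    proof -
      have "e \<in> {closed_segment a b, closed_segment b c, closed_segment c a}" using e tri_edge_of[OF tri] by simp
      then consider "e = closed_segment a b" | "e = closed_segment b c" | "e = closed_segment c a" by auto
      then show ?thesis
      proof cases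
        case 1
        have "u \<bullet> n = 0" using unit_normal_segment(2)[OF n[unfolded 1]] by (simp add: u_def inner_commute)
        moreover have "Y x = 0" using bary_segment_zero x unfolding 1 Y_def by blast
        ultimately show ?thesis by (simp add: Mn g2_def g3_def)
      next
        case 2
        have "w \<bullet> n = 0" using unit_normal_segment(2)[OF n[unfolded 2]] by (simp add: w_def inner_commute)
        moreover have "1 - X x - Y x = 0" using bary_segment_zero[of x b c a] x unfolding 2 Z by simp
        ultimately show ?thesis by (simp add: Mn g1_def g2_def)
      next
        case 3
        have "(a - c) \<bullet> n = 0" using unit_normal_segment(2)[OF n[unfolded 3]] by (simp add: inner_commute)
        then have "v \<bullet> n = 0" by (simp add: v_def inner_diff_left)
        moreover have "X x = 0" using bary_segment_zero[of x c a b] x unfolding 3 X_def by simp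
        ultimately show ?thesis by (simp add: Mn g1_def g3_def)
      qed
    qed
  qed
qed

text \<open>The symmetric matrix field is orthogonal to the constant skew gradient of a rigid motion.\<close>

lemma green_RM:
  assumes K: "2 simplex K" and n: "\<And>e. e edge_of K \<Longrightarrow> unit_normal e (n e)"
    and s: "\<sigma> \<in> Pk k UNIV" and sym: "\<And>x. transpose (\<sigma> x) = \<sigma> x" and r: "r \<in> RM"
  shows "integral K (\<lambda>x. div_field \<sigma> x \<bullet> r x) =
    (\<Sum>e | e edge_of K. nu K e (n e) * edge_inner e (\<lambda>x. (\<sigma> x *v n e) \<bullet> r x) (\<lambda>x. 1))"
proof -
  obtain a b where r: "r = (\<lambda>x. a + b *\<^sub>R rot x)" using r unfolding RM_iff by blast
  define r1 r2 where "r1 x = a $ 1 + b * x $ 2" and "r2 x = a $ 2 + (- b) * x $ 1" for x :: pt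
  have rn: "r x $ 1 = r1 x" "r x $ 2 = r2 x" for x by (simp_all add: r r1_def r2_def)
  have rP: "r1 \<in> Pk 1 UNIV" "r2 \<in> Pk 1 UNIV"
    unfolding r1_def[abs_def] r2_def[abs_def] by (intro Pk_add Pk_const Pk_cmult Pk_coord, simp)+
  have dr: "pd 1 r1 x = 0" "pd 2 r1 x = b" "pd 1 r2 x = - b" "pd 2 r2 x = 0" for x
    unfolding r1_def[abs_def] r2_def[abs_def] by (simp_all add: pd_add pd_diff pd_cmult differentiable_mult)
  let ?s = "\<lambda>i j x. \<sigma> x $ i $ j"
  note sP = Pk_entry[OF s]
  have s21: "\<sigma> x $ 2 $ 1 = \<sigma> x $ 1 $ 2" for x
    using arg_cong[OF sym[of x], of "\<lambda>m. m $ 1 $ 2"] by (simp add: transpose_def)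
  define w where "w j x = r1 x * \<sigma> x $ 1 $ j + r2 x * \<sigma> x $ 2 $ j" for j x
  have wP: "w j \<in> Pk (1 + k) UNIV" for j
    unfolding w_def[abs_def] by (intro Pk_add Pk_mult rP sP)
  have d: "f differentiable at x" if "f \<in> Pk m UNIV" for f :: "pt \<Rightarrow> real" and x m by (rule Pk_differentiable[OF that])
  have pw: "pd i (w j) x = pd i r1 x * \<sigma> x $ 1 $ j + r1 x * pd i (?s 1 j) x + (pd i r2 x * \<sigma> x $ 2 $ j + r2 x * pd i (?s 2 j) x)" for i j x
    unfolding w_def[abs_def] by (simp add: pd_add pd_mult differentiable_mult d[OF rP(1)] d[OF rP(2)] d[OF sP])
  have wn: "(\<lambda>x. w 1 x * n e $ 1 + w 2 x * n e $ 2) = (\<lambda>x. (\<sigma> x *v n e) \<bullet> r x)" for e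
    by (rule ext) (simp add: w_def inner_vec_def sum_2 matrix_vector_mult_def rn algebra_simps)
  have "div_field \<sigma> x \<bullet> r x = pd 1 (w 1) x + pd 2 (w 2) x" for x
    unfolding pw dr inner_vec_def sum_2 div_field_nth rn s21 by (simp add: algebra_simps)
  then have "integral K (\<lambda>x. div_field \<sigma> x \<bullet> r x) = integral K (\<lambda>x. pd 1 (w 1) x + pd 2 (w 2) x)" by simp
  also have "\<dots> = (\<Sum>e | e edge_of K. nu K e (n e) * edge_inner e (\<lambda>x. w 1 x * n e $ 1 + w 2 x * n e $ 2) (\<lambda>x. 1))"
    by (rule divergence_triangle[OF K C1_Pk[OF wP] C1_Pk[OF wP] n])
  finally show ?thesis unfolding wn .
qed

section \<open>Balancing piecewise rigid motions by loads on edges\<close>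

context polygon_mesh
begin

text \<open>\<open>m e\<close> is a flow through \<open>e\<close> in the direction of
  \<open>n e\<close>, and the sum is the net outflow of \<open>K\<close>. A unit source in one
  triangle is passed across edges until it leaves through a boundary edge; superposition yields
  every \<open>s\<close>.\<close>

lemma edge_flow:
  assumes normal: "\<And>K e. K \<in> T \<Longrightarrow> e edge_of K \<Longrightarrow> unit_normal e (n e)"
  shows "\<exists>m. \<forall>K\<in>T. (\<Sum>e | e edge_of K. nu K e (n e) * m e) = s K"
proof -
  have nu2: "nu K e n * nu K e n = 1" for K e n using nu_cases[of K e n] by auto
  have fin: "finite {e. e edge_of K}" if "K \<in> T" for K by (rule finite_edges[OF simplex_T[OF that]])
  have delta: "(\<Sum>e' | e' edge_of K. nu K e' (n e') * (if e' = e then c else 0)) = (if e edge_of K then nu K e (n e) * c else 0)"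
    if "K \<in> T" for K e and c :: real
  proof -
    have "(\<Sum>e' | e' edge_of K. nu K e' (n e') * (if e' = e then c else 0)) = (\<Sum>e' | e' edge_of K. if e' = e then nu K e (n e) * c else 0)"
      by (rule sum.cong) auto
    then show ?thesis using fin[OF that] by (simp add: sum.delta)
  qed
  have ex: "\<exists>m. \<forall>L\<in>T. (\<Sum>e | e edge_of L. nu L e (n e) * m e) = (if L = K then 1 else 0)" if "K \<in> T" for K
  proof (rule edge_path_to_boundary[OF _ _ that])
    fix K e assume b: "boundary_edge_of K e"
    then have K: "K \<in> T" "e edge_of K" and u: "\<And>L. L \<in> T \<Longrightarrow> e edge_of L \<Longrightarrow> L = K"
      unfolding boundary_edge_of_def by auto
    show "\<exists>m. \<forall>L\<in>T. (\<Sum>e | e edge_of L. nu L e (n e) * m e) = (if L = K then 1 else 0)"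
    proof (rule exI[of _ "\<lambda>e'. if e' = e then nu K e (n e) else 0"], rule ballI)
      fix L assume L: "L \<in> T"
      have "(if e edge_of L then nu L e (n e) * nu K e (n e) else 0) = (if L = K then 1 else 0)"
      proof (cases "L = K")
        case True
        then show ?thesis using K(2) by (simp add: nu2)
      next
        case False
        then have "\<not> e edge_of L" using u[OF L] by blast
        then show ?thesis using False by simp
      qed
      then show "(\<Sum>e' | e' edge_of L. nu L e' (n e') * (if e' = e then nu K e (n e) else 0)) = (if L = K then 1 else 0)"
        unfolding delta[OF L] .
    qed
  next
    fix K K' e assume K: "K \<in> T" "K' \<in> T" "K \<noteq> K'" "e edge_of K" "e edge_of K'"
      and "\<exists>m. \<forall>L\<in>T. (\<Sum>e | e edge_of L. nu L e (n e) * m e) = (if L = K' then 1 else 0)"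
    then obtain m where m: "\<And>L. L \<in> T \<Longrightarrow> (\<Sum>e | e edge_of L. nu L e (n e) * m e) = (if L = K' then 1 else 0)" by blast
    have opp: "nu K e (n e) = - nu K' e (n e)" by (rule interior_edge(2)[OF K(1,4,2,5,3) normal[OF K(1,4)]])
    have only: "L = K \<or> L = K'" if "L \<in> T" "e edge_of L" for L by (rule interior_edge(3)[OF K(1,4,2,5,3) that])
    show "\<exists>m. \<forall>L\<in>T. (\<Sum>e | e edge_of L. nu L e (n e) * m e) = (if L = K then 1 else 0)"
    \<comment> \<open>The extra amount on \<open>e\<close> adds 1 to the balance of \<open>K\<close>
      and takes 1 from that of \<open>K'\<close>, so the unit source moves from \<open>K'\<close> to
      \<open>K\<close>.\<close>
    proof (rule exI[of _ "\<lambda>e'. m e' + (if e' = e then nu K e (n e) else 0)"], rule ballI)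
      fix L assume L: "L \<in> T"
      have "(\<Sum>e' | e' edge_of L. nu L e' (n e') * (m e' + (if e' = e then nu K e (n e) else 0))) =
        (if L = K' then 1 else 0) + (if e edge_of L then nu L e (n e) * nu K e (n e) else 0)"
        unfolding distrib_left sum.distrib m[OF L] delta[OF L] ..
      also have "\<dots> = (if L = K then 1 else 0)"
      proof -
        have "nu K' e (n e) * nu K e (n e) = - 1" using opp nu2[of K' e "n e"] by simp
        moreover have "\<not> e edge_of L" if "L \<noteq> K" "L \<noteq> K'" using only[OF L] that by blast
        ultimately show ?thesis using K(3,4,5) by (cases "L = K"; cases "L = K'") (simp_all add: nu2)
      qed
      finally show "(\<Sum>e' | e' edge_of L. nu L e' (n e') * (m e' + (if e' = e then nu K e (n e) else 0))) = (if L = K then 1 else 0)" .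
    qed
  qed
  have "\<forall>K\<in>T. \<exists>m. \<forall>L\<in>T. (\<Sum>e | e edge_of L. nu L e (n e) * m e) = (if L = K then 1 else 0)" using ex by blast
  then obtain m where m: "\<forall>K\<in>T. \<forall>L\<in>T. (\<Sum>e | e edge_of L. nu L e (n e) * m K e) = (if L = K then 1 else 0)"
    by (drule_tac bchoice) (elim exE)
  show ?thesis
  proof (rule exI[of _ "\<lambda>e. \<Sum>K\<in>T. s K * m K e"], rule ballI)
    fix L assume L: "L \<in> T"
    have "(\<Sum>e | e edge_of L. nu L e (n e) * (\<Sum>K\<in>T. s K * m K e)) = (\<Sum>e | e edge_of L. \<Sum>K\<in>T. s K * (nu L e (n e) * m K e))"
      by (simp add: sum_distrib_left algebra_simps)
    also have "\<dots> = (\<Sum>K\<in>T. s K * (\<Sum>e | e edge_of L. nu L e (n e) * m K e))"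
      unfolding sum_distrib_left by (rule sum.swap)
    also have "\<dots> = (\<Sum>K\<in>T. s K * (if L = K then 1 else 0))" by (rule sum.cong[OF refl]) (use m L in simp)
    also have "\<dots> = s L" using L finite_T by (simp add: sum.delta if_distrib cong: if_cong)
    finally show "(\<Sum>e | e edge_of L. nu L e (n e) * (\<Sum>K\<in>T. s K * m K e)) = s L" .
  qed
qed

end

text \<open>The weight \<open>s * (1 - s)\<close> makes the load vanish at the ends. The
  coefficients \<open>\<alpha>\<close> and \<open>\<beta>\<close> fix the resultant force
  \<open>(m1, m2)\<close>; the odd profile \<open>1 - 2 * s\<close> has no resultant and supplies
  the missing torque.\<close>

lemma edge_load:
  assumes PQ: "P \<noteq> Q" and n: "unit_normal (closed_segment P Q) n" and t: "unit_tangent (closed_segment P Q) t"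
  obtains \<alpha> \<beta> \<gamma> where "\<And>F a b. (\<And>s. F (linepath P Q s) = (s * (1 - s)) *\<^sub>R ((\<alpha> + \<gamma> * (1 - 2 * s)) *\<^sub>R n + \<beta> *\<^sub>R t)) \<Longrightarrow>
    edge_inner (closed_segment P Q) (\<lambda>x. F x \<bullet> (a + b *\<^sub>R rot x)) (\<lambda>x. 1) = a $ 1 * m1 + a $ 2 * m2 + b * m3"
proof -
  define D L where "D = Q - P" and "L = dist P Q"
  have L: "L \<noteq> 0" using PQ by (simp add: L_def)
  note un = unit_normal_segment[OF n]
  obtain \<kappa> where k: "\<kappa> \<noteq> 0" "t = \<kappa> *\<^sub>R (Q - P)" "norm t = 1" by (rule unit_tangent_segment[OF t PQ])
  have tD: "t \<bullet> rot D = 0" unfolding k(2) D_def by (simp add: inner_vec_def sum_2 algebra_simps)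
  have "t \<bullet> n = 0" using un(2) unfolding k(2) by (simp add: inner_commute)
  then have tn: "t $ 1 * n $ 1 + t $ 2 * n $ 2 = 0" by (simp add: inner_vec_def sum_2)
  have nn: "n $ 1 * n $ 1 + n $ 2 * n $ 2 = 1" "t $ 1 * t $ 1 + t $ 2 * t $ 2 = 1"
    using un(1) k(3) by (simp_all add: norm_eq_1 inner_vec_def sum_2)
  define v :: pt where "v = vector [m1, m2]"
  have vn: "v $ 1 = m1" "v $ 2 = m2" by (simp_all add: v_def)
  have basis: "(n \<bullet> v) *\<^sub>R n + (t \<bullet> v) *\<^sub>R t = v"
  proof -
    have o: "n $ 1 * n $ 1 + t $ 1 * t $ 1 = 1" "n $ 2 * n $ 2 + t $ 2 * t $ 2 = 1" "n $ 1 * n $ 2 + t $ 1 * t $ 2 = 0"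
      using tn nn by algebra+
    have "(n \<bullet> v) * n $ 1 + (t \<bullet> v) * t $ 1 = (n $ 1 * n $ 1 + t $ 1 * t $ 1) * v $ 1 + (n $ 1 * n $ 2 + t $ 1 * t $ 2) * v $ 2"
      "(n \<bullet> v) * n $ 2 + (t \<bullet> v) * t $ 2 = (n $ 1 * n $ 2 + t $ 1 * t $ 2) * v $ 1 + (n $ 2 * n $ 2 + t $ 2 * t $ 2) * v $ 2"
      by (simp_all add: inner_vec_def sum_2 algebra_simps)
    then show ?thesis unfolding o by (simp add: vec_eq_iff forall_2)
  qed
  have nD: "n \<bullet> rot D \<noteq> 0"
  proof
    assume "n \<bullet> rot D = 0"
    then have "rot D = 0" by (intro orthogonal_zero[OF un]) (use PQ in \<open>auto simp: D_def inner_vec_def sum_2 algebra_simps\<close>)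
    then show False using PQ by (simp add: D_def vec_eq_iff forall_2)
  qed
  \<comment> \<open>The value of \<open>rot\<close> at the midpoint of the edge, so that
    \<open>v \<bullet> h\<close> is the torque of the even part of the load.\<close>
  define h where "h = rot P + (1/2) *\<^sub>R rot D"
  \<comment> \<open>The numbers 6 and 60 invert the integrals of \<open>s * (1 - s)\<close> and of
    \<open>s * (1 - s) * (1 - 2 * s) * s\<close> over the unit interval, which are
    \<open>1/6\<close> and \<open>- 1/60\<close>; \<open>L\<close> is the length factor in
    \<open>edge_inner\<close>.\<close>
  define \<alpha> \<beta> \<gamma> where "\<alpha> = 6 / L * (n \<bullet> v)" and "\<beta> = 6 / L * (t \<bullet> v)" and "\<gamma> = 60 * (v \<bullet> h - m3) / (L * (n \<bullet> rot D))"
  show ?thesis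
  proof (rule that[of \<alpha> \<gamma> \<beta>])
    fix F :: "pt \<Rightarrow> pt" and a :: pt and b :: real
    assume F: "\<And>s. F (linepath P Q s) = (s * (1 - s)) *\<^sub>R ((\<alpha> + \<gamma> * (1 - 2 * s)) *\<^sub>R n + \<beta> *\<^sub>R t)"
    define A0 A1 B0 where "A0 = n \<bullet> (a + b *\<^sub>R rot P)" and "A1 = b * (n \<bullet> rot D)" and "B0 = t \<bullet> (a + b *\<^sub>R rot P)"
    define c0 c1 c2 where "c0 = (\<alpha> + \<gamma>) * A0 + \<beta> * B0" and "c1 = (\<alpha> + \<gamma>) * A1 - 2 * \<gamma> * A0" and "c2 = - 2 * \<gamma> * A1"
    have rl: "rot (linepath P Q s) = rot P + s *\<^sub>R rot D" for s
      by (simp add: linepath_def D_def vec_eq_iff forall_2 algebra_simps)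
    have "F (linepath P Q s) \<bullet> (a + b *\<^sub>R rot (linepath P Q s)) = poly [:0, c0, c1 - c0, c2 - c1, - c2:] s" for s
    proof -
      have "F (linepath P Q s) \<bullet> (a + b *\<^sub>R rot (linepath P Q s)) = (s * (1 - s)) * ((\<alpha> + \<gamma> * (1 - 2 * s)) * (A0 + s * A1) + \<beta> * (B0 + s * b * (t \<bullet> rot D)))"
        unfolding F rl A0_def A1_def B0_def by (simp add: inner_add_left inner_add_right algebra_simps)
      then show ?thesis unfolding tD by (simp add: c0_def c1_def c2_def algebra_simps)
    qed
    then have hp: "(\<lambda>s. F (linepath P Q s) \<bullet> (a + b *\<^sub>R rot (linepath P Q s)) * 1) = poly [:0, c0, c1 - c0, c2 - c1, - c2:]"
      by (intro ext) (simp only: mult_1_right)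
    have "line_int P Q (\<lambda>x. F x \<bullet> (a + b *\<^sub>R rot x) * 1) = 0 + c0 / 2 + (c1 - c0) / 3 + (c2 - c1) / 4 + (- c2) / 5"
      unfolding line_int_def hp by (rule integral_poly4)
    also have "\<dots> = \<alpha> * (A0 + A1 / 2) / 6 + \<beta> * B0 / 6 - \<gamma> * A1 / 60"
      by (simp add: c0_def c1_def c2_def field_simps)
    also have "A0 + A1 / 2 = n \<bullet> (a + b *\<^sub>R h)" by (simp add: A0_def A1_def h_def inner_add_right algebra_simps)
    also have "B0 = t \<bullet> (a + b *\<^sub>R h)" using tD by (simp add: B0_def h_def inner_add_right algebra_simps)
    also have "\<alpha> * (n \<bullet> (a + b *\<^sub>R h)) / 6 + \<beta> * (t \<bullet> (a + b *\<^sub>R h)) / 6 = (v \<bullet> (a + b *\<^sub>R h)) / L"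
    proof -
      have "v \<bullet> y = (n \<bullet> v) * (n \<bullet> y) + (t \<bullet> v) * (t \<bullet> y)" for y
        using arg_cong[OF basis, of "\<lambda>z. z \<bullet> y"] by (simp only: inner_add_left inner_scaleR_left)
      then show ?thesis by (simp add: \<alpha>_def \<beta>_def add_divide_distrib)
    qed
    also have "\<gamma> * A1 / 60 = b * (v \<bullet> h - m3) / L" using nD L by (simp add: \<gamma>_def A1_def field_simps)
    finally have "L * line_int P Q (\<lambda>x. F x \<bullet> (a + b *\<^sub>R rot x) * 1) = v \<bullet> (a + b *\<^sub>R h) - b * (v \<bullet> h - m3)"
      using L by (simp add: diff_divide_distrib[symmetric])
    also have "\<dots> = a $ 1 * m1 + a $ 2 * m2 + b * m3" by (simp add: inner_add_right algebra_simps) (simp add: inner_vec_def sum_2 vn)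
    finally show "edge_inner (closed_segment P Q) (\<lambda>x. F x \<bullet> (a + b *\<^sub>R rot x)) (\<lambda>x. 1) = a $ 1 * m1 + a $ 2 * m2 + b * m3"
      unfolding edge_inner_segment[OF PQ] L_def .
  qed
qed

lemma continuous_integral_square_zero:
  fixes d :: "pt \<Rightarrow> pt"
  assumes K: "compact K" and d: "continuous_on UNIV d" and z: "integral K (\<lambda>x. d x \<bullet> d x) = 0"
  shows "AE x in lebesgue_on K. d x = 0"
proof -
  have c: "continuous_on K (\<lambda>x. d x \<bullet> d x)" by (intro continuous_intros continuous_on_subset[OF d] subset_UNIV)
  note i = integrable_lebesgue_on_compact[OF K c]
  have "K \<in> sets lebesgue" using K by (intro sets_completionI_sets) (simp add: borel_compact)
  then have "integral\<^sup>L (lebesgue_on K) (\<lambda>x. d x \<bullet> d x) = 0" using z lebesgue_integral_eq_integral[OF i] by simp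
  then have "AE x in lebesgue_on K. d x \<bullet> d x = 0" using integral_nonneg_eq_0_iff_AE[OF i] by simp
  then show ?thesis by simp
qed

section \<open>Surjectivity of the divergence\<close>

context oriented_mesh
begin

text \<open>Chosen once for each edge and not for each triangle, so that the odd profile in
  \<open>edge_tensor\<close> has the same orientation from both sides.\<close>

definition endpoints :: "pt set \<Rightarrow> pt \<times> pt" where
  "endpoints e = (SOME ab. fst ab \<noteq> snd ab \<and> e = closed_segment (fst ab) (snd ab))"

lemma endpoints:
  assumes "K \<in> T" "e edge_of K"
  shows "fst (endpoints e) \<noteq> snd (endpoints e)" "e = closed_segment (fst (endpoints e)) (snd (endpoints e))"
proof -
  obtain a b where "a \<noteq> b" "e = closed_segment a b" by (rule edge_imp_segment[OF assms(2) simplex_T[OF assms(1)]])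
  then have "\<exists>ab. fst ab \<noteq> snd ab \<and> e = closed_segment (fst ab) (snd ab)" by (intro exI[of _ "(a, b)"]) simp
  from someI_ex[OF this] show "fst (endpoints e) \<noteq> snd (endpoints e)" "e = closed_segment (fst (endpoints e)) (snd (endpoints e))"
    unfolding endpoints_def by auto
qed

definition apex :: "pt set \<Rightarrow> pt set \<Rightarrow> pt" where
  "apex K e = (SOME c. tri (fst (endpoints e)) (snd (endpoints e)) c K)"

lemma apex:
  assumes K: "K \<in> T" "e edge_of K"
  shows "tri (fst (endpoints e)) (snd (endpoints e)) (apex K e) K"
proof -
  obtain a b c where t: "tri a b c K" "e = closed_segment a b" by (rule edge_tri[OF simplex_T[OF K(1)] K(2)])
  have "closed_segment a b = closed_segment (fst (endpoints e)) (snd (endpoints e))"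
    using endpoints(2)[OF K] t(2) by simp
  then have "{a, b} = {fst (endpoints e), snd (endpoints e)}" by (rule iffD1[OF closed_segment_eq])
  then have "tri (fst (endpoints e)) (snd (endpoints e)) c K" using t(1) tri_swap[OF t(1)] by (auto simp: doubleton_eq_iff)
  then show ?thesis unfolding apex_def by (rule someI)
qed

text \<open>The first two factors are the barycentric coordinates of the end points \<open>p\<close>
  and \<open>q\<close>; their product vanishes at the vertices and on the other two edges. The two
  symmetric dyads have the tractions \<open>n e\<close> and \<open>t e\<close> on \<open>e\<close>,
  and their coefficients reproduce the profile of \<open>edge_load\<close>.\<close>

definition edge_tensor :: "(pt set \<Rightarrow> real) \<Rightarrow> (pt set \<Rightarrow> real) \<Rightarrow> (pt set \<Rightarrow> real) \<Rightarrow> pt set \<Rightarrow> pt set \<Rightarrow> pt \<Rightarrow> real^2^2" where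
  "edge_tensor \<alpha> \<beta> \<gamma> K e x = (let p = fst (endpoints e); q = snd (endpoints e); c = apex K e in
     \<chi> i j. bary q c p x * bary c p q x * ((\<alpha> e + \<gamma> e * (bary q c p x - bary c p q x)) * (n e $ i * n e $ j) +
       \<beta> e * (t e $ i * n e $ j + n e $ i * t e $ j)))"

lemma tangent_normal:
  assumes "K \<in> T" "e edge_of K"
  shows "norm (n e) = 1" "norm (t e) = 1" "t e \<bullet> n e = 0"
proof -
  define p q where "p = fst (endpoints e)" and "q = snd (endpoints e)"
  have e: "p \<noteq> q" "e = closed_segment p q" unfolding p_def q_def by (rule endpoints[OF assms])+
  have "unit_normal (closed_segment p q) (n e)" "unit_tangent (closed_segment p q) (t e)"
    using normal[OF assms] tangent[OF assms] e(2) by simp_all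
  then obtain \<kappa> where "norm (n e) = 1" "n e \<bullet> (q - p) = 0" "t e = \<kappa> *\<^sub>R (q - p)" "norm (t e) = 1"
    using unit_normal_segment unit_tangent_segment[OF _ e(1)] by metis
  then show "norm (n e) = 1" "norm (t e) = 1" "t e \<bullet> n e = 0" by (simp_all add: inner_commute)
qed

lemma Pk_edge_tensor: "edge_tensor \<alpha> \<beta> \<gamma> K e \<in> Pk 3 UNIV"
proof (rule Pk_matrixI)
  fix i j
  have m: "(\<lambda>x. h1 x * h2 x * h3 x) \<in> Pk 3 UNIV" if "h1 \<in> Pk 1 UNIV" "h2 \<in> Pk 1 UNIV" "h3 \<in> Pk 1 UNIV" for h1 h2 h3 :: "pt \<Rightarrow> real"
    by (rule Pk_multI[OF Pk_multI[OF that(1,2), of 2] that(3)]) simp_all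
  have b: "bary a b c \<in> Pk 1 UNIV" for a b c by (rule Pk_bary) simp
  have l: "(\<lambda>x. (\<alpha> e + \<gamma> e * (f x - g x)) * k1 + k2) \<in> Pk 1 UNIV" if "f \<in> Pk 1 UNIV" "g \<in> Pk 1 UNIV" for f g :: "pt \<Rightarrow> real" and k1 k2
  proof -
    have "(\<lambda>x. (\<alpha> e + \<gamma> e * (f x - g x)) * k1 + k2) = (\<lambda>x. k1 * (\<alpha> e + \<gamma> e * (f x - g x)) + k2)" by (simp add: mult.commute)
    also have "\<dots> \<in> Pk 1 UNIV" by (intro Pk_add Pk_cmult Pk_const Pk_diff that)
    finally show ?thesis .
  qed
  show "(\<lambda>x. edge_tensor \<alpha> \<beta> \<gamma> K e x $ i $ j) \<in> Pk 3 UNIV"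
    unfolding edge_tensor_def Let_def vec_lambda_beta by (intro m l b)
qed

lemma transpose_edge_tensor: "transpose (edge_tensor \<alpha> \<beta> \<gamma> K e x) = edge_tensor \<alpha> \<beta> \<gamma> K e x"
  by (simp add: edge_tensor_def Let_def vec_eq_iff transpose_def algebra_simps)

lemma edge_tensor_zero:
  assumes K: "K \<in> T" "e edge_of K"
  shows "y extreme_point_of K \<Longrightarrow> edge_tensor \<alpha> \<beta> \<gamma> K e y = 0"
    and "e' edge_of K \<Longrightarrow> e' \<noteq> e \<Longrightarrow> x \<in> e' \<Longrightarrow> edge_tensor \<alpha> \<beta> \<gamma> K e x = 0"
proof -
  let ?p = "fst (endpoints e)" and ?q = "snd (endpoints e)" and ?c = "apex K e"
  note tr = apex[OF K]
  have z: "edge_tensor \<alpha> \<beta> \<gamma> K e x = 0" if "bary ?q ?c ?p x * bary ?c ?p ?q x = 0" for x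
    unfolding edge_tensor_def Let_def that by (simp add: vec_eq_iff)
  show "edge_tensor \<alpha> \<beta> \<gamma> K e y = 0" if "y extreme_point_of K"
  proof (rule z)
    have "y \<in> {?p, ?q, ?c}" using that tri_extreme_point[OF tr] by blast
    then show "bary ?q ?c ?p y * bary ?c ?p ?q y = 0" by auto
  qed
  show "edge_tensor \<alpha> \<beta> \<gamma> K e x = 0" if e': "e' edge_of K" "e' \<noteq> e" "x \<in> e'"
  proof (rule z)
    have "e' = closed_segment ?q ?c \<or> e' = closed_segment ?c ?p"
      using e'(1,2) endpoints(2)[OF K] unfolding tri_edge_of[OF tr] by (metis empty_iff insert_iff)
    then have "bary ?q ?c ?p x = 0 \<or> bary ?c ?p ?q x = 0" using bary_segment_zero e'(3) by metis
    then show "bary ?q ?c ?p x * bary ?c ?p ?q x = 0" by simp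
  qed
qed

text \<open>The right-hand side no longer mentions \<open>K\<close>, so the triangles on both sides
  of \<open>e\<close> receive the same traction.\<close>

lemma edge_tensor_traction:
  assumes K: "K \<in> T" "e edge_of K"
  shows "edge_tensor \<alpha> \<beta> \<gamma> K e (linepath (fst (endpoints e)) (snd (endpoints e)) s) *v n e =
    (s * (1 - s)) *\<^sub>R ((\<alpha> e + \<gamma> e * (1 - 2 * s)) *\<^sub>R n e + \<beta> e *\<^sub>R t e)"
proof -
  define p q c where "p = fst (endpoints e)" and "q = snd (endpoints e)" and "c = apex K e"
  have tr: "tri p q c K" unfolding p_def q_def c_def by (rule apex[OF K])
  then have D: "cr (q - p) (c - p) \<noteq> 0" by (simp add: tri_def)
  have D1: "cr (c - q) (p - q) \<noteq> 0" "cr (p - c) (q - c) \<noteq> 0" using D cr_rot by metis+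
  have l: "linepath p q s = (1 - s) *\<^sub>R p + s *\<^sub>R q + 0 *\<^sub>R c" by (simp add: linepath_def)
  have b: "bary q c p (linepath p q s) = 1 - s" "bary c p q (linepath p q s) = s"
    unfolding l using D1 by (simp_all only: bary_affine bary_simps bary_self) simp_all
  define N S where "N = n e" and "S = t e"
  have o: "N $ 1 * N $ 1 + N $ 2 * N $ 2 = 1" "S $ 1 * N $ 1 + S $ 2 * N $ 2 = 0"
    using tangent_normal[OF K] unfolding N_def S_def norm_eq_1 inner_vec_def sum_2 by simp_all
  let ?A = "\<alpha> e + \<gamma> e * (1 - 2 * s)"
  have "(edge_tensor \<alpha> \<beta> \<gamma> K e (linepath p q s) *v N) $ i =
      (s * (1 - s)) * (?A * N $ i * (N $ 1 * N $ 1 + N $ 2 * N $ 2) + \<beta> e * (S $ i * (N $ 1 * N $ 1 + N $ 2 * N $ 2) + N $ i * (S $ 1 * N $ 1 + S $ 2 * N $ 2)))" for i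
    unfolding edge_tensor_def Let_def p_def[symmetric] q_def[symmetric] c_def[symmetric] matrix_vector_mult_def sum_2 vec_lambda_beta b
      N_def[symmetric] S_def[symmetric] by (simp add: algebra_simps)
  then show ?thesis unfolding p_def[symmetric] q_def[symmetric] N_def[symmetric] S_def[symmetric] o
    by (simp add: vec_eq_iff)
qed

text \<open>The boundary bubbles prescribe the traction, the interior bubbles push the divergence into
  the rigid motions; neither disturbs the other.\<close>

lemma local_stress:
  assumes K: "K \<in> T"
  shows "\<exists>\<sigma>. \<sigma> \<in> Sigma_r n t K \<and> (\<forall>y. y extreme_point_of K \<longrightarrow> \<sigma> y = 0) \<and>
    (\<forall>e x. e edge_of K \<longrightarrow> x \<in> e \<longrightarrow> \<sigma> x *v n e = edge_tensor \<alpha> \<beta> \<gamma> K e x *v n e)"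
proof -
  define E where "E = edge_tensor \<alpha> \<beta> \<gamma> K"
  define S where "S x = (\<Sum>e | e edge_of K. E e x)" for x
  have fin: "finite {e. e edge_of K}" by (rule finite_edges[OF simplex_T[OF K]])
  have S: "S \<in> Pk 3 UNIV" unfolding S_def[abs_def] E_def by (intro Pk_sum Pk_edge_tensor)
  obtain a b c where tr: "tri a b c K" by (rule simplex_2_tri[OF simplex_T[OF K]])
  obtain B where B: "B \<in> Pk 3 UNIV" "\<And>x. transpose (B x) = B x"
    "\<And>e n x. e edge_of K \<Longrightarrow> unit_normal e n \<Longrightarrow> x \<in> e \<Longrightarrow> B x *v n = 0"
    "\<And>y. y extreme_point_of K \<Longrightarrow> B y = 0" "(\<lambda>x. div_field S x - div_field B x) \<in> RM"
    apply (rule bubble_correction[OF tr S])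
    subgoal premises h for B by (rule h(1)[OF h(2) h(3) h(4) h(5) h(6)])
    done
  define \<sigma> where "\<sigma> x = S x - B x" for x
  have \<sigma>: "\<sigma> \<in> Pk 3 UNIV" unfolding \<sigma>_def[abs_def] by (intro Pk_diff S B)
  have v: "\<sigma> y = 0" if "y extreme_point_of K" for y
    unfolding \<sigma>_def S_def B(4)[OF that] E_def using edge_tensor_zero(1)[OF K _ that] by simp
  have Se: "S x = E e x" if e: "e edge_of K" and x: "x \<in> e" for e x
  proof -
    have "S x = (\<Sum>e' | e' edge_of K. if e' = e then E e x else 0)"
      unfolding S_def
    proof (rule sum.cong[OF refl])
      fix e' assume "e' \<in> {e'. e' edge_of K}"
      then have e': "e' edge_of K" by simp
      show "E e' x = (if e' = e then E e x else 0)"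
        using edge_tensor_zero(2)[OF K e' e _ x] by (auto simp: E_def)
    qed
    then show ?thesis using fin e by (simp add: sum.delta)
  qed
  have tr: "\<sigma> x *v n e = E e x *v n e" if e: "e edge_of K" and x: "x \<in> e" for e x
    unfolding \<sigma>_def matrix_vector_mult_diff_rdistrib B(3)[OF e normal[OF K e] x] Se[OF e x] by simp
  have sym: "transpose (\<sigma> x) = \<sigma> x" for x
  proof -
    have e: "E e x $ j $ i = E e x $ i $ j" for e i j
      using arg_cong[OF transpose_edge_tensor, of "\<lambda>m. m $ i $ j"] by (simp add: E_def transpose_def)
    have b: "B x $ j $ i = B x $ i $ j" for i j using arg_cong[OF B(2)[of x], of "\<lambda>m. m $ i $ j"] by (simp add: transpose_def)
    have "\<sigma> x $ j $ i = \<sigma> x $ i $ j" for i j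
      unfolding \<sigma>_def S_def vector_minus_component sum_component b[of i j] e[of _ i j] ..
    then show ?thesis by (simp add: vec_eq_iff transpose_def)
  qed
  have dv: "div_field \<sigma> = (\<lambda>x. div_field S x - div_field B x)"
  proof
    fix x
    have "pd k (\<lambda>y. \<sigma> y $ i $ j) x = pd k (\<lambda>y. S y $ i $ j) x - pd k (\<lambda>y. B y $ i $ j) x" for i j k
      unfolding \<sigma>_def vector_minus_component
      by (rule pd_diff[OF Pk_differentiable[OF Pk_entry[OF S]] Pk_differentiable[OF Pk_entry[OF B(1)]]])
    then show "div_field \<sigma> x = div_field S x - div_field B x" by (simp add: vec_eq_iff div_field_nth)
  qed
  have tn: "(\<lambda>x. t e \<bullet> (\<sigma> x *v n e)) \<in> Pk 2 e" if e: "e edge_of K" for e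
  proof -
    let ?p = "fst (endpoints e)" and ?q = "snd (endpoints e)"
    note en = endpoints[OF K e]
    have "(\<lambda>x. t e \<bullet> (\<sigma> x *v n e)) \<in> Pk 2 (closed_segment ?p ?q)"
    \<comment> \<open>The cubic part of the load is normal. The shear is \<open>\<beta> e\<close>
      times \<open>s * (1 - s)\<close>, within the degree that \<open>Sigma_r\<close>
      allows.\<close>
    proof (rule Pk_segmentI[OF en(1), of "[:0, \<beta> e, - \<beta> e:]"])
      fix s :: real assume "0 \<le> s" "s \<le> 1"
      then have x: "linepath ?p ?q s \<in> e" using linepath_in_path[of s ?p ?q] en(2) by simp
      have "t e \<bullet> t e = 1" using tangent_normal(2)[OF K e] by (simp add: norm_eq_1)
      then show "t e \<bullet> (\<sigma> (linepath ?p ?q s) *v n e) = poly [:0, \<beta> e, - \<beta> e:] s"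
        unfolding tr[OF e x] E_def edge_tensor_traction[OF K e]
        using tangent_normal(3)[OF K e] by (simp add: inner_add_right algebra_simps)
    qed simp
    then show ?thesis unfolding en(2)[symmetric] .
  qed
  have "\<sigma> \<in> Sigma_r n t K" unfolding Sigma_r_def using \<sigma> sym B(5) dv tn by simp
  then show ?thesis using v tr unfolding E_def by blast
qed

text \<open>The edge moments are chosen such that, by \<open>green_RM\<close>, the divergence of
  \<open>\<sigma> K\<close> has the same integrals as \<open>r K\<close> against a basis of
  \<open>RM\<close>, two translations and \<open>rot\<close>. The difference \<open>d\<close> lies
  in \<open>RM\<close>, can be tested with itself, and vanishes.\<close>

lemma div_surjective:
  assumes q: "q \<in> Vh \<Omega> T"
  shows "\<exists>\<tau>\<in>Sigma_h n t \<Omega> T. weak_div \<Omega> \<tau> q"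
proof -
  have "\<forall>K\<in>T. \<exists>r. r \<in> RM \<and> (AE x in lebesgue_on K. q x = r x)" using q unfolding Vh_def by auto
  then obtain r where r0: "\<forall>K\<in>T. r K \<in> RM \<and> (AE x in lebesgue_on K. q x = r K x)" by (drule_tac bchoice) (elim exE)
  then have r: "\<And>K. K \<in> T \<Longrightarrow> r K \<in> RM" "\<And>K. K \<in> T \<Longrightarrow> AE x in lebesgue_on K. q x = r K x" by auto
  have flow: "\<exists>m. \<forall>K\<in>T. (\<Sum>e | e edge_of K. nu K e (n e) * m e) = s K" for s
    by (rule edge_flow[OF normal])
  obtain m1 where m1: "\<forall>K\<in>T. (\<Sum>e | e edge_of K. nu K e (n e) * m1 e) = integral K (\<lambda>x. r K x $ 1)"
    using flow[of "\<lambda>K. integral K (\<lambda>x. r K x $ 1)"] by (elim exE)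
  obtain m2 where m2: "\<forall>K\<in>T. (\<Sum>e | e edge_of K. nu K e (n e) * m2 e) = integral K (\<lambda>x. r K x $ 2)"
    using flow[of "\<lambda>K. integral K (\<lambda>x. r K x $ 2)"] by (elim exE)
  obtain m3 where m3: "\<forall>K\<in>T. (\<Sum>e | e edge_of K. nu K e (n e) * m3 e) = integral K (\<lambda>x. r K x \<bullet> rot x)"
    using flow[of "\<lambda>K. integral K (\<lambda>x. r K x \<bullet> rot x)"] by (elim exE)
  let ?p = "\<lambda>e. fst (endpoints e)" and ?q = "\<lambda>e. snd (endpoints e)"
  \<comment> \<open>The coefficients of \<open>edge_load\<close> for one edge as a triple, so that a
    single choice over all edges yields \<open>\<alpha>\<close>, \<open>\<beta>\<close> and
    \<open>\<gamma>\<close>.\<close>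
  define load where "load e g \<longleftrightarrow> (\<forall>F a b. (\<forall>s. F (linepath (?p e) (?q e) s) =
       (s * (1 - s)) *\<^sub>R ((fst g + snd (snd g) * (1 - 2 * s)) *\<^sub>R n e + fst (snd g) *\<^sub>R t e)) \<longrightarrow>
     edge_inner e (\<lambda>x. F x \<bullet> (a + b *\<^sub>R rot x)) (\<lambda>x. 1) = a $ 1 * m1 e + a $ 2 * m2 e + b * m3 e)"
    for e and g :: "real \<times> real \<times> real"
  have "\<exists>g. load e g" if K: "K \<in> T" "e edge_of K" for K e
  proof -
    define p q where "p = ?p e" and "q = ?q e"
    have en: "p \<noteq> q" "e = closed_segment p q" unfolding p_def q_def by (rule endpoints[OF K])+
    have "unit_normal (closed_segment p q) (n e)" "unit_tangent (closed_segment p q) (t e)"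
      using normal[OF K] tangent[OF K] en(2) by simp_all
    note el = edge_load[OF en(1) this]
    obtain \<alpha> \<beta> \<gamma> where l: "\<And>F a b. (\<And>s. F (linepath p q s) = (s * (1 - s)) *\<^sub>R ((\<alpha> + \<gamma> * (1 - 2 * s)) *\<^sub>R n e + \<beta> *\<^sub>R t e)) \<Longrightarrow>
      edge_inner (closed_segment p q) (\<lambda>x. F x \<bullet> (a + b *\<^sub>R rot x)) (\<lambda>x. 1) = a $ 1 * m1 e + a $ 2 * m2 e + b * m3 e"
      apply (rule el[of "m1 e" "m2 e" "m3 e"])
      subgoal premises h for \<alpha> \<beta> \<gamma> by (rule h(1)) (rule h(2))
      done
    have "load e (\<alpha>, \<beta>, \<gamma>)"
      unfolding load_def fst_conv snd_conv
    proof (intro allI impI)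
      fix F :: "pt \<Rightarrow> pt" and a :: pt and b :: real
      assume "\<forall>s. F (linepath (?p e) (?q e) s) = (s * (1 - s)) *\<^sub>R ((\<alpha> + \<gamma> * (1 - 2 * s)) *\<^sub>R n e + \<beta> *\<^sub>R t e)"
      from l[unfolded p_def q_def, OF spec[OF this]]
      show "edge_inner e (\<lambda>x. F x \<bullet> (a + b *\<^sub>R rot x)) (\<lambda>x. 1) = a $ 1 * m1 e + a $ 2 * m2 e + b * m3 e"
        unfolding p_def[symmetric] q_def[symmetric] en(2)[symmetric] .
    qed
    then show ?thesis by blast
  qed
  then have "\<forall>e\<in>{e. \<exists>K\<in>T. e edge_of K}. \<exists>g. load e g" by blast
  then obtain G where G: "\<forall>e\<in>{e. \<exists>K\<in>T. e edge_of K}. load e (G e)" by (drule_tac bchoice) (elim exE)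
  define \<alpha> \<beta> \<gamma> where "\<alpha> e = fst (G e)" and "\<beta> e = fst (snd (G e))" and "\<gamma> e = snd (snd (G e))" for e
  have "\<forall>K\<in>T. \<exists>\<sigma>. \<sigma> \<in> Sigma_r n t K \<and> (\<forall>y. y extreme_point_of K \<longrightarrow> \<sigma> y = 0) \<and>
    (\<forall>e x. e edge_of K \<longrightarrow> x \<in> e \<longrightarrow> \<sigma> x *v n e = edge_tensor \<alpha> \<beta> \<gamma> K e x *v n e)"
    by (intro ballI local_stress)
  then obtain \<sigma> where \<sigma>: "\<forall>K\<in>T. \<sigma> K \<in> Sigma_r n t K \<and> (\<forall>y. y extreme_point_of K \<longrightarrow> \<sigma> K y = 0) \<and>
    (\<forall>e x. e edge_of K \<longrightarrow> x \<in> e \<longrightarrow> \<sigma> K x *v n e = edge_tensor \<alpha> \<beta> \<gamma> K e x *v n e)"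
    by (drule_tac bchoice) (elim exE)
  have \<sigma>e: "\<sigma> K x *v n e = edge_tensor \<alpha> \<beta> \<gamma> K e x *v n e" if "K \<in> T" "e edge_of K" "x \<in> e" for K e x
    using bspec[OF \<sigma> that(1)] that by simp
  have inner_cong: "edge_inner e f h = edge_inner e g h" if "K \<in> T" "e edge_of K" "\<And>x. x \<in> e \<Longrightarrow> f x = g x" for K e and f g h :: "pt \<Rightarrow> real"
  proof -
    note en = endpoints[OF that(1,2)]
    have "edge_inner (closed_segment (?p e) (?q e)) f h = edge_inner (closed_segment (?p e) (?q e)) g h"
      unfolding edge_inner_segment[OF en(1)]
      by (intro arg_cong[where f = "times (dist (?p e) (?q e))"] line_int_cong) (simp add: that(3) en(2)[symmetric])
    then show ?thesis unfolding en(2)[symmetric] .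
  qed
  have fam: "sigma_family \<sigma>"
    unfolding sigma_family_def
  proof (intro conjI ballI allI impI)
    show "\<sigma> K \<in> Sigma_r n t K" if "K \<in> T" for K using \<sigma> that by simp
    show "\<sigma> K a = \<sigma> K' a" if "K \<in> T" "K' \<in> T" "a extreme_point_of K \<and> a extreme_point_of K'" for K K' a
      using bspec[OF \<sigma> that(1)] bspec[OF \<sigma> that(2)] that(3) by simp
    fix K K' e and f :: "pt \<Rightarrow> real" assume K: "K \<in> T" "K' \<in> T" "e edge_of K \<and> e edge_of K'"
    then have e: "e edge_of K" "e edge_of K'" by auto
    have "\<sigma> K x *v n e = \<sigma> K' x *v n e" if x: "x \<in> e" for x
    proof -
      obtain s where s: "x = linepath (?p e) (?q e) s" using segment_linepathE x endpoints(2)[OF K(1) e(1)] by metis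
      show ?thesis
        unfolding \<sigma>e[OF K(1) e(1) x] \<sigma>e[OF K(2) e(2) x] unfolding s edge_tensor_traction[OF K(1) e(1)] edge_tensor_traction[OF K(2) e(2)] ..
    qed
    then show "edge_inner e (\<lambda>x. n e \<bullet> (\<sigma> K x *v n e)) f = edge_inner e (\<lambda>x. n e \<bullet> (\<sigma> K' x *v n e)) f"
      "edge_inner e (\<lambda>x. t e \<bullet> (\<sigma> K x *v n e)) f = edge_inner e (\<lambda>x. t e \<bullet> (\<sigma> K' x *v n e)) f"
      by (intro inner_cong[OF K(1) e(1)]; simp)+
  qed
  note sf = sigma_familyD[OF fam]
  have qd: "AE x in lebesgue_on K. q x = div_field (\<sigma> K) x" if K: "K \<in> T" for K
  proof -
    define d where "d x = div_field (\<sigma> K) x - r K x" for x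
    have dRM: "d \<in> RM" unfolding d_def[abs_def] by (rule RM_diff[OF sf(3)[OF K] r(1)[OF K]])
    then obtain a b where d: "d = (\<lambda>x. a + b *\<^sub>R rot x)" unfolding RM_iff by blast
    have cd: "continuous_on UNIV (\<lambda>x. f x \<bullet> g x)" if "f \<in> RM" "g \<in> RM" for f g
      unfolding inner_vec_def by (intro continuous_on_sum continuous_on_inner Pk_continuous_on[OF Pk_RM] that)
    have cc: "continuous_on UNIV (\<lambda>x. f x $ i)" if "f \<in> RM" for f i by (rule Pk_continuous_on[OF Pk_RM[OF that]])
    have rotRM: "rot \<in> RM" unfolding RM_iff by (intro exI[of _ 0] exI[of _ 1]) auto
    note I = integrable_triangle[OF K]
    have A: "integral K (\<lambda>x. r K x \<bullet> d x) = a $ 1 * integral K (\<lambda>x. r K x $ 1) + a $ 2 * integral K (\<lambda>x. r K x $ 2) + b * integral K (\<lambda>x. r K x \<bullet> rot x)"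
    proof -
      have "(\<lambda>x. r K x \<bullet> d x) = (\<lambda>x. a $ 1 * (r K x $ 1) + a $ 2 * (r K x $ 2) + b * (r K x \<bullet> rot x))"
        unfolding d by (auto simp: inner_vec_def sum_2 algebra_simps)
      moreover have "(\<lambda>x. a $ 1 * (r K x $ 1)) integrable_on K" "(\<lambda>x. a $ 2 * (r K x $ 2)) integrable_on K" "(\<lambda>x. b * (r K x \<bullet> rot x)) integrable_on K"
        by (intro I continuous_on_mult continuous_on_const cc cd r(1)[OF K] rotRM)+
      ultimately show ?thesis by (simp add: Henstock_Kurzweil_Integration.integral_add integrable_add)
    qed
    have "integral K (\<lambda>x. div_field (\<sigma> K) x \<bullet> d x) =
      (\<Sum>e | e edge_of K. nu K e (n e) * edge_inner e (\<lambda>x. (\<sigma> K x *v n e) \<bullet> d x) (\<lambda>x. 1))"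
      by (rule green_RM[OF simplex_T[OF K] normal[OF K] sf(1)[OF K] sf(2)[OF K] dRM])
    also have "\<dots> = (\<Sum>e | e edge_of K. nu K e (n e) * (a $ 1 * m1 e + a $ 2 * m2 e + b * m3 e))"
    proof (rule sum.cong[OF refl])
      fix e assume "e \<in> {e. e edge_of K}"
      then have e: "e edge_of K" by simp
      have ld: "load e (G e)" using G K e by blast
      have "edge_inner e (\<lambda>x. (\<sigma> K x *v n e) \<bullet> d x) (\<lambda>x. 1) = edge_inner e (\<lambda>x. (edge_tensor \<alpha> \<beta> \<gamma> K e x *v n e) \<bullet> d x) (\<lambda>x. 1)"
        by (rule inner_cong[OF K e]) (simp add: \<sigma>e[OF K e])
      also have "\<dots> = a $ 1 * m1 e + a $ 2 * m2 e + b * m3 e"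
        unfolding d by (rule ld[unfolded load_def, rule_format]) (simp only: edge_tensor_traction[OF K e] \<alpha>_def \<beta>_def \<gamma>_def)
      finally show "nu K e (n e) * edge_inner e (\<lambda>x. (\<sigma> K x *v n e) \<bullet> d x) (\<lambda>x. 1) =
        nu K e (n e) * (a $ 1 * m1 e + a $ 2 * m2 e + b * m3 e)" by simp
    qed
    also have "\<dots> = a $ 1 * (\<Sum>e | e edge_of K. nu K e (n e) * m1 e) + a $ 2 * (\<Sum>e | e edge_of K. nu K e (n e) * m2 e)
        + b * (\<Sum>e | e edge_of K. nu K e (n e) * m3 e)"
      by (simp add: sum_distrib_left sum.distrib algebra_simps)
    also have "\<dots> = integral K (\<lambda>x. r K x \<bullet> d x)" unfolding A using m1 m2 m3 K by simp
    finally have eq: "integral K (\<lambda>x. div_field (\<sigma> K) x \<bullet> d x) = integral K (\<lambda>x. r K x \<bullet> d x)" .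
    have "integral K (\<lambda>x. d x \<bullet> d x) = integral K (\<lambda>x. div_field (\<sigma> K) x \<bullet> d x - r K x \<bullet> d x)"
      by (simp add: d_def inner_diff_left)
    also have "\<dots> = 0"
      using Henstock_Kurzweil_Integration.integral_diff[OF I[OF cd[OF sf(3)[OF K] dRM]] I[OF cd[OF r(1)[OF K] dRM]]] eq by simp
    finally have z: "integral K (\<lambda>x. d x \<bullet> d x) = 0" .
    have "continuous_on UNIV (\<lambda>x. \<chi> i. d x $ i)" by (intro continuous_on_vec_lambda cc dRM)
    then have "continuous_on UNIV d" by simp
    from continuous_integral_square_zero[OF compact_T[OF K] this z]
    have "AE x in lebesgue_on K. d x = 0" .
    with r(2)[OF K] show ?thesis by eventually_elim (simp add: d_def)
  qed
  note s = sigma_family_Sigma_h[OF fam pw_AE]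
  have "weak_div \<Omega> (pw \<sigma>) q" by (rule s(2), assumption, rule qd)
  moreover have "pw \<sigma> \<in> Sigma_h n t \<Omega> T" by (rule s(1))
  ultimately show ?thesis by blast
qed

end

text \<open>The differential operators are relations between representatives, hence the two claims
  of existence next to the three equations of exactness.\<close>

theorem lemma2p6:
  fixes \<Omega> :: "(real^2) set" and T :: "(real^2) set set"
    and n t :: "(real^2) set \<Rightarrow> real^2"
  assumes "polygon_domain \<Omega>"
    and "conforming_mesh \<Omega> T"
    and "\<And>K e. K \<in> T \<Longrightarrow> e edge_of K \<Longrightarrow> unit_normal e (n e)"
    and "\<And>K e. K \<in> T \<Longrightarrow> e edge_of K \<Longrightarrow> unit_tangent e (t e)"
  shows "(\<forall>v\<in>Wh n \<Omega> T. \<exists>\<tau>. weak_airy \<Omega> v \<tau>) \<and>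
    (\<forall>\<tau>\<in>Sigma_h n t \<Omega> T. \<exists>q. weak_div \<Omega> \<tau> q) \<and>
    {v \<in> Wh n \<Omega> T. weak_airy \<Omega> v (\<lambda>x. 0)} = P1_space \<Omega> \<and>
    {\<tau>. \<exists>v\<in>Wh n \<Omega> T. weak_airy \<Omega> v \<tau>} = {\<tau> \<in> Sigma_h n t \<Omega> T. weak_div \<Omega> \<tau> (\<lambda>x. 0)} \<and>
    {q. \<exists>\<tau>\<in>Sigma_h n t \<Omega> T. weak_div \<Omega> \<tau> q} = Vh \<Omega> T"
proof -
  interpret oriented_mesh \<Omega> T n t by unfold_locales (fact assms)+
  have "{q. \<exists>\<tau>\<in>Sigma_h n t \<Omega> T. weak_div \<Omega> \<tau> q} = Vh \<Omega> T"
    using weak_div_in_Vh div_surjective by blast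
  then show ?thesis using weak_airy_exists weak_div_exists airy_kernel airy_range by simp
qed

end
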